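(* Let $\lambda\in\Lambda_k$ and $i\ge1$. The sequence $(E_{\lambda0^n})_{n\ge0}$ is convergent, $$\mathscr E_\lambda:=\lim_nE_{\lambda0^n}\in\mathcal P(k)^+,\qquad\text{and}\qquad \mathscr Y_i\,\mathscr E_\lambda=\delta_i(\lambda)\,q^{\lambda_i}t^{u_\lambda(i)}\,\mathscr E_\lambda .$$
   Context: Let $\mathbb K=\mathbb Q(t,q)$. For $k\ge1$ let $\mathcal P_k^+=\mathbb K[x_1,\dots,x_k]$, and let $\pi_k:\mathcal P_k^+\to\mathcal P_{k-1}^+$ be evaluation at $x_k=0$. Let $\mathcal P_\infty^+$ be the graded inverse limit of the $\mathcal P_k^+$ (bounded-degree formal series in $x_1,x_2,\dots$), with canonical maps $\Pi_k:\mathcal P_\infty^+\to\mathcal P_k^+$. The simple transpositions $s_i$ act on $\mathcal P_\infty^+$. Put $\mathcal P(k)^+=\{F\in\mathcal P_\infty^+ : s_iF=F \text{ for all } i>k\}$ and $\mathcal P_{as}^+=\bigcup_{k\ge0}\mathcal P(k)^+$. Limits. For $R=A/B\in\mathbb K$ with $A,B\in\mathbb Q[t,q]$, $\operatorname{ord}R$ is the order of vanishing of $A$ at $t=0$ minus that of $B$. A sequence $(a_n)$ in $\mathbb K$ converges to $a$ if $\operatorname{ord}(a_n-a)\to+\infty$. A sequence $(f_k)$, $f_k\in\mathcal P_k^+$ (starting index irrelevant), is convergent if there are $N\ge 1$ and $h_k,g_{i,k}\in\mathcal P_k^+$, $a_{i,k}\in\mathbb K$ ($1\le i\le N$) with $f_k=h_k+\sum_{i=1}^Na_{i,k}g_{i,k}$,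 $\pi_k(h_k)=h_{k-1}$, $\pi_k(g_{i,k})=g_{i,k-1}$, such that the element $g_i\in\mathcal P_\infty^+$ defined by $(g_{i,k})_k$ lies in $\mathcal P_{as}^+$ and $(a_{i,k})_k$ converges to some $a_i$. Then $\lim_kf_k:=h+\sum_i a_ig_i$, $h$ being defined by $(h_k)$; this is independent of choices. A sequence of operators $A_k$ on $\mathcal P_k^+$ has limit operator $A=\lim_kA_k$ on $\mathcal P_{as}^+$, $Af:=\lim_kA_k\Pi_kf$, if for every $f\in\mathcal P_{as}^+$ this limit exists and lies in $\mathcal P_{as}^+$. Operators. On $\mathcal P_k^+$ let $T_if=s_if+(1-t)x_i\frac{f-s_if}{x_i-x_{i+1}}$, $\omega_k^{-1}f=f(x_2,\dots,x_k,qx_1)$, and $Y_i^{(k)}=t^{k+1-i}T_{i-1}\cdots T_1\omega_k^{-1}T_{k-1}^{-1}\cdots T_i^{-1}$ for $1\le i\le k$. Let $\mathrm{pr}_1$ be the linear map that is the identity on monomials divisible by $x_1$ and zero on other monomials, $\varpi_k=\mathrm{pr}_1\omega_k^{-1}$, $\widetilde Y_i^{(k)}=t^{k+1-i}T_{i-1}\cdots T_1\varpi_kT_{k-1}^{-1}\cdots T_i^{-1}$, and $\mathscr Y_i:=\lim_k\widetilde Y_i^{(k)}:\mathcal P_{as}^+\to\mathcal P_{as}^+$ (this limit operator is known to exist). Bruhat order. The affine symmetric group $\widetilde S_k$ (generators $s_0,\dots,s_{k-1}$) acts on $\mathbb Z^k$: $s_i$ ($1\le i\le k-1$) swaps coordinates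 $i,i+1$, and $s_0(x_1,\dots,x_k)=(x_k+1,x_2,\dots,x_{k-1},x_1-1)$. Each orbit contains a unique $\tilde\lambda$ with $\tilde\lambda_1\ge\dots\ge\tilde\lambda_k\ge\tilde\lambda_1-1$; let $w_\lambda$ be the minimal length element with $w_\lambda(\tilde\lambda)=\lambda$. Then $\lambda\le\mu$ means that $\lambda,\mu$ lie in the same $\widetilde S_k$-orbit and $w_\lambda\le w_\mu$ in the Bruhat order of $\widetilde S_k$. Let $\Lambda_k=\mathbb Z_{\ge0}^k$. For $\lambda\in\Lambda_k$ and $1\le i\le k$, $u_\lambda(i)=|\{1\le j\le i:\lambda_j>\lambda_i\}|+|\{i\le j\le k:\lambda_j\ge\lambda_i\}|$. Also $\delta_i(\lambda)=1$ if $i\le k$ and $\lambda_i>0$, and $\delta_i(\lambda)=0$ otherwise (in which case the right-hand side is $0$). The non-symmetric Macdonald polynomials $E_\lambda=E_\lambda(q,t)\in\mathcal P_k^+$, $\lambda\in\Lambda_k$, are the common eigenfunctions of the $Y_i^{(k)}$, determined by $E_\lambda\in x^\lambda+\sum_{\mu<\lambda}\mathbb K x^\mu$ (with $x^\lambda=\prod_ix_i^{\lambda_i}$) and $Y_i^{(k)}E_\lambda=q^{\lambda_i}t^{u_\lambda(i)}E_\lambda$ for $1\le i\le k$. $\lambda0^n\in\Lambda_{k+n}$ is $\lambda$ followed by $n$ zeros, so $E_{\lambda0^n}\in\mathcal P_{k+n}^+$. *)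

theory Defs
  imports
    Complex_Main
    "HOL-Library.Poly_Mapping"
    "HOL-Library.Extended_Real"
    "HOL-Computational_Algebra.Fraction_Field"
    "HOL-Computational_Algebra.Polynomial"
    "HOL-Combinatorics.Transposition"
begin

text \<open>In \<^typ>\<open>rat poly poly\<close> the inner variable is q and the outer variable is t, so that the order
  of vanishing at t = 0 of A is \<open>order 0 A\<close>.\<close>

type_synonym ratfun = "rat poly poly fract"

definition t_par :: ratfun where
  "t_par = Fract [:0, 1:] 1"

definition q_par :: ratfun where
  "q_par = Fract [:[:0, 1:]:] 1"

definition t_ord :: "ratfun \<Rightarrow> ereal" where
  "t_ord R = (if R = 0 then \<infinity> else
     (THE n. \<exists>A B :: rat poly poly. A \<noteq> 0 \<and> B \<noteq> 0 \<and> R = Fract A B \<and>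
        n = ereal (real (order 0 A) - real (order 0 B))))"

lemma t_ord_Fract:
  assumes "A \<noteq> 0" "B \<noteq> 0"
  shows "t_ord (Fract A B) = ereal (real (order 0 A) - real (order 0 B))"
proof -
  have "Fract A B \<noteq> 0"
    using assms by (simp add: Zero_fract_def eq_fract)
  moreover have "n = ereal (real (order 0 A) - real (order 0 B))"
    if "\<exists>C D :: rat poly poly. C \<noteq> 0 \<and> D \<noteq> 0 \<and> Fract A B = Fract C D \<and>
          n = ereal (real (order 0 C) - real (order 0 D))" for n
  proof -
    from that obtain C D :: "rat poly poly" where CD: "C \<noteq> 0" "D \<noteq> 0" "Fract A B = Fract C D"
      and n: "n = ereal (real (order 0 C) - real (order 0 D))" by blast
    from CD assms have "A * D = C * B" by (simp add: eq_fract)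
    hence "order 0 (A * D) = order 0 (C * B)" by simp
    hence "order 0 A + order 0 D = order 0 C + order 0 B"
      using CD assms by (simp add: order_mult)
    thus ?thesis using n by simp
  qed
  ultimately show ?thesis
    unfolding t_ord_def using assms by (auto intro!: the_equality)
qed

definition t_tendsto :: "(nat \<Rightarrow> ratfun) \<Rightarrow> ratfun \<Rightarrow> bool" where
  "t_tendsto a l \<longleftrightarrow> (\<lambda>n. t_ord (a n - l)) \<longlonglongrightarrow> \<infinity>"

text \<open>Variables are indexed from 1.  A vector of k nonnegative integers is identified with its
  extension by zeros to a finitely supported sequence; in particular a vector and the longer
  vectors obtained from it by appending zeros are the same sequence, and the number of variables
  is always passed as a separate argument.\<close>

type_synonym expo = "nat \<Rightarrow>\<^sub>0 nat"
type_synonym pol = "expo \<Rightarrow>\<^sub>0 ratfun"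
type_synonym series = "expo \<Rightarrow> ratfun"

definition Lambda :: "nat \<Rightarrow> expo set" where
  "Lambda k = {m. Poly_Mapping.keys m \<subseteq> {1..k}}"

definition Pol :: "nat \<Rightarrow> pol set" where
  "Pol k = {f. Poly_Mapping.keys f \<subseteq> Lambda k}"

definition total_degree :: "expo \<Rightarrow> nat" where
  "total_degree m = (\<Sum>i\<in>Poly_Mapping.keys m. Poly_Mapping.lookup m i)"

definition Pinf :: "series set" where
  "Pinf = {F. \<exists>d. \<forall>m. F m \<noteq> 0 \<longrightarrow> Poly_Mapping.keys m \<subseteq> {1..} \<and> total_degree m \<le> d}"

definition pconst :: "ratfun \<Rightarrow> pol" where
  "pconst c = Poly_Mapping.single 0 c"

definition xmon :: "expo \<Rightarrow> pol" where
  "xmon m = Poly_Mapping.single m 1"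

definition var :: "nat \<Rightarrow> pol" where
  "var i = xmon (Poly_Mapping.single i 1)"

definition psubst :: "(nat \<Rightarrow> pol) \<Rightarrow> pol \<Rightarrow> pol" where
  "psubst \<sigma> f = (\<Sum>m\<in>Poly_Mapping.keys f. pconst (Poly_Mapping.lookup f m) *
     (\<Prod>i\<in>Poly_Mapping.keys m. \<sigma> i ^ Poly_Mapping.lookup m i))"

definition pi_pol :: "nat \<Rightarrow> pol \<Rightarrow> pol" where
  "pi_pol k = psubst (\<lambda>j. if j = k then 0 else var j)"

text \<open>The canonical map from the inverse limit to polynomials in k variables; the sum is finite for
  every series of bounded degree.\<close>

definition Pi_inf :: "nat \<Rightarrow> series \<Rightarrow> pol" where
  "Pi_inf k F = (\<Sum>m | m \<in> Lambda k \<and> F m \<noteq> 0. Poly_Mapping.single m (F m))"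

definition swap_series :: "nat \<Rightarrow> series \<Rightarrow> series" where
  "swap_series i F = (\<lambda>m. F (Poly_Mapping.map_key (transpose i (Suc i)) m))"

definition Psym :: "nat \<Rightarrow> series set" where
  "Psym k = {F \<in> Pinf. \<forall>i>k. swap_series i F = F}"

definition Pas :: "series set" where
  "Pas = (\<Union>k. Psym k)"

definition represents :: "nat \<Rightarrow> (nat \<Rightarrow> pol) \<Rightarrow> series \<Rightarrow> bool" where
  "represents k0 h H \<longleftrightarrow> H \<in> Pinf \<and> (\<forall>k\<ge>k0. h k \<in> Pol k \<and> Pi_inf k H = h k) \<and>
     (\<forall>k>k0. pi_pol k (h k) = h (k - 1))"

text \<open>The k-th term of the sequence is a polynomial in k variables; the index k0 at which the
  sequence starts is existentially quantified, and the values before k0 are ignored.\<close>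

definition pol_tendsto :: "(nat \<Rightarrow> pol) \<Rightarrow> series \<Rightarrow> bool" where
  "pol_tendsto f L \<longleftrightarrow>
     (\<exists>(k0::nat) (N::nat) (h::nat \<Rightarrow> pol) (g::nat \<Rightarrow> nat \<Rightarrow> pol) (a::nat \<Rightarrow> nat \<Rightarrow> ratfun)
        (H::series) (G::nat \<Rightarrow> series) (A::nat \<Rightarrow> ratfun).
        N \<ge> 1 \<and>
        (\<forall>k\<ge>k0. f k = h k + (\<Sum>i=1..N. pconst (a i k) * g i k)) \<and>
        represents k0 h H \<and>
        (\<forall>i\<in>{1..N}. represents k0 (g i) (G i) \<and> G i \<in> Pas \<and> t_tendsto (a i) (A i)) \<and>
        L = (\<lambda>m. H m + (\<Sum>i=1..N. A i * G i m)))"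

definition pol_convergent :: "(nat \<Rightarrow> pol) \<Rightarrow> bool" where
  "pol_convergent f \<longleftrightarrow> (\<exists>L. pol_tendsto f L)"

definition pol_lim :: "(nat \<Rightarrow> pol) \<Rightarrow> series" where
  "pol_lim f = (THE L. pol_tendsto f L)"

definition lim_op :: "(nat \<Rightarrow> pol \<Rightarrow> pol) \<Rightarrow> series \<Rightarrow> series" where
  "lim_op A F = pol_lim (\<lambda>k. A k (Pi_inf k F))"

definition swap_pol :: "nat \<Rightarrow> pol \<Rightarrow> pol" where
  "swap_pol i = psubst (\<lambda>j. var (transpose i (Suc i) j))"

definition divdiff :: "nat \<Rightarrow> pol \<Rightarrow> pol" where
  "divdiff i f = (THE g. (var i - var (Suc i)) * g = f - swap_pol i f)"

definition T_op :: "nat \<Rightarrow> pol \<Rightarrow> pol" where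
  "T_op i f = swap_pol i f + pconst (1 - t_par) * var i * divdiff i f"

definition omega_inv :: "nat \<Rightarrow> pol \<Rightarrow> pol" where
  "omega_inv k = psubst (\<lambda>j. if j = k then pconst q_par * var 1 else var (Suc j))"

definition pr1 :: "pol \<Rightarrow> pol" where
  "pr1 f = (\<Sum>m | m \<in> Poly_Mapping.keys f \<and> Poly_Mapping.lookup m 1 > 0.
     Poly_Mapping.single m (Poly_Mapping.lookup f m))"

text \<open>\<open>fold F [a..<b]\<close> applies \<open>F a\<close> first and \<open>F (b - 1)\<close> last.\<close>

definition Y_gen :: "(pol \<Rightarrow> pol) \<Rightarrow> nat \<Rightarrow> nat \<Rightarrow> pol \<Rightarrow> pol" where
  "Y_gen W k i f = pconst (t_par ^ (k + 1 - i)) *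
     fold T_op [1..<i] (W (fold (\<lambda>j. inv (T_op j)) [i..<k] f))"

definition Y_op :: "nat \<Rightarrow> nat \<Rightarrow> pol \<Rightarrow> pol" where
  "Y_op k = Y_gen (omega_inv k) k"

definition Y_tilde :: "nat \<Rightarrow> nat \<Rightarrow> pol \<Rightarrow> pol" where
  "Y_tilde k = Y_gen (pr1 \<circ> omega_inv k) k"

definition Y_lim :: "nat \<Rightarrow> series \<Rightarrow> series" where
  "Y_lim i = lim_op (\<lambda>k. Y_tilde k i)"

text \<open>The group acts faithfully on \<open>\<int>\<close> to the power k and is identified with the resulting group of
  transformations.  Vectors are functions of which only the coordinates 1, ..., k are moved.
  For \<open>k \<le> 1\<close> the group is trivial.\<close>

definition aff_gens :: "nat \<Rightarrow> nat set" where
  "aff_gens k = (if k \<ge> 2 then {0..<k} else {})"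

definition aff_s :: "nat \<Rightarrow> nat \<Rightarrow> (nat \<Rightarrow> int) \<Rightarrow> (nat \<Rightarrow> int)" where
  "aff_s k i x = (if i = 0 then x(1 := x k + 1, k := x 1 - 1) else x \<circ> transpose i (Suc i))"

definition aff_word :: "nat \<Rightarrow> nat list \<Rightarrow> (nat \<Rightarrow> int) \<Rightarrow> (nat \<Rightarrow> int)" where
  "aff_word k is = foldr (\<lambda>i w. aff_s k i \<circ> w) is id"

definition aff_group :: "nat \<Rightarrow> ((nat \<Rightarrow> int) \<Rightarrow> (nat \<Rightarrow> int)) set" where
  "aff_group k = {aff_word k is | is. set is \<subseteq> aff_gens k}"

definition aff_length :: "nat \<Rightarrow> ((nat \<Rightarrow> int) \<Rightarrow> (nat \<Rightarrow> int)) \<Rightarrow> nat" where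
  "aff_length k w = (LEAST n. \<exists>is. set is \<subseteq> aff_gens k \<and> length is = n \<and> w = aff_word k is)"

definition aff_reflections :: "nat \<Rightarrow> ((nat \<Rightarrow> int) \<Rightarrow> (nat \<Rightarrow> int)) set" where
  "aff_reflections k = {w \<circ> aff_s k i \<circ> inv w | w i. w \<in> aff_group k \<and> i \<in> aff_gens k}"

definition bruhat_step ::
  "nat \<Rightarrow> ((nat \<Rightarrow> int) \<Rightarrow> (nat \<Rightarrow> int)) \<Rightarrow> ((nat \<Rightarrow> int) \<Rightarrow> (nat \<Rightarrow> int)) \<Rightarrow> bool" where
  "bruhat_step k u w \<longleftrightarrow> u \<in> aff_group k \<and>
     (\<exists>r\<in>aff_reflections k. w = u \<circ> r) \<and> aff_length k u < aff_length k w"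

definition bruhat_le ::
  "nat \<Rightarrow> ((nat \<Rightarrow> int) \<Rightarrow> (nat \<Rightarrow> int)) \<Rightarrow> ((nat \<Rightarrow> int) \<Rightarrow> (nat \<Rightarrow> int)) \<Rightarrow> bool" where
  "bruhat_le k = (bruhat_step k)\<^sup>*\<^sup>*"

definition aff_orbit :: "nat \<Rightarrow> (nat \<Rightarrow> int) \<Rightarrow> (nat \<Rightarrow> int) set" where
  "aff_orbit k x = {w x | w. w \<in> aff_group k}"

definition alcove_rep :: "nat \<Rightarrow> (nat \<Rightarrow> int) \<Rightarrow> (nat \<Rightarrow> int)" where
  "alcove_rep k x = (THE y. y \<in> aff_orbit k x \<and> (\<forall>i\<in>{1..<k}. y i \<ge> y (Suc i)) \<and> y k \<ge> y 1 - 1)"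

definition min_elem :: "nat \<Rightarrow> (nat \<Rightarrow> int) \<Rightarrow> (nat \<Rightarrow> int) \<Rightarrow> (nat \<Rightarrow> int)" where
  "min_elem k x = (THE w. w \<in> aff_group k \<and> w (alcove_rep k x) = x \<and>
     (\<forall>v\<in>aff_group k. v (alcove_rep k x) = x \<longrightarrow> aff_length k w \<le> aff_length k v))"

definition vec_le :: "nat \<Rightarrow> (nat \<Rightarrow> int) \<Rightarrow> (nat \<Rightarrow> int) \<Rightarrow> bool" where
  "vec_le k x y \<longleftrightarrow> x \<in> aff_orbit k y \<and> bruhat_le k (min_elem k x) (min_elem k y)"

definition expo_less :: "nat \<Rightarrow> expo \<Rightarrow> expo \<Rightarrow> bool" where
  "expo_less k \<mu> \<nu> \<longleftrightarrow> \<mu> \<noteq> \<nu> \<and>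
     vec_le k (\<lambda>i. int (Poly_Mapping.lookup \<mu> i)) (\<lambda>i. int (Poly_Mapping.lookup \<nu> i))"

definition u_stat :: "nat \<Rightarrow> expo \<Rightarrow> nat \<Rightarrow> nat" where
  "u_stat k \<mu> i =
     card {j. 1 \<le> j \<and> j \<le> i \<and> Poly_Mapping.lookup \<mu> j > Poly_Mapping.lookup \<mu> i} +
     card {j. i \<le> j \<and> j \<le> k \<and> Poly_Mapping.lookup \<mu> j \<ge> Poly_Mapping.lookup \<mu> i}"

definition delta :: "nat \<Rightarrow> expo \<Rightarrow> nat \<Rightarrow> ratfun" where
  "delta k \<mu> i = (if i \<le> k \<and> Poly_Mapping.lookup \<mu> i > 0 then 1 else 0)"

definition macdonald_E :: "nat \<Rightarrow> expo \<Rightarrow> pol" where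
  "macdonald_E k \<mu> = (THE E. E \<in> Pol k \<and>
     (\<forall>\<nu>\<in>Poly_Mapping.keys (E - xmon \<mu>). expo_less k \<nu> \<mu>) \<and>
     (\<forall>i\<in>{1..k}. Y_op k i E =
        pconst (q_par ^ Poly_Mapping.lookup \<mu> i * t_par ^ u_stat k \<mu> i) * E))"

text \<open>For \<open>\<mu> \<in> Lambda k\<close> and \<open>m \<ge> k\<close>, \<open>macdonald_E m \<mu>\<close> is the polynomial attached to \<open>\<mu>\<close> followed by
  \<open>m - k\<close> zeros, so this sequence is the one indexed by the number of appended zeros, reindexed by
  the number m of variables.\<close>

definition E_seq :: "expo \<Rightarrow> nat \<Rightarrow> pol" where
  "E_seq \<mu> = (\<lambda>m. macdonald_E m \<mu>)"

definition E_lim :: "expo \<Rightarrow> series" where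
  "E_lim \<mu> = pol_lim (E_seq \<mu>)"

end

theory Submission
  imports Defs
begin

text \<open>
  The proof rests on a recursive construction of the polynomials. Three rules produce all of them:
  \<open>E\<^sub>0 = 1\<close>; if \<open>\<mu>\<^sub>i > \<mu>\<^sub>i\<^sub>+\<^sub>1\<close>, the entries are exchanged by the intertwiner,
  \<open>E\<^bsub>s\<^sub>i\<mu>\<^esub> = (T\<^sub>i + c) E\<^sub>\<mu>\<close> with \<open>c = (1 - t) z / (y - z)\<close>, where y and z are the eigenvalues of \<open>E\<^sub>\<mu>\<close>
  at i and i+1; and the last entry, increased by one, is brought to the front by
  \<open>E\<^bsub>cyc \<mu>\<^esub> = q\<^bsup>-\<mu>\<^sub>m\<^esup> x\<^sub>1 \<omega>\<inverse> E\<^sub>\<mu>\<close> (lemmas \<open>macdonald_E_swap\<close> and \<open>macdonald_E_cyc\<close>). That these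
  rules respect the triangularity with respect to the Bruhat order is the lifting property of that
  order and its invariance under the rotation of the vectors; the simplicity of the joint spectrum
  of the Cherednik operators gives uniqueness, and also \<open>T\<^sub>i E\<^sub>\<mu> = E\<^sub>\<mu>\<close> whenever \<open>\<mu>\<^sub>i = \<mu>\<^sub>i\<^sub>+\<^sub>1\<close>.

  Let the number m of variables grow. An exchange of a positive entry with a zero on its right
  involves a constant c in which \<open>z = t\<^sup>u\<close> with u of the order of m, so that c tends to zero. The
  rotation is more delicate: a positive last entry \<open>\<mu>\<^sub>k\<close> must first be carried past the m - k zeros
  that follow it, which takes m - k intertwiners whose constants all depend on m. Since \<open>E\<^sub>\<mu>\<close> is
  fixed by all \<open>T\<^sub>i\<close> with i > k and successive constants satisfy \<open>c\<^sub>s (1 + c\<^sub>s\<^sub>+\<^sub>1) = t c\<^sub>s\<^sub>+\<^sub>1\<close>, the product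
  of these intertwiners collapses to \<open>T\<^sub>m\<^sub>-\<^sub>1 \<cdots> T\<^sub>k + \<beta> H\<close> with a constant \<open>\<beta>\<close> independent of m and
  with the partial symmetrizer \<open>H = \<Sum>\<^sub>s t\<^bsup>m-k-1-s\<^esup> T\<^bsub>k+s-1\<^esub> \<cdots> T\<^sub>k\<close> (lemma \<open>macdonald_E_shift_entry\<close>). The
  operators \<open>\<omega>\<inverse> T\<^sub>m\<^sub>-\<^sub>1 \<cdots> T\<^sub>k\<close> and \<open>\<omega>\<inverse> H\<close> have limits on series that are symmetric in the variables
  after the k-th: the first one because setting the last variable to zero cancels the additional
  factor, the second one because such a series is the sum of one that is symmetric also in \<open>x\<^sub>k\<close>,
  on which H is the scalar \<open>(1 - t\<^bsup>m-k\<^esup>) / (1 - t)\<close>, and of a multiple of \<open>x\<^sub>k\<close>, on which \<open>\<omega>\<inverse> H\<close> is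
  compatible with setting the last variable to zero. Induction along the recursive
  construction gives the convergence and the symmetry of the limit (lemma \<open>macdonald_E_sym_conv\<close>).

  For the eigenvalues, the Cherednik operators \<open>Y\<^sub>i\<close> themselves and their deformations have the same
  limits on every almost symmetric series (lemma \<open>sym_conv_Y\<close>): they differ only on a part that
  carries the factor \<open>t\<^bsup>m+1-i\<^esup>\<close>. Hence the limit operator applied to the limit of the \<open>E\<^sub>\<lambda>\<close> is the limit
  of \<open>Y\<^sub>i E\<^sub>\<lambda>\<close>, and the eigenvalue at i is constant for large m if \<open>\<lambda>\<^sub>i > 0\<close> and tends to zero
  otherwise.
\<close>

section \<open>The polynomial ring\<close>

abbreviation lookup where "lookup \<equiv> Poly_Mapping.lookup"
abbreviation keys where "keys \<equiv> Poly_Mapping.keys"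
abbreviation single where "single \<equiv> Poly_Mapping.single"

lemma poly_mapping_sum_single:
  fixes f :: "'a \<Rightarrow>\<^sub>0 'b::comm_monoid_add"
  shows "f = (\<Sum>m\<in>keys f. single m (lookup f m))"
proof (rule poly_mapping_eqI)
  fix k
  have "lookup (\<Sum>m\<in>keys f. single m (lookup f m)) k = (\<Sum>m\<in>keys f. if m = k then lookup f m else 0)"
    by (simp add: lookup_sum lookup_single when_def)
  also have "\<dots> = lookup f k" by (simp add: in_keys_iff)
  finally show "lookup f k = lookup (\<Sum>m\<in>keys f. single m (lookup f m)) k" by simp
qed

lemma poly_mapping_single_induct [case_names zero single add]:
  fixes f :: "'a \<Rightarrow>\<^sub>0 'b::comm_monoid_add"
  assumes "P 0" and "\<And>m. m \<in> keys f \<Longrightarrow> P (single m (lookup f m))"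
    and "\<And>f g. P f \<Longrightarrow> P g \<Longrightarrow> P (f + g)"
  shows "P f"
proof -
  have "P (\<Sum>m\<in>A. single m (lookup f m))" if "finite A" "A \<subseteq> keys f" for A
    using that by (induction A rule: finite_induct) (use assms in auto)
  from this[of "keys f"] show ?thesis using poly_mapping_sum_single[of f] by simp
qed

lemma pconst_add: "pconst (a + b) = pconst a + pconst b"
  by (simp add: pconst_def single_add)
lemma pconst_mult: "pconst (a * b) = pconst a * pconst b"
  by (simp add: pconst_def mult_single)
lemma pconst_diff: "pconst (a - b) = pconst a - pconst b"
  by (simp add: pconst_def single_diff)
lemma pconst_uminus: "pconst (- a) = - pconst a"
  by (simp add: pconst_def single_uminus)
lemma pconst_0 [simp]: "pconst 0 = 0" by (simp add: pconst_def)
lemma pconst_1 [simp]: "pconst 1 = 1" by (simp add: pconst_def)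
lemma pconst_power: "pconst (a ^ n) = pconst a ^ n"
  by (induction n) (simp_all add: pconst_mult)
lemma pconst_eq_0_iff [simp]: "pconst a = 0 \<longleftrightarrow> a = 0"
  by (metis lookup_single_eq lookup_zero pconst_0 pconst_def)
lemma lookup_pconst_mult: "lookup (pconst c * f) m = c * lookup f m"
  by (induction f rule: poly_mapping_single_induct)
    (auto simp: pconst_def mult_single lookup_single when_def distrib_left lookup_add)
lemma xmon_add: "xmon (a + b) = xmon a * xmon b"
  by (simp add: xmon_def mult_single)
lemma xmon_0 [simp]: "xmon 0 = 1" by (simp add: xmon_def)
lemma lookup_xmon: "lookup (xmon m) n = (if m = n then 1 else 0)"
  by (simp add: xmon_def lookup_single when_def)
lemma single_eq_xmon: "single m c = pconst c * xmon m"
  by (simp add: pconst_def xmon_def mult_single)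
lemma xmon_single: "xmon (single i n) = var i ^ n"
proof (induction n)
  case (Suc n)
  have "single i (Suc n) = single i 1 + single i n" by (simp flip: single_add)
  then show ?case using Suc by (simp add: xmon_add var_def)
qed simp

definition mon_val :: "(nat \<Rightarrow> pol) \<Rightarrow> expo \<Rightarrow> pol" where
  "mon_val \<sigma> m = (\<Prod>i\<in>keys m. \<sigma> i ^ lookup m i)"

lemma mon_val_superset: "finite A \<Longrightarrow> keys m \<subseteq> A \<Longrightarrow> mon_val \<sigma> m = (\<Prod>i\<in>A. \<sigma> i ^ lookup m i)"
  unfolding mon_val_def by (rule prod.mono_neutral_left) (auto simp: in_keys_iff)

lemma mon_val_add: "mon_val \<sigma> (a + b) = mon_val \<sigma> a * mon_val \<sigma> b"
proof -
  let ?A = "keys a \<union> keys b"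
  have "keys (a + b) \<subseteq> ?A" by (rule keys_add)
  then show ?thesis
    by (simp add: mon_val_superset[of ?A] lookup_add power_add prod.distrib)
qed
lemma mon_val_0 [simp]: "mon_val \<sigma> 0 = 1" by (simp add: mon_val_def)
lemma mon_val_single: "mon_val \<sigma> (single i n) = \<sigma> i ^ n"
  by (cases "n = 0") (simp_all add: mon_val_def)

lemma mon_val_var: "mon_val var m = xmon m"
  by (induction m rule: poly_mapping_single_induct)
    (simp_all add: mon_val_add xmon_add mon_val_single xmon_single)

lemma psubst_superset:
  "finite A \<Longrightarrow> keys f \<subseteq> A \<Longrightarrow> psubst \<sigma> f = (\<Sum>m\<in>A. pconst (lookup f m) * mon_val \<sigma> m)"
  unfolding psubst_def mon_val_def by (rule sum.mono_neutral_left) (auto simp: in_keys_iff)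

lemma psubst_add: "psubst \<sigma> (f + g) = psubst \<sigma> f + psubst \<sigma> g"
proof -
  let ?A = "keys f \<union> keys g"
  have "keys (f + g) \<subseteq> ?A" by (rule keys_add)
  then show ?thesis
    by (simp add: psubst_superset[of ?A] lookup_add pconst_add distrib_right sum.distrib)
qed
lemma psubst_0 [simp]: "psubst \<sigma> 0 = 0" by (simp add: psubst_def)
lemma psubst_uminus: "psubst \<sigma> (- f) = - psubst \<sigma> f"
  using psubst_add[of \<sigma> f "- f"] by (simp add: eq_neg_iff_add_eq_0 add.commute)
lemma psubst_diff: "psubst \<sigma> (f - g) = psubst \<sigma> f - psubst \<sigma> g"
  using psubst_add[of \<sigma> f "- g"] by (simp add: psubst_uminus)
lemma psubst_single: "psubst \<sigma> (single m c) = pconst c * mon_val \<sigma> m"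
  by (cases "c = 0") (simp_all add: psubst_def mon_val_def)
lemma psubst_mult: "psubst \<sigma> (f * g) = psubst \<sigma> f * psubst \<sigma> g"
proof (induction f rule: poly_mapping_single_induct)
  case (single m)
  show ?case
    by (induction g rule: poly_mapping_single_induct)
      (simp_all add: mult_single psubst_single mon_val_add pconst_mult psubst_add algebra_simps)
qed (simp_all add: psubst_add algebra_simps)
lemma psubst_pconst [simp]: "psubst \<sigma> (pconst c) = pconst c"
  by (simp add: pconst_def psubst_single)
lemma psubst_1 [simp]: "psubst \<sigma> 1 = 1"
  using psubst_pconst[of \<sigma> 1] by simp
lemma psubst_var [simp]: "psubst \<sigma> (var i) = \<sigma> i"
  by (simp add: var_def xmon_def psubst_single mon_val_single)
lemma psubst_power: "psubst \<sigma> (f ^ n) = psubst \<sigma> f ^ n"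
  by (induction n) (simp_all add: psubst_mult)
lemma psubst_sum: "psubst \<sigma> (sum f A) = (\<Sum>x\<in>A. psubst \<sigma> (f x))"
  by (induction A rule: infinite_finite_induct) (simp_all add: psubst_add)
lemma psubst_prod: "psubst \<sigma> (prod f A) = (\<Prod>x\<in>A. psubst \<sigma> (f x))"
  by (induction A rule: infinite_finite_induct) (simp_all add: psubst_mult)

lemmas psubst_simps = psubst_add psubst_diff psubst_uminus psubst_mult psubst_power

lemma psubst_psubst: "psubst \<sigma> (psubst \<tau> f) = psubst (\<lambda>i. psubst \<sigma> (\<tau> i)) f"
  unfolding psubst_def[of \<tau>] psubst_def[of "\<lambda>i. psubst \<sigma> (\<tau> i)"]
  by (simp add: psubst_sum psubst_mult psubst_prod psubst_power)

lemma pol_induct [case_names const var add mult]: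
  assumes "\<And>m. m \<in> keys f \<Longrightarrow> keys m \<subseteq> I"
    and "\<And>c. P (pconst c)" and "\<And>i. i \<in> I \<Longrightarrow> P (var i)"
    and "\<And>f g. P f \<Longrightarrow> P g \<Longrightarrow> P (f + g)" and mult: "\<And>f g. P f \<Longrightarrow> P g \<Longrightarrow> P (f * g)"
  shows "P f"
proof (induction f rule: poly_mapping_single_induct)
  case zero then show ?case using assms(2)[of 0] by simp
next
  case (single m)
  have pow: "P (g ^ n)" if "P g" for g n
    using that assms(2)[of 1] mult by (induction n) auto
  have prod: "P (prod g A)" if "finite A" "\<And>x. x \<in> A \<Longrightarrow> P (g x)" for g and A :: "nat set"
    using that assms(2)[of 1] mult by (induction A rule: finite_induct) auto
  have "P (mon_val var m)" unfolding mon_val_def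
    using assms(1)[OF single] assms(3) by (intro prod pow) auto
  then show ?case using mult[OF assms(2)] by (simp add: mon_val_var single_eq_xmon)
qed (use assms in auto)

subsection \<open>Polynomials in finitely many variables\<close>

lemma in_Pol_iff: "f \<in> Pol k \<longleftrightarrow> (\<forall>m\<in>keys f. keys m \<subseteq> {1..k})"
  by (auto simp: Pol_def Lambda_def)

lemma Lambda_lookup_0: "m \<in> Lambda k \<Longrightarrow> i = 0 \<or> k < i \<Longrightarrow> lookup m i = 0"
  by (auto simp: Lambda_def in_keys_iff)
lemma Lambda_mono: "k \<le> l \<Longrightarrow> Lambda k \<subseteq> Lambda l"
  by (auto simp: Lambda_def)
lemma Lambda_add: "a \<in> Lambda k \<Longrightarrow> b \<in> Lambda k \<Longrightarrow> a + b \<in> Lambda k"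
  using keys_add[of a b] by (auto simp: Lambda_def)
lemma Lambda_single: "1 \<le> i \<Longrightarrow> i \<le> k \<Longrightarrow> single i n \<in> Lambda k"
  by (auto simp: Lambda_def)

lemma Pol_add: "f \<in> Pol k \<Longrightarrow> g \<in> Pol k \<Longrightarrow> f + g \<in> Pol k"
  using keys_add[of f g] by (auto simp: Pol_def)
lemma Pol_0 [simp]: "0 \<in> Pol k" by (simp add: Pol_def)
lemma Pol_uminus: "f \<in> Pol k \<Longrightarrow> - f \<in> Pol k"
  by (simp add: Pol_def)
lemma Pol_diff: "f \<in> Pol k \<Longrightarrow> g \<in> Pol k \<Longrightarrow> f - g \<in> Pol k"
  using Pol_add[of f k "- g"] Pol_uminus by simp
lemma Pol_mult: "f \<in> Pol k \<Longrightarrow> g \<in> Pol k \<Longrightarrow> f * g \<in> Pol k"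
  using keys_mult[of f g] Lambda_add[of _ k] unfolding Pol_def by blast
lemma Pol_pconst [simp]: "pconst c \<in> Pol k"
  by (simp add: Pol_def pconst_def Lambda_def)
lemma Pol_1 [simp]: "1 \<in> Pol k" using Pol_pconst[of 1] by simp
lemma Pol_xmon: "m \<in> Lambda k \<Longrightarrow> xmon m \<in> Pol k"
  by (simp add: Pol_def xmon_def)
lemma Pol_var: "1 \<le> i \<Longrightarrow> i \<le> k \<Longrightarrow> var i \<in> Pol k"
  by (simp add: var_def Pol_xmon Lambda_single)
lemma Pol_sum: "(\<And>x. x \<in> A \<Longrightarrow> f x \<in> Pol k) \<Longrightarrow> sum f A \<in> Pol k"
  by (induction A rule: infinite_finite_induct) (simp_all add: Pol_add)
lemma Pol_induct [consumes 1, case_names const var add mult]: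
  assumes "f \<in> Pol k" "\<And>c. P (pconst c)" "\<And>i. 1 \<le> i \<Longrightarrow> i \<le> k \<Longrightarrow> P (var i)"
    "\<And>f g. P f \<Longrightarrow> P g \<Longrightarrow> P (f + g)" "\<And>f g. P f \<Longrightarrow> P g \<Longrightarrow> P (f * g)"
  shows "P f"
  by (rule pol_induct[of f "{1..k}"]) (use assms in \<open>auto simp: in_Pol_iff\<close>)

lemma psubst_in_Pol:
  assumes "f \<in> Pol k" "\<And>i. 1 \<le> i \<Longrightarrow> i \<le> k \<Longrightarrow> \<sigma> i \<in> Pol l"
  shows "psubst \<sigma> f \<in> Pol l"
  using assms(1) by (induction f rule: Pol_induct) (simp_all add: psubst_simps Pol_add Pol_mult assms)

lemma psubst_cong_Pol:
  assumes "f \<in> Pol k" "\<And>i. 1 \<le> i \<Longrightarrow> i \<le> k \<Longrightarrow> \<sigma> i = \<tau> i"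
  shows "psubst \<sigma> f = psubst \<tau> f"
  using assms(1) by (induction f rule: Pol_induct) (simp_all add: psubst_simps assms)

subsection \<open>Coefficients\<close>

lemma lookup_single_mult:
  "lookup (single e (1::ratfun) * g) (e + m) = lookup g (m::expo)"
  by (induction g rule: poly_mapping_single_induct)
    (simp_all add: mult_single lookup_single when_def distrib_left lookup_add)

lemma lookup_var_mult:
  "lookup (var j * g) m = (if lookup m j = 0 then 0 else lookup g (m - single j 1))"
proof (cases "lookup m j = 0")
  case True
  have "lookup (var j * g) m = 0"
  proof (induction g rule: poly_mapping_single_induct)
    case (single n)
    have "single j 1 + n \<noteq> m" using True by (metis add_is_0 lookup_add lookup_single_eq zero_neq_one)
    then show ?case by (simp add: var_def xmon_def mult_single lookup_single when_def)
  qed (simp_all add: distrib_left lookup_add)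
  then show ?thesis using True by simp
next
  case False
  have "m = single j 1 + (m - single j 1)"
    using False by (intro poly_mapping_eqI) (auto simp: lookup_add lookup_minus lookup_single when_def)
  then show ?thesis using False lookup_single_mult[of "single j 1" g "m - single j 1"]
    by (simp add: var_def xmon_def)
qed

lemma var_mult_in_Pol_cancel:
  assumes "var j * g \<in> Pol k" shows "g \<in> Pol k"
  unfolding in_Pol_iff
proof (intro ballI)
  fix m assume m: "m \<in> keys g"
  have "single j 1 + m \<in> keys (var j * g)"
    using m lookup_single_mult[of "single j 1" g m] by (simp add: in_keys_iff var_def xmon_def)
  then have "keys (single j 1 + m) \<subseteq> {1..k}" using assms by (auto simp: in_Pol_iff)
  moreover have "keys m \<subseteq> keys (single j 1 + m)" by (auto simp: in_keys_iff lookup_add)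
  ultimately show "keys m \<subseteq> {1..k}" by blast
qed

lemma lookup_pi_pol: "lookup (pi_pol k f) m = (if lookup m k = 0 then lookup f m else 0)"
proof (induction f rule: poly_mapping_single_induct)
  case (single n)
  let ?\<sigma> = "\<lambda>j. if j = k then 0 else var j"
  have "mon_val ?\<sigma> n = (if lookup n k = 0 then xmon n else 0)"
  proof (cases "lookup n k = 0")
    case True
    then have "mon_val ?\<sigma> n = mon_val var n" unfolding mon_val_def by (intro prod.cong) (auto simp: in_keys_iff)
    then show ?thesis using True by (simp add: mon_val_var)
  next
    case False
    then have "k \<in> keys n" by (simp add: in_keys_iff)
    then show ?thesis using False unfolding mon_val_def by (subst prod.remove[of _ k]) auto
  qed
  then show ?case unfolding pi_pol_def
    by (auto simp: psubst_single lookup_single when_def simp flip: single_eq_xmon)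
qed (simp_all add: pi_pol_def psubst_add lookup_add)

abbreviation swap_expo :: "nat \<Rightarrow> expo \<Rightarrow> expo" where
  "swap_expo i \<equiv> Poly_Mapping.map_key (transpose i (Suc i))"

lemma lookup_swap_expo: "lookup (swap_expo i m) j = lookup m (transpose i (Suc i) j)"
  by (simp add: map_key.rep_eq)

lemma swap_expo_swap_expo [simp]: "swap_expo i (swap_expo i m) = m"
  by (rule poly_mapping_eqI) (simp add: lookup_swap_expo)

lemma mon_val_swap: "mon_val (\<lambda>j. var (transpose i (Suc i) j)) m = xmon (swap_expo i m)"
proof (induction m rule: poly_mapping_single_induct)
  case (single j)
  have "swap_expo i (single j (lookup m j)) = single (transpose i (Suc i) j) (lookup m j)"
    by (rule poly_mapping_eqI) (auto simp: lookup_swap_expo lookup_single when_def transpose_eq_iff)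
  then show ?case by (simp add: mon_val_single xmon_single)
qed (simp_all add: mon_val_add map_key_plus xmon_add)

lemma lookup_swap_pol: "lookup (swap_pol i f) m = lookup f (swap_expo i m)"
proof (induction f rule: poly_mapping_single_induct)
  case (single n)
  have "swap_expo i n = m \<longleftrightarrow> n = swap_expo i m" by auto
  then show ?case unfolding swap_pol_def
    by (simp add: psubst_single mon_val_swap lookup_single when_def flip: single_eq_xmon)
qed (simp_all add: swap_pol_def psubst_add lookup_add)

lemma swap_pol_add: "swap_pol i (f + g) = swap_pol i f + swap_pol i g"
  and swap_pol_diff: "swap_pol i (f - g) = swap_pol i f - swap_pol i g"
  and swap_pol_uminus: "swap_pol i (- f) = - swap_pol i f"
  and swap_pol_mult: "swap_pol i (f * g) = swap_pol i f * swap_pol i g"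
  and swap_pol_pconst [simp]: "swap_pol i (pconst c) = pconst c"
  and swap_pol_1 [simp]: "swap_pol i 1 = 1"
  and swap_pol_0 [simp]: "swap_pol i 0 = 0"
  and swap_pol_var: "swap_pol i (var j) = var (transpose i (Suc i) j)"
  by (simp_all add: swap_pol_def psubst_simps)

lemmas swap_pol_simps = swap_pol_add swap_pol_diff swap_pol_uminus swap_pol_mult

lemma swap_pol_var_simps [simp]:
  "swap_pol i (var i) = var (Suc i)" "swap_pol i (var (Suc i)) = var i"
  "j \<noteq> i \<Longrightarrow> j \<noteq> Suc i \<Longrightarrow> swap_pol i (var j) = var j"
  by (simp_all add: swap_pol_var)

lemma swap_pol_swap_pol [simp]: "swap_pol i (swap_pol i f) = f"
  by (rule poly_mapping_eqI) (simp add: lookup_swap_pol)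

lemma swap_pol_in_Pol: "f \<in> Pol k \<Longrightarrow> 1 \<le> i \<Longrightarrow> i < k \<Longrightarrow> swap_pol i f \<in> Pol k"
  unfolding swap_pol_def by (erule psubst_in_Pol) (auto intro!: Pol_var simp: transpose_def)

lemma pi_pol_add: "pi_pol i (f + g) = pi_pol i f + pi_pol i g"
  and pi_pol_diff: "pi_pol i (f - g) = pi_pol i f - pi_pol i g"
  and pi_pol_mult: "pi_pol i (f * g) = pi_pol i f * pi_pol i g"
  and pi_pol_pconst [simp]: "pi_pol i (pconst c) = pconst c"
  and pi_pol_0 [simp]: "pi_pol i 0 = 0"
  and pi_pol_var: "pi_pol i (var j) = (if j = i then 0 else var j)"
  by (simp_all add: pi_pol_def psubst_simps)

lemma var_neq_0 [simp]: "var i \<noteq> 0"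
  by (metis lookup_xmon lookup_zero var_def zero_neq_one)
lemma var_eq_iff [simp]: "var i = var j \<longleftrightarrow> i = j"
proof
  assume "var i = var j"
  then have "lookup (xmon (single i 1)) (single i 1) = lookup (xmon (single j 1)) (single i 1)"
    by (simp add: var_def)
  then have "single i (1::nat) = single j 1" by (simp add: lookup_xmon split: if_splits)
  then have "lookup (single i (1::nat)) i = lookup (single j 1) i" by simp
  then show "i = j" by (simp add: lookup_single when_def split: if_splits)
qed simp

text \<open>Taylor expansion of order zero at \<open>x\<^sub>j = 0\<close>.\<close>

lemma pi_pol_decomp: "\<exists>g. f = pi_pol j f + var j * g"
proof (rule pol_induct[where I = UNIV and f = f], goal_cases)
  case (2 c)
  show ?case by (rule exI[of _ 0]) simp
next
  case (3 i)
  show ?case by (rule exI[of _ "if i = j then 1 else 0"]) (simp add: pi_pol_var)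
next
  case (4 f g)
  then obtain a b where "f = pi_pol j f + var j * a" "g = pi_pol j g + var j * b" by blast
  then show ?case by (intro exI[of _ "a + b"]) (simp add: pi_pol_add algebra_simps)
next
  case (5 f g)
  then obtain a b where 1: "f = pi_pol j f + var j * a" and 2: "g = pi_pol j g + var j * b" by blast
  have "f * g = pi_pol j f * g + var j * (a * g)"
    by (subst 1) (simp add: algebra_simps)
  also have "pi_pol j f * g = pi_pol j f * pi_pol j g + var j * (pi_pol j f * b)"
    by (subst 2) (simp add: algebra_simps)
  finally show ?case unfolding pi_pol_mult
    by (intro exI[of _ "a * g + pi_pol j f * b"]) (simp add: algebra_simps)
qed simp_all

section \<open>Demazure--Lusztig operators\<close>

subsection \<open>The parameters\<close>

lemma t_par_neq_0 [simp]: "t_par \<noteq> 0"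
  by (simp add: t_par_def Zero_fract_def eq_fract)
lemma q_par_neq_0 [simp]: "q_par \<noteq> 0"
  by (simp add: q_par_def Zero_fract_def eq_fract)
lemma t_par_neq_1 [simp]: "t_par \<noteq> 1"
  by (simp add: t_par_def One_fract_def eq_fract one_pCons)

lemma Fract_power: "Fract (a::rat poly poly) 1 ^ n = Fract (a ^ n) 1"
  by (induction n) (simp_all add: One_fract_def)

lemma q_t_monomial_Fract: "q_par ^ a * t_par ^ b = Fract (monom (monom 1 a) b) 1"
proof -
  have t: "[:0, 1:] ^ b = (monom 1 b :: rat poly poly)"
    by (simp add: monom_altdef)
  have "[:0, 1:] ^ a = (monom 1 a :: rat poly)"
    by (simp add: monom_altdef)
  then have q: "[:[:0, 1:]:] ^ a = ([:monom 1 a:] :: rat poly poly)"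
    by (simp add: poly_const_pow)
  show ?thesis unfolding q_par_def t_par_def Fract_power
    by (simp add: t q smult_monom)
qed

lemma q_t_monomial_inj:
  assumes "q_par ^ a * t_par ^ b = q_par ^ c * t_par ^ d" shows "a = c \<and> b = d"
proof -
  have "monom (monom 1 a) b = (monom (monom 1 c) d :: rat poly poly)"
    using assms by (simp add: q_t_monomial_Fract eq_fract)
  then show ?thesis by (auto simp: monom_eq_iff')
qed

subsection \<open>The divided difference\<close>

text \<open>The operator \<open>f \<mapsto> f - s\<^sub>i f\<close> is a twisted derivation, so divisibility by \<open>x\<^sub>i - x\<^sub>i\<^sub>+\<^sub>1\<close>
  passes from the variables to sums and products.\<close>

lemma divdiff_exists: "\<exists>g. (var i - var (Suc i)) * g = f - swap_pol i f"
proof (rule pol_induct[where I = UNIV and f = f], goal_cases)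
  case (2 c)
  show ?case by (rule exI[of _ 0]) simp
next
  case (3 j)
  show ?case
    by (rule exI[of _ "if j = i then 1 else if j = Suc i then - 1 else 0"]) auto
next
  case (4 f g)
  then obtain a b where "(var i - var (Suc i)) * a = f - swap_pol i f" "(var i - var (Suc i)) * b = g - swap_pol i g"
    by blast
  then show ?case by (intro exI[of _ "a + b"]) (simp add: swap_pol_add distrib_left)
next
  case (5 f g)
  then obtain a b where 1: "(var i - var (Suc i)) * a = f - swap_pol i f" and 2: "(var i - var (Suc i)) * b = g - swap_pol i g"
    by blast
  have "(var i - var (Suc i)) * (a * g + swap_pol i f * b)
      = ((var i - var (Suc i)) * a) * g + swap_pol i f * ((var i - var (Suc i)) * b)"
    by (simp only: distrib_left mult.assoc mult.left_commute)
  also have "\<dots> = f * g - swap_pol i (f * g)"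
    unfolding 1 2 by (simp add: swap_pol_mult algebra_simps)
  finally show ?case by blast
qed simp_all

lemma divdiff_eq: "(var i - var (Suc i)) * divdiff i f = f - swap_pol i f"
proof -
  obtain g where g: "(var i - var (Suc i)) * g = f - swap_pol i f" using divdiff_exists by blast
  have "h = g" if "(var i - var (Suc i)) * h = f - swap_pol i f" for h
    using that g by (metis (no_types) eq_iff_diff_eq_0 mult_cancel_left n_not_Suc_n var_eq_iff)
  then have "divdiff i f = g" unfolding divdiff_def using g by (intro the_equality)
  then show ?thesis using g by simp
qed

text \<open>Since the polynomial ring is a domain, the identity below determines \<open>T\<^sub>i\<close>; every relation
  among these operators is obtained by multiplying out with differences of variables.\<close>

lemma T_op_char:
  "(var i - var (Suc i)) * T_op i f =
     pconst (1 - t_par) * var i * f + (pconst t_par * var i - var (Suc i)) * swap_pol i f"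
proof -
  have "(var i - var (Suc i)) * T_op i f = (var i - var (Suc i)) * swap_pol i f
      + pconst (1 - t_par) * var i * ((var i - var (Suc i)) * divdiff i f)"
    unfolding T_op_def by (simp only: distrib_left mult.assoc mult.left_commute)
  also have "\<dots> = pconst (1 - t_par) * var i * f + (pconst t_par * var i - var (Suc i)) * swap_pol i f"
    unfolding divdiff_eq by (simp add: pconst_diff algebra_simps)
  finally show ?thesis .
qed

lemma var_diff_cancel: "i \<noteq> j \<Longrightarrow> (var i - var j) * f = (var i - var j) * g \<Longrightarrow> f = g"
  by simp

lemma T_op_eqI:
  assumes "(var i - var (Suc i)) * g =
     pconst (1 - t_par) * var i * f + (pconst t_par * var i - var (Suc i)) * swap_pol i f"
  shows "T_op i f = g"
  by (rule var_diff_cancel[of i "Suc i"]) (simp_all add: T_op_char assms)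

lemma T_op_add: "T_op i (f + g) = T_op i f + T_op i g"
  by (rule T_op_eqI, unfold distrib_left T_op_char swap_pol_add) (simp add: algebra_simps)

lemma T_op_mult_sym: "swap_pol i g = g \<Longrightarrow> T_op i (g * f) = g * T_op i f"
proof (rule T_op_eqI)
  assume g: "swap_pol i g = g"
  have "(var i - var (Suc i)) * (g * T_op i f) = g * ((var i - var (Suc i)) * T_op i f)"
    by (simp only: mult.left_commute)
  then show "(var i - var (Suc i)) * (g * T_op i f) = pconst (1 - t_par) * var i * (g * f)
      + (pconst t_par * var i - var (Suc i)) * swap_pol i (g * f)"
    unfolding T_op_char swap_pol_mult g by (simp add: algebra_simps)
qed

lemma T_op_pconst: "T_op i (pconst c * f) = pconst c * T_op i f"
  by (rule T_op_mult_sym) simp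
lemma T_op_0 [simp]: "T_op i 0 = 0" using T_op_pconst[of i 0] by simp
lemma T_op_uminus: "T_op i (- f) = - T_op i f"
  using T_op_add[of i f "- f"] by (simp add: eq_neg_iff_add_eq_0 add.commute)
lemma T_op_diff: "T_op i (f - g) = T_op i f - T_op i g"
  using T_op_add[of i f "- g"] by (simp add: T_op_uminus)

text \<open>The identity \<open>(x\<^sub>i - x\<^sub>i\<^sub>+\<^sub>1) (T\<^sub>i f - f) = (t x\<^sub>i - x\<^sub>i\<^sub>+\<^sub>1) (s\<^sub>i f - f)\<close> in a domain.
  Symmetry can therefore be expressed by the operators \<open>T\<^sub>i\<close>, whose relations with the other
  operators are simple.\<close>

lemma T_op_fix_iff: "T_op i f = f \<longleftrightarrow> swap_pol i f = f"
proof
  assume "T_op i f = f"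
  then have "(var i - var (Suc i)) * f =
     pconst (1 - t_par) * var i * f + (pconst t_par * var i - var (Suc i)) * swap_pol i f"
    using T_op_char[of i f] by simp
  then have "(pconst t_par * var i - var (Suc i)) * f = (pconst t_par * var i - var (Suc i)) * swap_pol i f"
    by (simp add: pconst_diff algebra_simps)
  moreover have "pconst t_par * var i - var (Suc i) \<noteq> 0"
  proof
    assume "pconst t_par * var i - var (Suc i) = 0"
    then have "lookup (pconst t_par * var i) (single i 1) = lookup (var (Suc i)) (single i 1)" by simp
    moreover have "single (Suc i) (1::nat) \<noteq> single i 1"
      by (metis lookup_single_eq lookup_single_not_eq n_not_Suc_n zero_neq_one)
    ultimately show False by (simp add: lookup_pconst_mult var_def lookup_xmon)
  qed
  ultimately show "swap_pol i f = f" by simp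
next
  assume "swap_pol i f = f"
  then show "T_op i f = f" by (intro T_op_eqI) (simp add: pconst_diff algebra_simps)
qed

lemma swap_T_op:
  "(var i - var (Suc i)) * swap_pol i (T_op i f) =
     (var i - pconst t_par * var (Suc i)) * f - pconst (1 - t_par) * var (Suc i) * swap_pol i f"
proof -
  have "swap_pol i ((var i - var (Suc i)) * T_op i f) =
     swap_pol i (pconst (1 - t_par) * var i * f + (pconst t_par * var i - var (Suc i)) * swap_pol i f)"
    by (simp only: T_op_char)
  then show ?thesis by (simp add: swap_pol_simps algebra_simps)
qed

lemma T_op_quadratic: "T_op i (T_op i f) = pconst (1 - t_par) * T_op i f + pconst t_par * f"
proof (rule T_op_eqI, rule var_diff_cancel[of i "Suc i"])
  let ?x = "var i" and ?y = "var (Suc i)" and ?t = "pconst t_par"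
  have 1: "(?x - ?y) * T_op i f = (1 - ?t) * ?x * f + (?t * ?x - ?y) * swap_pol i f"
    using T_op_char[of i f] by (simp add: pconst_diff)
  have 2: "(?x - ?y) * swap_pol i (T_op i f) = (?x - ?t * ?y) * f - (1 - ?t) * ?y * swap_pol i f"
    using swap_T_op[of i f] by (simp add: pconst_diff)
  show "(?x - ?y) * ((?x - ?y) * (pconst (1 - t_par) * T_op i f + ?t * f)) =
    (?x - ?y) * (pconst (1 - t_par) * ?x * T_op i f + (?t * ?x - ?y) * swap_pol i (T_op i f))"
    (is "?l = ?r")
  proof -
    have "?l = (?x - ?y) * ((1 - ?t) * ((?x - ?y) * T_op i f) + ?t * ((?x - ?y) * f))"
      by (simp only: pconst_diff pconst_1 distrib_left mult.left_commute)
    also have "\<dots> = (1 - ?t) * ?x * ((?x - ?y) * T_op i f) + (?t * ?x - ?y) * ((?x - ?y) * swap_pol i (T_op i f))"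
      unfolding 1 2 by (simp add: algebra_simps)
    also have "\<dots> = ?r"
      by (simp only: pconst_diff pconst_1 distrib_left mult.left_commute mult.assoc)
    finally show ?thesis .
  qed
qed simp

text \<open>The quadratic relation \<open>(T\<^sub>i - 1) (T\<^sub>i + t) = 0\<close>, solved for the inverse.\<close>

definition T_inv :: "nat \<Rightarrow> pol \<Rightarrow> pol" where
  "T_inv i f = pconst (inverse t_par) * (T_op i f - pconst (1 - t_par) * f)"

lemma pconst_t_inverse [simp]:
  "pconst t_par * (pconst (inverse t_par) * f) = f" "pconst (inverse t_par) * (pconst t_par * f) = f"
  by (simp_all flip: mult.assoc pconst_mult)

lemma T_op_T_inv [simp]: "T_op i (T_inv i f) = f"
  unfolding T_inv_def by (simp add: T_op_pconst T_op_diff T_op_quadratic)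
lemma T_inv_T_op [simp]: "T_inv i (T_op i f) = f"
  unfolding T_inv_def by (simp add: T_op_quadratic)

lemma inv_T_op: "inv (T_op i) = T_inv i"
  by (rule inv_equality) simp_all

lemma T_inv_eqI: "T_op i g = f \<Longrightarrow> T_inv i f = g" by auto

lemma T_inv_fix: "T_op i f = f \<Longrightarrow> T_inv i f = f"
  by (rule T_inv_eqI)

lemma T_inv_add: "T_inv i (f + g) = T_inv i f + T_inv i g"
  by (rule T_inv_eqI) (simp add: T_op_add)
lemma T_inv_mult_sym: "swap_pol i g = g \<Longrightarrow> T_inv i (g * f) = g * T_inv i f"
  by (rule T_inv_eqI) (simp add: T_op_mult_sym)
lemma T_inv_pconst: "T_inv i (pconst c * f) = pconst c * T_inv i f"
  by (rule T_inv_mult_sym) simp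

text \<open>The cross relations of the affine Hecke algebra: a variable that passes through the operator turns it
  into a multiple of its inverse.\<close>

lemma T_op_var: "T_op i (var i * f) = var (Suc i) * T_op i f + pconst (1 - t_par) * var i * f"
proof (rule T_op_eqI)
  show "(var i - var (Suc i)) * (var (Suc i) * T_op i f + pconst (1 - t_par) * var i * f) =
    pconst (1 - t_par) * var i * (var i * f) + (pconst t_par * var i - var (Suc i)) * swap_pol i (var i * f)"
    (is "?l = ?r")
  proof -
    have "?l = var (Suc i) * ((var i - var (Suc i)) * T_op i f)
        + (var i - var (Suc i)) * (pconst (1 - t_par) * var i * f)"
      by (simp only: distrib_left mult.left_commute)
    also have "\<dots> = ?r"
      unfolding T_op_char by (simp add: swap_pol_mult algebra_simps)
    finally show ?thesis .
  qed
qed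

lemma T_op_var_Suc: "T_op i (var (Suc i) * f) = var i * T_op i f - pconst (1 - t_par) * var i * f"
proof (rule T_op_eqI)
  show "(var i - var (Suc i)) * (var i * T_op i f - pconst (1 - t_par) * var i * f) =
    pconst (1 - t_par) * var i * (var (Suc i) * f)
      + (pconst t_par * var i - var (Suc i)) * swap_pol i (var (Suc i) * f)"
    (is "?l = ?r")
  proof -
    have "?l = var i * ((var i - var (Suc i)) * T_op i f)
        - (var i - var (Suc i)) * (pconst (1 - t_par) * var i * f)"
      by (simp only: right_diff_distrib mult.left_commute)
    also have "\<dots> = ?r"
      unfolding T_op_char by (simp add: swap_pol_mult pconst_diff algebra_simps)
    finally show ?thesis .
  qed
qed

lemma T_op_var_Suc': "T_op i (var (Suc i) * f) = pconst t_par * (var i * T_inv i f)"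
proof -
  have "pconst t_par * (var i * T_inv i f) = var i * (pconst t_par * T_inv i f)"
    by (simp only: mult.left_commute)
  then show ?thesis unfolding T_op_var_Suc T_inv_def pconst_t_inverse
    by (simp add: right_diff_distrib mult_ac)
qed

lemma T_inv_var: "T_inv i (var i * f) = pconst (inverse t_par) * (var (Suc i) * T_op i f)"
  by (rule T_inv_eqI) (simp add: T_op_pconst T_op_var_Suc')

lemma T_op_var_other: "j \<noteq> i \<Longrightarrow> j \<noteq> Suc i \<Longrightarrow> T_op i (var j * f) = var j * T_op i f"
  by (rule T_op_mult_sym) simp

text \<open>The substitution is applied to the identity that characterizes \<open>T\<^sub>i\<close>; it carries the
  denominator to the denominator.\<close>

lemma psubst_T_op:
  assumes "psubst \<sigma> (var i) = var j" "psubst \<sigma> (var (Suc i)) = var (Suc j)"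
    and "psubst \<sigma> (swap_pol i f) = swap_pol j (psubst \<sigma> f)"
  shows "psubst \<sigma> (T_op i f) = T_op j (psubst \<sigma> f)"
proof (rule T_op_eqI[symmetric])
  have "psubst \<sigma> ((var i - var (Suc i)) * T_op i f) =
    psubst \<sigma> (pconst (1 - t_par) * var i * f + (pconst t_par * var i - var (Suc i)) * swap_pol i f)"
    by (simp only: T_op_char)
  then show "(var j - var (Suc j)) * psubst \<sigma> (T_op i f) =
    pconst (1 - t_par) * var j * psubst \<sigma> f + (pconst t_par * var j - var (Suc j)) * swap_pol j (psubst \<sigma> f)"
    using assms by (simp add: psubst_simps)
qed

lemma swap_pol_commute: "Suc i < j \<Longrightarrow> swap_pol i (swap_pol j f) = swap_pol j (swap_pol i f)"
  unfolding swap_pol_def psubst_psubst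
  by (rule arg_cong[where f = "\<lambda>\<sigma>. psubst \<sigma> f"]) (auto simp: transpose_def)

lemma swap_pol_braid:
  "swap_pol i (swap_pol (Suc i) (swap_pol i f)) = swap_pol (Suc i) (swap_pol i (swap_pol (Suc i) f))"
  unfolding swap_pol_def psubst_psubst
  by (rule arg_cong[where f = "\<lambda>\<sigma>. psubst \<sigma> f"]) (auto simp: transpose_def)

lemma swap_T_op_commute:
  assumes "Suc i < j \<or> Suc j < i" shows "swap_pol i (T_op j f) = T_op j (swap_pol i f)"
proof -
  have "swap_pol i (swap_pol j f) = swap_pol j (swap_pol i f)"
    using assms swap_pol_commute[of i j f] swap_pol_commute[of j i f] by auto
  then show ?thesis using assms unfolding swap_pol_def[of i]
    by (intro psubst_T_op) (auto simp: transpose_def)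
qed

lemma T_op_commute:
  assumes "Suc i < j \<or> Suc j < i" shows "T_op i (T_op j f) = T_op j (T_op i f)"
proof (rule T_op_eqI)
  have s: "swap_pol j (var i - var (Suc i)) = var i - var (Suc i)"
    "swap_pol j (pconst t_par * var i - var (Suc i)) = pconst t_par * var i - var (Suc i)"
    "swap_pol j (pconst (1 - t_par) * var i) = pconst (1 - t_par) * var i"
    using assms by (auto simp: swap_pol_simps)
  have "(var i - var (Suc i)) * T_op j (T_op i f) = T_op j ((var i - var (Suc i)) * T_op i f)"
    using s by (simp add: T_op_mult_sym)
  also have "\<dots> = pconst (1 - t_par) * var i * T_op j f
      + (pconst t_par * var i - var (Suc i)) * T_op j (swap_pol i f)"
    unfolding T_op_char T_op_add using s by (simp add: T_op_mult_sym)
  finally show "(var i - var (Suc i)) * T_op j (T_op i f) = pconst (1 - t_par) * var i * T_op j f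
      + (pconst t_par * var i - var (Suc i)) * swap_pol i (T_op j f)"
    using swap_T_op_commute[OF assms] by simp
qed

text \<open>What the braid relation amounts to once all divided differences are written out: x, y, z
  are the three variables, f is the polynomial, and a, b, ab, ba, w are its images under the
  nontrivial permutations of the variables.\<close>

lemma braid_identity:
  fixes x y z t :: "'a::comm_ring_1"
  shows "(y - z) * ((1-t)*x*((x-z)*((1-t)*y*((1-t)*x*f+(t*x-y)*a)) + (x-y)*((t*y-z)*((1-t)*x*b+(t*x-z)*ba)))
     + (t*x-y)*((y-z)*((1-t)*x*((x-t*y)*f-(1-t)*y*a)) + (x-y)*((t*x-z)*((1-t)*y*ab+(t*y-z)*w))))
   = (x - y) * ((1-t)*y*((1-t)*x*((x-z)*((1-t)*y*f+(t*y-z)*b)) + (t*x-y)*((y-z)*((1-t)*x*a+(t*x-z)*ab)))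
     + (t*y-z)*((1-t)*x*((x-y)*((y-t*z)*f-(1-t)*z*b)) + (t*x-z)*((y-z)*((1-t)*x*ba+(t*x-y)*w))))"
  by (simp add: algebra_simps)

text \<open>The braid relation: both sides are multiplied by the product of all the denominators that
  occur when the operators are written out as combinations of permutations.\<close>

lemma T_op_braid: "T_op i (T_op (Suc i) (T_op i f)) = T_op (Suc i) (T_op i (T_op (Suc i) f))"
proof -
  define x y z t where "x = var i" "y = var (Suc i)" "z = var (Suc (Suc i))" "t = pconst t_par"
  note d = this
  let ?s = "swap_pol i" and ?r = "swap_pol (Suc i)"
  have tf: "T_op i u = v \<Longrightarrow> (x - y) * v = (1-t)*x*u + (t*x-y)*?s u" for u v
    using T_op_char[of i u] by (auto simp: d pconst_diff)
  have tr: "T_op (Suc i) u = v \<Longrightarrow> (y - z) * v = (1-t)*y*u + (t*y-z)*?r u" for u v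
    using T_op_char[of "Suc i" u] by (auto simp: d pconst_diff)
  have ap: "u = v \<Longrightarrow> swap_pol j u = swap_pol j v" for j u v by simp
  have sw: "?s x = y" "?s y = x" "?s z = z" "?s t = t" "?r x = x" "?r y = z" "?r z = y" "?r t = t"
    by (simp_all add: d)
  note ss = swap_pol_simps sw swap_pol_1 swap_pol_swap_pol
  define g h g' h' where "g = T_op i f" "h = T_op (Suc i) g" "g' = T_op (Suc i) f" "h' = T_op i g'"
  note e = this
  define a b ab ba w where "a = ?s f" "b = ?r f" "ab = ?s b" "ba = ?r a" "w = ?s ba"
  note n = this
  have w: "?r ab = w" using swap_pol_braid[of i f] by (simp add: n)
  have g: "(x-y)*g = (1-t)*x*f+(t*x-y)*a" using tf[of f g] by (simp add: e n)
  have sg: "(x-y)*?s g = (x-t*y)*f-(1-t)*y*a"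
    using ap[OF g, of i] by (simp add: ss n) (simp add: algebra_simps)
  have rg: "(x-z)*?r g = (1-t)*x*b+(t*x-z)*ba"
    using ap[OF g, of "Suc i"] by (simp add: ss n)
  have srg: "(y-z)*?s (?r g) = (1-t)*y*ab+(t*y-z)*w"
    using ap[OF rg, of i] by (simp add: ss n)
  have h: "(y-z)*h = (1-t)*y*g+(t*y-z)*?r g" using tr[of g h] by (simp add: e)
  have sh: "(x-z)*?s h = (1-t)*x*?s g+(t*x-z)*?s (?r g)"
    using ap[OF h, of i] by (simp add: ss)
  have L: "(x-y)*T_op i h = (1-t)*x*h+(t*x-y)*?s h" using tf[of h] by simp
  have g': "(y-z)*g' = (1-t)*y*f+(t*y-z)*b" using tr[of f g'] by (simp add: e n)
  have rg': "(y-z)*?r g' = (y-t*z)*f-(1-t)*z*b"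
    using ap[OF g', of "Suc i"] by (simp add: ss n) (simp add: algebra_simps)
  have sg': "(x-z)*?s g' = (1-t)*x*a+(t*x-z)*ab"
    using ap[OF g', of i] by (simp add: ss n)
  have rsg': "(x-y)*?r (?s g') = (1-t)*x*ba+(t*x-y)*w"
    using ap[OF sg', of "Suc i"] w by (simp add: ss n)
  have h': "(x-y)*h' = (1-t)*x*g'+(t*x-y)*?s g'" using tf[of g' h'] by (simp add: e)
  have rh': "(x-z)*?r h' = (1-t)*x*?r g'+(t*x-z)*?r (?s g')"
    using ap[OF h', of "Suc i"] by (simp add: ss)
  have R: "(y-z)*T_op (Suc i) h' = (1-t)*y*h'+(t*y-z)*?r h'" using tr[of h'] by simp
  have "(y-z)*((x-y)*((y-z)*((x-z)*((x-y)*T_op i h)))) =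
     (y-z)*((1-t)*x*((x-z)*((1-t)*y*((x-y)*g)) + (x-y)*((t*y-z)*((x-z)*?r g)))
       + (t*x-y)*((y-z)*((1-t)*x*((x-y)*?s g)) + (x-y)*((t*x-z)*((y-z)*?s (?r g)))))"
  proof -
    have "(y-z)*((x-y)*((y-z)*((x-z)*((x-y)*T_op i h)))) =
      (y-z)*((1-t)*x*((x-z)*((x-y)*((y-z)*h))) + (t*x-y)*((y-z)*((x-y)*((x-z)*?s h))))"
      unfolding L by (simp only: distrib_left mult.left_commute mult.assoc)
    then show ?thesis unfolding h sh
      by (simp only: distrib_left mult.left_commute mult.assoc)
  qed
  also have "\<dots> = (x - y) * ((1-t)*y*((1-t)*x*((x-z)*((y-z)*g')) + (t*x-y)*((y-z)*((x-z)*?s g')))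
     + (t*y-z)*((1-t)*x*((x-y)*((y-z)*?r g')) + (t*x-z)*((y-z)*((x-y)*?r (?s g')))))"
    unfolding g sg rg srg g' rg' sg' rsg' by (rule braid_identity)
  also have "\<dots> = (x-y)*((x-z)*((y-z)*((x-y)*((y-z)*T_op (Suc i) h'))))"
  proof -
    have "(x-y)*((x-z)*((y-z)*((x-y)*((y-z)*T_op (Suc i) h')))) =
      (x-y)*((1-t)*y*((x-z)*((y-z)*((x-y)*h'))) + (t*y-z)*((y-z)*((x-y)*((x-z)*?r h'))))"
      unfolding R by (simp only: distrib_left mult.left_commute mult.assoc)
    then show ?thesis unfolding h' rh'
      by (simp only: distrib_left mult.left_commute mult.assoc)
  qed
  finally have "((y-z)*(x-y)*(y-z)*(x-z)*(x-y)) * T_op i h = ((y-z)*(x-y)*(y-z)*(x-z)*(x-y)) * T_op (Suc i) h'"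
    by (simp only: mult.left_commute mult.assoc)
  moreover have "(y-z)*(x-y)*(y-z)*(x-z)*(x-y) \<noteq> 0" by (simp add: d)
  ultimately show ?thesis by (simp add: e)
qed

lemma T_op_T_inv_commute:
  assumes "Suc i < j \<or> Suc j < i" shows "T_op i (T_inv j f) = T_inv j (T_op i f)"
  by (rule T_inv_eqI[symmetric]) (simp flip: T_op_commute[OF assms])

subsection \<open>Supports\<close>

text \<open>The exponents on the segment between \<open>\<nu>\<close> and its transposition at i; the exponents that
  occur in \<open>T\<^sub>i x\<^sup>\<nu>\<close> are among them.\<close>

definition expo_string :: "nat \<Rightarrow> expo \<Rightarrow> expo set" where
  "expo_string i \<nu> = {\<kappa>. (\<forall>j. j \<noteq> i \<longrightarrow> j \<noteq> Suc i \<longrightarrow> lookup \<kappa> j = lookup \<nu> j) \<and>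
     lookup \<kappa> i + lookup \<kappa> (Suc i) = lookup \<nu> i + lookup \<nu> (Suc i) \<and>
     min (lookup \<nu> i) (lookup \<nu> (Suc i)) \<le> lookup \<kappa> i \<and> lookup \<kappa> i \<le> max (lookup \<nu> i) (lookup \<nu> (Suc i))}"

lemma xmon_remove_var: "lookup m j > 0 \<Longrightarrow> xmon m = var j * xmon (m - single j 1)"
  unfolding var_def
  by (subst xmon_add[symmetric], rule arg_cong[where f = xmon], rule poly_mapping_eqI)
    (auto simp: lookup_add lookup_minus lookup_single when_def)

lemma keys_var_mult: "m \<in> keys (var j * g) \<Longrightarrow> lookup m j > 0 \<and> m - single j 1 \<in> keys g"
  by (auto simp: in_keys_iff lookup_var_mult split: if_splits)

lemma keys_pconst_mult: "keys (pconst c * f) \<subseteq> keys f"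
  by (auto simp: in_keys_iff lookup_pconst_mult)

lemma keys_diff_subset: "keys (f - g) \<subseteq> keys f \<union> keys (g :: pol)"
  by (auto simp: in_keys_iff lookup_minus)

text \<open>A common factor \<open>x\<^sub>i x\<^sub>i\<^sub>+\<^sub>1\<close> passes through \<open>T\<^sub>i\<close>, and the cross relations lower the
  remaining exponent.\<close>

lemma keys_T_op_xmon: "keys (T_op i (xmon \<nu>)) \<subseteq> expo_string i \<nu>"
proof (induction "lookup \<nu> i + lookup \<nu> (Suc i)" arbitrary: \<nu> rule: less_induct)
  case less
  consider "lookup \<nu> i = 0" "lookup \<nu> (Suc i) = 0" | "lookup \<nu> i > 0" "lookup \<nu> (Suc i) > 0"
    | "lookup \<nu> i > 0" "lookup \<nu> (Suc i) = 0" | "lookup \<nu> i = 0" "lookup \<nu> (Suc i) > 0" by auto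
  then show ?case
  proof cases
    case 1
    then have "swap_expo i \<nu> = \<nu>" by (intro poly_mapping_eqI) (auto simp: lookup_swap_expo transpose_def)
    then have "swap_pol i (xmon \<nu>) = xmon \<nu>" by (intro poly_mapping_eqI) (metis lookup_swap_pol lookup_xmon swap_expo_swap_expo)
    then have "T_op i (xmon \<nu>) = xmon \<nu>" by (simp add: T_op_fix_iff)
    then show ?thesis by (simp add: xmon_def expo_string_def)
  next
    case 2
    define \<nu>' where "\<nu>' = \<nu> - single i 1 - single (Suc i) 1"
    have l: "lookup \<nu>' j = (if j = i \<or> j = Suc i then lookup \<nu> j - 1 else lookup \<nu> j)" for j
      by (auto simp: \<nu>'_def lookup_minus lookup_single when_def)
    have "xmon \<nu> = var i * (var (Suc i) * xmon \<nu>')"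
      unfolding \<nu>'_def using 2
      by (subst xmon_remove_var[of \<nu> i], simp, subst xmon_remove_var[of "\<nu> - single i 1" "Suc i"])
        (auto simp: lookup_minus lookup_single when_def)
    then have "T_op i (xmon \<nu>) = var i * (var (Suc i) * T_op i (xmon \<nu>'))"
      using T_op_mult_sym[of i "var i * var (Suc i)" "xmon \<nu>'"] by (simp add: swap_pol_mult mult.assoc)
    moreover have "keys (T_op i (xmon \<nu>')) \<subseteq> expo_string i \<nu>'"
      by (rule less) (use 2 in \<open>auto simp: l\<close>)
    moreover have "m \<in> expo_string i \<nu>" if "m - single i 1 - single (Suc i) 1 \<in> expo_string i \<nu>'"
      "lookup m i > 0" "lookup (m - single i 1) (Suc i) > 0" for m
    proof -
      have "lookup m (Suc i) > 0" using that by (simp add: lookup_minus lookup_single when_def)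
      then obtain a b c d where "lookup \<nu> i = Suc a" "lookup \<nu> (Suc i) = Suc b" "lookup m i = Suc c" "lookup m (Suc i) = Suc d"
        using 2 \<open>lookup m i > 0\<close> by (meson gr0_implies_Suc)
      then show ?thesis using that(1) by (auto simp: expo_string_def l lookup_minus lookup_single when_def)
    qed
    ultimately show ?thesis by (simp only:) (blast dest: keys_var_mult)
  next
    case 3
    define \<nu>' where "\<nu>' = \<nu> - single i 1"
    have l: "lookup \<nu>' j = (if j = i then lookup \<nu> j - 1 else lookup \<nu> j)" for j
      by (auto simp: \<nu>'_def lookup_minus lookup_single when_def)
    have x: "xmon \<nu> = var i * xmon \<nu>'"
      unfolding \<nu>'_def using 3 by (subst xmon_remove_var[of \<nu> i]) auto
    have "T_op i (xmon \<nu>) = var (Suc i) * T_op i (xmon \<nu>') + pconst (1 - t_par) * xmon \<nu>"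
      unfolding x T_op_var by (simp add: mult.assoc)
    then have "keys (T_op i (xmon \<nu>)) \<subseteq> keys (var (Suc i) * T_op i (xmon \<nu>')) \<union> {\<nu>}"
      using keys_add[of "var (Suc i) * T_op i (xmon \<nu>')" "pconst (1 - t_par) * xmon \<nu>"]
        keys_pconst_mult[of "1 - t_par" "xmon \<nu>"] by (auto simp: xmon_def)
    moreover have "keys (T_op i (xmon \<nu>')) \<subseteq> expo_string i \<nu>'"
      by (rule less) (use 3 in \<open>auto simp: l\<close>)
    moreover have "m \<in> expo_string i \<nu>" if "m - single (Suc i) 1 \<in> expo_string i \<nu>'" "lookup m (Suc i) > 0" for m
      using that 3 by (auto simp: expo_string_def l lookup_minus lookup_single when_def split: if_splits)
    moreover have "\<nu> \<in> expo_string i \<nu>" by (auto simp: expo_string_def)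
    ultimately show ?thesis by (blast dest: keys_var_mult)
  next
    case 4
    define \<nu>' where "\<nu>' = \<nu> - single (Suc i) 1"
    have l: "lookup \<nu>' j = (if j = Suc i then lookup \<nu> j - 1 else lookup \<nu> j)" for j
      by (auto simp: \<nu>'_def lookup_minus lookup_single when_def)
    have x: "xmon \<nu> = var (Suc i) * xmon \<nu>'"
      unfolding \<nu>'_def using 4 by (subst xmon_remove_var[of \<nu> "Suc i"]) auto
    have "T_op i (xmon \<nu>) = var i * T_op i (xmon \<nu>') - pconst (1 - t_par) * (var i * xmon \<nu>')"
      unfolding x T_op_var_Suc by (simp add: mult.assoc)
    then have k: "keys (T_op i (xmon \<nu>)) \<subseteq> keys (var i * T_op i (xmon \<nu>')) \<union> keys (var i * xmon \<nu>')"
      using keys_diff_subset[of "var i * T_op i (xmon \<nu>')" "pconst (1 - t_par) * (var i * xmon \<nu>')"]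
        keys_pconst_mult[of "1 - t_par" "var i * xmon \<nu>'"] by auto
    have "m \<in> expo_string i \<nu>" if "m - single i 1 \<in> expo_string i \<nu>'" "lookup m i > 0" for m
      using that 4 by (auto simp: expo_string_def l lookup_minus lookup_single when_def split: if_splits)
    then have sub: "keys (var i * g) \<subseteq> expo_string i \<nu>" if "keys g \<subseteq> expo_string i \<nu>'" for g
      using that keys_var_mult by blast
    have "keys (var i * T_op i (xmon \<nu>')) \<subseteq> expo_string i \<nu>"
      by (intro sub less) (use 4 in \<open>auto simp: l\<close>)
    moreover have "keys (var i * xmon \<nu>') \<subseteq> expo_string i \<nu>"
      by (rule sub) (auto simp: xmon_def expo_string_def)
    ultimately show ?thesis using k by auto
  qed
qed

text \<open>This coefficient normalizes the intertwiner: an entry that moves to the right keeps the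
  leading coefficient 1.\<close>

lemma lookup_T_op_xmon_swap:
  "lookup \<nu> (Suc i) < lookup \<nu> i \<Longrightarrow> lookup (T_op i (xmon \<nu>)) (swap_expo i \<nu>) = 1"
proof (induction "lookup \<nu> i + lookup \<nu> (Suc i)" arbitrary: \<nu> rule: less_induct)
  case less
  show ?case
  proof (cases "lookup \<nu> (Suc i) = 0")
    case False
    define \<nu>' where "\<nu>' = \<nu> - single i 1 - single (Suc i) 1"
    have l: "lookup \<nu>' j = (if j = i \<or> j = Suc i then lookup \<nu> j - 1 else lookup \<nu> j)" for j
      by (auto simp: \<nu>'_def lookup_minus lookup_single when_def)
    have "xmon \<nu> = var i * (var (Suc i) * xmon \<nu>')"
      unfolding \<nu>'_def using False less
      by (subst xmon_remove_var[of \<nu> i], simp, subst xmon_remove_var[of "\<nu> - single i 1" "Suc i"])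
        (auto simp: lookup_minus lookup_single when_def)
    then have "T_op i (xmon \<nu>) = var i * (var (Suc i) * T_op i (xmon \<nu>'))"
      using T_op_mult_sym[of i "var i * var (Suc i)" "xmon \<nu>'"] by (simp add: swap_pol_mult mult.assoc)
    moreover have "swap_expo i \<nu> - single i 1 - single (Suc i) 1 = swap_expo i \<nu>'"
      by (rule poly_mapping_eqI) (auto simp: l lookup_minus lookup_swap_expo lookup_single when_def transpose_def)
    ultimately show ?thesis using less.hyps[of \<nu>'] False less.prems
      by (auto simp: lookup_var_mult l lookup_swap_expo lookup_minus lookup_single)
  next
    case True
    define \<nu>' where "\<nu>' = \<nu> - single i 1"
    have l: "lookup \<nu>' j = (if j = i then lookup \<nu> j - 1 else lookup \<nu> j)" for j
      by (auto simp: \<nu>'_def lookup_minus lookup_single when_def)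
    have x: "xmon \<nu> = var i * xmon \<nu>'"
      unfolding \<nu>'_def using less.prems by (subst xmon_remove_var[of \<nu> i]) auto
    have s: "swap_expo i \<nu> - single (Suc i) 1 = swap_expo i \<nu>'"
      by (rule poly_mapping_eqI) (auto simp: l lookup_minus lookup_swap_expo lookup_single when_def transpose_def)
    have "lookup (T_op i (xmon \<nu>)) (swap_expo i \<nu>) = lookup (T_op i (xmon \<nu>')) (swap_expo i \<nu>')"
      unfolding x T_op_var using True less.prems
      by (simp add: lookup_add mult.assoc lookup_pconst_mult lookup_var_mult lookup_swap_expo s[simplified])
    also have "\<dots> = 1"
    proof (cases "lookup \<nu>' i = 0")
      case True
      then have e: "swap_expo i \<nu>' = \<nu>'" using \<open>lookup \<nu> (Suc i) = 0\<close>
        by (intro poly_mapping_eqI) (auto simp: lookup_swap_expo transpose_def l)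
      then have "swap_pol i (xmon \<nu>') = xmon \<nu>'" by (intro poly_mapping_eqI) (metis lookup_swap_pol lookup_xmon swap_expo_swap_expo)
      then have "T_op i (xmon \<nu>') = xmon \<nu>'" by (simp add: T_op_fix_iff)
      then show ?thesis by (simp add: e lookup_xmon)
    next
      case F: False
      then show ?thesis using less.hyps[of \<nu>'] True by (auto simp: l)
    qed
    finally show ?thesis .
  qed
qed

lemma linear_eq_sum:
  assumes "\<And>f g. A (f + g) = A f + A g" "\<And>c f. A (pconst c * f) = pconst c * A f"
  shows "A f = (\<Sum>m\<in>keys f. pconst (lookup f m) * A (xmon m))"
proof -
  have "A 0 = 0" using assms(2)[of 0 0] by simp
  then have "A (sum g S) = (\<Sum>m\<in>S. A (g m))" for g and S :: "expo set"
    by (induction S rule: infinite_finite_induct) (simp_all add: assms)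
  then show ?thesis
    by (subst poly_mapping_sum_single[of f]) (simp add: single_eq_xmon assms)
qed

lemma lookup_T_op: "lookup (T_op i f) \<kappa> = (\<Sum>m\<in>keys f. lookup f m * lookup (T_op i (xmon m)) \<kappa>)"
proof -
  have e: "T_op i f = (\<Sum>m\<in>keys f. pconst (lookup f m) * T_op i (xmon m))"
    by (rule linear_eq_sum[of "T_op i"]) (rule T_op_add, rule T_op_pconst)
  show ?thesis by (subst e) (simp only: lookup_sum lookup_pconst_mult)
qed

lemma keys_T_op: "keys (T_op i f) \<subseteq> (\<Union>\<nu>\<in>keys f. expo_string i \<nu>)"
proof
  fix \<kappa> assume "\<kappa> \<in> keys (T_op i f)"
  then have "(\<Sum>m\<in>keys f. lookup f m * lookup (T_op i (xmon m)) \<kappa>) \<noteq> 0"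
    using lookup_T_op[of i f \<kappa>] by (simp add: in_keys_iff)
  then obtain m where m: "m \<in> keys f" "lookup f m * lookup (T_op i (xmon m)) \<kappa> \<noteq> 0"
    by (meson sum.not_neutral_contains_not_neutral)
  then have "\<kappa> \<in> keys (T_op i (xmon m))" by (simp add: in_keys_iff)
  then show "\<kappa> \<in> (\<Union>\<nu>\<in>keys f. expo_string i \<nu>)"
    using keys_T_op_xmon[of i m] m(1) by blast
qed

lemma expo_string_in_Lambda:
  assumes "\<kappa> \<in> expo_string i \<nu>" "\<nu> \<in> Lambda k" "1 \<le> i" "i < k" shows "\<kappa> \<in> Lambda k"
  unfolding Lambda_def
proof safe
  fix j assume "j \<in> keys \<kappa>"
  then have "j = i \<or> j = Suc i \<or> lookup \<nu> j \<noteq> 0"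
    using assms(1) by (auto simp: expo_string_def in_keys_iff)
  then show "j \<in> {1..k}" using assms Lambda_lookup_0[OF assms(2), of j] by fastforce
qed

lemma T_op_in_Pol:
  assumes "f \<in> Pol k" "1 \<le> i" "i < k" shows "T_op i f \<in> Pol k"
  unfolding Pol_def
proof safe
  fix \<kappa> assume "\<kappa> \<in> keys (T_op i f)"
  then obtain \<nu> where "\<nu> \<in> keys f" "\<kappa> \<in> expo_string i \<nu>" using keys_T_op by blast
  then show "\<kappa> \<in> Lambda k" using assms expo_string_in_Lambda by (auto simp: Pol_def)
qed

lemma T_inv_in_Pol: "f \<in> Pol k \<Longrightarrow> 1 \<le> i \<Longrightarrow> i < k \<Longrightarrow> T_inv i f \<in> Pol k"
  unfolding T_inv_def by (intro Pol_mult Pol_diff T_op_in_Pol Pol_pconst)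

subsection \<open>Products of operators along an interval\<close>

text \<open>In \<open>T_up\<close> and \<open>T_dn\<close> the factor with the smallest index is applied first, so the two
  products are not inverse to each other; both occur in this order in the Cherednik operators.\<close>

definition T_up :: "nat \<Rightarrow> nat \<Rightarrow> pol \<Rightarrow> pol" where
  "T_up a b = fold T_op [a..<b]"
definition T_dn :: "nat \<Rightarrow> nat \<Rightarrow> pol \<Rightarrow> pol" where
  "T_dn a b = fold T_inv [a..<b]"

lemma T_up_refl [simp]: "b \<le> a \<Longrightarrow> T_up a b f = f" by (simp add: T_up_def)
lemma T_dn_refl [simp]: "b \<le> a \<Longrightarrow> T_dn a b f = f" by (simp add: T_dn_def)
lemma T_up_Suc: "a \<le> b \<Longrightarrow> T_up a (Suc b) f = T_op b (T_up a b f)" by (simp add: T_up_def)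
lemma T_dn_Suc: "a \<le> b \<Longrightarrow> T_dn a (Suc b) f = T_inv b (T_dn a b f)" by (simp add: T_dn_def)
lemma T_up_first: "a < b \<Longrightarrow> T_up a b f = T_up (Suc a) b (T_op a f)" by (simp add: T_up_def upt_conv_Cons)
lemma T_dn_first: "a < b \<Longrightarrow> T_dn a b f = T_dn (Suc a) b (T_inv a f)" by (simp add: T_dn_def upt_conv_Cons)
lemma T_dn_trans: "a \<le> b \<Longrightarrow> b \<le> c \<Longrightarrow> T_dn a c f = T_dn b c (T_dn a b f)"
  using upt_add_eq_append[of a b "c - b"] by (simp add: T_dn_def)

lemma T_up_induct:
  assumes "P f" "\<And>j g. a \<le> j \<Longrightarrow> j < b \<Longrightarrow> P g \<Longrightarrow> P (T_op j g)" shows "P (T_up a b f)"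
  using assms
proof (induction b)
  case (Suc b)
  then show ?case by (cases "a \<le> b") (auto simp: T_up_Suc)
qed simp
lemma T_dn_induct:
  assumes "P f" "\<And>j g. a \<le> j \<Longrightarrow> j < b \<Longrightarrow> P g \<Longrightarrow> P (T_inv j g)" shows "P (T_dn a b f)"
  using assms
proof (induction b)
  case (Suc b)
  then show ?case by (cases "a \<le> b") (auto simp: T_dn_Suc)
qed simp

lemma T_up_in_Pol: "f \<in> Pol k \<Longrightarrow> 1 \<le> a \<Longrightarrow> b \<le> k \<Longrightarrow> T_up a b f \<in> Pol k"
  by (rule T_up_induct) (auto intro: T_op_in_Pol)
lemma T_dn_in_Pol: "f \<in> Pol k \<Longrightarrow> 1 \<le> a \<Longrightarrow> b \<le> k \<Longrightarrow> T_dn a b f \<in> Pol k"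
  by (rule T_dn_induct) (auto intro: T_inv_in_Pol)

lemma T_up_hom:
  assumes "\<And>j f. a \<le> j \<Longrightarrow> j < b \<Longrightarrow> A (T_op j f) = T_op (j + d) (A f)"
  shows "A (T_up a b f) = T_up (a + d) (b + d) (A f)"
  using assms
proof (induction b)
  case (Suc b)
  then show ?case by (cases "a \<le> b") (auto simp: T_up_Suc)
qed simp
lemma T_dn_hom:
  assumes "\<And>j f. a \<le> j \<Longrightarrow> j < b \<Longrightarrow> A (T_inv j f) = T_inv (j + d) (A f)"
  shows "A (T_dn a b f) = T_dn (a + d) (b + d) (A f)"
  using assms
proof (induction b)
  case (Suc b)
  then show ?case by (cases "a \<le> b") (auto simp: T_dn_Suc)
qed simp

lemma T_up_add: "T_up a b (f + g) = T_up a b f + T_up a b g"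
proof (induction b)
  case (Suc b) then show ?case by (cases "a \<le> b") (auto simp: T_up_Suc T_op_add)
qed simp
lemma T_dn_add: "T_dn a b (f + g) = T_dn a b f + T_dn a b g"
proof (induction b)
  case (Suc b) then show ?case by (cases "a \<le> b") (auto simp: T_dn_Suc T_inv_add)
qed simp
lemma T_up_mult_sym:
  "(\<And>j. a \<le> j \<Longrightarrow> j < b \<Longrightarrow> swap_pol j g = g) \<Longrightarrow> T_up a b (g * f) = g * T_up a b f"
  using T_up_hom[of a b "(*) g" 0 f] by (simp add: T_op_mult_sym)
lemma T_dn_mult_sym:
  "(\<And>j. a \<le> j \<Longrightarrow> j < b \<Longrightarrow> swap_pol j g = g) \<Longrightarrow> T_dn a b (g * f) = g * T_dn a b f"
  using T_dn_hom[of a b "(*) g" 0 f] by (simp add: T_inv_mult_sym)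
lemma T_up_pconst: "T_up a b (pconst c * f) = pconst c * T_up a b f"
  by (rule T_up_mult_sym) simp
lemma T_dn_pconst: "T_dn a b (pconst c * f) = pconst c * T_dn a b f"
  by (rule T_dn_mult_sym) simp
lemma T_up_fix: "(\<And>j. a \<le> j \<Longrightarrow> j < b \<Longrightarrow> T_op j f = f) \<Longrightarrow> T_up a b f = f"
  by (rule T_up_induct[where P = "\<lambda>g. g = f"]) auto
lemma T_dn_fix: "(\<And>j. a \<le> j \<Longrightarrow> j < b \<Longrightarrow> T_op j f = f) \<Longrightarrow> T_dn a b f = f"
  by (rule T_dn_induct[where P = "\<lambda>g. g = f"]) (auto simp: T_inv_fix)

lemma T_op_T_up_far: "Suc l < a \<or> b < l \<Longrightarrow> T_op l (T_up a b f) = T_up a b (T_op l f)"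
  using T_up_hom[of a b "T_op l" 0 f] T_op_commute[of l] by fastforce
lemma T_op_T_dn_far: "Suc l < a \<or> b < l \<Longrightarrow> T_op l (T_dn a b f) = T_dn a b (T_op l f)"
  using T_dn_hom[of a b "T_op l" 0 f] T_op_T_inv_commute[of l] by fastforce

text \<open>Far factors commute, and the braid relation at the factors with indices l and l+1 raises
  the index of \<open>T\<^sub>l\<close> by one.\<close>

lemma T_op_T_up_inside:
  assumes "a \<le> l" "Suc l < b" shows "T_op l (T_up a b f) = T_up a b (T_op (Suc l) f)"
  using assms(2)
proof (induction b)
  case (Suc b)
  show ?case
  proof (cases "Suc l < b")
    case True
    then show ?thesis using Suc assms T_op_commute[of l b] by (simp add: T_up_Suc)
  next
    case False
    then have b: "b = Suc l" using Suc by simp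
    show ?thesis using assms T_op_braid[of l "T_up a l f"] T_op_T_up_far[of "Suc l" a l f]
      by (simp add: T_up_Suc b)
  qed
qed simp

lemma T_op_T_inv_braid: "T_op l (T_inv (Suc l) (T_inv l f)) = T_inv (Suc l) (T_inv l (T_op (Suc l) f))"
  by (intro T_inv_eqI[symmetric]) (simp add: T_op_braid)

lemma T_op_T_dn_inside:
  assumes "a \<le> l" "Suc l < b" shows "T_op l (T_dn a b f) = T_dn a b (T_op (Suc l) f)"
  using assms(2)
proof (induction b)
  case (Suc b)
  show ?case
  proof (cases "Suc l < b")
    case True
    then show ?thesis using Suc assms T_op_T_inv_commute[of l b] by (simp add: T_dn_Suc)
  next
    case False
    then have b: "b = Suc l" using Suc by simp
    show ?thesis using assms T_op_T_inv_braid[of l "T_dn a l f"] T_op_T_dn_far[of "Suc l" a l f]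
      by (simp add: T_dn_Suc b)
  qed
qed simp

text \<open>Each factor \<open>T\<^sub>l\<inverse>\<close> moves the variable one place to the right and becomes \<open>t\<inverse> T\<^sub>l\<close>. These
  powers of \<open>t\<inverse>\<close> compensate the growing power of t in front of the Cherednik operators, which is
  why only multiples of a variable survive in the limit.\<close>

lemma T_dn_var:
  "a \<le> b \<Longrightarrow> T_dn a b (var a * f) = pconst (inverse t_par ^ (b - a)) * (var b * T_up a b f)"
proof (induction b)
  case (Suc b)
  show ?case
  proof (cases "a = Suc b")
    case False
    then have "a \<le> b" using Suc by simp
    then have "T_dn a (Suc b) (var a * f) = T_inv b (pconst (inverse t_par ^ (b - a)) * (var b * T_up a b f))"
      using Suc by (simp add: T_dn_Suc)
    also have "\<dots> = pconst (inverse t_par ^ (b - a)) * (pconst (inverse t_par) * (var (Suc b) * T_op b (T_up a b f)))"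
      by (simp only: T_inv_pconst T_inv_var)
    finally show ?thesis using \<open>a \<le> b\<close>
      by (simp only: T_up_Suc Suc_diff_le power_Suc pconst_mult mult.assoc mult.left_commute)
  qed simp
qed simp

section \<open>The operators of Cherednik and their intertwiners\<close>

lemma omega_inv_simps:
  "omega_inv k (f + g) = omega_inv k f + omega_inv k g"
  "omega_inv k (f - g) = omega_inv k f - omega_inv k g"
  "omega_inv k (f * g) = omega_inv k f * omega_inv k g"
  "omega_inv k (pconst c) = pconst c" "omega_inv k 1 = 1" "omega_inv k 0 = 0"
  "omega_inv k (var k) = pconst q_par * var 1"
  "j \<noteq> k \<Longrightarrow> omega_inv k (var j) = var (Suc j)"
  by (simp_all add: omega_inv_def psubst_simps)

lemma omega_inv_in_Pol: "f \<in> Pol k \<Longrightarrow> 1 \<le> k \<Longrightarrow> omega_inv k f \<in> Pol k"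
  unfolding omega_inv_def by (erule psubst_in_Pol) (auto intro!: Pol_var Pol_mult)

lemma omega_inv_swap:
  "1 \<le> l \<Longrightarrow> Suc l < k \<Longrightarrow> omega_inv k (swap_pol l f) = swap_pol (Suc l) (omega_inv k f)"
  unfolding swap_pol_def omega_inv_def psubst_psubst
  by (rule arg_cong[where f = "\<lambda>\<sigma>. psubst \<sigma> f"]) (auto simp: transpose_def psubst_simps)

lemma omega_inv_T_op:
  "1 \<le> l \<Longrightarrow> Suc l < k \<Longrightarrow> omega_inv k (T_op l f) = T_op (Suc l) (omega_inv k f)"
  unfolding omega_inv_def
  by (rule psubst_T_op) (auto simp: omega_inv_swap omega_inv_simps simp flip: omega_inv_def)

lemma omega_inv_T_inv:
  "1 \<le> l \<Longrightarrow> Suc l < k \<Longrightarrow> omega_inv k (T_inv l f) = T_inv (Suc l) (omega_inv k f)"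
  by (intro T_inv_eqI[symmetric]) (simp flip: omega_inv_T_op)

lemma omega_inv_T_dn:
  "1 \<le> a \<Longrightarrow> b < k \<Longrightarrow> omega_inv k (T_dn a b f) = T_dn (Suc a) (Suc b) (omega_inv k f)"
  using T_dn_hom[of a b "omega_inv k" 1 f] by (simp add: omega_inv_T_inv)
lemma omega_inv_T_up:
  "1 \<le> a \<Longrightarrow> b < k \<Longrightarrow> omega_inv k (T_up a b f) = T_up (Suc a) (Suc b) (omega_inv k f)"
  using T_up_hom[of a b "omega_inv k" 1 f] by (simp add: omega_inv_T_op)

lemma omega_inv_squared_swap:
  assumes "f \<in> Pol k" "2 \<le> k"
  shows "omega_inv k (omega_inv k (swap_pol (k - 1) f)) = swap_pol 1 (omega_inv k (omega_inv k f))"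
  unfolding swap_pol_def omega_inv_def psubst_psubst
  by (rule psubst_cong_Pol[OF assms(1)]) (use assms(2) in \<open>auto simp: transpose_def psubst_simps\<close>)

text \<open>One rotation would carry \<open>T\<^sub>k\<^sub>-\<^sub>1\<close> to an operator between the variables \<open>x\<^sub>k\<close> and \<open>q x\<^sub>1\<close>;
  after the second one both variables have been moved to the front.\<close>

lemma omega_inv_squared_T_op:
  assumes f: "f \<in> Pol k" "2 \<le> k"
  shows "omega_inv k (omega_inv k (T_op (k - 1) f)) = T_op 1 (omega_inv k (omega_inv k f))"
proof (rule T_op_eqI[symmetric])
  let ?O = "\<lambda>f. omega_inv k (omega_inv k f)"
  have v: "omega_inv k (var (k - 1)) = var k" "omega_inv k (var k) = pconst q_par * var 1"
      "omega_inv k (var 1) = var 2"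
    using f(2) omega_inv_simps(8)[of "k - 1" k] omega_inv_simps(8)[of 1 k]
    by (auto simp: omega_inv_simps(7) numeral_2_eq_2)
  have k: "Suc (k - 1) = k" using f by simp
  have "?O ((var (k - 1) - var k) * T_op (k - 1) f) =
    ?O (pconst (1 - t_par) * var (k - 1) * f + (pconst t_par * var (k - 1) - var k) * swap_pol (k - 1) f)"
    using T_op_char[of "k - 1" f] by (simp only: k)
  then have "pconst q_par * ((var 1 - var 2) * ?O (T_op (k - 1) f)) = pconst q_par *
    (pconst (1 - t_par) * var 1 * ?O f + (pconst t_par * var 1 - var 2) * swap_pol 1 (?O f))"
    by (simp only: omega_inv_simps(1-4) v omega_inv_squared_swap[OF f]) (simp add: algebra_simps)
  then show "(var 1 - var (Suc 1)) * ?O (T_op (k - 1) f) =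
    pconst (1 - t_par) * var 1 * ?O f + (pconst t_par * var 1 - var (Suc 1)) * swap_pol 1 (?O f)"
    by (simp add: numeral_2_eq_2)
qed

lemma omega_inv_squared_T_inv:
  assumes f: "f \<in> Pol k" "2 \<le> k"
  shows "omega_inv k (omega_inv k (T_inv (k - 1) f)) = T_inv 1 (omega_inv k (omega_inv k f))"
  using omega_inv_squared_T_op[of "T_inv (k - 1) f" k] T_inv_in_Pol[of f k "k - 1"] f
  by (simp add: T_inv_eqI)

lemma Y_gen_eq: "Y_gen W k i f = pconst (t_par ^ (k + 1 - i)) * T_up 1 i (W (T_dn i k f))"
  unfolding Y_gen_def T_up_def T_dn_def inv_T_op ..

lemma Y_op_eq: "Y_op k i f = pconst (t_par ^ (k + 1 - i)) * T_up 1 i (omega_inv k (T_dn i k f))"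
  by (simp add: Y_op_def Y_gen_eq)

lemma Y_op_add: "Y_op k i (f + g) = Y_op k i f + Y_op k i g"
  by (simp add: Y_op_eq T_dn_add T_up_add omega_inv_simps distrib_left)
lemma Y_op_pconst: "Y_op k i (pconst c * f) = pconst c * Y_op k i f"
  by (simp add: Y_op_eq T_dn_pconst T_up_pconst omega_inv_simps mult.left_commute)
lemma Y_op_0 [simp]: "Y_op k i 0 = 0" using Y_op_pconst[of k i 0] by simp
lemma Y_op_sum: "Y_op k i (sum f A) = (\<Sum>x\<in>A. Y_op k i (f x))"
  by (induction A rule: infinite_finite_induct) (simp_all add: Y_op_add)

text \<open>This and the next lemma are the relations between the operators \<open>T\<^sub>i\<close> and \<open>Y\<^sub>j\<close> from which
  the intertwiners are built.\<close>

lemma T_Y_T: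
  assumes "1 \<le> i" "i < k" shows "T_op i (Y_op k i (T_op i f)) = pconst t_par * Y_op k (Suc i) f"
  using assms
  by (simp add: Y_op_eq T_dn_first[of i k] T_op_pconst T_up_Suc Suc_diff_le pconst_mult mult.assoc)

lemma T_Y_commute:
  assumes "1 \<le> i" "i \<le> k" "1 \<le> l" "l < k" "l \<noteq> i" "Suc l \<noteq> i"
  shows "T_op l (Y_op k i f) = Y_op k i (T_op l f)"
proof (cases "l < i")
  case True
  have "T_op l (T_up 1 i (omega_inv k (T_dn i k f))) = T_up 1 i (omega_inv k (T_op l (T_dn i k f)))"
    using assms True by (simp add: T_op_T_up_inside omega_inv_T_op)
  also have "T_op l (T_dn i k f) = T_dn i k (T_op l f)"
    using assms True by (intro T_op_T_dn_far) auto
  finally show ?thesis by (simp add: Y_op_eq T_op_pconst)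
next
  case False
  have "T_op l (T_up 1 i (omega_inv k (T_dn i k f))) = T_up 1 i (omega_inv k (T_op (l - 1) (T_dn i k f)))"
    using assms False omega_inv_T_op[of "l - 1" k] by (simp add: T_op_T_up_far)
  also have "T_op (l - 1) (T_dn i k f) = T_dn i k (T_op l f)"
    using assms False T_op_T_dn_inside[of i "l - 1" k f] by simp
  finally show ?thesis by (simp add: Y_op_eq T_op_pconst)
qed

text \<open>The raising operator \<open>x\<^sub>1 \<omega>\<inverse>\<close>, which permutes the Cherednik operators cyclically.\<close>

definition Phi :: "nat \<Rightarrow> pol \<Rightarrow> pol" where
  "Phi k f = var 1 * omega_inv k f"

lemma Phi_in_Pol: "f \<in> Pol k \<Longrightarrow> 1 \<le> k \<Longrightarrow> Phi k f \<in> Pol k"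
  unfolding Phi_def by (intro Pol_mult Pol_var omega_inv_in_Pol) auto

lemma Phi_pconst: "Phi k (pconst c * f) = pconst c * Phi k f"
  by (simp add: Phi_def omega_inv_simps mult.left_commute)

lemma Y_Phi:
  assumes f: "f \<in> Pol k" and i: "1 \<le> i" "i < k"
  shows "Y_op k (Suc i) (Phi k f) = Phi k (Y_op k i f)"
proof -
  let ?g = "T_dn i (k - 1) f" and ?O = "omega_inv k"
  have k: "Suc (k - 1) = k" using i by simp
  have g: "?g \<in> Pol k" using f i by (intro T_dn_in_Pol) auto
  have "T_dn (Suc i) k (Phi k f) = var 1 * T_dn (Suc i) k (?O f)"
    unfolding Phi_def using i by (intro T_dn_mult_sym) auto
  also have "T_dn (Suc i) k (?O f) = ?O ?g"
    using omega_inv_T_dn[of i "k - 1" k f] i by (simp add: k)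
  finally have "?O (T_dn (Suc i) k (Phi k f)) = var (Suc 1) * ?O (?O ?g)"
    using i by (simp add: omega_inv_simps)
  then have "T_op 1 (?O (T_dn (Suc i) k (Phi k f))) = pconst t_par * (var 1 * T_inv 1 (?O (?O ?g)))"
    by (simp only: T_op_var_Suc')
  also have "T_inv 1 (?O (?O ?g)) = ?O (?O (T_dn i k f))"
    using omega_inv_squared_T_inv[OF g] T_dn_Suc[of i "k - 1" f] i by (simp add: k)
  finally have "T_up 1 (Suc i) (?O (T_dn (Suc i) k (Phi k f))) =
      T_up 2 (Suc i) (pconst t_par * (var 1 * ?O (?O (T_dn i k f))))"
    using i by (simp add: T_up_first[of "Suc 0" "Suc i"] numeral_2_eq_2)
  also have "\<dots> = pconst t_par * (var 1 * T_up 2 (Suc i) (?O (?O (T_dn i k f))))"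
    by (subst T_up_pconst, subst T_up_mult_sym) auto
  also have "T_up 2 (Suc i) (?O (?O (T_dn i k f))) = ?O (T_up 1 i (?O (T_dn i k f)))"
    using omega_inv_T_up[of 1 i k "?O (T_dn i k f)"] i by (simp add: numeral_2_eq_2)
  finally show ?thesis using i
    by (simp add: Y_op_eq Phi_def omega_inv_simps Suc_diff_le pconst_mult mult_ac)
qed

lemma Y_Phi_last:
  assumes "1 \<le> k"
  shows "Y_op k 1 (Phi k f) = pconst q_par * Phi k (Y_op k k f)"
proof -
  have "pconst (t_par ^ k) * pconst (inverse t_par ^ (k - 1)) = pconst t_par"
    using assms by (cases k) (simp_all add: field_simps flip: pconst_mult)
  then have *: "pconst (t_par ^ k) * (pconst (inverse t_par ^ (k - 1)) * g) = pconst t_par * g" for g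
    by (simp flip: mult.assoc)
  let ?h = "T_up 1 k (omega_inv k f)"
  have "Y_op k 1 (Phi k f) = pconst (t_par ^ k) * omega_inv k (pconst (inverse t_par ^ (k - 1)) * (var k * ?h))"
    using T_dn_var[OF assms, of "omega_inv k f"] by (simp add: Y_op_eq Phi_def)
  also have "\<dots> = pconst t_par * (pconst q_par * (var 1 * omega_inv k ?h))"
    by (simp only: omega_inv_simps * mult.assoc)
  also have "\<dots> = pconst q_par * Phi k (Y_op k k f)"
    by (simp add: Y_op_eq Phi_def omega_inv_simps mult.left_commute)
  finally show ?thesis .
qed

section \<open>The Bruhat order on integer vectors\<close>

subsection \<open>Affine roots\<close>

type_synonym vec = "nat \<Rightarrow> int"

text \<open>Affine roots are encoded as affine functions on vectors, so that the group acts on them by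
  composition.\<close>

definition root_fun :: "nat \<Rightarrow> nat \<Rightarrow> int \<Rightarrow> vec \<Rightarrow> int" where
  "root_fun i j c x = x i - x j + c"

definition reflect :: "nat \<Rightarrow> nat \<Rightarrow> int \<Rightarrow> vec \<Rightarrow> vec" where
  "reflect i j c x = x(i := x j - c, j := x i + c)"

definition roots :: "nat \<Rightarrow> (vec \<Rightarrow> int) set" where
  "roots k = {root_fun i j c | i j c. i \<in> {1..k} \<and> j \<in> {1..k} \<and> i \<noteq> j}"

text \<open>This is k times the value of the root at the rational point \<open>((k - 1) x + y) / k\<close>, kept
  integral. For \<open>x = 0\<close> and \<open>y = (-1, \<dots>, -k)\<close> the point lies inside the fundamental alcove, and
  all simple roots have the value 1 there: this is the height of a root, and a root is positive
  if its height is. For \<open>x = y\<close> it is a multiple of the value at an integer vector. The two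
  cases give the inversions of a group element and the hyperplanes between a vector and the
  fundamental alcove, and are treated together.\<close>

definition pair_eval :: "nat \<Rightarrow> vec \<Rightarrow> vec \<Rightarrow> (vec \<Rightarrow> int) \<Rightarrow> int" where
  "pair_eval k x y \<alpha> = (int k - 1) * \<alpha> x + \<alpha> y"

definition ht :: "nat \<Rightarrow> (vec \<Rightarrow> int) \<Rightarrow> int" where
  "ht k = pair_eval k (\<lambda>_. 0) (\<lambda>i. - int i)"

definition sroot :: "nat \<Rightarrow> nat \<Rightarrow> vec \<Rightarrow> int" where
  "sroot k s = (if s = 0 then root_fun k 1 1 else root_fun s (Suc s) 0)"

definition neg_roots :: "nat \<Rightarrow> vec \<Rightarrow> vec \<Rightarrow> (vec \<Rightarrow> int) set" where
  "neg_roots k x y = {\<alpha> \<in> roots k. ht k \<alpha> > 0 \<and> pair_eval k x y \<alpha> < 0}"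

definition Neg :: "nat \<Rightarrow> vec \<Rightarrow> (vec \<Rightarrow> int) set" where
  "Neg k x = neg_roots k x x"

definition Inv :: "nat \<Rightarrow> (vec \<Rightarrow> vec) \<Rightarrow> (vec \<Rightarrow> int) set" where
  "Inv k w = neg_roots k (w (\<lambda>_. 0)) (w (\<lambda>i. - int i))"

lemma ht_root_fun: "ht k (root_fun i j c) = int k * c + int j - int i"
  by (simp add: ht_def pair_eval_def root_fun_def algebra_simps)

lemma pair_eval_root_fun:
  "pair_eval k x y (root_fun i j c) = (int k - 1) * (x i - x j) + (y i - y j) + int k * c"
  by (simp add: pair_eval_def root_fun_def algebra_simps)

lemma root_fun_in_roots: "i \<in> {1..k} \<Longrightarrow> j \<in> {1..k} \<Longrightarrow> i \<noteq> j \<Longrightarrow> root_fun i j c \<in> roots k"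
  by (auto simp: roots_def)

lemma rootsE:
  assumes "\<alpha> \<in> roots k"
  obtains i j c where "\<alpha> = root_fun i j c" "i \<in> {1..k}" "j \<in> {1..k}" "i \<noteq> j"
  using assms by (auto simp: roots_def)

lemma root_pos_iff:
  assumes "i \<in> {1..k}" "j \<in> {1..k}" "i \<noteq> j"
  shows "ht k (root_fun i j c) > 0 \<longleftrightarrow> c > 0 \<or> c = 0 \<and> i < j"
proof -
  have b: "int j - int i < int k" "int i - int j < int k" using assms by auto
  consider "c > 0" | "c = 0" | "c < 0" by linarith
  then show ?thesis
  proof cases
    case 1
    then have "int k * c \<ge> int k" using mult_left_mono[of 1 c "int k"] by simp
    then show ?thesis using 1 b unfolding ht_root_fun by linarith
  next
    case 3
    then have "int k * c \<le> int k * (-1)" by (intro mult_left_mono) auto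
    then show ?thesis using 3 b unfolding ht_root_fun by linarith
  qed (auto simp: ht_root_fun)
qed

lemma root_fun_uminus: "- root_fun i j c x = root_fun j i (- c) x"
  by (simp add: root_fun_def)

lemma uminus_in_roots: "\<alpha> \<in> roots k \<Longrightarrow> (\<lambda>x. - \<alpha> x) \<in> roots k"
  by (erule rootsE) (auto simp: root_fun_uminus intro: root_fun_in_roots)

lemma ht_uminus: "ht k (\<lambda>x. - \<alpha> x) = - ht k \<alpha>"
  by (simp add: ht_def pair_eval_def algebra_simps)

lemma ht_neq_0:
  assumes "\<alpha> \<in> roots k" shows "ht k \<alpha> \<noteq> 0"
proof -
  obtain i j c where a: "\<alpha> = root_fun i j c" "i \<in> {1..k}" "j \<in> {1..k}" "i \<noteq> j"
    using assms by (rule rootsE)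
  then have "ht k \<alpha> > 0 \<or> ht k (\<lambda>x. - \<alpha> x) > 0"
    by (auto simp: root_fun_uminus root_pos_iff)
  then show ?thesis by (auto simp: ht_uminus)
qed

lemma reflect_apply: "i \<noteq> j \<Longrightarrow> reflect i j c x a = x (transpose i j a) + (if a = i then - c else if a = j then c else 0)"
  by (auto simp: reflect_def transpose_def)

lemma reflect_reflect: "i \<noteq> j \<Longrightarrow> reflect i j c (reflect i j c x) = x"
  by (rule ext) (auto simp: reflect_apply transpose_def)

lemma reflect_comp: "i \<noteq> j \<Longrightarrow> reflect i j c \<circ> (reflect i j c \<circ> w) = w"
  by (rule ext) (simp add: reflect_reflect)

lemma reflect_swap: "i \<noteq> j \<Longrightarrow> reflect i j c = reflect j i (- c)"
  by (intro ext) (auto simp: reflect_apply transpose_def)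

lemma root_reflect_self: "i \<noteq> j \<Longrightarrow> root_fun i j c (reflect i j c x) = - root_fun i j c x"
  by (auto simp: reflect_apply root_fun_def)

lemma reflect_fix: "root_fun i j c x = 0 \<Longrightarrow> reflect i j c x = x"
  by (auto simp: reflect_def root_fun_def)

lemma root_reflect:
  assumes "i \<noteq> j"
  shows "root_fun a b d (reflect i j c x) = root_fun (transpose i j a) (transpose i j b)
     (d + (if a = i then - c else if a = j then c else 0) - (if b = i then - c else if b = j then c else 0)) x"
  using assms by (simp add: root_fun_def reflect_apply)

text \<open>The pairing of the root \<open>e\<^sub>a - e\<^sub>b\<close> with the coroot of \<open>e\<^sub>i - e\<^sub>j\<close>.\<close>

definition pairing :: "nat \<Rightarrow> nat \<Rightarrow> nat \<Rightarrow> nat \<Rightarrow> int" where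
  "pairing a b i j = of_bool (a = i) - of_bool (a = j) - of_bool (b = i) + of_bool (b = j)"

lemma root_reflect_pairing:
  "i \<noteq> j \<Longrightarrow> root_fun a b d (reflect i j c x) = root_fun a b d x - pairing a b i j * root_fun i j c x"
  by (auto simp: root_fun_def reflect_def pairing_def)

lemma reflect_conj:
  assumes "i \<noteq> j" "a \<noteq> b"
  obtains i' j' c' where "\<And>x. root_fun i' j' c' x = root_fun i j c (reflect a b d x)"
    "i' = transpose a b i" "j' = transpose a b j"
    "\<And>x. reflect i' j' c' (reflect a b d x) = reflect a b d (reflect i j c x)"
proof
  let ?i = "transpose a b i" and ?j = "transpose a b j"
  let ?c = "c + (if i = a then - d else if i = b then d else 0) - (if j = a then - d else if j = b then d else 0)"
  show "root_fun ?i ?j ?c x = root_fun i j c (reflect a b d x)" for x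
    using assms by (simp add: root_reflect)
  show "reflect ?i ?j ?c (reflect a b d x) = reflect a b d (reflect i j c x)" for x
    by (rule ext) (use assms in \<open>auto simp: reflect_def transpose_def\<close>)
qed auto

subsection \<open>The group\<close>

context
  fixes k :: nat
  assumes k2: "2 \<le> k"
begin

lemma gens_eq: "aff_gens k = {0..<k}" using k2 by (simp add: aff_gens_def)

lemma aff_s_eq_refl: "s < k \<Longrightarrow> aff_s k s = (if s = 0 then reflect k 1 1 else reflect s (Suc s) 0)"
  using k2 by (intro ext) (auto simp: aff_s_def reflect_def transpose_def)

lemma gen_cases:
  assumes "s < k"
  obtains i j c where "aff_s k s = reflect i j c" "sroot k s = root_fun i j c" "i \<in> {1..k}" "j \<in> {1..k}" "i \<noteq> j"
proof (cases "s = 0")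
  case True
  then show ?thesis using k2 assms by (intro that[of k 1 1]) (auto simp: aff_s_eq_refl sroot_def)
next
  case False
  then show ?thesis using k2 assms by (intro that[of s "Suc s" 0]) (auto simp: aff_s_eq_refl sroot_def)
qed

lemma sroot_in_roots: "s < k \<Longrightarrow> sroot k s \<in> roots k"
  by (erule gen_cases) (auto intro: root_fun_in_roots)
lemma ht_sroot: "s < k \<Longrightarrow> ht k (sroot k s) = 1"
  using k2 by (auto simp: sroot_def ht_root_fun)

lemma aff_s_aff_s: "s < k \<Longrightarrow> aff_s k s (aff_s k s x) = x"
  by (erule gen_cases) (simp add: reflect_reflect)
lemma sroot_aff_s: "s < k \<Longrightarrow> sroot k s (aff_s k s x) = - sroot k s x"
  by (erule gen_cases) (simp add: root_reflect_self)
lemma aff_s_fix: "s < k \<Longrightarrow> sroot k s x = 0 \<Longrightarrow> aff_s k s x = x"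
  by (erule gen_cases) (simp add: reflect_fix)

lemma aff_s_comp: "s < k \<Longrightarrow> aff_s k s \<circ> (aff_s k s \<circ> w) = w"
  by (rule ext) (simp add: aff_s_aff_s)

lemma aff_word_Cons: "aff_word k (s # ss) = aff_s k s \<circ> aff_word k ss"
  by (simp add: aff_word_def)
lemma aff_word_Nil: "aff_word k [] = id"
  by (simp add: aff_word_def)
lemma aff_word_append: "aff_word k (ss @ ts) = aff_word k ss \<circ> aff_word k ts"
  by (induction ss) (auto simp: aff_word_Cons aff_word_Nil comp_assoc)

lemma group_induct [consumes 1, case_names id gen]:
  assumes "w \<in> aff_group k" "P id"
    "\<And>s w. s < k \<Longrightarrow> w \<in> aff_group k \<Longrightarrow> P w \<Longrightarrow> P (aff_s k s \<circ> w)"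
  shows "P w"
proof -
  obtain ss where "w = aff_word k ss" "set ss \<subseteq> {0..<k}"
    using assms(1) by (auto simp: aff_group_def gens_eq)
  moreover have "set ss \<subseteq> {0..<k} \<Longrightarrow> P (aff_word k ss)"
  proof (induction ss)
    case Nil show ?case unfolding aff_word_Nil by (rule assms(2))
  next
    case (Cons s ss)
    then have "aff_word k ss \<in> aff_group k" by (auto simp: aff_group_def gens_eq)
    then show ?case unfolding aff_word_Cons using Cons by (intro assms(3)) auto
  qed
  ultimately show ?thesis by simp
qed

lemma id_in_group [simp]: "id \<in> aff_group k"
  unfolding aff_group_def by (auto intro!: exI[of _ "[]"] simp: aff_word_Nil)
lemma gen_in_group: "s < k \<Longrightarrow> aff_s k s \<in> aff_group k"
  unfolding aff_group_def by (auto intro!: exI[of _ "[s]"] simp: aff_word_Nil aff_word_Cons gens_eq)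
lemma group_comp: "v \<in> aff_group k \<Longrightarrow> w \<in> aff_group k \<Longrightarrow> v \<circ> w \<in> aff_group k"
  unfolding aff_group_def by clarsimp (metis aff_word_append le_sup_iff set_append)

lemma group_inverse:
  assumes "w \<in> aff_group k"
  shows "\<exists>v\<in>aff_group k. \<forall>x. v (w x) = x \<and> w (v x) = x"
  using assms
proof (induction rule: group_induct)
  case id show ?case by (rule bexI[OF _ id_in_group]) simp
next
  case (gen s w)
  from gen(3) obtain v where v: "v \<in> aff_group k" "\<forall>x. v (w x) = x \<and> w (v x) = x" by (rule bexE)
  show ?case
  proof (rule bexI[of _ "v \<circ> aff_s k s"])
    show "v \<circ> aff_s k s \<in> aff_group k" using gen(1) v(1) by (intro group_comp gen_in_group)
    show "\<forall>x. (v \<circ> aff_s k s) ((aff_s k s \<circ> w) x) = x \<and> (aff_s k s \<circ> w) ((v \<circ> aff_s k s) x) = x"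
      using v(2) gen(1) by (simp add: aff_s_aff_s)
  qed
qed

lemma group_inv:
  assumes "w \<in> aff_group k"
  shows "inv w \<in> aff_group k" "inv w (w x) = x" "w (inv w x) = x" "bij w"
proof -
  obtain v where v: "v \<in> aff_group k" "\<forall>x. v (w x) = x \<and> w (v x) = x"
    using group_inverse[OF assms] by (rule bexE)
  then have "inv w = v" by (intro inv_equality) auto
  moreover have "bij w" using v(2) by (intro o_bij[of v]) (simp_all add: fun_eq_iff)
  ultimately show "inv w \<in> aff_group k" "inv w (w x) = x" "w (inv w x) = x" "bij w"
    using v by simp_all
qed

lemma root_comp_reflect:
  assumes "\<alpha> \<in> roots k" "i \<in> {1..k}" "j \<in> {1..k}" "i \<noteq> j" shows "(\<lambda>x. \<alpha> (reflect i j c x)) \<in> roots k"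
proof -
  obtain a b d where a: "\<alpha> = root_fun a b d" "a \<in> {1..k}" "b \<in> {1..k}" "a \<noteq> b"
    using assms(1) by (rule rootsE)
  show ?thesis unfolding a root_reflect[OF assms(4)]
    using a assms by (intro root_fun_in_roots) (auto simp: transpose_def)
qed

lemma root_comp_gen: "\<alpha> \<in> roots k \<Longrightarrow> s < k \<Longrightarrow> \<alpha> \<circ> aff_s k s \<in> roots k"
  by (erule gen_cases[of s]) (auto simp: comp_def intro: root_comp_reflect)

lemma root_comp:
  assumes "w \<in> aff_group k" "\<alpha> \<in> roots k" shows "\<alpha> \<circ> w \<in> roots k"
  using assms
proof (induction arbitrary: \<alpha> rule: group_induct)
  case (gen s w)
  have "(\<alpha> \<circ> aff_s k s) \<circ> w \<in> roots k" by (rule gen.IH[OF root_comp_gen[OF gen.prems gen(1)]])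
  then show ?case by (simp only: comp_assoc)
qed simp

lemma ht_comp: "ht k (\<alpha> \<circ> w) = pair_eval k (w (\<lambda>_. 0)) (w (\<lambda>i. - int i)) \<alpha>"
  by (simp add: ht_def pair_eval_def)

lemma Inv_iff: "\<alpha> \<in> Inv k w \<longleftrightarrow> \<alpha> \<in> roots k \<and> ht k \<alpha> > 0 \<and> ht k (\<alpha> \<circ> w) < 0"
  by (simp add: Inv_def neg_roots_def ht_comp)

lemma Neg_iff: "\<alpha> \<in> Neg k x \<longleftrightarrow> \<alpha> \<in> roots k \<and> ht k \<alpha> > 0 \<and> \<alpha> x < 0"
proof -
  have "pair_eval k x x \<alpha> = int k * \<alpha> x" by (simp add: pair_eval_def algebra_simps)
  then show ?thesis using k2 by (simp add: Neg_def neg_roots_def mult_less_0_iff)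
qed

lemma finite_neg_roots [simp]: "finite (neg_roots k x y)"
proof -
  let ?B = "\<lambda>i j. \<bar>(int k - 1) * (x i - x j) + (y i - y j)\<bar>"
  have "neg_roots k x y \<subseteq> (\<Union>i\<in>{1..k}. \<Union>j\<in>{1..k}. root_fun i j ` {0..?B i j})"
  proof
    fix \<alpha> assume a: "\<alpha> \<in> neg_roots k x y"
    then have "\<alpha> \<in> roots k" by (simp add: neg_roots_def)
    then obtain i j c where i: "\<alpha> = root_fun i j c" "i \<in> {1..k}" "j \<in> {1..k}" "i \<noteq> j" by (rule rootsE)
    then have c: "c \<ge> 0" using a root_pos_iff[OF i(2-4)] by (auto simp: neg_roots_def)
    have "(int k - 1) * (x i - x j) + (y i - y j) + int k * c < 0"
      using a i(1) by (simp add: neg_roots_def pair_eval_root_fun)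
    moreover have "int k * c \<ge> 1 * c" using c k2 by (intro mult_right_mono) auto
    ultimately have "c \<le> ?B i j" by linarith
    then have "\<alpha> \<in> root_fun i j ` {0..?B i j}" using i(1) c by auto
    then show "\<alpha> \<in> (\<Union>i\<in>{1..k}. \<Union>j\<in>{1..k}. root_fun i j ` {0..?B i j})"
      by (intro UN_I[OF i(2)] UN_I[OF i(3)])
  qed
  then show ?thesis by (rule finite_subset) auto
qed

lemma finite_Inv [simp]: "finite (Inv k w)" and finite_Neg [simp]: "finite (Neg k x)"
  by (simp_all add: Inv_def Neg_def)

text \<open>The map \<open>\<gamma> \<mapsto> \<gamma> \<circ> r\<close>, replaced by \<open>\<gamma> \<mapsto> \<gamma>\<close> if \<open>\<gamma> \<circ> r\<close> is negative, is an injection from the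
  hyperplanes that separate the point from the fundamental alcove to those that separate the
  reflected point, and it misses the hyperplane of the reflection itself.\<close>

lemma card_neg_roots_reflect:
  assumes ij: "i \<in> {1..k}" "j \<in> {1..k}" "i \<noteq> j"
    and pos: "ht k (root_fun i j c) > 0" and at: "pair_eval k x y (root_fun i j c) > 0"
  shows "card (neg_roots k x y) < card (neg_roots k (reflect i j c x) (reflect i j c y))"
proof -
  let ?b = "root_fun i j c" and ?r = "reflect i j c"
  let ?A = "neg_roots k x y" and ?B = "neg_roots k (?r x) (?r y)"
  define f where "f \<gamma> = (if ht k (\<lambda>x. \<gamma> (?r x)) > 0 then (\<lambda>x. \<gamma> (?r x)) else \<gamma>)" for \<gamma> :: "vec \<Rightarrow> int"
  have rr: "(\<lambda>x. \<gamma> (?r (?r x))) = \<gamma>" for \<gamma> :: "vec \<Rightarrow> int" using reflect_reflect[OF ij(3)] by simp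
  have sub: "f ` ?A \<subseteq> ?B - {?b}"
  proof (rule image_subsetI)
    fix \<gamma> assume g: "\<gamma> \<in> ?A"
    then have gr: "\<gamma> \<in> roots k" "ht k \<gamma> > 0" "pair_eval k x y \<gamma> < 0" by (auto simp: neg_roots_def)
    have r: "(\<lambda>x. \<gamma> (?r x)) \<in> roots k" using root_comp_reflect gr(1) ij by blast
    obtain a b d where a: "\<gamma> = root_fun a b d" "a \<in> {1..k}" "b \<in> {1..k}" "a \<noteq> b"
      using gr(1) by (rule rootsE)
    define n where "n = pairing a b i j"
    have gx: "\<gamma> (?r z) = \<gamma> z - n * ?b z" for z
      using root_reflect_pairing[OF ij(3)] by (simp add: a n_def)
    have h: "ht k (\<lambda>x. \<gamma> (?r x)) = ht k \<gamma> - n * ht k ?b"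
      by (simp add: gx ht_def pair_eval_def algebra_simps)
    have p: "pair_eval k (?r x) (?r y) \<gamma> = pair_eval k x y \<gamma> - n * pair_eval k x y ?b"
      by (simp add: gx pair_eval_def algebra_simps)
    show "f \<gamma> \<in> ?B - {?b}"
    proof (cases "ht k (\<lambda>x. \<gamma> (?r x)) > 0")
      case True
      have "pair_eval k (?r x) (?r y) (\<lambda>x. \<gamma> (?r x)) < 0"
        using gr(3) reflect_reflect[OF ij(3)] by (simp add: pair_eval_def)
      moreover have "(\<lambda>x. \<gamma> (?r x)) \<noteq> ?b"
      proof
        assume "(\<lambda>x. \<gamma> (?r x)) = ?b"
        then have "\<gamma> = (\<lambda>x. - ?b x)" using rr[of \<gamma>] root_reflect_self[OF ij(3), of c]
          by (metis (no_types, lifting))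
        then show False using gr(2) pos by (simp add: ht_uminus)
      qed
      ultimately show ?thesis using True r by (simp add: f_def neg_roots_def)
    next
      case False
      then have "ht k \<gamma> < n * ht k ?b" using ht_neq_0[OF r] h by linarith
      then have "n * ht k ?b > 0" using gr(2) by linarith
      then have "n > 0" using pos by (simp add: zero_less_mult_iff)
      then have "n * pair_eval k x y ?b > 0" using at by simp
      then have "pair_eval k (?r x) (?r y) \<gamma> < 0" using p gr(3) by linarith
      moreover have "\<gamma> \<noteq> ?b" using gr(3) at by auto
      ultimately show ?thesis using False gr by (simp add: f_def neg_roots_def)
    qed
  qed
  have "inj_on f ?A"
  proof (rule inj_onI)
    fix \<gamma> \<delta> assume g: "\<gamma> \<in> ?A" "\<delta> \<in> ?A" and e: "f \<gamma> = f \<delta>"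
    then have h: "ht k \<gamma> > 0" "ht k \<delta> > 0" by (auto simp: neg_roots_def)
    have flip_eq: "\<beta> = (\<lambda>x. \<alpha> (?r x))" if "(\<lambda>x. \<beta> (?r x)) = \<alpha>" for \<alpha> \<beta> :: "vec \<Rightarrow> int"
      using rr[of \<beta>] that by auto
    show "\<gamma> = \<delta>"
    proof (cases "ht k (\<lambda>x. \<gamma> (?r x)) > 0"; cases "ht k (\<lambda>x. \<delta> (?r x)) > 0")
      assume p: "ht k (\<lambda>x. \<gamma> (?r x)) > 0" "ht k (\<lambda>x. \<delta> (?r x)) > 0"
      then have "(\<lambda>x. \<gamma> (?r x)) = (\<lambda>x. \<delta> (?r x))" using e by (simp add: f_def)
      then have "\<gamma> = (\<lambda>x. \<delta> (?r (?r x)))" by (rule flip_eq)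
      then show ?thesis by (simp only: rr)
    next
      assume p: "ht k (\<lambda>x. \<gamma> (?r x)) > 0" "\<not> ht k (\<lambda>x. \<delta> (?r x)) > 0"
      then have "(\<lambda>x. \<gamma> (?r x)) = \<delta>" using e by (simp add: f_def)
      then have "\<gamma> = (\<lambda>x. \<delta> (?r x))" by (rule flip_eq)
      then show ?thesis using p h by simp
    next
      assume p: "\<not> ht k (\<lambda>x. \<gamma> (?r x)) > 0" "ht k (\<lambda>x. \<delta> (?r x)) > 0"
      then have "(\<lambda>x. \<delta> (?r x)) = \<gamma>" using e by (simp add: f_def)
      then have "\<delta> = (\<lambda>x. \<gamma> (?r x))" by (rule flip_eq)
      then show ?thesis using p h by simp
    next
      assume "\<not> ht k (\<lambda>x. \<gamma> (?r x)) > 0" "\<not> ht k (\<lambda>x. \<delta> (?r x)) > 0"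
      then show ?thesis using e by (simp add: f_def)
    qed
  qed
  then have "card ?A = card (f ` ?A)" by (simp add: card_image)
  also have "\<dots> \<le> card (?B - {?b})" using sub by (intro card_mono) auto
  also have "\<dots> < card ?B"
  proof (rule psubset_card_mono)
    have "pair_eval k (?r x) (?r y) ?b < 0" using at root_reflect_self[OF ij(3)]
      by (simp add: pair_eval_def)
    then have "?b \<in> ?B" using pos ij by (simp add: neg_roots_def root_fun_in_roots)
    then show "?B - {?b} \<subset> ?B" by auto
  qed simp
  finally show ?thesis .
qed

lemma gen_permutes_pos:
  assumes "s < k" "\<alpha> \<in> roots k" "ht k \<alpha> > 0" "\<alpha> \<noteq> sroot k s"
  shows "ht k (\<alpha> \<circ> aff_s k s) > 0"
proof -
  obtain a b d where a: "\<alpha> = root_fun a b d" "a \<in> {1..k}" "b \<in> {1..k}" "a \<noteq> b"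
    using assms(2) by (rule rootsE)
  have d: "d > 0 \<or> d = 0 \<and> a < b" using assms(3) a by (simp add: root_pos_iff)
  show ?thesis
  proof (cases "s = 0")
    case True
    have ne: "\<not> (a = k \<and> b = 1 \<and> d = 1)" using assms(4) True a by (auto simp: sroot_def)
    let ?e = "d + (if a = k then - 1 else if a = 1 then 1 else 0) - (if b = k then - 1 else if b = 1 then 1 else 0)"
    have "\<alpha> \<circ> aff_s k s = root_fun (transpose k 1 a) (transpose k 1 b) ?e"
      using True k2 root_reflect[of k 1 a b d 1] by (auto simp: a aff_s_eq_refl fun_eq_iff)
    moreover have "transpose k 1 a \<in> {1..k}" "transpose k 1 b \<in> {1..k}" "transpose k 1 a \<noteq> transpose k 1 b"
      using a k2 by (auto simp: transpose_def)
    moreover have "?e > 0 \<or> ?e = 0 \<and> transpose k 1 a < transpose k 1 b"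
      using d a k2 ne by (auto simp: transpose_def)
    ultimately show ?thesis by (simp only: root_pos_iff simp_thms)
  next
    case False
    have ne: "\<not> (a = s \<and> b = Suc s \<and> d = 0)" using assms(4) False a by (auto simp: sroot_def)
    have "\<alpha> \<circ> aff_s k s = root_fun (transpose s (Suc s) a) (transpose s (Suc s) b) d"
      using False assms(1) root_reflect[of s "Suc s" a b d 0] by (auto simp: a aff_s_eq_refl fun_eq_iff)
    moreover have "transpose s (Suc s) a \<in> {1..k}" "transpose s (Suc s) b \<in> {1..k}"
      "transpose s (Suc s) a \<noteq> transpose s (Suc s) b"
      using a False assms(1) by (auto simp: transpose_def)
    moreover have "d > 0 \<or> d = 0 \<and> transpose s (Suc s) a < transpose s (Suc s) b"
      using d ne by (auto simp: transpose_def)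
    ultimately show ?thesis by (simp only: root_pos_iff simp_thms)
  qed
qed

text \<open>A simple reflection permutes the positive roots other than its own root.\<close>

lemma neg_roots_gen:
  assumes s: "s < k"
  shows "neg_roots k (aff_s k s x) (aff_s k s y) - {sroot k s} = (\<lambda>\<alpha>. \<alpha> \<circ> aff_s k s) ` (neg_roots k x y - {sroot k s})"
    (is "?A s x y = ?f ` ?B")
proof -
  have ss: "?f (?f \<alpha>) = \<alpha>" for \<alpha> :: "vec \<Rightarrow> int" 
    by (rule ext) (simp add: aff_s_aff_s[OF s])
  have sr: "?f (sroot k s) = (\<lambda>x. - sroot k s x)" by (rule ext) (simp add: sroot_aff_s[OF s])
  have ev: "pair_eval k x y (?f \<alpha>) = pair_eval k (aff_s k s x) (aff_s k s y) \<alpha>" for x y \<alpha>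
    by (simp add: pair_eval_def)
  have in1: "?f \<alpha> \<in> neg_roots k (aff_s k s x) (aff_s k s y) - {sroot k s}"
    if "\<alpha> \<in> neg_roots k x y - {sroot k s}" for \<alpha> x y
  proof -
    have a: "\<alpha> \<in> roots k" "ht k \<alpha> > 0" "\<alpha> \<noteq> sroot k s" "pair_eval k x y \<alpha> < 0"
      using that by (auto simp: neg_roots_def)
    have "?f \<alpha> \<noteq> sroot k s"
    proof
      assume "?f \<alpha> = sroot k s"
      then have "\<alpha> = (\<lambda>x. - sroot k s x)" using ss[of \<alpha>] sr by simp
      then show False using a(2) ht_sroot[OF s] by (simp add: ht_uminus)
    qed
    then show ?thesis using a gen_permutes_pos[OF s a(1,2,3)] root_comp_gen[OF a(1) s]
      by (simp add: neg_roots_def pair_eval_def aff_s_aff_s[OF s] comp_def)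
  qed
  show ?thesis
  proof (intro equalityI subsetI)
    fix \<alpha> assume "\<alpha> \<in> ?A s x y"
    then have "?f \<alpha> \<in> ?B" using in1[of \<alpha> "aff_s k s x" "aff_s k s y"] by (simp add: aff_s_aff_s[OF s])
    then show "\<alpha> \<in> ?f ` ?B" using ss[of \<alpha>] by (metis imageI)
  next
    fix \<alpha> assume "\<alpha> \<in> ?f ` ?B"
    then obtain \<beta> where "\<beta> \<in> ?B" "\<alpha> = ?f \<beta>" by (rule imageE)
    then show "\<alpha> \<in> ?A s x y" using in1[of \<beta> x y] by (simp only:)
  qed
qed

lemma card_neg_roots_gen:
  assumes s: "s < k"
  shows "pair_eval k x y (sroot k s) < 0 \<Longrightarrow>
      card (neg_roots k x y) = Suc (card (neg_roots k (aff_s k s x) (aff_s k s y)))"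
    and "card (neg_roots k (aff_s k s x) (aff_s k s y)) \<le> Suc (card (neg_roots k x y))"
proof -
  let ?A = "neg_roots k (aff_s k s x) (aff_s k s y)" and ?B = "neg_roots k x y" and ?r = "sroot k s"
  have "inj_on (\<lambda>\<alpha>. \<alpha> \<circ> aff_s k s) X" for X :: "(vec \<Rightarrow> int) set"
    by (rule inj_onI) (metis aff_s_aff_s[OF s] comp_apply ext)
  then have c: "card (?A - {?r}) = card (?B - {?r})"
    unfolding neg_roots_gen[OF s] by (rule card_image)
  have "card ?A \<le> card (insert ?r (?A - {?r}))" by (intro card_mono) auto
  also have "\<dots> = Suc (card (?A - {?r}))" by (rule card_insert_disjoint) auto
  also have "\<dots> = Suc (card (?B - {?r}))" by (simp only: c)
  also have "\<dots> \<le> Suc (card ?B)" using card_Diff1_le by simp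
  finally show "card ?A \<le> Suc (card ?B)" .
  assume n: "pair_eval k x y ?r < 0"
  have "?r \<in> ?B" using n s by (simp add: neg_roots_def sroot_in_roots ht_sroot)
  then have "card ?B = Suc (card (?B - {?r}))" by (intro card.remove) auto
  moreover have "?r \<notin> ?A" using n s by (simp add: neg_roots_def pair_eval_def sroot_aff_s)
  then have "?A - {?r} = ?A" by simp
  ultimately show "card ?B = Suc (card ?A)" using c by (simp only:)
qed

text \<open>Subtracting a suitable simple root from a positive root leaves a positive root of smaller
  height or a nonnegative constant; so some simple root is negative wherever some positive root
  is.\<close>

lemma exists_negative_simple:
  assumes "\<alpha> \<in> neg_roots k x y"
  shows "\<exists>s<k. pair_eval k x y (sroot k s) < 0"
  using assms
proof (induction "nat (ht k \<alpha>)" arbitrary: \<alpha> rule: less_induct)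
  case less
  then have a: "\<alpha> \<in> roots k" "ht k \<alpha> > 0" "pair_eval k x y \<alpha> < 0" by (auto simp: neg_roots_def)
  obtain i j c where i: "\<alpha> = root_fun i j c" "i \<in> {1..k}" "j \<in> {1..k}" "i \<noteq> j"
    using a(1) by (rule rootsE)
  have c: "c > 0 \<or> c = 0 \<and> i < j" using a(2) i by (simp add: root_pos_iff)
  define s i' c' where "s = (if i < k then i else 0)" "i' = (if i < k then Suc i else 1)"
    "c' = (if i < k then c else c - 1)"
  note d = this
  have s: "s < k" and i': "i' \<in> {1..k}" using i d k2 by auto
  have c': "c' > 0 \<or> c' = 0 \<and> i' \<le> j" using c d i by auto
  have e: "\<alpha> z = sroot k s z + root_fun i' j c' z" for z
    using i d by (auto simp: sroot_def root_fun_def)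
  have h: "ht k \<alpha> = 1 + ht k (root_fun i' j c')"
    using ht_sroot[OF s] by (simp add: e ht_def pair_eval_def algebra_simps)
  have p: "pair_eval k x y \<alpha> = pair_eval k x y (sroot k s) + pair_eval k x y (root_fun i' j c')"
    by (simp add: e pair_eval_def algebra_simps)
  show ?case
  proof (cases "pair_eval k x y (root_fun i' j c') < 0")
    case True
    have "i' \<noteq> j"
    proof
      assume "i' = j"
      then have "pair_eval k x y (root_fun i' j c') \<ge> 0" using c' by (auto simp: pair_eval_root_fun)
      then show False using True by simp
    qed
    then have "root_fun i' j c' \<in> neg_roots k x y"
      using True c' i i' by (auto simp: neg_roots_def root_fun_in_roots root_pos_iff)
    moreover have "nat (ht k (root_fun i' j c')) < nat (ht k \<alpha>)" using h a(2) by auto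
    ultimately show ?thesis using less.hyps by blast
  next
    case False
    then show ?thesis using p a(3) s by (intro exI[of _ s]) auto
  qed
qed

lemma group_apply:
  assumes "w \<in> aff_group k"
  shows "(\<forall>i. i \<notin> {1..k} \<longrightarrow> (\<forall>x. w x i = x i)) \<and> (\<forall>i\<in>{1..k}. \<exists>j\<in>{1..k}. \<exists>c. \<forall>x. w x i = x j + c)"
  using assms
proof (induction rule: group_induct)
  case (gen s w)
  obtain a b d where s: "aff_s k s = reflect a b d" "a \<in> {1..k}" "b \<in> {1..k}" "a \<noteq> b"
    using gen_cases[OF gen(1)] by metis
  show ?case
  proof (intro conjI allI impI ballI)
    fix i x assume "i \<notin> {1..k}"
    then have "i \<noteq> a" "i \<noteq> b" using s by auto
    then show "(aff_s k s \<circ> w) x i = x i"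
      using gen(3) \<open>i \<notin> {1..k}\<close> by (simp add: s reflect_def)
  next
    fix i assume i: "i \<in> {1..k}"
    let ?e = "if i = a then - d else if i = b then d else 0"
    have "transpose a b i \<in> {1..k}" using i s by (auto simp: transpose_def)
    then obtain j c where "j \<in> {1..k}" "\<And>x. w x (transpose a b i) = x j + c" using gen(3) by blast
    then show "\<exists>j\<in>{1..k}. \<exists>c. \<forall>x. (aff_s k s \<circ> w) x i = x j + c"
      by (intro bexI[of _ j] exI[of _ "c + ?e"]) (auto simp: s reflect_apply)
  qed
qed (auto intro!: exI[of _ 0])

lemma sum_reflect:
  assumes "i \<in> {1..k}" "j \<in> {1..k}" "i \<noteq> j"
  shows "(\<Sum>a=1..k. reflect i j c x a) = (\<Sum>a=1..k. x a)"
proof -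
  have "(\<Sum>a=1..k. reflect i j c x a) = reflect i j c x i + (reflect i j c x j + (\<Sum>a\<in>{1..k}-{i}-{j}. reflect i j c x a))"
    using assms by (simp add: sum.remove[of _ i] sum.remove[of _ j])
  also have "(\<Sum>a\<in>{1..k}-{i}-{j}. reflect i j c x a) = (\<Sum>a\<in>{1..k}-{i}-{j}. x a)"
    by (intro sum.cong) (auto simp: reflect_def)
  also have "reflect i j c x i + (reflect i j c x j + (\<Sum>a\<in>{1..k}-{i}-{j}. x a)) = (\<Sum>a=1..k. x a)"
    using assms by (simp add: sum.remove[of _ i] sum.remove[of _ j] reflect_def)
  finally show ?thesis .
qed

lemma group_sum: "w \<in> aff_group k \<Longrightarrow> (\<Sum>a=1..k. w x a) = (\<Sum>a=1..k. x a)"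
proof (induction rule: group_induct)
  case (gen s w)
  obtain a b d where "aff_s k s = reflect a b d" "a \<in> {1..k}" "b \<in> {1..k}" "a \<noteq> b"
    using gen_cases[OF gen(1)] by metis
  then show ?case using gen(3) sum_reflect[of a b d "w x"] by simp
qed simp

text \<open>The image of the interior point of the fundamental alcove satisfies the inequalities of
  that alcove and has the same sum of coordinates, which leaves only the point itself. Since
  each coordinate of the image of a vector is a translate of another coordinate, this determines
  the transformation.\<close>

lemma Inv_empty_imp_id:
  assumes w: "w \<in> aff_group k" and e: "Inv k w = {}"
  shows "w = id"
proof -
  define p where "p i = (int k - 1) * w (\<lambda>_. 0) i + w (\<lambda>i. - int i) i" for i
  have ge: "ht k (sroot k s \<circ> w) \<ge> 1" if "s < k" for s
  proof -
    have "sroot k s \<notin> Inv k w" using e by simp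
    then have "\<not> ht k (sroot k s \<circ> w) < 0"
      using that by (simp add: Inv_iff sroot_in_roots ht_sroot)
    moreover have "ht k (sroot k s \<circ> w) \<noteq> 0"
      using that w by (intro ht_neq_0 root_comp sroot_in_roots)
    ultimately show ?thesis by linarith
  qed
  have p1: "p i \<ge> p (Suc i) + 1" if "1 \<le> i" "i < k" for i
    using ge[of i] that by (simp add: ht_comp sroot_def pair_eval_root_fun p_def algebra_simps)
  have p2: "p k - p 1 + int k \<ge> 1"
    using ge[of 0] k2 by (simp add: ht_comp sroot_def pair_eval_root_fun p_def algebra_simps)
  have down: "p 1 \<ge> p i + int i - 1" if "1 \<le> i" "i \<le> k" for i
    using that(2)
  proof (induction rule: dec_induct[OF that(1)])
    case (2 n) then show ?case using p1[of n] that by auto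
  qed simp
  have up: "p i \<ge> p k + int k - int i" if "1 \<le> i" "i \<le> k" for i
    using that(2,1)
  proof (induction rule: inc_induct)
    case (step n) then show ?case using p1[of n] by auto
  qed simp
  have p: "p i = p 1 + 1 - int i" if "1 \<le> i" "i \<le> k" for i
    using down[OF that] up[OF that] up[of 1] p2 k2 by linarith
  have "(\<Sum>i=1..k. p i) = (int k - 1) * (\<Sum>i=1..k. w (\<lambda>_. 0) i) + (\<Sum>i=1..k. w (\<lambda>i. - int i) i)"
    by (simp add: p_def sum.distrib sum_distrib_left)
  also have "\<dots> = (\<Sum>i=1..k. - int i)" by (simp only: group_sum[OF w]) simp
  finally have "(\<Sum>i=1..k. p i) = (\<Sum>i=1..k. - int i)" .
  moreover have "(\<Sum>i=1..k. p i) = (\<Sum>i=1..k. (p 1 + 1) + - int i)"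
  proof (rule sum.cong[OF HOL.refl])
    fix i assume "i \<in> {1..k}"
    then show "p i = (p 1 + 1) + - int i" using p[of i] by simp
  qed
  moreover have "(\<Sum>i=1..k. (p 1 + 1) + - int i) = (\<Sum>i=1..k. p 1 + 1) + (\<Sum>i=1..k. - int i)"
    by (rule sum.distrib)
  moreover have "(\<Sum>i=1..k. p 1 + 1) = int k * (p 1 + 1)"
    by (simp only: sum_constant card_atLeastAtMost diff_Suc_1)
  ultimately have "int k * (p 1 + 1) = 0" by linarith
  then have p': "p i = - int i" if "1 \<le> i" "i \<le> k" for i using p[OF that] k2 by simp
  show ?thesis
  proof (intro ext)
    fix x i
    show "w x i = id x i"
    proof (cases "i \<in> {1..k}")
      case True
      then obtain j c where j: "j \<in> {1..k}" and c: "\<And>x. w x i = x j + c"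
        using group_apply[OF w] by blast
      have "int k * c = int j - int i" using p'[of i] True by (simp add: p_def c algebra_simps)
      moreover have "\<bar>int j - int i\<bar> < int k" using True j by auto
      ultimately have "\<bar>int k * c\<bar> < int k * 1" by simp
      then have "c = 0" using k2 by (simp add: abs_mult)
      then show ?thesis using c \<open>int k * c = int j - int i\<close> by simp
    qed (use group_apply[OF w] in auto)
  qed
qed

lemma Inv_gen: "s < k \<Longrightarrow> Inv k (aff_s k s \<circ> w) - {sroot k s} = (\<lambda>\<alpha>. \<alpha> \<circ> aff_s k s) ` (Inv k w - {sroot k s})"
  using neg_roots_gen[of s "w (\<lambda>_. 0)" "w (\<lambda>i. - int i)"] by (simp add: Inv_def comp_def)

lemma card_Inv_gen:
  assumes "s < k"
  shows "sroot k s \<in> Inv k w \<Longrightarrow> card (Inv k w) = Suc (card (Inv k (aff_s k s \<circ> w)))"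
    and "card (Inv k (aff_s k s \<circ> w)) \<le> Suc (card (Inv k w))"
  using card_neg_roots_gen[OF assms] unfolding Inv_def by (auto simp: neg_roots_def)

lemma simple_in_Inv: "Inv k w \<noteq> {} \<Longrightarrow> \<exists>s<k. sroot k s \<in> Inv k w"
proof -
  assume "Inv k w \<noteq> {}"
  then obtain \<alpha> where "\<alpha> \<in> neg_roots k (w (\<lambda>_. 0)) (w (\<lambda>i. - int i))" unfolding Inv_def by blast
  then obtain s where "s < k" "pair_eval k (w (\<lambda>_. 0)) (w (\<lambda>i. - int i)) (sroot k s) < 0"
    using exists_negative_simple by blast
  then show ?thesis by (intro exI[of _ s]) (simp add: Inv_def neg_roots_def sroot_in_roots ht_sroot)
qed

lemma Inv_induct [consumes 1, case_names id gen]: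
  assumes "w \<in> aff_group k" "P id"
    "\<And>s w. s < k \<Longrightarrow> w \<in> aff_group k \<Longrightarrow> sroot k s \<in> Inv k (aff_s k s \<circ> w) \<Longrightarrow> P w \<Longrightarrow> P (aff_s k s \<circ> w)"
  shows "P w"
  using assms(1)
proof (induction "card (Inv k w)" arbitrary: w rule: less_induct)
  case less
  show ?case
  proof (cases "Inv k w = {}")
    case True
    then have "w = id" using Inv_empty_imp_id less.prems by blast
    then show ?thesis using assms(2) by blast
  next
    case False
    then obtain s where s: "s < k" "sroot k s \<in> Inv k w" using simple_in_Inv by blast
    have "P (aff_s k s \<circ> w)"
      using card_Inv_gen(1)[OF s] less.prems s by (intro less.hyps group_comp gen_in_group) auto
    moreover have "aff_s k s \<circ> (aff_s k s \<circ> w) = w" using s(1) by (rule aff_s_comp)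
    ultimately show ?thesis
      using assms(3)[of s "aff_s k s \<circ> w"] s less.prems by (auto intro: group_comp gen_in_group)
  qed
qed

lemma Inv_id: "Inv k id = {}"
  by (auto simp: Inv_iff)

text \<open>Composition with a simple reflection changes the number of inversions by at most one, and
  an element with an inversion has a simple one, which can be removed.\<close>

lemma aff_length_eq:
  assumes "w \<in> aff_group k"
  shows "aff_length k w = card (Inv k w)"
  unfolding aff_length_def
proof (rule Least_equality)
  show "\<exists>is. set is \<subseteq> aff_gens k \<and> length is = card (Inv k w) \<and> w = aff_word k is"
    using assms
  proof (induction rule: Inv_induct)
    case id
    have "set [] \<subseteq> aff_gens k \<and> length [] = card (Inv k id) \<and> id = aff_word k []"
      unfolding aff_word_Nil Inv_id by simp
    then show ?case by blast
  next
    case (gen s w)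
    then obtain ss where "set ss \<subseteq> aff_gens k" "length ss = card (Inv k w)" "w = aff_word k ss" by blast
    moreover have "card (Inv k (aff_s k s \<circ> w)) = Suc (card (Inv k w))"
      using card_Inv_gen(1)[OF gen(1,3)] aff_s_aff_s[OF gen(1)] by (simp add: comp_def)
    ultimately show ?case using gen(1)
      by (intro exI[of _ "s # ss"]) (auto simp: aff_word_Cons gens_eq comp_def)
  qed
  fix n assume "\<exists>is. set is \<subseteq> aff_gens k \<and> length is = n \<and> w = aff_word k is"
  then obtain ss where ss: "set ss \<subseteq> aff_gens k" "length ss = n" "w = aff_word k ss" by blast
  have "set ss \<subseteq> aff_gens k \<Longrightarrow> card (Inv k (aff_word k ss)) \<le> length ss"
  proof (induction ss)
    case Nil then show ?case by (simp add: aff_word_Nil Inv_id[unfolded id_def] id_def)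
  next
    case (Cons s ss)
    then show ?case using card_Inv_gen(2)[of s "aff_word k ss"] by (auto simp: aff_word_Cons gens_eq comp_def)
  qed
  then show "card (Inv k w) \<le> n" using ss by simp
qed

lemma Inv_inject:
  assumes "w \<in> aff_group k" "v \<in> aff_group k" "Inv k w = Inv k v" shows "w = v"
  using assms
proof (induction arbitrary: v rule: Inv_induct)
  case id then show ?case using Inv_empty_imp_id Inv_id by metis
next
  case (gen s w)
  have s: "s < k" by fact
  let ?v = "aff_s k s \<circ> v"
  have ss: "aff_s k s \<circ> (aff_s k s \<circ> u) = u" for u :: "vec \<Rightarrow> vec"
    using s by (rule aff_s_comp)
  have n: "sroot k s \<notin> Inv k (aff_s k s \<circ> u)" if "sroot k s \<in> Inv k u" for u
    using that sroot_aff_s[OF s] by (auto simp: Inv_def neg_roots_def pair_eval_def)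
  have "Inv k w = Inv k (aff_s k s \<circ> (aff_s k s \<circ> w)) - {sroot k s}"
    using n[OF gen(3)] by (simp add: ss)
  also have "\<dots> = (\<lambda>\<alpha>. \<alpha> \<circ> aff_s k s) ` (Inv k (aff_s k s \<circ> w) - {sroot k s})"
    by (rule Inv_gen[OF s])
  also have "\<dots> = (\<lambda>\<alpha>. \<alpha> \<circ> aff_s k s) ` (Inv k v - {sroot k s})"
    using gen.prems(2) by (simp add: comp_def)
  also have "\<dots> = Inv k ?v - {sroot k s}"
    by (rule Inv_gen[OF s, symmetric])
  also have "\<dots> = Inv k ?v" using n[of v] gen by simp
  finally have "w = ?v" using gen by (intro gen.IH group_comp gen_in_group)
  then have "aff_s k s \<circ> w = aff_s k s \<circ> ?v" by (rule arg_cong)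
  then show ?case unfolding ss .
qed

subsection \<open>Dominant vectors and minimal elements\<close>

definition dom_vec :: "vec \<Rightarrow> bool" where
  "dom_vec y \<longleftrightarrow> (\<forall>s<k. sroot k s y \<ge> 0)"

lemma dom_vec_iff: "dom_vec y \<longleftrightarrow> (\<forall>i\<in>{1..<k}. y i \<ge> y (Suc i)) \<and> y k \<ge> y 1 - 1"
proof -
  have "dom_vec y \<longleftrightarrow> sroot k 0 y \<ge> 0 \<and> (\<forall>s\<in>{1..<k}. sroot k s y \<ge> 0)"
  proof -
    have "{..<k} = insert 0 {1..<k}" using k2 by auto
    moreover have "dom_vec y \<longleftrightarrow> (\<forall>s\<in>{..<k}. sroot k s y \<ge> 0)" by (auto simp: dom_vec_def)
    ultimately show ?thesis by simp
  qed
  then show ?thesis by (auto simp: sroot_def root_fun_def)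
qed

lemma simple_in_Neg: "Neg k x \<noteq> {} \<Longrightarrow> \<exists>s<k. sroot k s x < 0"
proof -
  assume "Neg k x \<noteq> {}"
  then obtain s where "s < k" "pair_eval k x x (sroot k s) < 0"
    using exists_negative_simple unfolding Neg_def by blast
  moreover have "pair_eval k x x (sroot k s) = int k * sroot k s x"
    by (simp add: pair_eval_def algebra_simps)
  ultimately show ?thesis by (auto simp: mult_less_0_iff)
qed

lemma dom_vec_iff_Neg: "dom_vec y \<longleftrightarrow> Neg k y = {}"
proof
  assume "dom_vec y"
  then show "Neg k y = {}" using simple_in_Neg[of y] unfolding dom_vec_def by (meson linorder_not_le)
next
  assume "Neg k y = {}"
  then have "\<not> sroot k s y < 0" if "s < k" for s
    using that sroot_in_roots[of s] ht_sroot[of s] Neg_iff[of "sroot k s" y] by simp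
  then show "dom_vec y" unfolding dom_vec_def by (simp add: not_less)
qed

lemma card_Neg_gen: "s < k \<Longrightarrow> sroot k s x < 0 \<Longrightarrow> card (Neg k x) = Suc (card (Neg k (aff_s k s x)))"
  unfolding Neg_def using k2
  by (intro card_neg_roots_gen(1)) (auto simp: pair_eval_def mult_less_0_iff simp flip: distrib_right intro!: add_nonpos_neg mult_nonneg_nonpos)

lemma Neg_subset_Inv:
  assumes "w \<in> aff_group k" "dom_vec y" "w y = x" shows "Neg k x \<subseteq> Inv k w"
proof
  fix \<alpha> assume "\<alpha> \<in> Neg k x"
  then have a: "\<alpha> \<in> roots k" "ht k \<alpha> > 0" "\<alpha> x < 0" by (auto simp: Neg_iff)
  have r: "\<alpha> \<circ> w \<in> roots k" using root_comp assms a by blast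
  have "\<not> ht k (\<alpha> \<circ> w) > 0"
  proof
    assume "ht k (\<alpha> \<circ> w) > 0"
    then have "\<alpha> \<circ> w \<in> Neg k y" using r a assms(3) by (simp add: Neg_iff)
    then show False using assms(2) by (simp add: dom_vec_iff_Neg)
  qed
  then show "\<alpha> \<in> Inv k w" using a ht_neq_0[OF r] by (simp add: Inv_iff)
qed

text \<open>Reflecting in simple roots that are negative at the vector lowers the number of
  hyperplanes one by one, and the product of these reflections has no inversions besides them.\<close>

lemma exists_dominant: "\<exists>y w. dom_vec y \<and> w \<in> aff_group k \<and> w y = x \<and> Inv k w = Neg k x"
proof (induction "card (Neg k x)" arbitrary: x rule: less_induct)
  case less
  show ?case
  proof (cases "Neg k x = {}")
    case True
    then show ?thesis by (intro exI[of _ x] exI[of _ id]) (simp add: dom_vec_iff_Neg Inv_id)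
  next
    case False
    then obtain s where s: "s < k" "sroot k s x < 0" using simple_in_Neg by blast
    have c: "card (Neg k x) = Suc (card (Neg k (aff_s k s x)))" using card_Neg_gen s by blast
    then obtain y w where y: "dom_vec y" and w: "w \<in> aff_group k" "w y = aff_s k s x" "Inv k w = Neg k (aff_s k s x)"
      using less[of "aff_s k s x"] by auto
    have g: "aff_s k s \<circ> w \<in> aff_group k" using s w by (intro group_comp gen_in_group)
    have e: "(aff_s k s \<circ> w) y = x" using w s by (simp add: aff_s_aff_s)
    have "card (Inv k (aff_s k s \<circ> w)) \<le> card (Neg k x)"
      using card_Inv_gen(2)[OF s(1), of w] w c by simp
    then have "Neg k x = Inv k (aff_s k s \<circ> w)"
      by (rule card_seteq[OF finite_Inv Neg_subset_Inv[OF g y e]])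
    then show ?thesis using y g e by blast
  qed
qed

lemma dominant_unique:
  assumes "w \<in> aff_group k" "dom_vec y" "dom_vec (w y)" shows "w y = y"
  using assms
proof (induction rule: Inv_induct)
  case (gen s w)
  have s: "s < k" by fact
  let ?w = "aff_s k s \<circ> w"
  have g: "?w \<in> aff_group k" using gen s by (intro group_comp gen_in_group)
  have r: "sroot k s \<circ> ?w \<in> roots k" "ht k (sroot k s \<circ> ?w) < 0"
    using root_comp[OF g sroot_in_roots[OF s]] gen(3) by (auto simp: Inv_iff)
  have "(\<lambda>x. - (sroot k s \<circ> ?w) x) \<notin> Neg k y" using gen.prems by (simp add: dom_vec_iff_Neg)
  then have "(sroot k s \<circ> ?w) y \<le> 0"
    using uminus_in_roots[OF r(1)] r(2) ht_uminus[of k "sroot k s \<circ> ?w"] by (auto simp: Neg_iff)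
  then have "sroot k s (?w y) = 0" using gen.prems s by (force simp: dom_vec_def)
  then have "aff_s k s (?w y) = ?w y" by (rule aff_s_fix[OF s])
  then have "?w y = w y" using s by (simp add: aff_s_aff_s)
  then show ?case using gen by simp
qed simp

lemma orbitI: "w \<in> aff_group k \<Longrightarrow> w x \<in> aff_orbit k x"
  by (auto simp: aff_orbit_def)
lemma orbitE:
  assumes "x \<in> aff_orbit k z" obtains w where "w \<in> aff_group k" "x = w z"
  using assms by (auto simp: aff_orbit_def)
lemma orbit_refl [simp]: "x \<in> aff_orbit k x"
  using orbitI[OF id_in_group] by simp
lemma orbit_trans:
  assumes "x \<in> aff_orbit k y" "y \<in> aff_orbit k z" shows "x \<in> aff_orbit k z"
proof -
  obtain v w where "v \<in> aff_group k" "x = v y" "w \<in> aff_group k" "y = w z"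
    using assms by (auto elim!: orbitE)
  then show ?thesis using orbitI[OF group_comp, of v w z] by simp
qed
lemma orbit_apply: "w \<in> aff_group k \<Longrightarrow> x \<in> aff_orbit k z \<Longrightarrow> w x \<in> aff_orbit k z"
  by (rule orbit_trans[OF orbitI])
lemma orbit_sym:
  assumes "x \<in> aff_orbit k z" shows "z \<in> aff_orbit k x"
proof -
  obtain w where w: "w \<in> aff_group k" "x = w z" using assms by (rule orbitE)
  then show ?thesis using orbitI[OF group_inv(1)[OF w(1)], of x] group_inv(2)[OF w(1)] by simp
qed

lemma alcove_rep_eqI:
  assumes "dom_vec y" "y \<in> aff_orbit k x" shows "alcove_rep k x = y"
  unfolding alcove_rep_def
proof (rule the_equality)
  show "y \<in> aff_orbit k x \<and> (\<forall>i\<in>{1..<k}. y i \<ge> y (Suc i)) \<and> y k \<ge> y 1 - 1"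
    using assms by (simp add: dom_vec_iff)
  fix z assume "z \<in> aff_orbit k x \<and> (\<forall>i\<in>{1..<k}. z i \<ge> z (Suc i)) \<and> z k \<ge> z 1 - 1"
  then have z: "dom_vec z" "z \<in> aff_orbit k x" by (simp_all add: dom_vec_iff)
  obtain w where "w \<in> aff_group k" "z = w y"
    using orbit_trans[OF z(2) orbit_sym[OF assms(2)]] by (rule orbitE)
  then show "z = y" using dominant_unique[of w y] assms(1) z(1) by simp
qed

text \<open>The minimal element is characterized by its inversions: they are exactly the positive
  roots that are negative at the vector. All comparisons below go through this description.\<close>

lemma min_elem_props:
  shows "dom_vec (alcove_rep k x)" "alcove_rep k x \<in> aff_orbit k x" "min_elem k x \<in> aff_group k"
    "min_elem k x (alcove_rep k x) = x" "Inv k (min_elem k x) = Neg k x"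
proof -
  obtain y w where y: "dom_vec y" and w: "w \<in> aff_group k" "w y = x" "Inv k w = Neg k x"
    using exists_dominant by blast
  have "y \<in> aff_orbit k x" using orbit_sym[OF orbitI[OF w(1), of y]] w(2) by simp
  then have r: "alcove_rep k x = y" using y by (intro alcove_rep_eqI)
  have "min_elem k x = w"
    unfolding min_elem_def r
  proof (rule the_equality)
    have "aff_length k w \<le> aff_length k v" if "v \<in> aff_group k" "v y = x" for v
      using that w Neg_subset_Inv[OF that(1) y that(2)] by (simp add: aff_length_eq card_mono)
    then show "w \<in> aff_group k \<and> w y = x \<and> (\<forall>v\<in>aff_group k. v y = x \<longrightarrow> aff_length k w \<le> aff_length k v)"
      using w by blast
    fix v assume v: "v \<in> aff_group k \<and> v y = x \<and> (\<forall>u\<in>aff_group k. u y = x \<longrightarrow> aff_length k v \<le> aff_length k u)"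
    then have "card (Inv k v) \<le> card (Neg k x)" using w by (metis aff_length_eq)
    then have "Neg k x = Inv k v" using Neg_subset_Inv[of v y x] v y by (intro card_seteq) auto
    then show "v = w" using Inv_inject v w by simp
  qed
  then show "dom_vec (alcove_rep k x)" "alcove_rep k x \<in> aff_orbit k x" "min_elem k x \<in> aff_group k"
    "min_elem k x (alcove_rep k x) = x" "Inv k (min_elem k x) = Neg k x"
    using r y w \<open>y \<in> aff_orbit k x\<close> by auto
qed

lemma min_elem_eqI:
  assumes "w \<in> aff_group k" "w (alcove_rep k x) = x" "card (Inv k w) \<le> card (Neg k x)"
  shows "w = min_elem k x"
proof -
  have "Neg k x = Inv k w" using assms Neg_subset_Inv[of w "alcove_rep k x" x] min_elem_props(1)
    by (intro card_seteq) auto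
  then show ?thesis using min_elem_props[of x] assms by (intro Inv_inject) auto
qed

lemma alcove_rep_orbit: "x \<in> aff_orbit k z \<Longrightarrow> alcove_rep k x = alcove_rep k z"
  using min_elem_props[of z] by (intro alcove_rep_eqI) (auto intro: orbit_trans orbit_sym)

subsection \<open>Reflections and Bruhat steps\<close>

lemma group_conj_reflect:
  assumes "g \<in> aff_group k" "i \<in> {1..k}" "j \<in> {1..k}" "i \<noteq> j"
  shows "\<exists>i'\<in>{1..k}. \<exists>j'\<in>{1..k}. \<exists>c'. i' \<noteq> j' \<and> g \<circ> reflect i j c = reflect i' j' c' \<circ> g"
  using assms(1)
proof (induction rule: group_induct)
  case id then show ?case using assms by (intro bexI[of _ i] bexI[of _ j] exI[of _ c]) auto
next
  case (gen s g)
  from gen(3) obtain i' j' c' where 1: "i' \<in> {1..k}" "j' \<in> {1..k}" "i' \<noteq> j'"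
    "g \<circ> reflect i j c = reflect i' j' c' \<circ> g" by (elim bexE exE conjE)
  obtain a b d where s: "aff_s k s = reflect a b d" "a \<in> {1..k}" "b \<in> {1..k}" "a \<noteq> b"
    using gen_cases[OF gen(1)] by metis
  obtain i2 j2 c2 where 2: "i2 = transpose a b i'" "j2 = transpose a b j'"
     "\<And>x. reflect i2 j2 c2 (reflect a b d x) = reflect a b d (reflect i' j' c' x)"
    using reflect_conj[OF 1(3) s(4)] by metis
  have "i2 \<in> {1..k}" "j2 \<in> {1..k}" "i2 \<noteq> j2" using 1 2 s by (auto simp: transpose_def)
  moreover have "aff_s k s \<circ> g \<circ> reflect i j c = reflect i2 j2 c2 \<circ> (aff_s k s \<circ> g)"
  proof
    fix x
    show "(aff_s k s \<circ> g \<circ> reflect i j c) x = (reflect i2 j2 c2 \<circ> (aff_s k s \<circ> g)) x"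
      using fun_cong[OF 1(4), of x] 2(3)[of "g x"] by (simp add: s)
  qed
  ultimately show ?case by blast
qed

lemma reflect_pos:
  assumes "i \<in> {1..k}" "j \<in> {1..k}" "i \<noteq> j"
  shows "\<exists>i'\<in>{1..k}. \<exists>j'\<in>{1..k}. \<exists>c'. i' \<noteq> j' \<and> reflect i j c = reflect i' j' c' \<and> ht k (root_fun i' j' c') > 0"
proof (cases "ht k (root_fun i j c) > 0")
  case False
  then have "ht k (root_fun j i (- c)) > 0"
    using assms by (auto simp: root_pos_iff)
  then show ?thesis using assms reflect_swap[OF assms(3), of c]
    by (intro bexI[of _ j] bexI[of _ i] exI[of _ "- c"] conjI) auto
next
  case True
  then show ?thesis using assms by (intro bexI[of _ i] bexI[of _ j] exI[of _ c] conjI) auto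
qed

text \<open>Induction on the height: a simple reflection lowers the height of a positive root until
  the root is simple.\<close>

lemma reflect_in_reflections:
  assumes "i \<in> {1..k}" "j \<in> {1..k}" "i \<noteq> j" "ht k (root_fun i j c) > 0"
  shows "\<exists>w\<in>aff_group k. \<exists>s<k. reflect i j c \<circ> w = w \<circ> aff_s k s"
  using assms
proof (induction "nat (ht k (root_fun i j c))" arbitrary: i j c rule: less_induct)
  case less
  define s where "s = (if i < k then i else 0)"
  have s: "s < k" using less.prems k2 by (simp add: s_def)
  show ?case
  proof (cases "root_fun i j c = sroot k s")
    case True
    have "reflect i j c = aff_s k s"
    proof (cases "i < k")
      case i: True
      have "c = 0" using fun_cong[OF True, of "\<lambda>_. 0"] i less.prems by (simp add: s_def sroot_def root_fun_def)
      moreover have "j = Suc i"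
        using fun_cong[OF True, of "\<lambda>n. of_bool (n = j)"] i less.prems calculation
        by (auto simp: s_def sroot_def root_fun_def split: if_splits)
      ultimately show ?thesis using i less.prems by (simp add: aff_s_eq_refl s_def)
    next
      case i: False
      have "c = 1" using fun_cong[OF True, of "\<lambda>_. 0"] i by (simp add: s_def sroot_def root_fun_def)
      moreover have "j = 1"
        using fun_cong[OF True, of "\<lambda>n. of_bool (n = j)"] i less.prems calculation
        by (auto simp: s_def sroot_def root_fun_def split: if_splits)
      ultimately show ?thesis using i less.prems k2 by (simp add: aff_s_eq_refl s_def)
    qed
    then show ?thesis using s by (intro bexI[of _ id]) auto
  next
    case False
    obtain a b d where ab: "aff_s k s = reflect a b d" "sroot k s = root_fun a b d" "a = i" "b \<noteq> i" "b \<in> {1..k}"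
      using less.prems k2 s by (cases "i < k") (auto simp: aff_s_eq_refl sroot_def s_def)
    obtain i' j' c' where 2: "\<And>x. root_fun i' j' c' x = root_fun i j c (reflect a b d x)"
      "i' = transpose a b i" "j' = transpose a b j"
      "\<And>x. reflect i' j' c' (reflect a b d x) = reflect a b d (reflect i j c x)"
      using reflect_conj[OF less.prems(3), of a b c d] ab by metis
    have i': "i' \<in> {1..k}" "j' \<in> {1..k}" "i' \<noteq> j'" using 2 less.prems ab by (auto simp: transpose_def)
    have eq: "root_fun i' j' c' = root_fun i j c \<circ> aff_s k s" by (rule ext) (simp add: 2(1) ab(1))
    have pos: "ht k (root_fun i' j' c') > 0"
      unfolding eq using less.prems s False by (intro gen_permutes_pos root_fun_in_roots)
    have e: "root_fun i' j' c' x = root_fun i j c x - pairing i j a b * sroot k s x" for x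
      unfolding 2(1) ab(2) using ab(3,4) by (intro root_reflect_pairing) auto
    have "ht k (root_fun i' j' c') = ht k (root_fun i j c) - pairing i j a b * ht k (sroot k s)"
      unfolding ht_def pair_eval_def e by (simp add: algebra_simps)
    moreover have "pairing i j a b \<ge> 1" using ab less.prems by (auto simp: pairing_def)
    ultimately have "ht k (root_fun i' j' c') < ht k (root_fun i j c)" using ht_sroot[OF s] by simp
    then obtain w t where w: "w \<in> aff_group k" "t < k" "reflect i' j' c' \<circ> w = w \<circ> aff_s k t"
      using less.hyps[of i' j' c'] i' pos by auto
    have "reflect i j c (aff_s k s (w x)) = aff_s k s (w (aff_s k t x))" for x
    proof -
      have "reflect i j c (aff_s k s (w x)) = aff_s k s (aff_s k s (reflect i j c (aff_s k s (w x))))"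
        using s by (simp add: aff_s_aff_s)
      also have "\<dots> = aff_s k s (reflect i' j' c' (aff_s k s (aff_s k s (w x))))"
        using 2(4) ab(1) by simp
      finally show ?thesis using fun_cong[OF w(3), of x] s by (simp add: aff_s_aff_s)
    qed
    then have "reflect i j c \<circ> (aff_s k s \<circ> w) = (aff_s k s \<circ> w) \<circ> aff_s k t" by (intro ext) simp
    moreover have "aff_s k s \<circ> w \<in> aff_group k" using w s by (intro group_comp gen_in_group)
    ultimately show ?thesis using w(2)
      by (intro bexI[of _ "aff_s k s \<circ> w"] exI[of _ t] conjI)
  qed
qed

lemma reflect_in_group:
  assumes "i \<in> {1..k}" "j \<in> {1..k}" "i \<noteq> j" "ht k (root_fun i j c) > 0"
  shows "reflect i j c \<in> aff_group k"
proof -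
  obtain w s where w: "w \<in> aff_group k" "s < k" "reflect i j c \<circ> w = w \<circ> aff_s k s"
    using reflect_in_reflections[OF assms] by (elim bexE exE conjE)
  have "reflect i j c = w \<circ> aff_s k s \<circ> inv w"
  proof
    fix x
    show "reflect i j c x = (w \<circ> aff_s k s \<circ> inv w) x"
      using fun_cong[OF w(3), of "inv w x"] group_inv(3)[OF w(1)] by simp
  qed
  moreover have "w \<circ> aff_s k s \<circ> inv w \<in> aff_group k"
    using w group_inv(1)[OF w(1)] by (intro group_comp gen_in_group)
  ultimately show ?thesis by simp
qed

lemma card_Inv_reflect:
  assumes "i \<in> {1..k}" "j \<in> {1..k}" "i \<noteq> j" "ht k (root_fun i j c) > 0" "ht k (root_fun i j c \<circ> u) > 0"
  shows "card (Inv k u) < card (Inv k (reflect i j c \<circ> u))"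
  using card_neg_roots_reflect[OF assms(1-4)] assms(5) by (simp add: Inv_def ht_comp)

lemma bruhat_stepI:
  assumes "u \<in> aff_group k" "i \<in> {1..k}" "j \<in> {1..k}" "i \<noteq> j" "ht k (root_fun i j c) > 0"
    "ht k (root_fun i j c \<circ> u) > 0"
  shows "bruhat_step k u (reflect i j c \<circ> u)"
proof -
  obtain w s where w: "w \<in> aff_group k" "s < k" "reflect i j c \<circ> w = w \<circ> aff_s k s"
    using reflect_in_reflections[OF assms(2-5)] by (elim bexE exE conjE)
  have iu: "inv u \<in> aff_group k" using assms(1) group_inv by blast
  let ?g = "inv u \<circ> w"
  have g: "?g \<in> aff_group k" using iu w by (intro group_comp)
  have ig: "inv ?g = inv w \<circ> u"
    using group_inv(4)[OF w(1)] group_inv(4)[OF iu] group_inv(4)[OF assms(1)] by (simp add: o_inv_distrib inv_inv_eq)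
  have conj: "?g \<circ> aff_s k s \<circ> inv ?g = inv u \<circ> reflect i j c \<circ> u"
  proof (rule ext)
    fix x
    show "(?g \<circ> aff_s k s \<circ> inv ?g) x = (inv u \<circ> reflect i j c \<circ> u) x"
      using fun_cong[OF w(3), of "inv w (u x)"] group_inv(3)[OF w(1)]
      by (simp add: ig)
  qed
  have "?g \<circ> aff_s k s \<circ> inv ?g \<in> aff_reflections k"
    using g w(2) unfolding aff_reflections_def gens_eq by (intro CollectI exI[of _ ?g] exI[of _ s]) simp
  then have "inv u \<circ> reflect i j c \<circ> u \<in> aff_reflections k" unfolding conj .
  moreover have "reflect i j c \<circ> u = u \<circ> (inv u \<circ> reflect i j c \<circ> u)"
    by (rule ext) (simp add: group_inv(3)[OF assms(1)])
  moreover have "reflect i j c \<circ> u \<in> aff_group k" using assms reflect_in_group group_comp by blast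
  moreover have "aff_length k u < aff_length k (reflect i j c \<circ> u)"
    using card_Inv_reflect[OF assms(2-6)] aff_length_eq[OF assms(1)] aff_length_eq[OF calculation(3)] by simp
  ultimately show ?thesis unfolding bruhat_step_def using assms(1) by (intro conjI bexI)
qed

lemma bruhat_stepE:
  assumes "bruhat_step k u w"
  obtains i j c where "u \<in> aff_group k" "i \<in> {1..k}" "j \<in> {1..k}" "i \<noteq> j" "ht k (root_fun i j c) > 0"
    "ht k (root_fun i j c \<circ> u) > 0" "w = reflect i j c \<circ> u" "w \<in> aff_group k" "card (Inv k u) < card (Inv k w)"
proof -
  obtain v s where u: "u \<in> aff_group k" and v: "v \<in> aff_group k" "s < k" "w = u \<circ> (v \<circ> aff_s k s \<circ> inv v)"
    and l: "aff_length k u < aff_length k w"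
    using assms by (auto simp: bruhat_step_def aff_reflections_def gens_eq)
  have w: "w \<in> aff_group k" using u v group_inv by (auto intro!: group_comp gen_in_group)
  obtain a b d where s: "aff_s k s = reflect a b d" "a \<in> {1..k}" "b \<in> {1..k}" "a \<noteq> b"
    using gen_cases[OF v(2)] by metis
  obtain i' j' c' where 1: "i' \<in> {1..k}" "j' \<in> {1..k}" "i' \<noteq> j'" "(u \<circ> v) \<circ> reflect a b d = reflect i' j' c' \<circ> (u \<circ> v)"
    using group_conj_reflect[OF group_comp[OF u v(1)] s(2-4), of d] by (elim bexE exE conjE)
  obtain i j c where 2: "i \<in> {1..k}" "j \<in> {1..k}" "i \<noteq> j" "reflect i' j' c' = reflect i j c" "ht k (root_fun i j c) > 0"
    using reflect_pos[OF 1(1-3), of c'] by (elim bexE exE conjE)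
  have w_eq: "w = reflect i j c \<circ> u"
  proof
    fix x
    have "w x = ((u \<circ> v) \<circ> reflect a b d) (inv v x)" by (simp add: v(3) s(1))
    also have "\<dots> = reflect i j c (u (v (inv v x)))" unfolding 1(4) 2(4) by simp
    finally show "w x = (reflect i j c \<circ> u) x" using group_inv(3)[OF v(1)] by simp
  qed
  have c: "card (Inv k u) < card (Inv k w)" using l u w by (simp add: aff_length_eq)
  have "ht k (root_fun i j c \<circ> u) > 0"
  proof (rule ccontr)
    assume "\<not> ?thesis"
    moreover have "ht k (root_fun i j c \<circ> u) \<noteq> 0"
      using root_comp[OF u root_fun_in_roots] 2 by (intro ht_neq_0) auto
    moreover have "ht k (root_fun i j c \<circ> w) = - ht k (root_fun i j c \<circ> u)"
      using root_reflect_self[OF 2(3)] by (simp add: w_eq ht_def pair_eval_def algebra_simps)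
    ultimately have "ht k (root_fun i j c \<circ> w) > 0" by linarith
    then have "card (Inv k w) < card (Inv k (reflect i j c \<circ> w))" using 2 by (intro card_Inv_reflect)
    moreover have "reflect i j c \<circ> w = u" using reflect_reflect[OF 2(3)] by (simp add: w_eq fun_eq_iff)
    ultimately show False using c by simp
  qed
  then show ?thesis by (rule that[OF u 2(1-3,5) _ w_eq w c])
qed

lemma bruhat_le_trans: "bruhat_le k u v \<Longrightarrow> bruhat_le k v w \<Longrightarrow> bruhat_le k u w"
  unfolding bruhat_le_def by (rule rtranclp_trans)

lemma bruhat_le_length: "bruhat_le k u w \<Longrightarrow> u = w \<or> card (Inv k u) < card (Inv k w)"
  unfolding bruhat_le_def
  by (induction rule: rtranclp_induct) (auto elim!: bruhat_stepE)

text \<open>The lifting property. In a chain of Bruhat steps, a step by a reflection r is either the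
  one by s itself, or its conjugate by s is again a step, because s keeps the root of r
  positive.\<close>

lemma bruhat_lift:
  assumes "bruhat_le k u w" "s < k"
  shows "bruhat_le k (aff_s k s \<circ> u) w \<or> bruhat_le k (aff_s k s \<circ> u) (aff_s k s \<circ> w)"
  using assms(1) unfolding bruhat_le_def
proof (induction rule: rtranclp_induct)
  case base then show ?case by simp
next
  case (step w w')
  have s: "s < k" by fact
  have ss: "aff_s k s \<circ> (aff_s k s \<circ> u) = u" for u :: "vec \<Rightarrow> vec"
    using s by (rule aff_s_comp)
  have ww: "(bruhat_step k)\<^sup>*\<^sup>* w w'" using step by simp
  obtain i j c where 1: "w \<in> aff_group k" "i \<in> {1..k}" "j \<in> {1..k}" "i \<noteq> j" "ht k (root_fun i j c) > 0"
    "ht k (root_fun i j c \<circ> w) > 0" "w' = reflect i j c \<circ> w"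
    using bruhat_stepE[OF step(2)] by metis
  obtain a b d where ab: "aff_s k s = reflect a b d" "sroot k s = root_fun a b d" "a \<in> {1..k}" "b \<in> {1..k}" "a \<noteq> b"
    using gen_cases[OF s] by metis
  show ?case
  proof (cases "root_fun i j c = sroot k s")
    case True
    then have e: "root_fun i j c x = root_fun a b d x" for x using ab by simp
    have "c = d" using e[of "\<lambda>_. 0"] by (simp add: root_fun_def)
    moreover have "i = a" using e[of "\<lambda>n. of_bool (n = i)"] 1(4) ab(5) calculation
      by (auto simp: root_fun_def of_bool_def split: if_splits)
    moreover have "j = b" using e[of "\<lambda>n. of_bool (n = j)"] 1(4) ab(5) calculation
      by (auto simp: root_fun_def of_bool_def split: if_splits)
    ultimately have sw: "aff_s k s \<circ> w = w'" using 1(7) ab(1) by simp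
    from step(3) show ?thesis
    proof (elim disjE)
      assume "(bruhat_step k)\<^sup>*\<^sup>* (aff_s k s \<circ> u) w"
      then show ?thesis using ww by (intro disjI1) (rule rtranclp_trans)
    next
      assume "(bruhat_step k)\<^sup>*\<^sup>* (aff_s k s \<circ> u) (aff_s k s \<circ> w)"
      then show ?thesis unfolding sw by (rule disjI1)
    qed
  next
    case False
    obtain i' j' c' where 2: "\<And>x. root_fun i' j' c' x = root_fun i j c (reflect a b d x)"
      "i' = transpose a b i" "j' = transpose a b j"
      "\<And>x. reflect i' j' c' (reflect a b d x) = reflect a b d (reflect i j c x)"
      using reflect_conj[OF 1(4) ab(5)] by metis
    have i': "i' \<in> {1..k}" "j' \<in> {1..k}" "i' \<noteq> j'" using 1 2 ab by (auto simp: transpose_def)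
    have eq: "root_fun i' j' c' = root_fun i j c \<circ> aff_s k s" by (rule ext) (simp add: 2(1) ab(1))
    have pos: "ht k (root_fun i' j' c') > 0"
      unfolding eq using 1 s False by (intro gen_permutes_pos root_fun_in_roots)
    have "ht k (root_fun i' j' c' \<circ> (aff_s k s \<circ> w)) > 0"
      unfolding eq using 1(6) ss[of w] by (simp add: comp_assoc)
    then have "bruhat_step k (aff_s k s \<circ> w) (reflect i' j' c' \<circ> (aff_s k s \<circ> w))"
      using i' pos 1 s by (intro bruhat_stepI group_comp gen_in_group)
    moreover have "reflect i' j' c' \<circ> (aff_s k s \<circ> w) = aff_s k s \<circ> w'"
      by (rule ext) (simp add: 2(4) 1(7) ab(1))
    ultimately have st: "bruhat_step k (aff_s k s \<circ> w) (aff_s k s \<circ> w')" by (simp only:)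
    from step(3) show ?thesis
    proof (elim disjE)
      assume "(bruhat_step k)\<^sup>*\<^sup>* (aff_s k s \<circ> u) w"
      then show ?thesis using ww by (intro disjI1) (rule rtranclp_trans)
    next
      assume "(bruhat_step k)\<^sup>*\<^sup>* (aff_s k s \<circ> u) (aff_s k s \<circ> w)"
      then show ?thesis using st by (intro disjI2) (rule rtranclp.rtrancl_into_rtrancl)
    qed
  qed
qed

text \<open>An inversion of u that is not forced by the vector belongs to a root vanishing at it; the
  reflection in that root fixes the vector and shortens u.\<close>

lemma min_elem_least:
  assumes "u \<in> aff_group k" "u (alcove_rep k x) = x"
  shows "bruhat_le k (min_elem k x) u"
  using assms
proof (induction "card (Inv k u)" arbitrary: u rule: less_induct)
  case less
  show ?case
  proof (cases "Inv k u = Neg k x")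
    case True
    then have "u = min_elem k x" using less.prems by (intro min_elem_eqI) auto
    then show ?thesis by (simp add: bruhat_le_def)
  next
    case False
    have "Neg k x \<subseteq> Inv k u" using Neg_subset_Inv less.prems min_elem_props(1) by blast
    then obtain \<alpha> where "\<alpha> \<in> Inv k u" "\<alpha> \<notin> Neg k x" using False by blast
    then have a: "\<alpha> \<in> roots k" "ht k \<alpha> > 0" "ht k (\<alpha> \<circ> u) < 0" "\<alpha> x \<ge> 0"
      by (auto simp: Inv_iff Neg_iff)
    obtain i j c where i: "\<alpha> = root_fun i j c" "i \<in> {1..k}" "j \<in> {1..k}" "i \<noteq> j"
      using a(1) by (rule rootsE)
    have r: "(\<lambda>z. - (\<alpha> \<circ> u) z) \<in> roots k" "ht k (\<lambda>z. - (\<alpha> \<circ> u) z) > 0"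
      using uminus_in_roots[OF root_comp[OF less.prems(1) a(1)]] a(3) ht_uminus[of k "\<alpha> \<circ> u"] by auto
    moreover have "(\<lambda>z. - (\<alpha> \<circ> u) z) \<notin> Neg k (alcove_rep k x)"
      using min_elem_props(1) by (simp add: dom_vec_iff_Neg)
    ultimately have "\<alpha> x = 0" using a(4) less.prems(2) by (auto simp: Neg_iff)
    then have fix_x: "reflect i j c x = x" using i by (simp add: reflect_fix)
    let ?v = "reflect i j c \<circ> u"
    have v: "?v \<in> aff_group k" using less.prems a i reflect_in_group group_comp by blast
    have "ht k (\<alpha> \<circ> ?v) = - ht k (\<alpha> \<circ> u)"
      using root_reflect_self[OF i(4)] by (simp add: i(1) ht_def pair_eval_def algebra_simps)
    then have pos: "ht k (root_fun i j c \<circ> ?v) > 0" using a(3) i(1) by simp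
    have uv: "reflect i j c \<circ> ?v = u" using i(4) by (rule reflect_comp)
    have "bruhat_step k ?v u" using bruhat_stepI[OF v i(2-4) _ pos] a(2) i(1) uv by simp
    moreover have "card (Inv k ?v) < card (Inv k u)"
      using card_Inv_reflect[OF i(2-4) _ pos] a(2) i(1) uv by simp
    then have "bruhat_le k (min_elem k x) ?v" using v fix_x less.prems by (intro less.hyps) auto
    ultimately show ?thesis unfolding bruhat_le_def by simp
  qed
qed

subsection \<open>Comparison of vectors\<close>

lemma vec_le_refl [simp]: "vec_le k x x"
  by (simp add: vec_le_def bruhat_le_def)
lemma vec_le_trans: "vec_le k x y \<Longrightarrow> vec_le k y z \<Longrightarrow> vec_le k x z"
  unfolding vec_le_def using orbit_trans bruhat_le_trans by blast

lemma vec_le_rank: "vec_le k x y \<Longrightarrow> x = y \<or> card (Neg k x) < card (Neg k y)"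
proof -
  assume "vec_le k x y"
  then have "x \<in> aff_orbit k y" "bruhat_le k (min_elem k x) (min_elem k y)" by (auto simp: vec_le_def)
  then show ?thesis using bruhat_le_length alcove_rep_orbit[of x y] min_elem_props(4,5)
    by metis
qed

text \<open>If the root is negative at x, the reflection shortens the minimal element of x, and the
  minimal element of the reflected vector lies below the shortened one.\<close>

lemma vec_le_reflect_root:
  assumes i: "i \<in> {1..k}" "j \<in> {1..k}" "i \<noteq> j" and pos: "ht k (root_fun i j c) > 0"
    and le: "root_fun i j c x \<le> 0"
  shows "vec_le k (reflect i j c x) x"
proof (cases "root_fun i j c x = 0")
  case True then show ?thesis by (simp add: reflect_fix)
next
  case False
  let ?u = "reflect i j c \<circ> min_elem k x"
  have g: "reflect i j c \<in> aff_group k" using reflect_in_group i pos by blast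
  then have u: "?u \<in> aff_group k" using min_elem_props group_comp by blast
  have orb: "reflect i j c x \<in> aff_orbit k x" using g by (simp add: orbit_apply)
  have "root_fun i j c \<in> Inv k (min_elem k x)"
    using False le pos i min_elem_props(5)[of x] by (simp add: Neg_iff root_fun_in_roots)
  then have n: "ht k (root_fun i j c \<circ> min_elem k x) < 0" by (simp add: Inv_iff)
  have "ht k (root_fun i j c \<circ> ?u) = - ht k (root_fun i j c \<circ> min_elem k x)"
    using root_reflect_self[OF i(3)] by (simp add: ht_def pair_eval_def algebra_simps)
  then have "bruhat_step k ?u (reflect i j c \<circ> ?u)" using n u i pos by (intro bruhat_stepI) auto
  moreover have "reflect i j c \<circ> ?u = min_elem k x" using i(3) by (rule reflect_comp)
  moreover have "bruhat_le k (min_elem k (reflect i j c x)) ?u"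
    using u alcove_rep_orbit[OF orb] min_elem_props(4)[of x] by (intro min_elem_least) auto
  ultimately show ?thesis using orb unfolding vec_le_def bruhat_le_def by simp
qed

lemma vec_le_gen:
  assumes "s < k" "sroot k s z \<ge> 0" shows "vec_le k z (aff_s k s z)"
proof -
  obtain a b d where ab: "aff_s k s = reflect a b d" "sroot k s = root_fun a b d" "a \<in> {1..k}" "b \<in> {1..k}" "a \<noteq> b"
    using gen_cases[OF assms(1)] by metis
  have "vec_le k (reflect a b d (aff_s k s z)) (aff_s k s z)"
    using ab assms ht_sroot[OF assms(1)] sroot_aff_s[OF assms(1), of z] by (intro vec_le_reflect_root) auto
  then show ?thesis using assms(1) by (simp add: aff_s_aff_s flip: ab(1))
qed

text \<open>The form of the lifting property that the intertwiners need.\<close>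

lemma vec_le_lift:
  assumes "vec_le k x z" and s: "s < k" and pos: "sroot k s z > 0"
  shows "vec_le k (aff_s k s x) (aff_s k s z)"
proof -
  let ?s = "aff_s k s"
  have o: "x \<in> aff_orbit k z" and b: "bruhat_le k (min_elem k x) (min_elem k z)"
    using assms by (auto simp: vec_le_def)
  have os: "?s y \<in> aff_orbit k y" for y using s by (simp add: orbit_apply gen_in_group)
  have "card (Neg k (?s z)) = Suc (card (Neg k z))"
    using card_Neg_gen[OF s, of "?s z"] pos by (simp add: sroot_aff_s[OF s] aff_s_aff_s[OF s])
  then have "?s \<circ> min_elem k z = min_elem k (?s z)"
    using card_Inv_gen(2)[OF s, of "min_elem k z"] min_elem_props[of z] alcove_rep_orbit[OF os] s
    by (intro min_elem_eqI group_comp gen_in_group) auto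
  moreover have "bruhat_le k (min_elem k z) (min_elem k (?s z))"
    using vec_le_gen[OF s, of z] pos by (simp add: vec_le_def)
  ultimately have "bruhat_le k (?s \<circ> min_elem k x) (min_elem k (?s z))"
    using bruhat_lift[OF b s] bruhat_le_trans by metis
  moreover have "bruhat_le k (min_elem k (?s x)) (?s \<circ> min_elem k x)"
    using min_elem_props[of x] alcove_rep_orbit[OF os] s
    by (intro min_elem_least group_comp gen_in_group) auto
  ultimately show ?thesis
    unfolding vec_le_def using bruhat_le_trans orbit_trans[OF os orbit_trans[OF o orbit_sym[OF os]]] by blast
qed

subsection \<open>The cyclic symmetry of the order\<close>

text \<open>The rotation of vectors behind the raising operator. It normalizes the group, and
  conjugation by it permutes the generators cyclically; so it preserves the length, the
  reflections and the order.\<close>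

definition cyc :: "vec \<Rightarrow> vec" where
  "cyc x i = (if i = 1 then x k + 1 else if 2 \<le> i \<and> i \<le> k then x (i - 1) else x i)"
definition cyc_inv :: "vec \<Rightarrow> vec" where
  "cyc_inv x i = (if i = k then x 1 - 1 else if 1 \<le> i \<and> i < k then x (Suc i) else x i)"

lemma cyc_cyc_inv [simp]: "cyc (cyc_inv x) = x" "cyc_inv (cyc x) = x"
  using k2 by (auto simp: cyc_def cyc_inv_def fun_eq_iff)

lemma cyc_gen:
  assumes "s < k"
  shows "cyc (aff_s k s x) = aff_s k (if Suc s = k then 0 else Suc s) (cyc x)"
proof
  fix i
  consider (zero) "s = 0" | (last) "s \<noteq> 0" "Suc s = k" | (mid) "s \<noteq> 0" "Suc s < k" using assms by linarith
  then show "cyc (aff_s k s x) i = aff_s k (if Suc s = k then 0 else Suc s) (cyc x) i"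
  proof cases
    case zero
    consider "i = 1" | "i = 2" | "i \<noteq> 1" "i \<noteq> 2" by blast
    then show ?thesis using zero k2 by cases (auto simp: cyc_def aff_s_def transpose_def)
  next
    case last
    consider "i = 1" | "i = k" "i \<noteq> 1" | "i \<noteq> 1" "i \<noteq> k" by blast
    then show ?thesis using last k2 by cases (auto simp: cyc_def aff_s_def transpose_def)
  next
    case mid
    consider "i = 1" | "i = Suc s" "i \<noteq> 1" | "i = Suc (Suc s)" "i \<noteq> 1" | "i \<noteq> 1" "i \<noteq> Suc s" "i \<noteq> Suc (Suc s)" by blast
    then show ?thesis using mid k2 by cases (auto simp: cyc_def aff_s_def transpose_def)
  qed
qed

definition cyc_conj :: "(vec \<Rightarrow> vec) \<Rightarrow> vec \<Rightarrow> vec" where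
  "cyc_conj w x = cyc (w (cyc_inv x))"

lemma cyc_conj_comp: "cyc_conj (v \<circ> w) = cyc_conj v \<circ> cyc_conj w"
  by (simp add: cyc_conj_def fun_eq_iff)
lemma cyc_conj_id: "cyc_conj id = id"
  by (simp add: cyc_conj_def fun_eq_iff)
lemma cyc_conj_gen: "s < k \<Longrightarrow> cyc_conj (aff_s k s) = aff_s k (if Suc s = k then 0 else Suc s)"
  by (simp add: cyc_conj_def fun_eq_iff cyc_gen)
lemma cyc_conj_inj: "cyc_conj v = cyc_conj w \<Longrightarrow> v = w"
  unfolding cyc_conj_def fun_eq_iff[of v] by (metis cyc_cyc_inv(2))

lemma cyc_conj_group: "w \<in> aff_group k \<Longrightarrow> cyc_conj w \<in> aff_group k"
proof (induction rule: group_induct)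
  case id show ?case by (simp only: cyc_conj_id id_in_group)
next
  case (gen s w)
  then show ?case unfolding cyc_conj_comp cyc_conj_gen[OF gen(1)]
    using k2 by (intro group_comp gen_in_group) auto
qed

lemma cyc_conj_group_surj:
  assumes "w \<in> aff_group k" shows "\<exists>v\<in>aff_group k. w = cyc_conj v"
  using assms
proof (induction rule: group_induct)
  case id
  show ?case by (rule bexI[of _ id]) (rule cyc_conj_id[symmetric], rule id_in_group)
next
  case (gen s w)
  from gen(3) obtain v where v: "v \<in> aff_group k" "w = cyc_conj v" by (rule bexE)
  let ?t = "if s = 0 then k - 1 else s - 1"
  have t: "?t < k" using gen(1) k2 by auto
  have "aff_s k s = cyc_conj (aff_s k ?t)"
    using gen(1) k2 by (subst cyc_conj_gen) auto
  then have "aff_s k s \<circ> w = cyc_conj (aff_s k ?t \<circ> v)"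
    by (simp only: cyc_conj_comp v(2))
  moreover have "aff_s k ?t \<circ> v \<in> aff_group k" using v(1) t by (intro group_comp gen_in_group)
  ultimately show ?case by (rule bexI)
qed

lemma cyc_conj_length_le: "w \<in> aff_group k \<Longrightarrow> card (Inv k (cyc_conj w)) \<le> card (Inv k w)"
proof (induction rule: Inv_induct)
  case id then show ?case by (simp add: cyc_conj_id[unfolded id_def] Inv_id[unfolded id_def] id_def)
next
  case (gen s w)
  let ?t = "if Suc s = k then 0 else Suc s"
  have "card (Inv k (cyc_conj (aff_s k s \<circ> w))) \<le> Suc (card (Inv k (cyc_conj w)))"
    unfolding cyc_conj_comp cyc_conj_gen[OF gen(1)] using gen(1) by (intro card_Inv_gen(2)) auto
  moreover have "card (Inv k (aff_s k s \<circ> w)) = Suc (card (Inv k w))"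
    using card_Inv_gen(1)[OF gen(1,3)] aff_s_aff_s[OF gen(1)] by (simp add: comp_def)
  ultimately show ?case using gen by (simp add: comp_def)
qed

lemma card_Inv_cyc_conj:
  assumes "w \<in> aff_group k" shows "card (Inv k (cyc_conj w)) = card (Inv k w)"
proof -
  have "card (Inv k v) \<le> card (Inv k w)" if "v \<in> aff_group k" "v = cyc_conj w" "w \<in> aff_group k" for v w
    using cyc_conj_length_le that by blast
  have "w \<in> aff_group k \<Longrightarrow> card (Inv k w) \<le> card (Inv k (cyc_conj w))" for w
  proof (induction "card (Inv k (cyc_conj w))" arbitrary: w rule: less_induct)
    case less
    have g: "cyc_conj w \<in> aff_group k" using less cyc_conj_group by blast
    show ?case
    proof (cases "Inv k (cyc_conj w) = {}")
      case True
      then have "cyc_conj w = cyc_conj id" using Inv_empty_imp_id[OF g] by (simp add: cyc_conj_id)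
      then have "w = id" by (rule cyc_conj_inj)
      then show ?thesis by (simp add: Inv_id)
    next
      case False
      then obtain s where s: "s < k" "sroot k s \<in> Inv k (cyc_conj w)" using simple_in_Inv by blast
      let ?t = "if s = 0 then k - 1 else s - 1"
      have t: "?t < k" "cyc_conj (aff_s k ?t) = aff_s k s" using s k2 by (auto simp: cyc_conj_gen)
      have c: "card (Inv k (cyc_conj w)) = Suc (card (Inv k (cyc_conj (aff_s k ?t \<circ> w))))"
        unfolding cyc_conj_comp t(2) using s by (rule card_Inv_gen(1))
      then have "card (Inv k (aff_s k ?t \<circ> w)) \<le> card (Inv k (cyc_conj (aff_s k ?t \<circ> w)))"
        using less t by (intro less.hyps group_comp gen_in_group) auto
      moreover have "card (Inv k w) \<le> Suc (card (Inv k (aff_s k ?t \<circ> w)))"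
        using card_Inv_gen(2)[OF t(1), of "aff_s k ?t \<circ> w"] aff_s_aff_s[OF t(1)] by (simp add: comp_def)
      ultimately show ?thesis using c by simp
    qed
  qed
  then show ?thesis using cyc_conj_length_le[OF assms] assms by (simp add: le_antisym)
qed

lemma cyc_orbit: "x \<in> aff_orbit k z \<Longrightarrow> cyc x \<in> aff_orbit k (cyc z)"
proof -
  assume "x \<in> aff_orbit k z"
  then obtain w where w: "w \<in> aff_group k" "x = w z" by (rule orbitE)
  then have "cyc x = cyc_conj w (cyc z)" by (simp add: cyc_conj_def)
  then show ?thesis using orbitI[OF cyc_conj_group[OF w(1)]] by simp
qed

lemma cyc_alcove_rep: "alcove_rep k (cyc x) = cyc (alcove_rep k x)"
proof (rule alcove_rep_eqI)
  have d: "dom_vec (alcove_rep k x)" by (rule min_elem_props)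
  let ?y = "alcove_rep k x"
  have dd: "?y (Suc i) \<le> ?y i" if "1 \<le> i" "i < k" for i
    using d that unfolding dom_vec_iff by simp
  have dl: "?y 1 - 1 \<le> ?y k" using d unfolding dom_vec_iff by blast
  show "dom_vec (cyc ?y)"
    unfolding dom_vec_iff
  proof (intro conjI ballI)
    fix i assume i: "i \<in> {1..<k}"
    show "cyc ?y (Suc i) \<le> cyc ?y i"
    proof (cases "i = 1")
      case True
      then show ?thesis using dl k2 by (simp add: cyc_def)
    next
      case False
      then have "?y (Suc (i - 1)) \<le> ?y (i - 1)" using i by (intro dd) auto
      then show ?thesis using False i by (simp add: cyc_def)
    qed
  next
    have "?y (Suc (k - 1)) \<le> ?y (k - 1)" using k2 by (intro dd) auto
    then show "cyc ?y 1 - 1 \<le> cyc ?y k" using k2 by (simp add: cyc_def)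
  qed
  show "cyc ?y \<in> aff_orbit k (cyc x)" by (intro cyc_orbit min_elem_props)
qed

lemma cyc_min_elem: "min_elem k (cyc x) = cyc_conj (min_elem k x)"
proof -
  obtain v where v: "v \<in> aff_group k" "min_elem k (cyc x) = cyc_conj v"
    using cyc_conj_group_surj[OF min_elem_props(3)] by blast
  have "cyc (v (alcove_rep k x)) = cyc x"
    using min_elem_props(4)[of "cyc x"] by (simp add: v(2) cyc_conj_def cyc_alcove_rep)
  then have "v (alcove_rep k x) = x" by (metis cyc_cyc_inv(2))
  then have "card (Neg k x) \<le> card (Inv k v)"
    by (intro card_mono finite_Inv Neg_subset_Inv[OF v(1) min_elem_props(1)])
  also have "\<dots> = card (Neg k (cyc x))"
    using card_Inv_cyc_conj[OF v(1)] min_elem_props(5)[of "cyc x"] by (simp add: v(2))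
  finally have "cyc_conj (min_elem k x) = min_elem k (cyc x)"
    using min_elem_props[of x] card_Inv_cyc_conj[of "min_elem k x"]
    by (intro min_elem_eqI cyc_conj_group) (auto simp: cyc_conj_def cyc_alcove_rep)
  then show ?thesis by simp
qed

lemma bruhat_step_cyc_conj:
  assumes "bruhat_step k u w" shows "bruhat_step k (cyc_conj u) (cyc_conj w)"
proof -
  obtain v s where u: "u \<in> aff_group k" and v: "v \<in> aff_group k" "s < k" "w = u \<circ> (v \<circ> aff_s k s \<circ> inv v)"
    and l: "aff_length k u < aff_length k w"
    using assms by (auto simp: bruhat_step_def aff_reflections_def gens_eq)
  have w: "w \<in> aff_group k" using assms by (rule bruhat_stepE)
  let ?t = "if Suc s = k then 0 else Suc s"
  have "cyc_conj (inv v) \<circ> cyc_conj v = id" "cyc_conj v \<circ> cyc_conj (inv v) = id"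
    by (rule ext, simp add: cyc_conj_def group_inv(2,3)[OF v(1)])+
  then have "inv (cyc_conj v) = cyc_conj (inv v)" by (intro inv_unique_comp)
  then have "cyc_conj w = cyc_conj u \<circ> (cyc_conj v \<circ> aff_s k ?t \<circ> inv (cyc_conj v))"
    by (simp add: v(3) cyc_conj_comp cyc_conj_gen[OF v(2)])
  moreover have "cyc_conj v \<circ> aff_s k ?t \<circ> inv (cyc_conj v) \<in> aff_reflections k"
    unfolding aff_reflections_def gens_eq using cyc_conj_group[OF v(1)] v(2) k2 by fastforce
  moreover have "aff_length k (cyc_conj u) < aff_length k (cyc_conj w)"
    using l by (simp only: aff_length_eq card_Inv_cyc_conj cyc_conj_group u w)
  ultimately show ?thesis
    unfolding bruhat_step_def using cyc_conj_group[OF u] by (intro conjI bexI)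
qed

lemma vec_le_cyc:
  assumes "vec_le k x z" shows "vec_le k (cyc x) (cyc z)"
proof -
  have "(bruhat_step k)\<^sup>*\<^sup>* (min_elem k x) (min_elem k z)"
    using assms by (simp add: vec_le_def bruhat_le_def)
  then have "(bruhat_step k)\<^sup>*\<^sup>* (cyc_conj (min_elem k x)) (cyc_conj (min_elem k z))"
    by (induction rule: rtranclp_induct) (auto intro: bruhat_step_cyc_conj rtranclp.rtrancl_into_rtrancl)
  then show ?thesis using assms cyc_orbit
    by (auto simp: vec_le_def bruhat_le_def cyc_min_elem)
qed

end

section \<open>Existence and uniqueness of the polynomials\<close>

subsection \<open>Eigenvalues\<close>

definition eigval :: "nat \<Rightarrow> expo \<Rightarrow> nat \<Rightarrow> ratfun" where
  "eigval k \<mu> i = q_par ^ lookup \<mu> i * t_par ^ u_stat k \<mu> i"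

lemma eigval_eq_iff: "eigval k \<mu> i = eigval l \<nu> j \<longleftrightarrow> lookup \<mu> i = lookup \<nu> j \<and> u_stat k \<mu> i = u_stat l \<nu> j"
  unfolding eigval_def using q_t_monomial_inj by auto

lemma eigval_neq_0 [simp]: "eigval k \<mu> i \<noteq> 0"
  by (simp add: eigval_def)

text \<open>If the positions are ordered by decreasing entries, and equal entries from right to left,
  the exponent of t in the eigenvalue at j is the place of j in this order. This makes its
  behaviour under permutations and rotations of the entries visible.\<close>

definition rank_set :: "nat \<Rightarrow> expo \<Rightarrow> nat \<Rightarrow> nat set" where
  "rank_set k \<mu> j = {l \<in> {1..k}. lookup \<mu> l > lookup \<mu> j \<or> lookup \<mu> l = lookup \<mu> j \<and> l \<ge> j}"

lemma u_stat_eq: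
  assumes "1 \<le> j" "j \<le> k" shows "u_stat k \<mu> j = card (rank_set k \<mu> j)"
proof -
  let ?A = "{l. 1 \<le> l \<and> l \<le> j \<and> lookup \<mu> l > lookup \<mu> j}"
  let ?B = "{l. j \<le> l \<and> l \<le> k \<and> lookup \<mu> l \<ge> lookup \<mu> j}"
  have "rank_set k \<mu> j = ?A \<union> ?B" using assms by (auto simp: rank_set_def)
  moreover have "?A \<inter> ?B = {}" by auto
  moreover have "finite ?A" by (rule finite_subset[of _ "{1..j}"]) auto
  moreover have "finite ?B" by (rule finite_subset[of _ "{1..k}"]) (use assms in auto)
  ultimately show ?thesis unfolding u_stat_def by (simp add: card_Un_disjoint)
qed

lemma transpose_in: "1 \<le> i \<Longrightarrow> i < k \<Longrightarrow> transpose i (Suc i) j \<in> {1..k} \<longleftrightarrow> j \<in> {1..k}"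
  by (auto simp: transpose_def)

lemma u_stat_swap:
  assumes i: "1 \<le> i" "i < k" and ne: "lookup \<mu> i \<noteq> lookup \<mu> (Suc i)" and j: "j \<in> {1..k}"
  shows "u_stat k (swap_expo i \<mu>) j = u_stat k \<mu> (transpose i (Suc i) j)"
proof -
  let ?\<tau> = "transpose i (Suc i)"
  have "?\<tau> ` rank_set k (swap_expo i \<mu>) j = rank_set k \<mu> (?\<tau> j)"
  proof (intro equalityI subsetI)
    fix l assume "l \<in> ?\<tau> ` rank_set k (swap_expo i \<mu>) j"
    then obtain l' where l': "l' \<in> rank_set k (swap_expo i \<mu>) j" "l = ?\<tau> l'" by blast
    then have "l \<in> {1..k}" using transpose_in[OF i] by (simp add: rank_set_def)
    moreover have "lookup \<mu> (?\<tau> l') = lookup \<mu> (?\<tau> j) \<Longrightarrow> l' \<ge> j \<Longrightarrow> ?\<tau> l' \<ge> ?\<tau> j"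
      using ne by (auto simp: transpose_def split: if_splits)
    ultimately show "l \<in> rank_set k \<mu> (?\<tau> j)" using l' by (auto simp: rank_set_def lookup_swap_expo)
  next
    fix l assume l: "l \<in> rank_set k \<mu> (?\<tau> j)"
    then have "?\<tau> l \<in> {1..k}" using transpose_in[OF i] by (simp add: rank_set_def)
    moreover have "lookup \<mu> l = lookup \<mu> (?\<tau> j) \<Longrightarrow> l \<ge> ?\<tau> j \<Longrightarrow> ?\<tau> l \<ge> j"
      using ne by (auto simp: transpose_def split: if_splits)
    ultimately have "?\<tau> l \<in> rank_set k (swap_expo i \<mu>) j" using l by (auto simp: rank_set_def lookup_swap_expo)
    then show "l \<in> ?\<tau> ` rank_set k (swap_expo i \<mu>) j" by (metis imageI transpose_involutory)
  qed
  moreover have "inj_on ?\<tau> A" for A by (rule inj_on_inverseI[where g = ?\<tau>]) simp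
  ultimately have "card (rank_set k (swap_expo i \<mu>) j) = card (rank_set k \<mu> (?\<tau> j))" by (metis card_image)
  then show ?thesis using j transpose_in[OF i, of j] by (simp add: u_stat_eq)
qed

lemma eigval_swap:
  assumes "1 \<le> i" "i < k" "lookup \<mu> i \<noteq> lookup \<mu> (Suc i)" "j \<in> {1..k}"
  shows "eigval k (swap_expo i \<mu>) j = eigval k \<mu> (transpose i (Suc i) j)"
  using u_stat_swap[OF assms] by (simp add: eigval_def lookup_swap_expo)

lemma eigval_equal_entries:
  assumes "1 \<le> i" "i < k" "lookup \<mu> i = lookup \<mu> (Suc i)"
  shows "eigval k \<mu> i = t_par * eigval k \<mu> (Suc i)"
proof -
  have "rank_set k \<mu> i = insert i (rank_set k \<mu> (Suc i))"
    using assms by (auto simp: rank_set_def)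
  moreover have "i \<notin> rank_set k \<mu> (Suc i)" "finite (rank_set k \<mu> (Suc i))"
    using assms by (auto simp: rank_set_def)
  ultimately have "u_stat k \<mu> i = Suc (u_stat k \<mu> (Suc i))" using assms by (simp add: u_stat_eq)
  then show ?thesis using assms by (simp add: eigval_def)
qed

definition cyc_expo :: "nat \<Rightarrow> expo \<Rightarrow> expo" where
  "cyc_expo k \<mu> = Abs_poly_mapping (\<lambda>i. if i = 1 then lookup \<mu> k + 1 else if 2 \<le> i \<and> i \<le> k then lookup \<mu> (i - 1) else 0)"

lemma lookup_cyc_expo:
  assumes "1 \<le> k"
  shows "lookup (cyc_expo k \<mu>) i = (if i = 1 then lookup \<mu> k + 1 else if 2 \<le> i \<and> i \<le> k then lookup \<mu> (i - 1) else 0)"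
proof -
  let ?f = "\<lambda>i. if i = 1 then lookup \<mu> k + 1 else if 2 \<le> i \<and> i \<le> k then lookup \<mu> (i - 1) else 0"
  have "finite {i. ?f i \<noteq> 0}" by (rule finite_subset[of _ "{1..k}"]) (use assms in \<open>auto split: if_splits\<close>)
  then show ?thesis unfolding cyc_expo_def by simp
qed

lemma cyc_expo_in_Lambda: "1 \<le> k \<Longrightarrow> cyc_expo k \<mu> \<in> Lambda k"
  by (auto simp: Lambda_def in_keys_iff lookup_cyc_expo split: if_splits)

lemma u_stat_cyc:
  assumes i: "i \<in> {1..k}"
  shows "u_stat k (cyc_expo k \<mu>) (if i = k then 1 else Suc i) = u_stat k \<mu> i"
proof -
  let ?c = "\<lambda>l. if l = k then 1 else Suc l"
  have k: "1 \<le> k" using i by auto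
  have lk: "lookup (cyc_expo k \<mu>) (?c l) = (if l = k then lookup \<mu> k + 1 else lookup \<mu> l)" if "l \<in> {1..k}" for l
    using that k by (auto simp: lookup_cyc_expo)
  have mem: "?c l \<in> rank_set k (cyc_expo k \<mu>) (?c i) \<longleftrightarrow> l \<in> rank_set k \<mu> i" if l: "l \<in> {1..k}" for l
  proof -
    have r: "?c l \<in> rank_set k (cyc_expo k \<mu>) (?c i) \<longleftrightarrow> ?c l \<in> {1..k} \<and>
      ((if l = k then lookup \<mu> k + 1 else lookup \<mu> l) > (if i = k then lookup \<mu> k + 1 else lookup \<mu> i) \<or>
       (if l = k then lookup \<mu> k + 1 else lookup \<mu> l) = (if i = k then lookup \<mu> k + 1 else lookup \<mu> i) \<and> ?c l \<ge> ?c i)"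
      unfolding rank_set_def mem_Collect_eq lk[OF l] lk[OF i] ..
    show ?thesis unfolding r using l i by (cases "l = k"; cases "i = k") (auto simp: rank_set_def)
  qed
  have "?c ` rank_set k \<mu> i = rank_set k (cyc_expo k \<mu>) (?c i)"
  proof (intro equalityI subsetI)
    fix m assume "m \<in> ?c ` rank_set k \<mu> i"
    then obtain l where l: "l \<in> rank_set k \<mu> i" "m = ?c l" by blast
    then have "l \<in> {1..k}" unfolding rank_set_def by blast
    then show "m \<in> rank_set k (cyc_expo k \<mu>) (?c i)" unfolding l(2) using l(1) by (rule mem[THEN iffD2])
  next
    fix m assume m: "m \<in> rank_set k (cyc_expo k \<mu>) (?c i)"
    define l where "l = (if m = 1 then k else m - 1)"
    have "m \<in> {1..k}" using m unfolding rank_set_def by blast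
    then have l: "l \<in> {1..k}" "m = ?c l" using k by (auto simp: l_def)
    have "l \<in> rank_set k \<mu> i" by (rule mem[THEN iffD1, OF l(1)]) (rule m[unfolded l(2)])
    then show "m \<in> ?c ` rank_set k \<mu> i" unfolding l(2) by (rule imageI)
  qed
  moreover have "inj_on ?c {1..k}"
    by (rule inj_on_inverseI[where g = "\<lambda>m. if m = 1 then k else m - 1"]) simp
  then have "inj_on ?c (rank_set k \<mu> i)" by (rule inj_on_subset) (auto simp: rank_set_def)
  then have "card (?c ` rank_set k \<mu> i) = card (rank_set k \<mu> i)" by (rule card_image)
  ultimately have "card (rank_set k (cyc_expo k \<mu>) (?c i)) = card (rank_set k \<mu> i)" by (simp only:)
  moreover have "1 \<le> ?c i" "?c i \<le> k" "1 \<le> i" "i \<le> k" using i by auto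
  ultimately show ?thesis by (simp only: u_stat_eq)
qed

lemma eigval_cyc:
  assumes "i \<in> {1..k}"
  shows "eigval k (cyc_expo k \<mu>) (if i = k then 1 else Suc i) = (if i = k then q_par else 1) * eigval k \<mu> i"
  using u_stat_cyc[OF assms, of \<mu>] assms by (auto simp: eigval_def lookup_cyc_expo)

subsection \<open>Intertwiners\<close>

lemma Y_op_T_op:
  assumes "1 \<le> i" "i < k"
  shows "Y_op k i (T_op i f) = T_op i (Y_op k (Suc i) f) - pconst (1 - t_par) * Y_op k (Suc i) f"
    and "Y_op k (Suc i) (T_op i f) = T_op i (Y_op k i f) + pconst (1 - t_par) * Y_op k (Suc i) f"
proof -
  have "T_op i (Y_op k i (T_op i f)) = pconst t_par * Y_op k (Suc i) f" by (rule T_Y_T[OF assms])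
  then have "Y_op k i (T_op i f) = T_inv i (pconst t_par * Y_op k (Suc i) f)" by (metis T_inv_T_op)
  then show "Y_op k i (T_op i f) = T_op i (Y_op k (Suc i) f) - pconst (1 - t_par) * Y_op k (Suc i) f"
    by (simp add: T_inv_pconst) (simp add: T_inv_def)
  have "T_op i (Y_op k i (T_op i (T_op i f))) = pconst t_par * Y_op k (Suc i) (T_op i f)" by (rule T_Y_T[OF assms])
  also have "T_op i (Y_op k i (T_op i (T_op i f))) =
      pconst (1 - t_par) * T_op i (Y_op k i (T_op i f)) + pconst t_par * T_op i (Y_op k i f)"
    by (simp add: T_op_quadratic Y_op_add Y_op_pconst T_op_add T_op_pconst)
  also have "T_op i (Y_op k i (T_op i f)) = pconst t_par * Y_op k (Suc i) f" by (rule T_Y_T[OF assms])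
  finally have "pconst t_par * Y_op k (Suc i) (T_op i f) =
      pconst t_par * (T_op i (Y_op k i f) + pconst (1 - t_par) * Y_op k (Suc i) f)"
    by (simp add: algebra_simps)
  then show "Y_op k (Suc i) (T_op i f) = T_op i (Y_op k i f) + pconst (1 - t_par) * Y_op k (Suc i) f" by simp
qed

text \<open>For the constant c the operator \<open>T\<^sub>i + c\<close> exchanges the eigenvalues at i and i+1. Both
  values of c that occur later solve the same equation: the quotient that defines the
  intertwiner, and -1 if the eigenvalues differ by the factor t.\<close>

lemma intertwiner_eigen:
  assumes i: "1 \<le> i" "i < k" and j: "j \<in> {1..k}"
    and E: "\<And>j. j \<in> {1..k} \<Longrightarrow> Y_op k j E = pconst (y j) * E"
    and c: "c * (y i - y (Suc i)) = (1 - t_par) * y (Suc i)"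
  shows "Y_op k j (T_op i E + pconst c * E) = pconst (y (transpose i (Suc i) j)) * (T_op i E + pconst c * E)"
proof -
  have c': "pconst c * pconst (y i) = pconst ((1 - t_par) * y (Suc i)) + pconst c * pconst (y (Suc i))"
  proof -
    have "c * y i = (1 - t_par) * y (Suc i) + c * y (Suc i)" using c by (simp add: algebra_simps)
    then show ?thesis by (simp only: pconst_mult[symmetric] pconst_add[symmetric])
  qed
  consider "j = i" | "j = Suc i" | "j \<noteq> i" "j \<noteq> Suc i" by blast
  then show ?thesis
  proof cases
    case 1
    have "Y_op k i (T_op i E + pconst c * E) =
      pconst (y (Suc i)) * T_op i E - pconst ((1 - t_par) * y (Suc i)) * E + (pconst c * pconst (y i)) * E"
      using i by (simp add: Y_op_add Y_op_pconst Y_op_T_op E T_op_pconst pconst_mult mult.assoc)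
    also have "\<dots> = pconst (y (Suc i)) * (T_op i E + pconst c * E)"
      unfolding c' by (simp add: algebra_simps)
    finally show ?thesis using 1 by simp
  next
    case 2
    have "Y_op k (Suc i) (T_op i E + pconst c * E) =
      pconst (y i) * T_op i E + (pconst ((1 - t_par) * y (Suc i)) + pconst c * pconst (y (Suc i))) * E"
      using i by (simp add: Y_op_add Y_op_pconst Y_op_T_op E T_op_pconst pconst_mult mult.assoc distrib_right)
    also have "\<dots> = pconst (y i) * (T_op i E + pconst c * E)"
      unfolding c'[symmetric] by (simp add: algebra_simps)
    finally show ?thesis using 2 by simp
  next
    case 3
    have "Y_op k j (T_op i E) = T_op i (Y_op k j E)"
      using T_Y_commute[of j k i E] i j 3 by simp
    then show ?thesis using 3 E[OF j]
      by (simp add: Y_op_add Y_op_pconst T_op_pconst distrib_left mult.left_commute)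
  qed
qed

subsection \<open>The defining properties\<close>

definition vec_of :: "expo \<Rightarrow> vec" where
  "vec_of \<mu> i = int (lookup \<mu> i)"

lemma vec_of_inject [simp]: "vec_of \<mu> = vec_of \<nu> \<longleftrightarrow> \<mu> = \<nu>"
  by (auto simp: vec_of_def fun_eq_iff intro: poly_mapping_eqI)

definition expo_le :: "nat \<Rightarrow> expo \<Rightarrow> expo \<Rightarrow> bool" where
  "expo_le k \<mu> \<nu> \<longleftrightarrow> vec_le k (vec_of \<mu>) (vec_of \<nu>)"

lemma expo_less_iff: "expo_less k \<mu> \<nu> \<longleftrightarrow> \<mu> \<noteq> \<nu> \<and> expo_le k \<mu> \<nu>"
  by (simp add: expo_less_def expo_le_def vec_of_def[abs_def])

definition rank_of :: "nat \<Rightarrow> expo \<Rightarrow> nat" where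
  "rank_of k \<mu> = card (Neg k (vec_of \<mu>))"

text \<open>The leading coefficient and the support are separated, since an operator acts on them by
  different arguments.\<close>

definition is_macdonald :: "nat \<Rightarrow> expo \<Rightarrow> pol \<Rightarrow> bool" where
  "is_macdonald k \<mu> E \<longleftrightarrow> E \<in> Pol k \<and> lookup E \<mu> = 1 \<and> (\<forall>\<nu>\<in>keys E. expo_le k \<nu> \<mu>) \<and>
     (\<forall>i\<in>{1..k}. Y_op k i E = pconst (eigval k \<mu> i) * E)"

lemma aff_s_vec_of: "1 \<le> i \<Longrightarrow> aff_s k i (vec_of \<mu>) = vec_of (swap_expo i \<mu>)"
  by (auto simp: aff_s_def vec_of_def fun_eq_iff lookup_swap_expo)

lemma cyc_vec_of: "2 \<le> k \<Longrightarrow> \<mu> \<in> Lambda k \<Longrightarrow> vec_of (cyc_expo k \<mu>) = cyc k (vec_of \<mu>)"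
  by (auto simp: vec_of_def fun_eq_iff lookup_cyc_expo cyc_def Lambda_lookup_0)

context
  fixes k :: nat
  assumes k2: "2 \<le> k"
begin

lemma expo_le_refl [simp]: "expo_le k \<mu> \<mu>"
  by (simp add: expo_le_def vec_le_refl[OF k2])
lemma expo_le_trans: "expo_le k \<mu> \<nu> \<Longrightarrow> expo_le k \<nu> \<kappa> \<Longrightarrow> expo_le k \<mu> \<kappa>"
  unfolding expo_le_def by (rule vec_le_trans[OF k2])
lemma expo_le_rank: "expo_le k \<mu> \<nu> \<Longrightarrow> \<mu> \<noteq> \<nu> \<Longrightarrow> rank_of k \<mu> < rank_of k \<nu>"
  using vec_le_rank[OF k2, of "vec_of \<mu>" "vec_of \<nu>"] by (auto simp: expo_le_def rank_of_def)
lemma expo_le_antisym: "expo_le k \<mu> \<nu> \<Longrightarrow> expo_le k \<nu> \<mu> \<Longrightarrow> \<mu> = \<nu>"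
  by (metis expo_le_rank less_asym)

lemma expo_le_swap:
  assumes "1 \<le> i" "i < k" "lookup \<mu> (Suc i) < lookup \<mu> i"
  shows "expo_le k \<mu> (swap_expo i \<mu>)"
    and "expo_le k \<nu> \<mu> \<Longrightarrow> expo_le k (swap_expo i \<nu>) (swap_expo i \<mu>)"
proof -
  have "sroot k i (vec_of \<mu>) > 0" using assms by (simp add: sroot_def root_fun_def vec_of_def)
  then show "expo_le k \<mu> (swap_expo i \<mu>)"
    "expo_le k \<nu> \<mu> \<Longrightarrow> expo_le k (swap_expo i \<nu>) (swap_expo i \<mu>)"
    using vec_le_gen[OF k2 assms(2), of "vec_of \<mu>"] vec_le_lift[OF k2 _ assms(2), of "vec_of \<nu>" "vec_of \<mu>"]
      aff_s_vec_of[OF assms(1)] by (simp_all add: expo_le_def)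
qed

lemma expo_le_string_aux:
  assumes i: "1 \<le> i" "i < k" and le: "lookup x i \<le> lookup x (Suc i)" and s: "\<kappa> \<in> expo_string i x"
  shows "expo_le k \<kappa> x"
proof -
  define c where "c = int (lookup x (Suc i)) - int (lookup \<kappa> i)"
  have *: "int (lookup x i) \<le> int (lookup \<kappa> i)" "int (lookup \<kappa> i) \<le> int (lookup x (Suc i))"
    "int (lookup \<kappa> i) + int (lookup \<kappa> (Suc i)) = int (lookup x i) + int (lookup x (Suc i))"
    using s le by (auto simp: expo_string_def)
  have "reflect i (Suc i) c (vec_of x) = vec_of \<kappa>"
    using s * by (auto simp: fun_eq_iff reflect_def vec_of_def c_def expo_string_def)
  moreover have "vec_le k (reflect i (Suc i) c (vec_of x)) (vec_of x)"
  proof (rule vec_le_reflect_root[OF k2])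
    show "0 < ht k (root_fun i (Suc i) c)"
      using i * by (subst root_pos_iff) (auto simp: c_def)
    show "root_fun i (Suc i) c (vec_of x) \<le> 0" using * by (simp add: root_fun_def vec_of_def c_def)
  qed (use i in auto)
  ultimately show ?thesis by (simp add: expo_le_def)
qed

text \<open>An exponent on the segment arises from its larger endpoint by the reflection in an affine
  root of the form \<open>x\<^sub>i - x\<^sub>i\<^sub>+\<^sub>1 + c\<close> that is positive and takes a value at most 0 there.\<close>

lemma expo_le_string:
  assumes i: "1 \<le> i" "i < k" and s: "\<kappa> \<in> expo_string i \<nu>"
  shows "expo_le k \<kappa> \<nu> \<or> expo_le k \<kappa> (swap_expo i \<nu>)"
proof (cases "lookup \<nu> i \<le> lookup \<nu> (Suc i)")
  case True
  then show ?thesis using expo_le_string_aux[OF i _ s] by blast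
next
  case False
  have "\<kappa> \<in> expo_string i (swap_expo i \<nu>)"
    using s by (auto simp: expo_string_def lookup_swap_expo transpose_def)
  then show ?thesis using expo_le_string_aux[OF i, of "swap_expo i \<nu>"] False by (auto simp: lookup_swap_expo)
qed

lemma is_macdonald_iff:
  "is_macdonald k \<mu> E \<longleftrightarrow> E \<in> Pol k \<and> (\<forall>\<nu>\<in>keys (E - xmon \<mu>). expo_less k \<nu> \<mu>) \<and>
     (\<forall>i\<in>{1..k}. Y_op k i E = pconst (eigval k \<mu> i) * E)"
proof -
  have l: "lookup (E - xmon \<mu>) \<nu> = (if \<nu> = \<mu> then lookup E \<mu> - 1 else lookup E \<nu>)" for \<nu>
    by (auto simp: lookup_minus lookup_xmon)
  have "(\<forall>\<nu>\<in>keys (E - xmon \<mu>). expo_less k \<nu> \<mu>) \<longleftrightarrow> lookup E \<mu> = 1 \<and> (\<forall>\<nu>\<in>keys E. expo_le k \<nu> \<mu>)"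
  proof (intro iffI conjI ballI)
    assume a: "\<forall>\<nu>\<in>keys (E - xmon \<mu>). expo_less k \<nu> \<mu>"
    then have "\<mu> \<notin> keys (E - xmon \<mu>)" by (auto simp: expo_less_iff)
    then show "lookup E \<mu> = 1" by (simp add: in_keys_iff l)
    fix \<nu> assume "\<nu> \<in> keys E"
    then have "\<nu> = \<mu> \<or> \<nu> \<in> keys (E - xmon \<mu>)" by (simp add: in_keys_iff l)
    then show "expo_le k \<nu> \<mu>" using a by (auto simp: expo_less_iff)
  next
    fix \<nu> assume a: "lookup E \<mu> = 1 \<and> (\<forall>\<nu>\<in>keys E. expo_le k \<nu> \<mu>)" "\<nu> \<in> keys (E - xmon \<mu>)"
    then have "\<nu> \<noteq> \<mu>" "\<nu> \<in> keys E" by (auto simp: in_keys_iff l split: if_splits)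
    then show "expo_less k \<nu> \<mu>" using a(1) by (simp add: expo_less_iff)
  qed
  then show ?thesis unfolding is_macdonald_def by blast
qed

lemma is_macdonald_zero: "is_macdonald k 0 1"
proof -
  have T1: "T_op j 1 = 1" for j by (simp add: T_op_fix_iff)
  have "Y_op k i 1 = pconst (eigval k 0 i) * 1" if "i \<in> {1..k}" for i
  proof -
    have "rank_set k 0 i = {i..k}" using that by (auto simp: rank_set_def)
    then have "u_stat k 0 i = k + 1 - i" using that by (simp add: u_stat_eq)
    then show ?thesis using T1
      by (simp add: Y_op_eq T_dn_fix T_up_fix omega_inv_simps eigval_def)
  qed
  moreover have "keys (1::pol) = {0}" by simp
  ultimately show ?thesis by (simp add: is_macdonald_def lookup_one)
qed

text \<open>The lifting property places the transpositions of all exponents of E below the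
  transposition of \<open>\<mu>\<close>, hence also the segments between them; only the segment of \<open>\<mu>\<close> reaches
  the top.\<close>

lemma is_macdonald_swap:
  assumes E: "is_macdonald k \<mu> E" and i: "1 \<le> i" "i < k" and lt: "lookup \<mu> (Suc i) < lookup \<mu> i"
    and c: "c * (eigval k \<mu> i - eigval k \<mu> (Suc i)) = (1 - t_par) * eigval k \<mu> (Suc i)"
  shows "is_macdonald k (swap_expo i \<mu>) (T_op i E + pconst c * E)"
proof -
  let ?F = "T_op i E + pconst c * E" and ?s = "swap_expo i \<mu>"
  have EP: "E \<in> Pol k" and E1: "lookup E \<mu> = 1" and Ele: "\<And>\<nu>. \<nu> \<in> keys E \<Longrightarrow> expo_le k \<nu> \<mu>"
    using E by (auto simp: is_macdonald_def)
  have s: "expo_le k \<mu> ?s" using expo_le_swap(1)[OF i lt] .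
  have ne: "?s \<noteq> \<mu>"
  proof
    assume "?s = \<mu>"
    then have "lookup ?s i = lookup \<mu> i" by simp
    then show False using lt by (simp add: lookup_swap_expo)
  qed
  have ns: "\<not> expo_le k ?s \<nu>" if "\<nu> \<in> keys E" for \<nu>
    using expo_le_trans Ele[OF that] expo_le_antisym[OF _ s] ne by blast
  have F: "?F \<in> Pol k" using EP i by (intro Pol_add Pol_mult T_op_in_Pol) auto
  have le: "expo_le k \<kappa> ?s" if "\<kappa> \<in> keys ?F" for \<kappa>
  proof -
    have "\<kappa> \<in> keys (T_op i E) \<or> \<kappa> \<in> keys E"
      using that keys_add[of "T_op i E" "pconst c * E"] keys_pconst_mult[of c E] by auto
    then show ?thesis
    proof
      assume "\<kappa> \<in> keys E"
      then show ?thesis using Ele s expo_le_trans by blast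
    next
      assume "\<kappa> \<in> keys (T_op i E)"
      then obtain \<nu> where \<nu>: "\<nu> \<in> keys E" "\<kappa> \<in> expo_string i \<nu>" using keys_T_op by blast
      have "expo_le k \<nu> ?s" "expo_le k (swap_expo i \<nu>) ?s"
        using Ele[OF \<nu>(1)] s expo_le_trans expo_le_swap(2)[OF i lt] by blast+
      then show ?thesis using expo_le_string[OF i \<nu>(2)] expo_le_trans by blast
    qed
  qed
  have "?s \<notin> keys E" using ns by (metis expo_le_refl)
  then have E0: "lookup E ?s = 0" by (simp add: in_keys_iff)
  have "lookup (T_op i E) ?s = (\<Sum>\<nu>\<in>keys E. lookup E \<nu> * lookup (T_op i (xmon \<nu>)) ?s)"
    by (rule lookup_T_op)
  also have "\<dots> = (\<Sum>\<nu>\<in>keys E. if \<nu> = \<mu> then 1 else 0)"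
  proof (rule sum.cong)
    fix \<nu> assume \<nu>: "\<nu> \<in> keys E"
    show "lookup E \<nu> * lookup (T_op i (xmon \<nu>)) ?s = (if \<nu> = \<mu> then 1 else 0)"
    proof (cases "\<nu> = \<mu>")
      case True
      then show ?thesis using E1 lookup_T_op_xmon_swap[OF lt] by simp
    next
      case False
      have "?s \<notin> expo_string i \<nu>"
      proof
        assume "?s \<in> expo_string i \<nu>"
        then have "expo_le k ?s (swap_expo i \<nu>)" using expo_le_string[OF i] ns[OF \<nu>] by blast
        moreover have "expo_le k (swap_expo i \<nu>) ?s" using expo_le_swap(2)[OF i lt] Ele[OF \<nu>] by blast
        ultimately have "?s = swap_expo i \<nu>" by (rule expo_le_antisym)
        then show False using False swap_expo_swap_expo by metis
      qed
      then have "?s \<notin> keys (T_op i (xmon \<nu>))" using keys_T_op_xmon by blast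
      then show ?thesis using False by (simp add: in_keys_iff)
    qed
  qed simp
  also have "\<dots> = 1" using E1 by (simp add: in_keys_iff)
  finally have F1: "lookup ?F ?s = 1" using E0 by (simp add: lookup_add lookup_pconst_mult)
  have "Y_op k j ?F = pconst (eigval k ?s j) * ?F" if "j \<in> {1..k}" for j
  proof -
    have "Y_op k j ?F = pconst (eigval k \<mu> (transpose i (Suc i) j)) * ?F"
      using E c by (intro intertwiner_eigen[OF i that]) (auto simp: is_macdonald_def)
    then show ?thesis using eigval_swap[OF i _ that, of \<mu>] lt by simp
  qed
  then show ?thesis using F F1 le by (simp add: is_macdonald_def)
qed

lemma Phi_xmon:
  assumes "\<nu> \<in> Lambda k"
  shows "Phi k (xmon \<nu>) = pconst (q_par ^ lookup \<nu> k) * xmon (cyc_expo k \<nu>)"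
proof -
  let ?\<sigma> = "\<lambda>j. if j = k then pconst q_par * var 1 else var (Suc j)"
  let ?P = "\<Prod>i\<in>{1..<k}. var (Suc i) ^ lookup \<nu> i"
  have k: "{1..k} = insert k {1..<k}" "{1..k} = insert 1 (Suc ` {1..<k})"
    using k2 by (auto simp: image_Suc_atLeastLessThan)
  have "omega_inv k (xmon \<nu>) = mon_val ?\<sigma> \<nu>"
    by (simp add: omega_inv_def xmon_def psubst_single)
  also have "\<dots> = (\<Prod>i\<in>{1..k}. ?\<sigma> i ^ lookup \<nu> i)"
    using assms by (intro mon_val_superset) (auto simp: Lambda_def)
  also have "\<dots> = (pconst q_par * var 1) ^ lookup \<nu> k * (\<Prod>i\<in>{1..<k}. ?\<sigma> i ^ lookup \<nu> i)"
    unfolding k(1) by (subst prod.insert) auto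
  also have "(\<Prod>i\<in>{1..<k}. ?\<sigma> i ^ lookup \<nu> i) = ?P" by (rule prod.cong) auto
  finally have 1: "Phi k (xmon \<nu>) = pconst (q_par ^ lookup \<nu> k) * (var 1 * var 1 ^ lookup \<nu> k * ?P)"
    by (simp add: Phi_def power_mult_distrib pconst_power mult_ac)
  have "xmon (cyc_expo k \<nu>) = (\<Prod>i\<in>{1..k}. var i ^ lookup (cyc_expo k \<nu>) i)"
    using cyc_expo_in_Lambda[of k \<nu>] k2 unfolding mon_val_var[symmetric]
    by (intro mon_val_superset) (auto simp: Lambda_def)
  also have "\<dots> = var 1 ^ lookup (cyc_expo k \<nu>) 1 * (\<Prod>i\<in>Suc ` {1..<k}. var i ^ lookup (cyc_expo k \<nu>) i)"
    unfolding k(2) by (subst prod.insert) auto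
  also have "(\<Prod>i\<in>Suc ` {1..<k}. var i ^ lookup (cyc_expo k \<nu>) i) = ?P"
    using k2 by (subst prod.reindex) (auto intro!: prod.cong simp: lookup_cyc_expo)
  finally show ?thesis using 1 k2 by (simp add: lookup_cyc_expo)
qed

lemma cyc_expo_inject: "\<mu> \<in> Lambda k \<Longrightarrow> \<nu> \<in> Lambda k \<Longrightarrow> cyc_expo k \<mu> = cyc_expo k \<nu> \<Longrightarrow> \<mu> = \<nu>"
  using cyc_vec_of[OF k2] cyc_cyc_inv(2)[OF k2] by (metis vec_of_inject)

lemma Phi_add: "Phi k (f + g) = Phi k f + Phi k g"
  by (simp add: Phi_def omega_inv_simps distrib_left)

text \<open>The raising operator sends monomials to multiples of monomials, so the support is rotated,
  and the rotation preserves the order.\<close>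

lemma is_macdonald_cyc:
  assumes E: "is_macdonald k \<mu> E" and \<mu>: "\<mu> \<in> Lambda k"
  shows "is_macdonald k (cyc_expo k \<mu>) (pconst (inverse q_par ^ lookup \<mu> k) * Phi k E)"
proof -
  let ?F = "pconst (inverse q_par ^ lookup \<mu> k) * Phi k E" and ?s = "cyc_expo k \<mu>"
  have EP: "E \<in> Pol k" and E1: "lookup E \<mu> = 1" and Ele: "\<And>\<nu>. \<nu> \<in> keys E \<Longrightarrow> expo_le k \<nu> \<mu>"
    and EY: "\<And>i. i \<in> {1..k} \<Longrightarrow> Y_op k i E = pconst (eigval k \<mu> i) * E"
    using E by (auto simp: is_macdonald_def)
  have L: "\<nu> \<in> Lambda k" if "\<nu> \<in> keys E" for \<nu> using EP that by (auto simp: Pol_def)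
  have PE: "Phi k E = (\<Sum>\<nu>\<in>keys E. pconst (lookup E \<nu>) * Phi k (xmon \<nu>))"
    by (rule linear_eq_sum[of "Phi k"]) (rule Phi_add, rule Phi_pconst)
  have l: "lookup (Phi k E) \<kappa> = (\<Sum>\<nu>\<in>keys E. lookup E \<nu> * (q_par ^ lookup \<nu> k * (if cyc_expo k \<nu> = \<kappa> then 1 else 0)))" for \<kappa>
    unfolding PE lookup_sum by (rule sum.cong) (simp_all add: Phi_xmon L lookup_pconst_mult lookup_xmon)
  have le: "expo_le k \<kappa> ?s" if "\<kappa> \<in> keys ?F" for \<kappa>
  proof -
    have "lookup (Phi k E) \<kappa> \<noteq> 0" using that by (simp add: in_keys_iff lookup_pconst_mult)
    then obtain \<nu> where "\<nu> \<in> keys E"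
      "lookup E \<nu> * (q_par ^ lookup \<nu> k * (if cyc_expo k \<nu> = \<kappa> then 1 else 0)) \<noteq> 0"
      unfolding l by (meson sum.not_neutral_contains_not_neutral)
    then have \<nu>: "\<nu> \<in> keys E" "cyc_expo k \<nu> = \<kappa>" by (auto split: if_splits)
    show ?thesis unfolding \<nu>(2)[symmetric] expo_le_def cyc_vec_of[OF k2 L[OF \<nu>(1)]] cyc_vec_of[OF k2 \<mu>]
      using Ele[OF \<nu>(1)] by (intro vec_le_cyc[OF k2]) (simp add: expo_le_def)
  qed
  have "lookup (Phi k E) ?s = (\<Sum>\<nu>\<in>keys E. if \<nu> = \<mu> then q_par ^ lookup \<mu> k else 0)"
    unfolding l using E1 cyc_expo_inject[OF L \<mu>] by (intro sum.cong) auto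
  also have "\<dots> = q_par ^ lookup \<mu> k" using E1 by (simp add: in_keys_iff)
  finally have F1: "lookup ?F ?s = 1" by (simp add: lookup_pconst_mult power_inverse)
  have Y: "Y_op k (if i = k then 1 else Suc i) ?F = pconst (eigval k ?s (if i = k then 1 else Suc i)) * ?F"
    if "i \<in> {1..k}" for i
  proof (cases "i = k")
    case True
    have "Y_op k 1 (Phi k E) = pconst q_par * (pconst (eigval k \<mu> k) * Phi k E)"
      using Y_Phi_last[of k E] EY[of k] k2 by (simp add: Phi_pconst)
    then show ?thesis using True eigval_cyc[OF that, of \<mu>]
      by (simp add: Y_op_pconst pconst_mult mult.assoc mult.left_commute)
  next
    case False
    have "Y_op k (Suc i) (Phi k E) = pconst (eigval k \<mu> i) * Phi k E"
      using Y_Phi[OF EP, of i] EY[OF that] that False by (simp add: Phi_pconst)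
    then show ?thesis using False eigval_cyc[OF that, of \<mu>]
      by (simp add: Y_op_pconst mult.left_commute)
  qed
  have "Y_op k j ?F = pconst (eigval k ?s j) * ?F" if "j \<in> {1..k}" for j
  proof -
    have "\<exists>i\<in>{1..k}. (if i = k then 1 else Suc i) = j"
      using that k2 by (cases "j = 1") (auto intro!: bexI[of _ "j - 1"])
    then show ?thesis using Y by force
  qed
  moreover have "?F \<in> Pol k" using EP k2 by (intro Pol_mult Phi_in_Pol) auto
  ultimately show ?thesis using F1 le by (simp add: is_macdonald_def)
qed

end

subsection \<open>An induction principle for compositions\<close>

definition weight :: "nat \<Rightarrow> expo \<Rightarrow> nat" where
  "weight k \<mu> = (\<Sum>i=1..k. lookup \<mu> i)"
definition moment :: "nat \<Rightarrow> expo \<Rightarrow> nat" where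
  "moment k \<mu> = (\<Sum>i=1..k. i * lookup \<mu> i)"

lemma weight_Lambda:
  assumes "\<mu> \<in> Lambda k" "\<mu> \<in> Lambda l" shows "weight k \<mu> = weight l \<mu>"
proof -
  have "weight n \<mu> = (\<Sum>i\<in>keys \<mu>. lookup \<mu> i)" if "\<mu> \<in> Lambda n" for n
    unfolding weight_def using that by (intro sum.mono_neutral_right) (auto simp: Lambda_def in_keys_iff)
  then show ?thesis using assms by simp
qed

lemma swap_expo_in_Lambda: "1 \<le> i \<Longrightarrow> i < k \<Longrightarrow> \<mu> \<in> Lambda k \<Longrightarrow> swap_expo i \<mu> \<in> Lambda k"
  unfolding Lambda_def in_keys_iff subset_iff mem_Collect_eq lookup_swap_expo
  using transpose_in[of i k] by metis

lemma cyc_expo_obtain: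
  assumes "\<mu> \<in> Lambda k" "lookup \<mu> 1 > 0"
  obtains \<nu> where "\<nu> \<in> Lambda k" "cyc_expo k \<nu> = \<mu>" "weight k \<mu> = Suc (weight k \<nu>)"
proof -
  have k: "1 \<le> k" using assms by (auto simp: Lambda_def subset_iff in_keys_iff)
  let ?f = "\<lambda>i. if i = k then lookup \<mu> 1 - 1 else if 1 \<le> i \<and> i < k then lookup \<mu> (Suc i) else 0"
  define \<nu> where "\<nu> = Abs_poly_mapping ?f"
  have "finite {i. ?f i \<noteq> 0}" by (rule finite_subset[of _ "{1..k}"]) (use k in \<open>auto split: if_splits\<close>)
  then have l: "lookup \<nu> i = ?f i" for i unfolding \<nu>_def by simp
  have "\<nu> \<in> Lambda k" using k by (auto simp: Lambda_def in_keys_iff l split: if_splits)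
  moreover have "cyc_expo k \<nu> = \<mu>"
  proof (rule poly_mapping_eqI)
    fix i
    consider "i = 0 \<or> k < i" "i \<noteq> 1" | "i = 1" | "2 \<le> i" "i \<le> k" using k by linarith
    then show "lookup (cyc_expo k \<nu>) i = lookup \<mu> i"
    proof cases
      case 1
      then show ?thesis using Lambda_lookup_0[OF assms(1) 1(1)] by (auto simp: lookup_cyc_expo[OF k])
    next
      case 2
      then show ?thesis using assms(2) by (simp add: lookup_cyc_expo[OF k] l)
    next
      case 3
      then have "i - 1 \<noteq> k" "1 \<le> i - 1" "i - 1 < k" "Suc (i - 1) = i" by auto
      then show ?thesis using 3 by (simp add: lookup_cyc_expo[OF k] l)
    qed
  qed
  moreover have "weight k \<mu> = Suc (weight k \<nu>)"
  proof -
    have k': "{1..k} = insert k {1..<k}" "{1..k} = insert 1 (Suc ` {1..<k})"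
      using k by (auto simp: image_Suc_atLeastLessThan)
    have "weight k \<nu> = (lookup \<mu> 1 - 1) + (\<Sum>i\<in>{1..<k}. lookup \<mu> (Suc i))"
      unfolding weight_def k'(1) by (subst sum.insert) (auto simp: l intro!: sum.cong)
    moreover have "weight k \<mu> = lookup \<mu> 1 + (\<Sum>i\<in>{1..<k}. lookup \<mu> (Suc i))"
    proof -
      have "(\<Sum>i\<in>insert 1 (Suc ` {1..<k}). lookup \<mu> i) = lookup \<mu> 1 + (\<Sum>i\<in>Suc ` {1..<k}. lookup \<mu> i)"
        by (rule sum.insert) auto
      also have "(\<Sum>i\<in>Suc ` {1..<k}. lookup \<mu> i) = (\<Sum>i\<in>{1..<k}. lookup \<mu> (Suc i))"
        by (subst sum.reindex) (simp_all only: inj_Suc comp_def)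
      finally show ?thesis unfolding weight_def k'(2) .
    qed
    ultimately show ?thesis using assms(2) by simp
  qed
  ultimately show ?thesis using that by blast
qed

text \<open>Induction on the sum of the entries and then on the sum of their positions, weighted by
  the entries. A composition that starts with a positive entry is the rotation of one of smaller
  sum; otherwise its first positive entry can be moved to the left. The hypothesis of the
  rotation case admits every number of entries, because a composition that ends with zeros has
  to be regarded as a shorter one there.\<close>

lemma Lambda_build_induct [consumes 1, case_names zero swap rotate]:
  assumes "\<mu> \<in> Lambda k"
    and zero: "\<And>k. P k 0"
    and swap: "\<And>k \<mu> i. \<mu> \<in> Lambda k \<Longrightarrow> 1 \<le> i \<Longrightarrow> i < k \<Longrightarrow> lookup \<mu> i > 0 \<Longrightarrow> lookup \<mu> (Suc i) = 0 \<Longrightarrow>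
        P k \<mu> \<Longrightarrow> P k (swap_expo i \<mu>)"
    and rotate: "\<And>k \<mu>. \<mu> \<in> Lambda k \<Longrightarrow> 1 \<le> k \<Longrightarrow> (\<And>l. \<mu> \<in> Lambda l \<Longrightarrow> P l \<mu>) \<Longrightarrow> P k (cyc_expo k \<mu>)"
  shows "P k \<mu>"
  using assms(1)
proof (induction "(k, \<mu>)" arbitrary: k \<mu> rule: wf_induct_rule[OF wf_measures[of "[\<lambda>(k, \<mu>). weight k \<mu>, \<lambda>(k, \<mu>). moment k \<mu>]"]])
  case (1 k \<mu>)
  have IH: "P l \<nu>" if "\<nu> \<in> Lambda l" "weight l \<nu> < weight k \<mu> \<or> weight l \<nu> = weight k \<mu> \<and> moment l \<nu> < moment k \<mu>" for l \<nu>
    using 1(1)[of l \<nu>] that by auto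
  show ?case
  proof (cases "\<mu> = 0")
    case True then show ?thesis using zero by simp
  next
    case False
    then obtain p where "lookup \<mu> p > 0" by (metis gr0I lookup_zero poly_mapping_eqI)
    define n where "n = (LEAST p. lookup \<mu> p > 0)"
    have n: "lookup \<mu> n > 0" unfolding n_def by (rule LeastI) fact
    have less_n: "lookup \<mu> p = 0" if "p < n" for p using not_less_Least[of p "\<lambda>p. lookup \<mu> p > 0"] that by (auto simp: n_def)
    have nk: "1 \<le> n" "n \<le> k" using n 1(2) by (auto simp: Lambda_def subset_iff in_keys_iff)
    show ?thesis
    proof (cases "n = 1")
      case True
      then obtain \<nu> where \<nu>: "\<nu> \<in> Lambda k" "cyc_expo k \<nu> = \<mu>" "weight k \<mu> = Suc (weight k \<nu>)"
        using cyc_expo_obtain[OF 1(2)] n by metis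
      have "P l \<nu>" if "\<nu> \<in> Lambda l" for l
        using \<nu> that weight_Lambda[OF \<nu>(1) that] by (intro IH) auto
      then show ?thesis using rotate[OF \<nu>(1)] \<nu>(2) nk by force
    next
      case False
      define i where "i = n - 1"
      have i: "1 \<le> i" "i < k" "Suc i = n" using False nk by (auto simp: i_def)
      let ?\<nu> = "swap_expo i \<mu>"
      have l: "lookup ?\<nu> i = lookup \<mu> n" "lookup ?\<nu> (Suc i) = 0" "\<And>j. j \<noteq> i \<Longrightarrow> j \<noteq> Suc i \<Longrightarrow> lookup ?\<nu> j = lookup \<mu> j"
        using i less_n[of i] by (auto simp: lookup_swap_expo)
      have k: "{1..k} = insert i (insert (Suc i) ({1..k} - {i, Suc i}))" using i by auto
      have rest: "(\<Sum>j\<in>{1..k} - {i, Suc i}. f j (lookup ?\<nu> j)) = (\<Sum>j\<in>{1..k} - {i, Suc i}. f j (lookup \<mu> j))"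
        for f :: "nat \<Rightarrow> nat \<Rightarrow> nat" by (rule sum.cong) (auto simp: l)
      have split: "(\<Sum>j=1..k. f j) = f i + (f (Suc i) + (\<Sum>j\<in>{1..k} - {i, Suc i}. f j))" for f :: "nat \<Rightarrow> nat"
        by (subst k, subst sum.insert, simp, simp, subst sum.insert) auto
      have "weight k ?\<nu> = weight k \<mu>"
        unfolding weight_def split using rest[of "\<lambda>j x. x"] l i less_n[of i] by simp
      moreover have "moment k ?\<nu> < moment k \<mu>"
        unfolding moment_def split using rest[of "\<lambda>j x. j * x"] l i less_n[of i] n by simp
      moreover have L: "?\<nu> \<in> Lambda k" using swap_expo_in_Lambda[OF i(1,2) 1(2)] .
      ultimately have "P k ?\<nu>" by (intro IH) auto
      then have "P k (swap_expo i ?\<nu>)"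
        by (rule swap[OF L i(1,2), rotated 2]) (use i l n in auto)
      then show ?thesis by simp
    qed
  qed
qed

lemma intertwiner_constant:
  "y \<noteq> z \<Longrightarrow> ((1 - t_par) * z / (y - z)) * (y - z) = (1 - t_par) * z" for y z :: ratfun
  by simp

lemma is_macdonald_exists:
  assumes "\<mu> \<in> Lambda k" "2 \<le> k" shows "\<exists>E. is_macdonald k \<mu> E"
  using assms
proof (induction rule: Lambda_build_induct)
  case (zero k) then show ?case using is_macdonald_zero by blast
next
  case (swap k \<mu> i)
  then obtain E where E: "is_macdonald k \<mu> E" by blast
  have "eigval k \<mu> i \<noteq> eigval k \<mu> (Suc i)" using swap by (simp add: eigval_eq_iff)
  then show ?case
    using is_macdonald_swap[OF swap.prems E swap(2,3) _ intertwiner_constant] swap by auto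
next
  case (rotate k \<mu>)
  then obtain E where E: "is_macdonald k \<mu> E" by blast
  then show ?case using is_macdonald_cyc[OF rotate.prems E rotate(1)] by blast
qed

subsection \<open>Uniqueness\<close>

context
  fixes k :: nat
  assumes k2: "2 \<le> k"
begin

text \<open>Any choice will do: uniqueness is deduced from the fact that these polynomials form a
  basis.\<close>

definition basis :: "expo \<Rightarrow> pol" where
  "basis \<mu> = (SOME E. is_macdonald k \<mu> E)"

lemma basis_props:
  assumes "\<mu> \<in> Lambda k"
  shows "is_macdonald k \<mu> (basis \<mu>)" "lookup (basis \<mu>) \<mu> = 1" "basis \<mu> \<in> Pol k"
    "i \<in> {1..k} \<Longrightarrow> Y_op k i (basis \<mu>) = pconst (eigval k \<mu> i) * basis \<mu>"
proof -
  show *: "is_macdonald k \<mu> (basis \<mu>)"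
    unfolding basis_def using is_macdonald_exists[OF assms k2] by (rule someI_ex)
  then show "lookup (basis \<mu>) \<mu> = 1" "basis \<mu> \<in> Pol k"
    "i \<in> {1..k} \<Longrightarrow> Y_op k i (basis \<mu>) = pconst (eigval k \<mu> i) * basis \<mu>"
    by (auto simp: is_macdonald_def)
qed

lemma basis_lookup_0:
  assumes "\<mu> \<in> Lambda k" "\<nu> \<noteq> \<mu>" "rank_of k \<nu> \<ge> rank_of k \<mu>" shows "lookup (basis \<mu>) \<nu> = 0"
proof (rule ccontr)
  assume "lookup (basis \<mu>) \<nu> \<noteq> 0"
  then have "expo_le k \<nu> \<mu>" using basis_props(1)[OF assms(1)] by (simp add: is_macdonald_def in_keys_iff)
  then show False using expo_le_rank[OF k2] assms by fastforce
qed

definition in_span :: "pol \<Rightarrow> bool" where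
  "in_span D \<longleftrightarrow> (\<exists>S c. finite S \<and> S \<subseteq> Lambda k \<and> D = (\<Sum>\<nu>\<in>S. pconst (c \<nu>) * basis \<nu>))"

lemma in_span_add:
  assumes "in_span D" "in_span F" shows "in_span (D + F)"
proof -
  obtain S c where S: "finite S" "S \<subseteq> Lambda k" "D = (\<Sum>\<nu>\<in>S. pconst (c \<nu>) * basis \<nu>)"
    using assms(1) by (auto simp: in_span_def)
  obtain R d where R: "finite R" "R \<subseteq> Lambda k" "F = (\<Sum>\<nu>\<in>R. pconst (d \<nu>) * basis \<nu>)"
    using assms(2) by (auto simp: in_span_def)
  let ?c = "\<lambda>\<nu>. if \<nu> \<in> S then c \<nu> else 0" and ?d = "\<lambda>\<nu>. if \<nu> \<in> R then d \<nu> else 0"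
  have "D = (\<Sum>\<nu>\<in>S \<union> R. pconst (?c \<nu>) * basis \<nu>)"
    unfolding S(3) using S(1) R(1) by (intro sum.mono_neutral_cong_left) auto
  moreover have "F = (\<Sum>\<nu>\<in>S \<union> R. pconst (?d \<nu>) * basis \<nu>)"
    unfolding R(3) using S(1) R(1) by (intro sum.mono_neutral_cong_left) auto
  ultimately have "D + F = (\<Sum>\<nu>\<in>S \<union> R. pconst (?c \<nu> + ?d \<nu>) * basis \<nu>)"
    by (simp only: pconst_add distrib_right sum.distrib)
  then show ?thesis unfolding in_span_def using S R by (intro exI[of _ "S \<union> R"] exI[of _ "\<lambda>\<nu>. ?c \<nu> + ?d \<nu>"]) auto
qed

text \<open>Triangularity: subtracting the basis elements that belong to the exponents of maximal rank
  lowers the rank.\<close>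

lemma basis_spans:
  assumes "D \<in> Pol k" shows "in_span D"
proof -
  have "D \<in> Pol k \<Longrightarrow> (\<And>\<nu>. \<nu> \<in> keys D \<Longrightarrow> rank_of k \<nu> < r) \<Longrightarrow> in_span D" for r D
  proof (induction r arbitrary: D)
    case 0
    have "keys D = {}" using 0(2) by blast
    then have "D = 0" by simp
    then show ?case unfolding in_span_def by (intro exI[of _ "{}"]) simp
  next
    case (Suc r)
    define A where "A = {\<nu> \<in> keys D. rank_of k \<nu> = r}"
    define F where "F = (\<Sum>\<nu>\<in>A. pconst (lookup D \<nu>) * basis \<nu>)"
    have A: "finite A" "A \<subseteq> Lambda k" using Suc(2) by (auto simp: A_def Pol_def)
    have F: "F \<in> Pol k" unfolding F_def using A basis_props(3) by (intro Pol_sum Pol_mult) auto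
    have "rank_of k \<kappa> < r" if k: "\<kappa> \<in> keys (D - F)" for \<kappa>
    proof (rule ccontr)
      assume "\<not> rank_of k \<kappa> < r"
      then have ge: "rank_of k \<kappa> \<ge> r" by simp
      have z: "lookup (basis \<nu>) \<kappa> = (if \<nu> = \<kappa> then 1 else 0)" if "\<nu> \<in> A" for \<nu>
        using basis_lookup_0[of \<nu> \<kappa>] basis_props(2)[of \<nu>] ge that A by (auto simp: A_def)
      have "lookup F \<kappa> = (\<Sum>\<nu>\<in>A. lookup D \<nu> * lookup (basis \<nu>) \<kappa>)"
        unfolding F_def lookup_sum lookup_pconst_mult ..
      also have "\<dots> = (\<Sum>\<nu>\<in>A. if \<nu> = \<kappa> then lookup D \<kappa> else 0)"
        by (rule sum.cong) (auto simp: z)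
      also have "\<dots> = (if \<kappa> \<in> A then lookup D \<kappa> else 0)" using A(1) by simp
      also have "\<dots> = lookup D \<kappa>"
        using Suc(3)[of \<kappa>] ge by (cases "\<kappa> \<in> keys D") (auto simp: A_def in_keys_iff)
      finally show False using k by (simp add: in_keys_iff lookup_minus)
    qed
    then have "in_span (D - F)" using Suc(2) F by (intro Suc(1) Pol_diff)
    moreover have "in_span F" unfolding in_span_def F_def using A by blast
    ultimately have "in_span ((D - F) + F)" by (rule in_span_add)
    then show ?case by simp
  qed
  from this[of D "Suc (Max (rank_of k ` keys D))"] show ?thesis
    using assms by (auto simp: less_Suc_eq_le)
qed

lemma basis_independent:
  assumes S: "finite S" "S \<subseteq> Lambda k" and 0: "(\<Sum>\<nu>\<in>S. pconst (c \<nu>) * basis \<nu>) = 0" and "\<nu> \<in> S"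
  shows "c \<nu> = 0"
proof (rule ccontr)
  assume "c \<nu> \<noteq> 0"
  let ?R = "{\<nu> \<in> S. c \<nu> \<noteq> 0}"
  have R: "finite ?R" "?R \<noteq> {}" using S \<open>c \<nu> \<noteq> 0\<close> \<open>\<nu> \<in> S\<close> by auto
  define M where "M = Max (rank_of k ` ?R)"
  have "M \<in> rank_of k ` ?R" unfolding M_def using R by (intro Max_in) auto
  then obtain \<mu> where \<mu>: "\<mu> \<in> ?R" "rank_of k \<mu> = M" by auto
  have le: "rank_of k \<kappa> \<le> rank_of k \<mu>" if "\<kappa> \<in> ?R" for \<kappa>
    using that R unfolding \<mu>(2) M_def by (intro Max_ge) auto
  have "0 = (\<Sum>\<kappa>\<in>S. c \<kappa> * lookup (basis \<kappa>) \<mu>)"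
    using arg_cong[OF 0, of "\<lambda>f. lookup f \<mu>"] by (simp add: lookup_sum lookup_pconst_mult)
  also have "\<dots> = (\<Sum>\<kappa>\<in>S. if \<kappa> = \<mu> then c \<mu> else 0)"
  proof (rule sum.cong)
    fix \<kappa> assume k: "\<kappa> \<in> S"
    show "c \<kappa> * lookup (basis \<kappa>) \<mu> = (if \<kappa> = \<mu> then c \<mu> else 0)"
    proof (cases "\<kappa> = \<mu> \<or> c \<kappa> = 0")
      case True
      then show ?thesis using k S(2) basis_props(2)[of \<kappa>] \<mu>(1) by auto
    next
      case False
      then show ?thesis using k S(2) basis_lookup_0[of \<kappa> \<mu>] le[of \<kappa>] by auto
    qed
  qed simp
  also have "\<dots> = c \<mu>" using S(1) \<mu>(1) by simp
  finally show False using \<mu>(1) by simp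
qed

lemma Lambda_eqI: "\<mu> \<in> Lambda k \<Longrightarrow> \<nu> \<in> Lambda k \<Longrightarrow> (\<And>i. i \<in> {1..k} \<Longrightarrow> lookup \<mu> i = lookup \<nu> i) \<Longrightarrow> \<mu> = \<nu>"
proof (rule poly_mapping_eqI)
  fix i assume a: "\<mu> \<in> Lambda k" "\<nu> \<in> Lambda k" "\<And>i. i \<in> {1..k} \<Longrightarrow> lookup \<mu> i = lookup \<nu> i"
  then show "lookup \<mu> i = lookup \<nu> i"
    using Lambda_lookup_0[OF a(1), of i] Lambda_lookup_0[OF a(2), of i] by (cases "i \<in> {1..k}") auto
qed

text \<open>The joint spectrum is simple, since the eigenvalues of the basis element of \<open>\<mu>\<close> determine
  the exponents of q in them and thereby \<open>\<mu>\<close>.\<close>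

lemma joint_eigenvector:
  assumes D: "D \<in> Pol k" "D \<noteq> 0" and Y: "\<And>i. i \<in> {1..k} \<Longrightarrow> Y_op k i D = pconst (\<chi> i) * D"
  shows "\<exists>\<nu>\<in>Lambda k. (\<forall>i\<in>{1..k}. \<chi> i = eigval k \<nu> i) \<and> (\<exists>c. D = pconst c * basis \<nu>)"
proof -
  obtain S c where S: "finite S" "S \<subseteq> Lambda k" "D = (\<Sum>\<nu>\<in>S. pconst (c \<nu>) * basis \<nu>)"
    using basis_spans[OF D(1)] by (auto simp: in_span_def)
  have ev: "\<chi> i = eigval k \<nu> i" if "i \<in> {1..k}" "\<nu> \<in> S" "c \<nu> \<noteq> 0" for i \<nu>
  proof -
    have "(\<Sum>\<nu>\<in>S. pconst (c \<nu> * (eigval k \<nu> i - \<chi> i)) * basis \<nu>) =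
        (\<Sum>\<nu>\<in>S. pconst (c \<nu>) * Y_op k i (basis \<nu>)) - pconst (\<chi> i) * D"
      unfolding S(3) sum_distrib_left sum_subtractf[symmetric]
    proof (rule sum.cong)
      fix \<nu> assume "\<nu> \<in> S"
      then have "Y_op k i (basis \<nu>) = pconst (eigval k \<nu> i) * basis \<nu>"
        using S(2) that(1) by (intro basis_props(4)) auto
      then show "pconst (c \<nu> * (eigval k \<nu> i - \<chi> i)) * basis \<nu> =
          pconst (c \<nu>) * Y_op k i (basis \<nu>) - pconst (\<chi> i) * (pconst (c \<nu>) * basis \<nu>)"
        by (simp add: pconst_mult pconst_diff algebra_simps)
    qed simp
    also have "(\<Sum>\<nu>\<in>S. pconst (c \<nu>) * Y_op k i (basis \<nu>)) = Y_op k i D"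
      unfolding S(3) by (simp add: Y_op_sum Y_op_pconst)
    finally have "(\<Sum>\<nu>\<in>S. pconst (c \<nu> * (eigval k \<nu> i - \<chi> i)) * basis \<nu>) = 0" using Y[OF that(1)] by simp
    then have "c \<nu> * (eigval k \<nu> i - \<chi> i) = 0" using S that(2) by (intro basis_independent)
    then show ?thesis using that(3) by simp
  qed
  have "\<exists>\<mu>\<in>S. c \<mu> \<noteq> 0"
  proof (rule ccontr)
    assume "\<not> (\<exists>\<mu>\<in>S. c \<mu> \<noteq> 0)"
    then show False using D(2) S(3) by simp
  qed
  then obtain \<mu> where \<mu>: "\<mu> \<in> S" "c \<mu> \<noteq> 0" by blast
  have "\<nu> = \<mu>" if "\<nu> \<in> S" "c \<nu> \<noteq> 0" for \<nu>
  proof (rule Lambda_eqI)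
    fix i assume "i \<in> {1..k}"
    then have "eigval k \<nu> i = eigval k \<mu> i" using ev[of i \<nu>] ev[of i \<mu>] that \<mu> by simp
    then show "lookup \<nu> i = lookup \<mu> i" by (simp add: eigval_eq_iff)
  qed (use S(2) that \<mu> in auto)
  then have "D = (\<Sum>\<nu>\<in>S. if \<nu> = \<mu> then pconst (c \<mu>) * basis \<mu> else 0)"
    unfolding S(3) by (intro sum.cong) auto
  then have "D = pconst (c \<mu>) * basis \<mu>" using S(1) \<mu>(1) by simp
  then show ?thesis using ev \<mu> S(2) by blast
qed

lemma is_macdonald_unique:
  assumes \<mu>: "\<mu> \<in> Lambda k" and E: "is_macdonald k \<mu> E" and F: "is_macdonald k \<mu> F"
  shows "E = F"
proof (rule ccontr)
  assume "E \<noteq> F"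
  have "Y_op k i (E - F) = pconst (eigval k \<mu> i) * (E - F)" if "i \<in> {1..k}" for i
  proof -
    have "Y_op k i (E - F) = Y_op k i (E + pconst (- 1) * F)" by (simp add: pconst_uminus)
    also have "\<dots> = pconst (eigval k \<mu> i) * (E - F)"
      unfolding Y_op_add Y_op_pconst using E F that by (simp add: is_macdonald_def pconst_uminus algebra_simps)
    finally show ?thesis .
  qed
  then obtain \<nu> c where \<nu>: "\<nu> \<in> Lambda k" "\<forall>i\<in>{1..k}. eigval k \<mu> i = eigval k \<nu> i" "E - F = pconst c * basis \<nu>"
    using joint_eigenvector[of "E - F" "eigval k \<mu>"] \<open>E \<noteq> F\<close> E F by (auto simp: is_macdonald_def Pol_diff)
  then have "\<mu> = \<nu>" using \<mu> by (intro Lambda_eqI) (auto simp: eigval_eq_iff)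
  then have "lookup (E - F) \<mu> = c" using \<nu>(3) basis_props(2)[OF \<mu>] by (simp add: lookup_pconst_mult)
  then have "c = 0" using E F by (simp add: is_macdonald_def lookup_minus)
  then show False using \<nu>(3) \<open>E \<noteq> F\<close> by simp
qed

lemma macdonald_E_eqI:
  assumes "\<mu> \<in> Lambda k" "is_macdonald k \<mu> E" shows "macdonald_E k \<mu> = E"
  unfolding macdonald_E_def
proof (rule the_equality)
  show "E \<in> Pol k \<and> (\<forall>\<nu>\<in>keys (E - xmon \<mu>). expo_less k \<nu> \<mu>) \<and>
     (\<forall>i\<in>{1..k}. Y_op k i E = pconst (q_par ^ lookup \<mu> i * t_par ^ u_stat k \<mu> i) * E)"
    using assms(2) unfolding is_macdonald_iff[OF k2] eigval_def .
  fix F assume "F \<in> Pol k \<and> (\<forall>\<nu>\<in>keys (F - xmon \<mu>). expo_less k \<nu> \<mu>) \<and>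
     (\<forall>i\<in>{1..k}. Y_op k i F = pconst (q_par ^ lookup \<mu> i * t_par ^ u_stat k \<mu> i) * F)"
  then have "is_macdonald k \<mu> F" unfolding is_macdonald_iff[OF k2] eigval_def .
  then show "F = E" using is_macdonald_unique assms by blast
qed

lemma macdonald_E_props:
  assumes "\<mu> \<in> Lambda k" shows "is_macdonald k \<mu> (macdonald_E k \<mu>)"
  using macdonald_E_eqI[OF assms basis_props(1)[OF assms]] basis_props(1)[OF assms] by simp

lemma macdonald_E_in_Pol: "\<mu> \<in> Lambda k \<Longrightarrow> macdonald_E k \<mu> \<in> Pol k"
  using macdonald_E_props by (simp add: is_macdonald_def)

lemma macdonald_E_eigen:
  "\<mu> \<in> Lambda k \<Longrightarrow> i \<in> {1..k} \<Longrightarrow> Y_op k i (macdonald_E k \<mu>) = pconst (eigval k \<mu> i) * macdonald_E k \<mu>"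
  using macdonald_E_props by (simp add: is_macdonald_def)

lemma macdonald_E_zero: "macdonald_E k 0 = 1"
  by (rule macdonald_E_eqI) (simp_all add: is_macdonald_zero[OF k2] Lambda_def)

lemma macdonald_E_swap:
  assumes "\<mu> \<in> Lambda k" "1 \<le> i" "i < k" "lookup \<mu> (Suc i) < lookup \<mu> i"
    "c * (eigval k \<mu> i - eigval k \<mu> (Suc i)) = (1 - t_par) * eigval k \<mu> (Suc i)"
  shows "macdonald_E k (swap_expo i \<mu>) = T_op i (macdonald_E k \<mu>) + pconst c * macdonald_E k \<mu>"
  by (intro macdonald_E_eqI swap_expo_in_Lambda is_macdonald_swap[OF k2 macdonald_E_props] assms)

lemma macdonald_E_cyc:
  assumes "\<mu> \<in> Lambda k"
  shows "macdonald_E k (cyc_expo k \<mu>) = pconst (inverse q_par ^ lookup \<mu> k) * Phi k (macdonald_E k \<mu>)"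
  using k2 by (intro macdonald_E_eqI cyc_expo_in_Lambda is_macdonald_cyc[OF k2 macdonald_E_props] assms) auto

text \<open>Otherwise \<open>T\<^sub>i E\<^sub>\<mu> - E\<^sub>\<mu>\<close> would be a joint eigenvector whose eigenvalues are those of \<open>\<mu>\<close>,
  with the two at i and i+1 exchanged; by the powers of q they could only belong to \<open>\<mu>\<close> itself,
  but these two differ by the factor t.\<close>

lemma T_op_macdonald_E:
  assumes \<mu>: "\<mu> \<in> Lambda k" and i: "1 \<le> i" "i < k" and eq: "lookup \<mu> i = lookup \<mu> (Suc i)"
  shows "T_op i (macdonald_E k \<mu>) = macdonald_E k \<mu>"
proof (rule ccontr)
  let ?E = "macdonald_E k \<mu>"
  let ?F = "T_op i ?E + pconst (- 1) * ?E" and ?\<chi> = "\<lambda>j. eigval k \<mu> (transpose i (Suc i) j)"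
  assume "T_op i ?E \<noteq> ?E"
  then have "?F \<noteq> 0" by (simp add: pconst_uminus)
  moreover have "?F \<in> Pol k" using i macdonald_E_in_Pol[OF \<mu>] by (intro Pol_add Pol_mult T_op_in_Pol) auto
  moreover have "Y_op k j ?F = pconst (?\<chi> j) * ?F" if "j \<in> {1..k}" for j
    using macdonald_E_eigen[OF \<mu>] eigval_equal_entries[OF i eq]
    by (intro intertwiner_eigen[OF i that]) (auto simp: algebra_simps)
  ultimately obtain \<nu> where \<nu>: "\<nu> \<in> Lambda k" "\<forall>j\<in>{1..k}. ?\<chi> j = eigval k \<nu> j"
    using joint_eigenvector[of ?F ?\<chi>] by blast
  have "lookup \<nu> j = lookup \<mu> j" if "j \<in> {1..k}" for j
  proof -
    have "lookup \<mu> (transpose i (Suc i) j) = lookup \<nu> j" using \<nu>(2) that by (simp add: eigval_eq_iff)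
    then show ?thesis using eq by (auto simp: transpose_def split: if_splits)
  qed
  then have "\<nu> = \<mu>" using \<nu>(1) \<mu> by (intro Lambda_eqI)
  then have "eigval k \<mu> (Suc i) = eigval k \<mu> i" using \<nu>(2) i by (auto dest: bspec[of _ _ i])
  then show False using eigval_equal_entries[OF i eq] by (auto simp: eigval_neq_0)
qed

end

section \<open>The t-adic topology on the coefficients\<close>

text \<open>The valuation ring of the order at t = 0. In terms of divisibility by powers of t the
  ultrametric inequality needs no computation with orders of sums.\<close>

definition t_integral :: "ratfun \<Rightarrow> bool" where
  "t_integral x \<longleftrightarrow> (\<exists>A B :: rat poly poly. poly B 0 \<noteq> 0 \<and> x = Fract A B)"

definition t_div :: "nat \<Rightarrow> ratfun \<Rightarrow> bool" where
  "t_div n x \<longleftrightarrow> (\<exists>y. t_integral y \<and> x = t_par ^ n * y)"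

lemma poly_0_neq: "poly (B::rat poly poly) 0 \<noteq> 0 \<Longrightarrow> B \<noteq> 0" by auto

lemma t_integral_Fract: "poly B 0 \<noteq> 0 \<Longrightarrow> t_integral (Fract A B)"
  by (auto simp: t_integral_def)
lemma t_integral_add: "t_integral x \<Longrightarrow> t_integral y \<Longrightarrow> t_integral (x + y)"
  unfolding t_integral_def
proof (elim exE conjE)
  fix A B C D :: "rat poly poly" assume "poly B 0 \<noteq> 0" "x = Fract A B" "poly D 0 \<noteq> 0" "y = Fract C D"
  then show "\<exists>A B. poly B 0 \<noteq> 0 \<and> x + y = Fract A B"
    using poly_0_neq[of B] poly_0_neq[of D] by (intro exI[of _ "A * D + C * B"] exI[of _ "B * D"]) simp
qed
lemma t_integral_mult: "t_integral x \<Longrightarrow> t_integral y \<Longrightarrow> t_integral (x * y)"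
  unfolding t_integral_def
proof (elim exE conjE)
  fix A B C D :: "rat poly poly" assume "poly B 0 \<noteq> 0" "x = Fract A B" "poly D 0 \<noteq> 0" "y = Fract C D"
  then show "\<exists>A B. poly B 0 \<noteq> 0 \<and> x * y = Fract A B"
    by (intro exI[of _ "A * C"] exI[of _ "B * D"]) simp
qed
lemma t_integral_uminus: "t_integral x \<Longrightarrow> t_integral (- x)"
  unfolding t_integral_def by (metis minus_fract)
lemma t_integral_1: "t_integral 1" and t_integral_0: "t_integral 0" and t_integral_t: "t_integral t_par"
  and t_integral_q: "t_integral q_par"
  unfolding One_fract_def Zero_fract_def t_par_def q_par_def by (rule t_integral_Fract; simp)+
lemma t_integral_power: "t_integral x \<Longrightarrow> t_integral (x ^ n)"
  by (induction n) (auto intro: t_integral_mult t_integral_1)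

lemma t_div_0: "t_div n 0"
  unfolding t_div_def by (rule exI[of _ 0]) (simp add: t_integral_0)
lemma t_div_add: "t_div n x \<Longrightarrow> t_div n y \<Longrightarrow> t_div n (x + y)"
  unfolding t_div_def by (metis distrib_left t_integral_add)
lemma t_div_uminus: "t_div n x \<Longrightarrow> t_div n (- x)"
  unfolding t_div_def by (metis mult_minus_right t_integral_uminus)
lemma t_div_mult: "t_integral x \<Longrightarrow> t_div n y \<Longrightarrow> t_div n (x * y)"
  unfolding t_div_def by (metis mult.left_commute t_integral_mult)
lemma t_div_mono: "t_div n x \<Longrightarrow> m \<le> n \<Longrightarrow> t_div m x"
proof -
  assume "t_div n x" "m \<le> n"
  then obtain y where "t_integral y" "x = t_par ^ n * y" by (auto simp: t_div_def)
  moreover have "t_par ^ n = t_par ^ m * t_par ^ (n - m)" using \<open>m \<le> n\<close> by (simp flip: power_add)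
  ultimately show ?thesis unfolding t_div_def
    by (intro exI[of _ "t_par ^ (n - m) * y"]) (auto intro: t_integral_mult t_integral_power t_integral_t)
qed

lemma t_par_power_Fract: "t_par ^ n = Fract ([:0, 1:] ^ n) 1"
  by (simp add: t_par_def Fract_power)

lemma factor_t:
  assumes "(A::rat poly poly) \<noteq> 0"
  obtains A' where "A = [:0, 1:] ^ order 0 A * A'" "poly A' 0 \<noteq> 0"
  using order_decomp[OF assms, of 0] by (auto simp: poly_eq_0_iff_dvd)

lemma t_div_iff: "t_div n x \<longleftrightarrow> t_ord x \<ge> ereal (real n)"
proof (cases "x = 0")
  case True then show ?thesis by (simp add: t_div_0 t_ord_def)
next
  case False
  obtain A B where x: "x = Fract A B" "B \<noteq> 0" by (cases x)
  have A: "A \<noteq> 0" using False x by (auto simp: Zero_fract_def eq_fract)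
  have o: "t_ord x = ereal (real (order 0 A) - real (order 0 B))" using x A by (simp add: t_ord_Fract)
  show ?thesis
  proof
    assume "t_div n x"
    then obtain C D where D: "poly D 0 \<noteq> 0" "x = t_par ^ n * Fract C D" by (auto simp: t_div_def t_integral_def)
    have x': "x = Fract ([:0, 1:] ^ n * C) D" by (simp add: D(2) t_par_power_Fract)
    have C: "C \<noteq> 0" using False x' D(1) by (auto simp: Zero_fract_def eq_fract)
    have D0: "D \<noteq> 0" using D(1) by auto
    have nz: "[:0, 1:] ^ n * C \<noteq> 0" using C by simp
    have "order 0 ([:0, 1:] ^ n * C) = n + order 0 C"
      using order_mult[OF nz] order_power_n_n[of "0::rat poly" n] by simp
    moreover have "order 0 D = 0" using D(1) by (simp add: order_0I)
    ultimately show "t_ord x \<ge> ereal (real n)" unfolding x' t_ord_Fract[OF nz D0] by simp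
  next
    assume "t_ord x \<ge> ereal (real n)"
    then have le: "n + order 0 B \<le> order 0 A" unfolding o by simp
    obtain A' where A': "A = [:0, 1:] ^ order 0 A * A'" using factor_t[OF A] by blast
    obtain B' where B': "B = [:0, 1:] ^ order 0 B * B'" "poly B' 0 \<noteq> 0" using factor_t[OF x(2)] by blast
    let ?d = "order 0 A - order 0 B - n"
    have p: "[:0, 1:] ^ order 0 A = ([:0, 1:] ^ order 0 B * ([:0, 1:] ^ n * [:0, 1:] ^ ?d) :: rat poly poly)"
      using le by (simp flip: power_add)
    have "A * B' = ([:0, 1:] ^ n * ([:0, 1:] ^ ?d * A')) * B"
      by (subst A', subst (2) B'(1), subst p) (simp only: mult.assoc mult.left_commute mult.commute)
    then have "x = Fract ([:0, 1:] ^ n * ([:0, 1:] ^ ?d * A')) B'"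
      unfolding x(1) using x(2) poly_0_neq[OF B'(2)] by (subst eq_fract) auto
    also have "\<dots> = t_par ^ n * Fract ([:0, 1:] ^ ?d * A') B'" by (simp add: t_par_power_Fract)
    finally show "t_div n x" unfolding t_div_def using t_integral_Fract[OF B'(2)] by blast
  qed
qed

lemma t_tendsto_iff: "t_tendsto a l \<longleftrightarrow> (\<forall>n. \<forall>\<^sub>F m in sequentially. t_div n (a m - l))"
proof -
  have "t_tendsto a l \<longleftrightarrow> (\<forall>r. \<forall>\<^sub>F m in sequentially. ereal r < t_ord (a m - l))"
    unfolding t_tendsto_def tendsto_PInfty ..
  also have "\<dots> \<longleftrightarrow> (\<forall>n. \<forall>\<^sub>F m in sequentially. t_div n (a m - l))"
  proof (intro iffI allI)
    fix n assume "\<forall>r. \<forall>\<^sub>F m in sequentially. ereal r < t_ord (a m - l)"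
    then have "\<forall>\<^sub>F m in sequentially. ereal (real n) < t_ord (a m - l)" by blast
    then show "\<forall>\<^sub>F m in sequentially. t_div n (a m - l)" by eventually_elim (simp add: t_div_iff)
  next
    fix r assume a: "\<forall>n. \<forall>\<^sub>F m in sequentially. t_div n (a m - l)"
    obtain n where n: "r < real n" using reals_Archimedean2 by blast
    have "\<forall>\<^sub>F m in sequentially. t_div n (a m - l)" using a by blast
    then show "\<forall>\<^sub>F m in sequentially. ereal r < t_ord (a m - l)"
    proof eventually_elim
      case (elim m)
      have "ereal r < ereal (real n)" using n by simp
      also have "\<dots> \<le> t_ord (a m - l)" using elim by (simp add: t_div_iff)
      finally show ?case .
    qed
  qed
  finally show ?thesis .
qed

lemma t_div_scale: "\<exists>N. \<forall>n x. t_div (n + N) x \<longrightarrow> t_div n (c * x)"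
proof -
  obtain A B where c: "c = Fract A B" "B \<noteq> 0" by (cases c)
  obtain B' where B': "B = [:0, 1:] ^ order 0 B * B'" "poly B' 0 \<noteq> 0" using factor_t[OF c(2)] by blast
  have ct: "c * t_par ^ order 0 B = Fract A B'"
  proof -
    have "c * t_par ^ order 0 B = Fract (A * [:0, 1:] ^ order 0 B) B" by (simp add: c t_par_power_Fract)
    moreover have "(A * [:0, 1:] ^ order 0 B) * B' = A * B"
      by (subst (2) B'(1)) (simp only: mult.assoc)
    ultimately show ?thesis using c(2) poly_0_neq[OF B'(2)] by (simp add: eq_fract)
  qed
  have "t_div n (c * x)" if as: "t_div (n + order 0 B) x" for n x
  proof -
    obtain y where y: "t_integral y" "x = t_par ^ (n + order 0 B) * y" using as unfolding t_div_def by blast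
    have "c * x = t_par ^ n * ((c * t_par ^ order 0 B) * y)"
      unfolding y(2) power_add by (simp only: mult.assoc mult.left_commute)
    then show ?thesis unfolding ct t_div_def using t_integral_mult[OF t_integral_Fract[OF B'(2)] y(1)] by blast
  qed
  then show ?thesis by blast
qed

lemma t_tendsto_const: "t_tendsto (\<lambda>m. c) c"
  by (simp add: t_tendsto_iff t_div_0)

lemma t_tendsto_cong: "(\<forall>\<^sub>F m in sequentially. a m = b m) \<Longrightarrow> t_tendsto a l \<Longrightarrow> t_tendsto b l"
  unfolding t_tendsto_iff
proof
  fix n assume "\<forall>\<^sub>F m in sequentially. a m = b m" "\<forall>n. \<forall>\<^sub>F m in sequentially. t_div n (a m - l)"
  then have "\<forall>\<^sub>F m in sequentially. a m = b m" "\<forall>\<^sub>F m in sequentially. t_div n (a m - l)" by auto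
  then show "\<forall>\<^sub>F m in sequentially. t_div n (b m - l)" by eventually_elim simp
qed

lemma t_tendsto_add:
  assumes "t_tendsto a k" "t_tendsto b l" shows "t_tendsto (\<lambda>m. a m + b m) (k + l)"
  unfolding t_tendsto_iff
proof
  fix n
  have "\<forall>\<^sub>F m in sequentially. t_div n (a m - k)" "\<forall>\<^sub>F m in sequentially. t_div n (b m - l)"
    using assms by (auto simp: t_tendsto_iff)
  then show "\<forall>\<^sub>F m in sequentially. t_div n (a m + b m - (k + l))"
  proof eventually_elim
    case (elim m)
    have e: "a m + b m - (k + l) = (a m - k) + (b m - l)" by simp
    show ?case unfolding e by (rule t_div_add[OF elim])
  qed
qed

lemma t_tendsto_mult:
  assumes "t_tendsto a k" "t_tendsto b l" shows "t_tendsto (\<lambda>m. a m * b m) (k * l)"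
  unfolding t_tendsto_iff
proof
  fix n
  obtain M where M: "\<And>n x. t_div (n + M) x \<Longrightarrow> t_div n (k * x)" using t_div_scale[of k] by blast
  obtain N where N: "\<And>n x. t_div (n + N) x \<Longrightarrow> t_div n (l * x)" using t_div_scale[of l] by blast
  have "\<forall>\<^sub>F m in sequentially. t_div (n + N) (a m - k)" "\<forall>\<^sub>F m in sequentially. t_div (n + M) (b m - l)"
    using assms by (auto simp: t_tendsto_iff)
  then show "\<forall>\<^sub>F m in sequentially. t_div n (a m * b m - k * l)"
  proof eventually_elim
    case (elim m)
    obtain y where "t_integral y" "a m - k = t_par ^ (n + N) * y" using elim(1) by (auto simp: t_div_def)
    then have "t_integral (a m - k)" by (auto intro: t_integral_mult t_integral_power t_integral_t)
    then have 1: "t_div n ((a m - k) * (b m - l))" using elim(2) by (intro t_div_mult) (auto elim: t_div_mono)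
    have e: "a m * b m - k * l = (a m - k) * (b m - l) + (k * (b m - l) + l * (a m - k))"
      by (simp add: algebra_simps)
    show ?case unfolding e by (rule t_div_add[OF 1 t_div_add[OF M[OF elim(2)] N[OF elim(1)]]])
  qed
qed

lemma t_tendsto_unique:
  assumes "t_tendsto a k" "t_tendsto a l" shows "k = l"
proof (rule ccontr)
  assume "k \<noteq> l"
  have "t_div n (k - l)" for n
  proof -
    have "\<forall>\<^sub>F m in sequentially. t_div n (a m - k)" "\<forall>\<^sub>F m in sequentially. t_div n (a m - l)"
      using assms by (auto simp: t_tendsto_iff)
    then have "\<forall>\<^sub>F m in sequentially. t_div n (k - l)"
    proof eventually_elim
      case (elim m)
      have e: "k - l = (a m - l) + - (a m - k)" by simp
      show ?case unfolding e by (rule t_div_add[OF elim(2) t_div_uminus[OF elim(1)]])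
    qed
    then show ?thesis by simp
  qed
  then have ge: "t_ord (k - l) \<ge> ereal (real n)" for n by (simp add: t_div_iff)
  obtain A B where x: "k - l = Fract A B" "B \<noteq> 0" by (cases "k - l")
  have "A \<noteq> 0" using \<open>k \<noteq> l\<close> x(1) by (auto simp: fract_collapse)
  then have "t_ord (k - l) = ereal (real (order 0 A) - real (order 0 B))" using x by (simp add: t_ord_Fract)
  then show False using ge[of "Suc (order 0 A)"] by simp
qed

lemma t_tendsto_t_power:
  assumes "\<forall>\<^sub>F m in sequentially. m \<le> u m + c" shows "t_tendsto (\<lambda>m. t_par ^ u m) 0"
  unfolding t_tendsto_iff
proof
  fix n
  have "\<forall>\<^sub>F m in sequentially. n + c \<le> m" by (rule eventually_ge_at_top)
  then show "\<forall>\<^sub>F m in sequentially. t_div n (t_par ^ u m - 0)"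
    using assms
  proof eventually_elim
    case (elim m)
    have "t_div (u m) (t_par ^ u m)" unfolding t_div_def by (rule exI[of _ 1]) (simp add: t_integral_1)
    then show ?case using elim by (auto elim: t_div_mono)
  qed
qed

lemma t_integral_unit:
  assumes "t_integral w" shows "t_integral (inverse (q_par ^ b - t_par * w))" "q_par ^ b - t_par * w \<noteq> 0"
proof -
  obtain A B where B: "poly B 0 \<noteq> 0" "w = Fract A B" using assms by (auto simp: t_integral_def)
  have q: "q_par ^ b = Fract (monom (monom 1 b) 0) 1" using q_t_monomial_Fract[of b 0] by simp
  let ?C = "monom (monom 1 b) 0 * B - [:0, 1:] * A"
  have e: "q_par ^ b - t_par * w = Fract ?C B"
    using poly_0_neq[OF B(1)] by (simp add: q B(2) t_par_def)
  have C: "poly ?C 0 \<noteq> 0" using B(1) by (simp add: poly_monom)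
  show "t_integral (inverse (q_par ^ b - t_par * w))" unfolding e inverse_fract by (rule t_integral_Fract[OF C])
  show "q_par ^ b - t_par * w \<noteq> 0"
    unfolding e using poly_0_neq[OF C] poly_0_neq[OF B(1)] by (simp add: Zero_fract_def eq_fract)
qed

text \<open>For u > v the denominator is \<open>t\<^sup>v (q\<^sup>b - t w)\<close> with an integral w, and its second factor
  is a unit.\<close>

lemma t_tendsto_intertwiner:
  assumes "\<forall>\<^sub>F m in sequentially. m \<le> u m + c"
  shows "t_tendsto (\<lambda>m. (1 - t_par) * t_par ^ u m / (q_par ^ b * t_par ^ v - t_par ^ u m)) 0"
  unfolding t_tendsto_iff
proof
  fix n
  have "\<forall>\<^sub>F m in sequentially. n + v + 1 + c \<le> m" by (rule eventually_ge_at_top)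
  then show "\<forall>\<^sub>F m in sequentially. t_div n ((1 - t_par) * t_par ^ u m / (q_par ^ b * t_par ^ v - t_par ^ u m) - 0)"
    using assms
  proof eventually_elim
    case (elim m)
    define d where "d = u m - n - v - 1"
    have um: "u m = v + (Suc d + n)" using elim by (simp add: d_def)
    let ?w = "t_par ^ (d + n)"
    have w: "t_integral ?w" by (intro t_integral_power t_integral_t)
    have tu: "t_par ^ u m = t_par ^ v * (t_par * ?w)" unfolding um by (simp add: power_add)
    have den: "q_par ^ b * t_par ^ v - t_par ^ u m = t_par ^ v * (q_par ^ b - t_par * ?w)"
      unfolding tu by (simp add: algebra_simps)
    have "(1 - t_par) * t_par ^ u m / (q_par ^ b * t_par ^ v - t_par ^ u m)
       = (t_par ^ v * ((1 - t_par) * (t_par * ?w))) / (t_par ^ v * (q_par ^ b - t_par * ?w))"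
      unfolding den unfolding tu by (simp only: mult.left_commute)
    also have "\<dots> = ((1 - t_par) * (t_par * ?w)) / (q_par ^ b - t_par * ?w)" by simp
    also have "\<dots> = t_par ^ n * (((1 - t_par) * (t_par ^ Suc d)) * inverse (q_par ^ b - t_par * ?w))"
      by (simp add: divide_inverse power_add mult_ac)
    finally have "(1 - t_par) * t_par ^ u m / (q_par ^ b * t_par ^ v - t_par ^ u m) = \<dots>" .
    moreover have "t_integral (1 - t_par)"
      using t_integral_add[OF t_integral_1 t_integral_uminus[OF t_integral_t]] by simp
    then have "t_integral (((1 - t_par) * (t_par ^ Suc d)) * inverse (q_par ^ b - t_par * ?w))"
      by (intro t_integral_mult t_integral_unit(1) w t_integral_power t_integral_t)
    ultimately show ?case unfolding t_div_def by auto
  qed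
qed

section \<open>Almost symmetric series\<close>

lemma total_degree_superset: "finite A \<Longrightarrow> keys m \<subseteq> A \<Longrightarrow> total_degree m = (\<Sum>i\<in>A. lookup m i)"
  unfolding total_degree_def by (rule sum.mono_neutral_left) (auto simp: in_keys_iff)

lemma total_degree_add: "total_degree (a + b) = total_degree a + total_degree b"
proof -
  have "keys (a + b) \<subseteq> keys a \<union> keys b" by (rule keys_add)
  then show ?thesis
    by (simp add: total_degree_superset[of "keys a \<union> keys b"] lookup_add sum.distrib)
qed
lemma total_degree_single: "total_degree (single i n) = n"
  by (cases "n = 0") (simp_all add: total_degree_def)
lemma lookup_le_total_degree: "lookup m i \<le> total_degree m"
  by (cases "i \<in> keys m") (auto simp: total_degree_def in_keys_iff intro: member_le_sum)

lemma finite_bounded_degree: "finite {m \<in> Lambda k. total_degree m \<le> d}"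
proof -
  let ?S = "{f. \<forall>x. (x \<in> {1..k} \<longrightarrow> f x \<in> {0..d}) \<and> (x \<notin> {1..k} \<longrightarrow> f x = 0)}"
  have "lookup ` {m \<in> Lambda k. total_degree m \<le> d} \<subseteq> ?S"
  proof (rule image_subsetI)
    fix m assume m: "m \<in> {m \<in> Lambda k. total_degree m \<le> d}"
    have "lookup m x \<in> {0..d}" for x using m lookup_le_total_degree[of m x] by simp
    moreover have "lookup m x = 0" if "x \<notin> {1..k}" for x
      using m that Lambda_lookup_0[of m k x] by auto
    ultimately show "lookup m \<in> ?S" by simp
  qed
  moreover have "finite ?S" by (rule finite_set_of_finite_funs) auto
  ultimately have "finite (lookup ` {m \<in> Lambda k. total_degree m \<le> d})" by (rule finite_subset)
  then show ?thesis by (rule finite_imageD) (auto intro!: inj_onI poly_mapping_eqI)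
qed

lemma lookup_Pi_inf:
  assumes "F \<in> Pinf" shows "lookup (Pi_inf k F) m = (if m \<in> Lambda k then F m else 0)"
proof -
  obtain d where d: "\<And>m. F m \<noteq> 0 \<Longrightarrow> total_degree m \<le> d" using assms by (auto simp: Pinf_def)
  have "{m. m \<in> Lambda k \<and> F m \<noteq> 0} \<subseteq> {m \<in> Lambda k. total_degree m \<le> d}" using d by auto
  then have fin: "finite {m. m \<in> Lambda k \<and> F m \<noteq> 0}" using finite_bounded_degree by (rule finite_subset)
  have "lookup (Pi_inf k F) m = (\<Sum>n | n \<in> Lambda k \<and> F n \<noteq> 0. if n = m then F n else 0)"
    unfolding Pi_inf_def lookup_sum by (simp add: lookup_single when_def)
  also have "\<dots> = (if m \<in> Lambda k then F m else 0)" using fin by simp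
  finally show ?thesis .
qed

lemma Pi_inf_in_Pol: "F \<in> Pinf \<Longrightarrow> Pi_inf k F \<in> Pol k"
  by (auto simp: Pol_def in_keys_iff lookup_Pi_inf split: if_splits)

lemma Pinf_lincomb:
  assumes "F \<in> Pinf" "G \<in> Pinf" shows "(\<lambda>m. a * F m + G m) \<in> Pinf"
proof -
  obtain d e where "\<forall>m. F m \<noteq> 0 \<longrightarrow> keys m \<subseteq> {1..} \<and> total_degree m \<le> d"
    "\<forall>m. G m \<noteq> 0 \<longrightarrow> keys m \<subseteq> {1..} \<and> total_degree m \<le> e" using assms by (auto simp: Pinf_def)
  note de = this
  have "keys m \<subseteq> {1..} \<and> total_degree m \<le> max d e" if "a * F m + G m \<noteq> 0" for m
  proof (cases "F m = 0")
    case True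
    then have "G m \<noteq> 0" using that by simp
    then show ?thesis using de(2) by (simp add: le_max_iff_disj)
  next
    case False
    then show ?thesis using de(1) by (simp add: le_max_iff_disj)
  qed
  then show ?thesis unfolding Pinf_def by blast
qed
lemma Pinf_0: "(\<lambda>m. 0) \<in> Pinf" by (simp add: Pinf_def)

lemma Pi_inf_lincomb:
  assumes "F \<in> Pinf" "G \<in> Pinf"
  shows "Pi_inf k (\<lambda>m. a * F m + G m) = pconst a * Pi_inf k F + Pi_inf k G"
  by (rule poly_mapping_eqI)
    (simp add: lookup_Pi_inf[OF Pinf_lincomb[OF assms]] lookup_Pi_inf assms lookup_add lookup_pconst_mult)
lemma Pi_inf_0: "Pi_inf k (\<lambda>m. 0) = 0" by (simp add: Pi_inf_def)

lemma Psym_lincomb: "F \<in> Psym j \<Longrightarrow> G \<in> Psym j \<Longrightarrow> (\<lambda>m. a * F m + G m) \<in> Psym j"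
  unfolding Psym_def swap_series_def using Pinf_lincomb by (auto simp: fun_eq_iff)
lemma Psym_0: "(\<lambda>m. 0) \<in> Psym j" by (simp add: Psym_def swap_series_def Pinf_0)
lemma Psym_mono: "j \<le> l \<Longrightarrow> Psym j \<subseteq> Psym l" by (auto simp: Psym_def)
lemma Psym_Pinf: "F \<in> Psym j \<Longrightarrow> F \<in> Pinf" by (simp add: Psym_def)

lemma Lambda_pred_iff: "1 \<le> k \<Longrightarrow> m \<in> Lambda (k - 1) \<longleftrightarrow> m \<in> Lambda k \<and> lookup m k = 0"
proof
  assume "1 \<le> k" "m \<in> Lambda (k - 1)"
  then show "m \<in> Lambda k \<and> lookup m k = 0"
    using Lambda_mono[of "k - 1" k] Lambda_lookup_0[of m "k - 1" k] by auto
next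
  assume k: "1 \<le> k" and m: "m \<in> Lambda k \<and> lookup m k = 0"
  show "m \<in> Lambda (k - 1)" unfolding Lambda_def
  proof safe
    fix i assume "i \<in> keys m"
    then have "i \<in> {1..k}" using m unfolding Lambda_def by blast
    moreover have "i \<noteq> k" using m \<open>i \<in> keys m\<close> by (auto simp: in_keys_iff)
    ultimately show "i \<in> {1..k - 1}" by auto
  qed
qed

lemma pi_pol_Pi_inf: "F \<in> Pinf \<Longrightarrow> 1 \<le> k \<Longrightarrow> pi_pol k (Pi_inf k F) = Pi_inf (k - 1) F"
  by (rule poly_mapping_eqI) (simp add: lookup_pi_pol lookup_Pi_inf Lambda_pred_iff del: One_nat_def)

lemma represents_Pi_inf: "F \<in> Pinf \<Longrightarrow> represents k0 (\<lambda>k. Pi_inf k F) F"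
  by (auto simp: represents_def Pi_inf_in_Pol pi_pol_Pi_inf)

lemma eventually_lookup_Pi_inf:
  assumes "F \<in> Pinf" shows "\<forall>\<^sub>F k in sequentially. lookup (Pi_inf k F) m = F m"
proof (cases "keys m \<subseteq> {1..}")
  case True
  have "\<forall>\<^sub>F k in sequentially. Max (insert 0 (keys m)) \<le> k" by (rule eventually_ge_at_top)
  then show ?thesis
  proof eventually_elim
    case (elim k)
    have "m \<in> Lambda k" unfolding Lambda_def
    proof safe
      fix i assume "i \<in> keys m"
      then have "i \<le> Max (insert 0 (keys m))" by (intro Max_ge) auto
      then show "i \<in> {1..k}" using True elim \<open>i \<in> keys m\<close> by auto
    qed
    then show ?case using assms by (simp add: lookup_Pi_inf)
  qed
next
  case False
  then have "F m = 0" using assms by (auto simp: Pinf_def)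
  then show ?thesis using assms by (simp add: lookup_Pi_inf)
qed

subsection \<open>Uniqueness of limits\<close>

text \<open>Every component is constant in each coefficient once there are enough variables. The limit
  is thus determined by the coefficients, whatever decomposition is used.\<close>

lemma pol_tendsto_coeff:
  assumes "pol_tendsto f L" shows "t_tendsto (\<lambda>k. lookup (f k) m) (L m)"
proof -
  obtain k0 N h g a H G A where
    f: "\<And>k. k \<ge> k0 \<Longrightarrow> f k = h k + (\<Sum>i=1..N. pconst (a i k) * g i k)" and
    H: "represents k0 h H" and
    G: "\<And>i. i \<in> {1..N::nat} \<Longrightarrow> represents k0 (g i) (G i) \<and> t_tendsto (a i) (A i)" and
    L: "L = (\<lambda>m. H m + (\<Sum>i=1..N. A i * G i m))"
    using assms unfolding pol_tendsto_def by blast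
  have rep: "\<forall>\<^sub>F k in sequentially. lookup (e k) m = E m" if "represents k0 e E" for e E
  proof -
    have "E \<in> Pinf" using that by (simp add: represents_def)
    then have "\<forall>\<^sub>F k in sequentially. lookup (Pi_inf k E) m = E m" by (rule eventually_lookup_Pi_inf)
    then show ?thesis using eventually_ge_at_top[of k0]
    proof eventually_elim
      case (elim k)
      then show ?case using that by (auto simp: represents_def)
    qed
  qed
  have S: "t_tendsto (\<lambda>k. \<Sum>i\<in>I. a i k * lookup (g i k) m) (\<Sum>i\<in>I. A i * G i m)" if "I \<subseteq> {1..N}" for I
  proof -
    have "finite I" using that finite_subset by blast
    then show ?thesis using that
    proof (induction I)
      case (insert i I)
      then have i: "represents k0 (g i) (G i)" "t_tendsto (a i) (A i)" using G by auto
      have "\<forall>\<^sub>F k in sequentially. G i m = lookup (g i k) m"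
        using rep[OF i(1)] by eventually_elim simp
      then have "t_tendsto (\<lambda>k. lookup (g i k) m) (G i m)" by (rule t_tendsto_cong[OF _ t_tendsto_const])
      then show ?case using insert i(2) by (auto intro!: t_tendsto_add t_tendsto_mult)
    qed (simp add: t_tendsto_const)
  qed
  have "\<forall>\<^sub>F k in sequentially. H m = lookup (h k) m" using rep[OF H] by eventually_elim simp
  then have "t_tendsto (\<lambda>k. lookup (h k) m) (H m)" by (rule t_tendsto_cong[OF _ t_tendsto_const])
  then have lim: "t_tendsto (\<lambda>k. lookup (h k) m + (\<Sum>i=1..N. a i k * lookup (g i k) m)) (L m)"
    unfolding L by (rule t_tendsto_add) (rule S, simp)
  have "\<forall>\<^sub>F k in sequentially. lookup (h k) m + (\<Sum>i=1..N. a i k * lookup (g i k) m) = lookup (f k) m"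
    using eventually_ge_at_top[of k0]
    by eventually_elim (simp add: f lookup_add lookup_sum lookup_pconst_mult)
  then show ?thesis using lim by (rule t_tendsto_cong)
qed

lemma pol_lim_eqI:
  assumes "pol_tendsto f L" shows "pol_lim f = L"
  unfolding pol_lim_def
proof (rule the_equality)
  show "pol_tendsto f L" by (rule assms)
next
  fix M assume "pol_tendsto f M"
  then show "M = L" using pol_tendsto_coeff assms t_tendsto_unique by (intro ext) blast
qed

subsection \<open>Convergence with all components in one space of almost symmetric series\<close>

text \<open>The general notion of convergence admits one component outside the almost symmetric
  series, where no limit operator is defined, and does not bound the number of exceptional
  variables of the others. Here all components are symmetric in the variables after the j-th, so
  operators can be applied to them one by one.\<close>

inductive sym_conv :: "nat \<Rightarrow> (nat \<Rightarrow> pol) \<Rightarrow> series \<Rightarrow> bool" for j where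
  zero: "\<forall>\<^sub>F m in sequentially. f m = 0 \<Longrightarrow> sym_conv j f (\<lambda>_. 0)"
| add: "t_tendsto a A \<Longrightarrow> G \<in> Psym j \<Longrightarrow> sym_conv j f L \<Longrightarrow>
    \<forall>\<^sub>F m in sequentially. g m = pconst (a m) * Pi_inf m G + f m \<Longrightarrow>
    sym_conv j g (\<lambda>\<mu>. A * G \<mu> + L \<mu>)"

lemma sym_conv_Psym: "sym_conv j f L \<Longrightarrow> L \<in> Psym j"
  by (induction rule: sym_conv.induct) (auto intro: Psym_0 Psym_lincomb)

lemma sym_conv_cong:
  assumes "sym_conv j f L" "\<forall>\<^sub>F m in sequentially. f m = g m" shows "sym_conv j g L"
  using assms(1)
proof cases
  case zero
  have "\<forall>\<^sub>F m in sequentially. g m = 0" using zero(2) assms(2) by eventually_elim simp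
  then show ?thesis unfolding zero(1) by (rule sym_conv.zero)
next
  case (add a A G f' L')
  have "\<forall>\<^sub>F m in sequentially. g m = pconst (a m) * Pi_inf m G + f' m"
    using add(5) assms(2) by eventually_elim simp
  then show ?thesis unfolding add(1) by (rule sym_conv.add[OF add(2-4)])
qed

lemma sym_conv_add:
  assumes "sym_conv j f L" "sym_conv j g M" shows "sym_conv j (\<lambda>m. f m + g m) (\<lambda>\<mu>. L \<mu> + M \<mu>)"
  using assms(1)
proof induction
  case (zero f)
  have "\<forall>\<^sub>F m in sequentially. g m = f m + g m" using zero by eventually_elim simp
  then show ?case using sym_conv_cong[OF assms(2)] by simp
next
  case (add a A G f L h)
  have "\<forall>\<^sub>F m in sequentially. h m + g m = pconst (a m) * Pi_inf m G + (f m + g m)"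
    using add(4) by eventually_elim simp
  then have "sym_conv j (\<lambda>m. h m + g m) (\<lambda>\<mu>. A * G \<mu> + (L \<mu> + M \<mu>))"
    by (rule sym_conv.add[OF add(1,2,5)])
  then show ?case by (simp add: add.assoc)
qed

lemma sym_conv_scale:
  assumes "t_tendsto b B" "sym_conv j f L" shows "sym_conv j (\<lambda>m. pconst (b m) * f m) (\<lambda>\<mu>. B * L \<mu>)"
  using assms(2)
proof induction
  case (zero f)
  have "\<forall>\<^sub>F m in sequentially. pconst (b m) * f m = 0" using zero by eventually_elim simp
  then show ?case using sym_conv.zero[of "\<lambda>m. pconst (b m) * f m" j] by simp
next
  case (add a A G f L h)
  have "\<forall>\<^sub>F m in sequentially. pconst (b m) * h m = pconst (b m * a m) * Pi_inf m G + pconst (b m) * f m"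
    using add(4) by eventually_elim (simp add: pconst_mult algebra_simps)
  then have "sym_conv j (\<lambda>m. pconst (b m) * h m) (\<lambda>\<mu>. (B * A) * G \<mu> + B * L \<mu>)"
    by (rule sym_conv.add[OF t_tendsto_mult[OF assms(1) add(1)] add(2,5)])
  then show ?case by (simp add: distrib_left mult.assoc)
qed

lemma sym_conv_Pi_inf:
  assumes "G \<in> Psym j" shows "sym_conv j (\<lambda>m. Pi_inf m G) G"
proof -
  have "sym_conv j (\<lambda>m. Pi_inf m G) (\<lambda>\<mu>. 1 * G \<mu> + 0)"
    by (rule sym_conv.add[OF t_tendsto_const assms sym_conv.zero[of "\<lambda>m. 0"]]) auto
  then show ?thesis by simp
qed

lemma sym_conv_mono:
  assumes "sym_conv j f L" "j \<le> l" shows "sym_conv l f L"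
  using assms(1)
proof induction
  case (zero f) then show ?case by (rule sym_conv.zero)
next
  case (add a A G f L h)
  then show ?case using Psym_mono[OF assms(2)] by (intro sym_conv.add[where f = f]) auto
qed

lemma sym_conv_pol_tendsto:
  assumes "sym_conv j f L" shows "pol_tendsto f L"
proof -
  have "\<exists>N a G A. N \<ge> 1 \<and> (\<forall>i\<in>{1..N::nat}. t_tendsto (a i) (A i) \<and> G i \<in> Psym j) \<and>
     (\<forall>\<^sub>F m in sequentially. f m = (\<Sum>i=1..N. pconst (a i m) * Pi_inf m (G i))) \<and>
     L = (\<lambda>\<mu>. \<Sum>i=1..N. A i * G i \<mu>)"
    using assms
  proof induction
    case (zero f)
    show ?case
      by (rule exI[of _ 1], rule exI[of _ "\<lambda>i m. 0"], rule exI[of _ "\<lambda>i m. 0"], rule exI[of _ "\<lambda>i. 0"])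
        (use zero in \<open>auto simp: t_tendsto_const Psym_0\<close>)
  next
    case (add b B H f L h)
    then obtain N :: nat and a G A where IH: "N \<ge> 1" "\<And>i. i \<in> {1..N} \<Longrightarrow> t_tendsto (a i) (A i) \<and> G i \<in> Psym j"
      "\<forall>\<^sub>F m in sequentially. f m = (\<Sum>i=1..N. pconst (a i m) * Pi_inf m (G i))"
      "L = (\<lambda>\<mu>. \<Sum>i=1..N. A i * G i \<mu>)" by blast
    let ?a = "a(Suc N := b)" and ?G = "G(Suc N := H)" and ?A = "A(Suc N := B)"
    have s: "(\<Sum>i=1..N. c (?a i) (?A i) (?G i)) = (\<Sum>i=1..N. c (a i) (A i) (G i))" for c :: "_ \<Rightarrow> _ \<Rightarrow> _ \<Rightarrow> 'z::comm_monoid_add"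
      by (rule sum.cong) auto
    have "\<forall>\<^sub>F m in sequentially. h m = (\<Sum>i=1..Suc N. pconst (?a i m) * Pi_inf m (?G i))"
      using add(4) IH(3)
    proof eventually_elim
      case (elim m)
      then show ?case using s[of "\<lambda>a A G. pconst (a m) * Pi_inf m G"] by (simp add: add.commute)
    qed
    moreover have "(\<lambda>\<mu>. B * H \<mu> + L \<mu>) = (\<lambda>\<mu>. \<Sum>i=1..Suc N. ?A i * ?G i \<mu>)"
    proof
      fix \<mu> show "B * H \<mu> + L \<mu> = (\<Sum>i=1..Suc N. ?A i * ?G i \<mu>)"
        using s[of "\<lambda>a A G. A * G \<mu>"] by (simp add: IH(4) add.commute)
    qed
    moreover have "\<forall>i\<in>{1..Suc N}. t_tendsto (?a i) (?A i) \<and> ?G i \<in> Psym j"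
      using IH(2) add(1,2) by (auto simp: le_Suc_eq)
    ultimately show ?case by (intro exI[of _ "Suc N"] exI[of _ ?a] exI[of _ ?G] exI[of _ ?A] conjI) auto
  qed
  then obtain N :: nat and a G A where N: "N \<ge> 1" "\<And>i. i \<in> {1..N} \<Longrightarrow> t_tendsto (a i) (A i) \<and> G i \<in> Psym j"
      "\<forall>\<^sub>F m in sequentially. f m = (\<Sum>i=1..N. pconst (a i m) * Pi_inf m (G i))"
      "L = (\<lambda>\<mu>. \<Sum>i=1..N. A i * G i \<mu>)" by blast
  obtain k0 where k0: "\<And>m. m \<ge> k0 \<Longrightarrow> f m = (\<Sum>i=1..N. pconst (a i m) * Pi_inf m (G i))"
    using N(3) unfolding eventually_sequentially by blast
  have "represents k0 (\<lambda>m. 0) (\<lambda>m. 0)" using represents_Pi_inf[OF Pinf_0] by (simp add: Pi_inf_0)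
  moreover have "represents k0 (\<lambda>m. Pi_inf m (G i)) (G i) \<and> G i \<in> Pas \<and> t_tendsto (a i) (A i)" if "i \<in> {1..N}" for i
    using N(2)[OF that] represents_Pi_inf Psym_Pinf by (auto simp: Pas_def)
  ultimately show ?thesis unfolding pol_tendsto_def using N(1) k0
    by (intro exI[of _ k0] exI[of _ N] exI[of _ "\<lambda>m. 0"] exI[of _ "\<lambda>i m. Pi_inf m (G i)"] exI[of _ a]
        exI[of _ "\<lambda>m. 0"] exI[of _ G] exI[of _ A] conjI) (auto simp: N(4))
qed

lemma sym_conv_unique: "sym_conv j f L \<Longrightarrow> sym_conv l f M \<Longrightarrow> L = M"
  using pol_lim_eqI[OF sym_conv_pol_tendsto] by metis

text \<open>Linear operators are applied component by component; convergent coefficients are carried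
  along. The theorem compares the values of one family on a convergent sequence with those of
  another family on the truncations of its limit, which is why two families appear.\<close>

lemma sym_conv_map2:
  assumes f: "sym_conv j f L"
    and R: "\<And>m f g. R m (f + g) = R m f + R m g" "\<And>m c f. R m (pconst c * f) = pconst c * R m f"
    and R': "\<And>m f g. R' m (f + g) = R' m f + R' m g" "\<And>m c f. R' m (pconst c * f) = pconst c * R' m f"
    and lim: "\<And>G. G \<in> Psym j \<Longrightarrow>
      \<exists>M. sym_conv l (\<lambda>m. R m (Pi_inf m G)) M \<and> sym_conv l (\<lambda>m. R' m (Pi_inf m G)) M"
  shows "\<exists>M. sym_conv l (\<lambda>m. R m (f m)) M \<and> sym_conv l (\<lambda>m. R' m (Pi_inf m L)) M"
  using f
proof induction
  case (zero f)
  have "R m 0 = 0" "R' m 0 = 0" for m using R(2)[of m 0 0] R'(2)[of m 0 0] by simp_all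
  then have "sym_conv l (\<lambda>m. R m (f m)) (\<lambda>_. 0)" "sym_conv l (\<lambda>m. R' m (Pi_inf m (\<lambda>_. 0))) (\<lambda>_. 0)"
    using zero by (auto intro!: sym_conv.zero simp: Pi_inf_0 elim: eventually_mono)
  then show ?case by blast
next
  case (add a A G f L g)
  obtain M where M: "sym_conv l (\<lambda>m. R m (f m)) M" "sym_conv l (\<lambda>m. R' m (Pi_inf m L)) M" using add by blast
  obtain M' where M': "sym_conv l (\<lambda>m. R m (Pi_inf m G)) M'" "sym_conv l (\<lambda>m. R' m (Pi_inf m G)) M'"
    using lim[OF add(2)] by blast
  have "sym_conv l (\<lambda>m. pconst (a m) * R m (Pi_inf m G) + R m (f m)) (\<lambda>\<mu>. A * M' \<mu> + M \<mu>)"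
    by (intro sym_conv_add sym_conv_scale add M M')
  then have "sym_conv l (\<lambda>m. R m (g m)) (\<lambda>\<mu>. A * M' \<mu> + M \<mu>)"
  proof (rule sym_conv_cong)
    show "\<forall>\<^sub>F m in sequentially. pconst (a m) * R m (Pi_inf m G) + R m (f m) = R m (g m)"
      using add(4) by eventually_elim (simp add: R)
  qed
  moreover have "sym_conv l (\<lambda>m. pconst A * R' m (Pi_inf m G) + R' m (Pi_inf m L)) (\<lambda>\<mu>. A * M' \<mu> + M \<mu>)"
    by (intro sym_conv_add sym_conv_scale t_tendsto_const M M')
  moreover have "Pi_inf m (\<lambda>\<mu>. A * G \<mu> + L \<mu>) = pconst A * Pi_inf m G + Pi_inf m L" for m
    using sym_conv_Psym[OF add(3)] add(2) by (intro Pi_inf_lincomb Psym_Pinf)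
  ultimately show ?case by (intro exI[of _ "\<lambda>\<mu>. A * M' \<mu> + M \<mu>"]) (simp add: R')
qed

lemma sym_conv_map:
  assumes f: "sym_conv j f L"
    and R: "\<And>m f g. R m (f + g) = R m f + R m g" "\<And>m c f. R m (pconst c * f) = pconst c * R m f"
    and lim: "\<And>G. G \<in> Psym j \<Longrightarrow> \<exists>M. sym_conv l (\<lambda>m. R m (Pi_inf m G)) M"
  shows "\<exists>M. sym_conv l (\<lambda>m. R m (f m)) M"
proof -
  have "\<exists>M. sym_conv l (\<lambda>m. R m (f m)) M \<and> sym_conv l (\<lambda>m. R m (Pi_inf m L)) M"
    by (rule sym_conv_map2[where R = R and R' = R, OF f R R]) (use lim in blast)
  then show ?thesis by blast
qed

section \<open>Stable sequences of polynomials\<close>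

definition deg_le :: "nat \<Rightarrow> pol \<Rightarrow> bool" where
  "deg_le d f \<longleftrightarrow> (\<forall>m\<in>keys f. total_degree m \<le> d)"

lemma deg_le_mono: "deg_le d f \<Longrightarrow> d \<le> e \<Longrightarrow> deg_le e f"
  by (auto simp: deg_le_def)
lemma deg_le_add: "deg_le d f \<Longrightarrow> deg_le d g \<Longrightarrow> deg_le d (f + g)"
  using keys_add[of f g] by (auto simp: deg_le_def)
lemma deg_le_diff: "deg_le d f \<Longrightarrow> deg_le d g \<Longrightarrow> deg_le d (f - g)"
  using keys_diff_subset[of f g] by (auto simp: deg_le_def)
lemma deg_le_pconst_mult: "deg_le d f \<Longrightarrow> deg_le d (pconst c * f)"
  using keys_pconst_mult[of c f] by (auto simp: deg_le_def)
lemma deg_le_0 [simp]: "deg_le d 0" by (simp add: deg_le_def)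
lemma deg_le_1 [simp]: "deg_le d 1" by (simp add: deg_le_def total_degree_def)
lemma deg_le_var [simp]: "deg_le (Suc 0) (var i)"
  by (simp add: deg_le_def var_def xmon_def total_degree_single)
lemma deg_le_mult:
  assumes "deg_le a f" "deg_le b g" shows "deg_le (a + b) (f * g)"
  unfolding deg_le_def
proof
  fix m assume "m \<in> keys (f * g)"
  then obtain x y where "x \<in> keys f" "y \<in> keys g" "m = x + y" using keys_mult[of f g] by blast
  then show "total_degree m \<le> a + b" using assms by (auto simp: deg_le_def total_degree_add intro: add_mono)
qed
lemma deg_le_power: "deg_le 1 f \<Longrightarrow> deg_le n (f ^ n)"
proof (induction n)
  case (Suc n)
  then show ?case using deg_le_mult[of 1 f n "f ^ n"] by simp
qed simp
lemma deg_le_sum: "(\<And>x. x \<in> A \<Longrightarrow> deg_le d (f x)) \<Longrightarrow> deg_le d (sum f A)"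
  by (induction A rule: infinite_finite_induct) (auto intro: deg_le_add)
lemma deg_le_prod: "(\<And>x. x \<in> A \<Longrightarrow> deg_le (e x) (f x)) \<Longrightarrow> deg_le (sum e A) (prod f A)"
  by (induction A rule: infinite_finite_induct) (auto intro: deg_le_mult)

lemma deg_le_psubst:
  assumes "\<And>i. deg_le 1 (\<sigma> i)" "deg_le d f" shows "deg_le d (psubst \<sigma> f)"
  unfolding psubst_def
proof (intro deg_le_sum deg_le_pconst_mult)
  fix m assume "m \<in> keys f"
  have "deg_le (total_degree m) (\<Prod>i\<in>keys m. \<sigma> i ^ lookup m i)"
    unfolding total_degree_def using assms(1) by (intro deg_le_prod deg_le_power)
  moreover have "total_degree m \<le> d" using assms(2) \<open>m \<in> keys f\<close> by (auto simp: deg_le_def)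
  ultimately show "deg_le d (\<Prod>i\<in>keys m. \<sigma> i ^ lookup m i)" by (rule deg_le_mono)
qed

lemma deg_le_omega_inv: "deg_le d f \<Longrightarrow> deg_le d (omega_inv k f)"
  unfolding omega_inv_def by (rule deg_le_psubst) (auto intro: deg_le_pconst_mult)
lemma deg_le_pi_pol: "deg_le d f \<Longrightarrow> deg_le d (pi_pol k f)"
  unfolding pi_pol_def by (rule deg_le_psubst) auto

lemma total_degree_expo_string:
  assumes "\<kappa> \<in> expo_string i \<nu>" shows "total_degree \<kappa> = total_degree \<nu>"
proof -
  let ?A = "insert i (insert (Suc i) (keys \<kappa> \<union> keys \<nu> - {i, Suc i}))"
  have "total_degree m = lookup m i + lookup m (Suc i) + (\<Sum>j\<in>keys \<kappa> \<union> keys \<nu> - {i, Suc i}. lookup m j)"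
    if "keys m \<subseteq> keys \<kappa> \<union> keys \<nu>" for m
  proof -
    have "total_degree m = (\<Sum>j\<in>?A. lookup m j)" using that by (intro total_degree_superset) auto
    also have "\<dots> = lookup m i + (lookup m (Suc i) + (\<Sum>j\<in>keys \<kappa> \<union> keys \<nu> - {i, Suc i}. lookup m j))"
      by (subst sum.insert, simp, simp, subst sum.insert) auto
    finally show ?thesis by simp
  qed
  moreover have "(\<Sum>j\<in>keys \<kappa> \<union> keys \<nu> - {i, Suc i}. lookup \<kappa> j) = (\<Sum>j\<in>keys \<kappa> \<union> keys \<nu> - {i, Suc i}. lookup \<nu> j)"
    using assms by (intro sum.cong) (auto simp: expo_string_def)
  ultimately show ?thesis using assms by (simp add: expo_string_def)
qed

lemma deg_le_T_op:
  assumes "deg_le d f" shows "deg_le d (T_op i f)"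
  unfolding deg_le_def
proof
  fix \<kappa> assume "\<kappa> \<in> keys (T_op i f)"
  then obtain \<nu> where "\<nu> \<in> keys f" "\<kappa> \<in> expo_string i \<nu>" using keys_T_op by blast
  then show "total_degree \<kappa> \<le> d" using assms total_degree_expo_string by (auto simp: deg_le_def)
qed

lemma deg_le_T_up: "deg_le d f \<Longrightarrow> deg_le d (T_up a b f)"
  by (rule T_up_induct) (auto intro: deg_le_T_op)

lemma deg_le_var_mult: "deg_le d f \<Longrightarrow> deg_le (Suc d) (var i * f)"
  using deg_le_mult[of "Suc 0" "var i" d f] by simp

lemma deg_le_var_mult_cancel:
  assumes "deg_le d (var j * g)" shows "deg_le d g"
  unfolding deg_le_def
proof
  fix m assume m: "m \<in> keys g"
  have "single j 1 + m \<in> keys (var j * g)"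
    using m lookup_single_mult[of "single j 1" g m] by (simp add: in_keys_iff var_def xmon_def)
  then have "total_degree (single j 1 + m) \<le> d" using assms by (auto simp: deg_le_def)
  then show "total_degree m \<le> d" by (simp add: total_degree_add)
qed

text \<open>The conditions under which the m-th and the next term are truncations of a common series
  that is symmetric in the variables after the j-th. Symmetry is expressed by the operators
  \<open>T\<^sub>i\<close> because these have simple relations with the operators that are applied to such
  sequences.\<close>

definition stable_at :: "nat \<Rightarrow> nat \<Rightarrow> (nat \<Rightarrow> pol) \<Rightarrow> nat \<Rightarrow> bool" where
  "stable_at j d h m \<longleftrightarrow> h m \<in> Pol m \<and> deg_le d (h m) \<and> pi_pol (Suc m) (h (Suc m)) = h m \<and>
     (\<forall>i. j < i \<longrightarrow> i < m \<longrightarrow> T_op i (h m) = h m)"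

definition stable_seq :: "nat \<Rightarrow> (nat \<Rightarrow> pol) \<Rightarrow> bool" where
  "stable_seq j h \<longleftrightarrow> (\<exists>k0 d. \<forall>m\<ge>k0. stable_at j d h m)"

lemma stableI: "(\<And>m. m \<ge> k0 \<Longrightarrow> stable_at j d h m) \<Longrightarrow> stable_seq j h"
  unfolding stable_seq_def by blast

lemma stable_Pi_inf:
  assumes "G \<in> Psym j" shows "stable_seq j (\<lambda>m. Pi_inf m G)"
proof -
  have P: "G \<in> Pinf" using assms by (rule Psym_Pinf)
  then obtain d where d: "\<And>m. G m \<noteq> 0 \<Longrightarrow> total_degree m \<le> d" by (auto simp: Pinf_def)
  have "stable_at j d (\<lambda>m. Pi_inf m G) m" for m
    unfolding stable_at_def
  proof (intro conjI allI impI)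
    show "Pi_inf m G \<in> Pol m" using P by (rule Pi_inf_in_Pol)
    show "deg_le d (Pi_inf m G)" using d by (auto simp: deg_le_def in_keys_iff lookup_Pi_inf[OF P] split: if_splits)
    show "pi_pol (Suc m) (Pi_inf (Suc m) G) = Pi_inf m G" using pi_pol_Pi_inf[OF P, of "Suc m"] by simp
    fix i assume i: "j < i" "i < m"
    have G: "G (swap_expo i n) = G n" for n
      using assms i(1) by (auto simp: Psym_def swap_series_def fun_eq_iff)
    have L: "swap_expo i n \<in> Lambda m \<longleftrightarrow> n \<in> Lambda m" for n
      using swap_expo_in_Lambda[of i m n] swap_expo_in_Lambda[of i m "swap_expo i n"] i by auto
    show "T_op i (Pi_inf m G) = Pi_inf m G"
      unfolding T_op_fix_iff by (rule poly_mapping_eqI) (simp add: lookup_swap_pol lookup_Pi_inf[OF P] G L)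
  qed
  then show ?thesis by (intro stableI)
qed

text \<open>The coefficient of a monomial no longer changes once all its variables are available, and
  these coefficients form the series.\<close>

lemma stable_glue:
  assumes "stable_seq j h" shows "\<exists>G\<in>Psym j. \<forall>\<^sub>F m in sequentially. Pi_inf m G = h m"
proof -
  obtain k0 d where "\<And>m. m \<ge> k0 \<Longrightarrow> stable_at j d h m" using assms unfolding stable_seq_def by blast
  then have Pol: "\<And>m. m \<ge> k0 \<Longrightarrow> h m \<in> Pol m" and deg: "\<And>m. m \<ge> k0 \<Longrightarrow> deg_le d (h m)"
    and pi: "\<And>m. m \<ge> k0 \<Longrightarrow> pi_pol (Suc m) (h (Suc m)) = h m"
    and sym: "\<And>m i. m \<ge> k0 \<Longrightarrow> j < i \<Longrightarrow> i < m \<Longrightarrow> swap_pol i (h m) = h m"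
    by (auto simp: stable_at_def T_op_fix_iff)
  define N where "N \<mu> = k0 + Poly_Mapping.degree \<mu>" for \<mu> :: expo
  define G where "G \<mu> = (if 0 \<in> keys \<mu> then 0 else lookup (h (N \<mu>)) \<mu>)" for \<mu>
  have LN: "\<mu> \<in> Lambda m" if "0 \<notin> keys \<mu>" "N \<mu> \<le> m" for \<mu> m
    unfolding Lambda_def
  proof safe
    fix i assume i: "i \<in> keys \<mu>"
    then have "i < Poly_Mapping.degree \<mu>" by (rule in_keys_less_degree)
    moreover have "i \<noteq> 0" using i that(1) by metis
    ultimately show "i \<in> {1..m}" using that(2) by (auto simp: N_def)
  qed
  have stepwise: "lookup (h n) \<mu> = lookup (h m) \<mu>" if "k0 \<le> m" "m \<le> n" "\<mu> \<in> Lambda m" for m n \<mu>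
    using that(2)
  proof (induction rule: dec_induct)
    case (step n)
    have "lookup \<mu> (Suc n) = 0" using Lambda_lookup_0[OF that(3)] step by simp
    then have "lookup (h (Suc n)) \<mu> = lookup (pi_pol (Suc n) (h (Suc n))) \<mu>" by (simp add: lookup_pi_pol)
    then show ?case using pi[of n] step that(1) by simp
  qed simp
  have G_eq: "G \<mu> = lookup (h m) \<mu>" if "k0 \<le> m" "\<mu> \<in> Lambda m" for m \<mu>
  proof -
    have 0: "0 \<notin> keys \<mu>" using that(2) by (auto simp: Lambda_def)
    let ?M = "max m (N \<mu>)"
    have "lookup (h ?M) \<mu> = lookup (h m) \<mu>" using that by (intro stepwise) auto
    moreover have "lookup (h ?M) \<mu> = lookup (h (N \<mu>)) \<mu>" using 0 by (intro stepwise LN) (auto simp: N_def)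
    ultimately show ?thesis using 0 by (simp add: G_def)
  qed
  have "keys \<mu> \<subseteq> {1..} \<and> total_degree \<mu> \<le> d" if "G \<mu> \<noteq> 0" for \<mu>
  proof
    have 0: "0 \<notin> keys \<mu>" using that by (auto simp: G_def)
    then show "keys \<mu> \<subseteq> {1..}" using LN[OF 0 order_refl] by (auto simp: Lambda_def)
    have "\<mu> \<in> keys (h (N \<mu>))" using that 0 by (simp add: G_def in_keys_iff)
    then show "total_degree \<mu> \<le> d" using deg[of "N \<mu>"] by (auto simp: deg_le_def N_def)
  qed
  then have P: "G \<in> Pinf" unfolding Pinf_def by blast
  have "swap_series i G = G" if i: "i > j" for i
  proof
    fix \<mu>
    show "swap_series i G \<mu> = G \<mu>"
    proof (cases "0 \<in> keys \<mu>")
      case True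
      have "lookup (swap_expo i \<mu>) 0 = lookup \<mu> 0" using i by (simp add: lookup_swap_expo)
      then show ?thesis using True by (simp add: swap_series_def G_def in_keys_iff)
    next
      case False
      define m where "m = max (N \<mu>) (Suc i)"
      have L: "\<mu> \<in> Lambda m" using False by (intro LN) (auto simp: m_def)
      have m: "k0 \<le> m" "i < m" "1 \<le> i" using i by (auto simp: m_def N_def)
      have "G (swap_expo i \<mu>) = lookup (h m) (swap_expo i \<mu>)"
        using m L by (intro G_eq swap_expo_in_Lambda)
      also have "\<dots> = lookup (swap_pol i (h m)) \<mu>" by (simp add: lookup_swap_pol)
      also have "\<dots> = G \<mu>" using sym[OF m(1) i m(2)] G_eq[OF m(1) L] by simp
      finally show ?thesis by (simp add: swap_series_def)
    qed
  qed
  then have "G \<in> Psym j" using P by (simp add: Psym_def)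
  moreover have "Pi_inf m G = h m" if "k0 \<le> m" for m
  proof (rule poly_mapping_eqI)
    fix \<mu> show "lookup (Pi_inf m G) \<mu> = lookup (h m) \<mu>"
    proof (cases "\<mu> \<in> Lambda m")
      case True then show ?thesis using G_eq[OF that] by (simp add: lookup_Pi_inf[OF P])
    next
      case False
      then have "\<mu> \<notin> keys (h m)" using Pol[OF that] by (auto simp: Pol_def)
      then show ?thesis using False by (simp add: lookup_Pi_inf[OF P] in_keys_iff)
    qed
  qed
  then have "\<forall>\<^sub>F m in sequentially. Pi_inf m G = h m" unfolding eventually_sequentially by blast
  ultimately show ?thesis by blast
qed

lemma stable_sym_conv: "stable_seq j h \<Longrightarrow> \<exists>L. sym_conv j h L"
  using stable_glue sym_conv_cong[OF sym_conv_Pi_inf] by blast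

lemma stable_add:
  assumes "stable_seq j f" "stable_seq j g" shows "stable_seq j (\<lambda>m. f m + g m)"
proof -
  obtain k0 d where f: "\<And>m. m \<ge> k0 \<Longrightarrow> stable_at j d f m" using assms(1) unfolding stable_seq_def by blast
  obtain k1 e where g: "\<And>m. m \<ge> k1 \<Longrightarrow> stable_at j e g m" using assms(2) unfolding stable_seq_def by blast
  have "stable_at j (d + e) (\<lambda>m. f m + g m) m" if "m \<ge> max k0 k1" for m
    using f[of m] g[of m] that deg_le_add[OF deg_le_mono[of d "f m" "d + e"] deg_le_mono[of e "g m" "d + e"]]
    by (auto simp: stable_at_def pi_pol_add T_op_add intro: Pol_add)
  then show ?thesis by (rule stableI)
qed

lemma stable_pconst:
  assumes "stable_seq j f" shows "stable_seq j (\<lambda>m. pconst c * f m)"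
proof -
  obtain k0 d where f: "\<And>m. m \<ge> k0 \<Longrightarrow> stable_at j d f m" using assms(1) unfolding stable_seq_def by blast
  have "stable_at j d (\<lambda>m. pconst c * f m) m" if "m \<ge> k0" for m
    using f[OF that] by (auto simp: stable_at_def pi_pol_mult T_op_pconst intro: Pol_mult deg_le_pconst_mult)
  then show ?thesis by (rule stableI)
qed

lemma stable_diff: "stable_seq j f \<Longrightarrow> stable_seq j g \<Longrightarrow> stable_seq j (\<lambda>m. f m - g m)"
  using stable_add[of j f "\<lambda>m. pconst (- 1) * g m"] stable_pconst[of j g "- 1"]
  by (simp add: pconst_uminus)

lemma pi_pol_swap: "n \<noteq> i \<Longrightarrow> n \<noteq> Suc i \<Longrightarrow> pi_pol n (swap_pol i f) = swap_pol i (pi_pol n f)"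
  by (rule poly_mapping_eqI) (simp add: lookup_pi_pol lookup_swap_pol lookup_swap_expo)

lemma pi_pol_T_op: "n \<noteq> i \<Longrightarrow> n \<noteq> Suc i \<Longrightarrow> pi_pol n (T_op i f) = T_op i (pi_pol n f)"
  unfolding pi_pol_def by (rule psubst_T_op) (auto simp: pi_pol_swap pi_pol_var simp flip: pi_pol_def)

lemma pi_pol_T_up: "b < n \<Longrightarrow> pi_pol n (T_up a b f) = T_up a b (pi_pol n f)"
  using T_up_hom[of a b "pi_pol n" 0 f] by (simp add: pi_pol_T_op)

lemma stable_T_op:
  assumes "stable_seq j h" "1 \<le> i" "i < j" shows "stable_seq j (\<lambda>m. T_op i (h m))"
proof -
  obtain k0 d where h: "\<And>m. m \<ge> k0 \<Longrightarrow> stable_at j d h m" using assms(1) unfolding stable_seq_def by blast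
  have "stable_at j d (\<lambda>m. T_op i (h m)) m" if "m \<ge> k0 + j" for m
    unfolding stable_at_def
  proof (intro conjI allI impI)
    have hm: "stable_at j d h m" using h that by simp
    show "T_op i (h m) \<in> Pol m" using hm assms that by (intro T_op_in_Pol) (auto simp: stable_at_def)
    show "deg_le d (T_op i (h m))" using hm by (intro deg_le_T_op) (auto simp: stable_at_def)
    show "pi_pol (Suc m) (T_op i (h (Suc m))) = T_op i (h m)"
      using hm assms that by (simp add: pi_pol_T_op stable_at_def)
    fix l assume "j < l" "l < m"
    then show "T_op l (T_op i (h m)) = T_op i (h m)"
      using hm assms T_op_commute[of l i "h m"] by (simp add: stable_at_def)
  qed
  then show ?thesis by (rule stableI)
qed

lemma stable_T_inv: "stable_seq j h \<Longrightarrow> 1 \<le> i \<Longrightarrow> i < j \<Longrightarrow> stable_seq j (\<lambda>m. T_inv i (h m))"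
  unfolding T_inv_def by (intro stable_pconst stable_diff stable_T_op)

lemma stable_T_up:
  assumes "stable_seq j h" "1 \<le> a" "b \<le> j" shows "stable_seq j (\<lambda>m. T_up a b (h m))"
  using assms(3)
proof (induction b)
  case (Suc b)
  then show ?case using assms stable_T_op[of j "\<lambda>m. T_up a b (h m)" b]
    by (cases "a \<le> b") (auto simp: T_up_Suc)
qed (simp add: assms)

lemma stable_T_dn:
  assumes "stable_seq j h" "1 \<le> a" "b \<le> j" shows "stable_seq j (\<lambda>m. T_dn a b (h m))"
  using assms(3)
proof (induction b)
  case (Suc b)
  then show ?case using assms stable_T_inv[of j "\<lambda>m. T_dn a b (h m)" b]
    by (cases "a \<le> b") (auto simp: T_dn_Suc)
qed (simp add: assms)

lemma stable_var_mult:
  assumes "stable_seq j h" "1 \<le> i" "i \<le> j" shows "stable_seq j (\<lambda>m. var i * h m)"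
proof -
  obtain k0 d where h: "\<And>m. m \<ge> k0 \<Longrightarrow> stable_at j d h m" using assms(1) unfolding stable_seq_def by blast
  have "stable_at j (Suc d) (\<lambda>m. var i * h m) m" if "m \<ge> k0 + j" for m
    using h[of m] assms that
    by (auto simp: stable_at_def pi_pol_mult pi_pol_var T_op_var_other intro!: Pol_mult Pol_var deg_le_var_mult)
  then show ?thesis by (rule stableI)
qed

lemma stable_pi_pol_1:
  assumes "stable_seq j h" "1 \<le> j" shows "stable_seq j (\<lambda>m. pi_pol 1 (h m))"
proof -
  obtain k0 d where h: "\<And>m. m \<ge> k0 \<Longrightarrow> stable_at j d h m" using assms(1) unfolding stable_seq_def by blast
  have "stable_at j d (\<lambda>m. pi_pol 1 (h m)) m" if "m \<ge> k0 + 1" for m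
    unfolding stable_at_def
  proof (intro conjI allI impI)
    have hm: "stable_at j d h m" using h that by simp
    show "pi_pol 1 (h m) \<in> Pol m" using hm unfolding pi_pol_def stable_at_def
      by (intro psubst_in_Pol[of _ m]) (auto intro: Pol_var)
    show "deg_le d (pi_pol 1 (h m))" using hm by (intro deg_le_pi_pol) (simp add: stable_at_def)
    have "pi_pol (Suc m) (pi_pol 1 f) = pi_pol 1 (pi_pol (Suc m) f)" for f
      by (rule poly_mapping_eqI) (simp add: lookup_pi_pol)
    then show "pi_pol (Suc m) (pi_pol 1 (h (Suc m))) = pi_pol 1 (h m)" using hm by (simp add: stable_at_def)
    fix l assume "j < l" "l < m"
    then show "T_op l (pi_pol 1 (h m)) = pi_pol 1 (h m)"
      using hm assms(2) pi_pol_T_op[of 1 l "h m"] by (simp add: stable_at_def)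
  qed
  then show ?thesis by (rule stableI)
qed

subsection \<open>Rotation of the variables\<close>

lemma pi_pol_omega_inv:
  assumes "g \<in> Pol (Suc m)" "1 \<le> m"
  shows "pi_pol (Suc m) (omega_inv (Suc m) g) = omega_inv m (pi_pol (Suc m) (swap_pol m g))"
  unfolding pi_pol_def omega_inv_def swap_pol_def psubst_psubst
  by (rule psubst_cong_Pol[OF assms(1)]) (use assms(2) in \<open>auto simp: transpose_def psubst_simps\<close>)

text \<open>At \<open>x\<^sub>m\<^sub>+\<^sub>1 = 0\<close> the identity for \<open>s\<^sub>m T\<^sub>m\<close> loses the term with \<open>s\<^sub>m f\<close>. In the passage
  from m to m+1 variables this cancels the additional factor \<open>T\<^sub>m\<close>.\<close>

lemma pi_pol_swap_T_op: "pi_pol (Suc m) (swap_pol m (T_op m f)) = pi_pol (Suc m) f"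
proof -
  have "pi_pol (Suc m) ((var m - var (Suc m)) * swap_pol m (T_op m f)) =
    pi_pol (Suc m) ((var m - pconst t_par * var (Suc m)) * f - pconst (1 - t_par) * var (Suc m) * swap_pol m f)"
    by (simp only: swap_T_op)
  then have "var m * pi_pol (Suc m) (swap_pol m (T_op m f)) = var m * pi_pol (Suc m) f"
    by (simp add: pi_pol_mult pi_pol_diff pi_pol_var)
  then show ?thesis by simp
qed

lemma stable_omega_inv:
  assumes "stable_seq j h" shows "stable_seq (Suc j) (\<lambda>m. omega_inv m (h m))"
proof -
  obtain k0 d where h: "\<And>m. m \<ge> k0 \<Longrightarrow> stable_at j d h m" using assms(1) unfolding stable_seq_def by blast
  have "stable_at (Suc j) d (\<lambda>m. omega_inv m (h m)) m" if m: "m \<ge> k0 + j + 1" for m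
    unfolding stable_at_def
  proof (intro conjI allI impI)
    have hm: "stable_at j d h m" "stable_at j d h (Suc m)" using h m by simp_all
    show "omega_inv m (h m) \<in> Pol m" using hm m by (intro omega_inv_in_Pol) (auto simp: stable_at_def)
    show "deg_le d (omega_inv m (h m))" using hm by (intro deg_le_omega_inv) (simp add: stable_at_def)
    have "swap_pol m (h (Suc m)) = h (Suc m)" using hm(2) m by (simp add: stable_at_def flip: T_op_fix_iff)
    then show "pi_pol (Suc m) (omega_inv (Suc m) (h (Suc m))) = omega_inv m (h m)"
      using hm m by (subst pi_pol_omega_inv) (auto simp: stable_at_def)
    fix l assume l: "Suc j < l" "l < m"
    then show "T_op l (omega_inv m (h m)) = omega_inv m (h m)"
      using hm omega_inv_T_op[of "l - 1" m "h m"] by (simp add: stable_at_def)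
  qed
  then show ?thesis by (rule stableI)
qed

text \<open>In m+1 variables there is one more factor \<open>T\<^sub>m\<close>, which disappears when the last variable
  of the rotated polynomial is set to zero.\<close>

lemma stable_omega_inv_T_up:
  assumes "stable_seq j h" "1 \<le> j" shows "stable_seq j (\<lambda>m. omega_inv m (T_up j m (h m)))"
proof -
  obtain k0 d where h: "\<And>m. m \<ge> k0 \<Longrightarrow> stable_at j d h m" using assms(1) unfolding stable_seq_def by blast
  have "stable_at j d (\<lambda>m. omega_inv m (T_up j m (h m))) m" if m: "m \<ge> k0 + j + 1" for m
    unfolding stable_at_def
  proof (intro conjI allI impI)
    have hm: "stable_at j d h m" "stable_at j d h (Suc m)" using h m by simp_all
    show "omega_inv m (T_up j m (h m)) \<in> Pol m"
      using hm m assms(2) by (intro omega_inv_in_Pol T_up_in_Pol) (auto simp: stable_at_def)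
    show "deg_le d (omega_inv m (T_up j m (h m)))"
      using hm by (intro deg_le_omega_inv deg_le_T_up) (simp add: stable_at_def)
    have P: "T_up j (Suc m) (h (Suc m)) \<in> Pol (Suc m)"
      using hm(2) m assms(2) by (intro T_up_in_Pol) (auto simp: stable_at_def)
    show "pi_pol (Suc m) (omega_inv (Suc m) (T_up j (Suc m) (h (Suc m)))) = omega_inv m (T_up j m (h m))"
      using hm(1) m pi_pol_omega_inv[OF P]
      by (simp add: T_up_Suc pi_pol_swap_T_op pi_pol_T_up stable_at_def)
    fix l assume l: "j < l" "l < m"
    have "T_op l (omega_inv m (T_up j m (h m))) = omega_inv m (T_op (l - 1) (T_up j m (h m)))"
      using omega_inv_T_op[of "l - 1" m "T_up j m (h m)"] l assms(2) by simp
    also have "T_op (l - 1) (T_up j m (h m)) = T_up j m (h m)"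
      using T_op_T_up_inside[of j "l - 1" m "h m"] l hm(1) by (simp add: stable_at_def)
    finally show "T_op l (omega_inv m (T_up j m (h m))) = omega_inv m (T_up j m (h m))" .
  qed
  then show ?thesis by (rule stableI)
qed

subsection \<open>Deleting a variable\<close>

definition drop_var :: "nat \<Rightarrow> pol \<Rightarrow> pol" where
  "drop_var j = psubst (\<lambda>r. if r = j then 0 else if j < r then var (r - 1) else var r)"

lemma drop_var_simps:
  "drop_var j (f + g) = drop_var j f + drop_var j g" "drop_var j (f - g) = drop_var j f - drop_var j g"
  "drop_var j (f * g) = drop_var j f * drop_var j g" "drop_var j (pconst c) = pconst c"
  "drop_var j (var r) = (if r = j then 0 else if j < r then var (r - 1) else var r)"
  by (simp_all add: drop_var_def psubst_simps)

lemma drop_var_swap: "drop_var (Suc l) (swap_pol l f) = drop_var l f"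
  unfolding drop_var_def swap_pol_def psubst_psubst
  by (rule arg_cong[where f = "\<lambda>\<sigma>. psubst \<sigma> f"]) (auto simp: transpose_def)

lemma swap_drop_var: "j \<le> l \<Longrightarrow> drop_var j (swap_pol (Suc l) f) = swap_pol l (drop_var j f)"
  unfolding drop_var_def swap_pol_def psubst_psubst
  by (intro arg_cong[where f = "\<lambda>\<sigma>. psubst \<sigma> f"] ext) (auto simp: transpose_def psubst_simps)

lemma drop_var_T_op: "j \<le> l \<Longrightarrow> drop_var j (T_op (Suc l) f) = T_op l (drop_var j f)"
  unfolding drop_var_def by (rule psubst_T_op) (auto simp: swap_drop_var drop_var_simps simp flip: drop_var_def)

lemma pi_pol_drop_var: "j \<le> n \<Longrightarrow> pi_pol n (drop_var j f) = drop_var j (pi_pol (Suc n) f)"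
  unfolding drop_var_def pi_pol_def psubst_psubst
  by (intro arg_cong[where f = "\<lambda>\<sigma>. psubst \<sigma> f"] ext) (auto simp: psubst_simps)

lemma drop_var_last: "f \<in> Pol n \<Longrightarrow> drop_var n f = pi_pol n f"
  unfolding drop_var_def pi_pol_def by (rule psubst_cong_Pol) auto

lemma drop_var_sym:
  assumes "f \<in> Pol n" "j \<le> n" "\<And>l. j \<le> l \<Longrightarrow> l < n \<Longrightarrow> swap_pol l f = f"
  shows "drop_var j f = pi_pol n f"
  using assms(2,3)
proof (induction rule: inc_induct)
  case base show ?case using assms(1) by (rule drop_var_last)
next
  case (step l)
  then show ?case using drop_var_swap[of l f] by simp
qed

lemma drop_var_in_Pol: "f \<in> Pol (Suc m) \<Longrightarrow> j \<le> Suc m \<Longrightarrow> 1 \<le> j \<Longrightarrow> drop_var j f \<in> Pol m"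
  unfolding drop_var_def by (erule psubst_in_Pol) (auto intro!: Pol_var)

lemma deg_le_drop_var: "deg_le d f \<Longrightarrow> deg_le d (drop_var j f)"
  unfolding drop_var_def by (rule deg_le_psubst) auto

lemma drop_var_eq_0: 
  assumes "drop_var j f = 0" shows "\<exists>g. f = var j * g"
proof -
  let ?u = "psubst (\<lambda>r. if r < j then var r else var (Suc r))"
  have "?u (drop_var j f) = pi_pol j f"
    unfolding drop_var_def pi_pol_def psubst_psubst
    by (intro arg_cong[where f = "\<lambda>\<sigma>. psubst \<sigma> f"] ext) (auto simp: psubst_simps)
  then have "pi_pol j f = 0" using assms by simp
  then show ?thesis using pi_pol_decomp[of f j] by simp
qed

lemma drop_var_T_op_same:
  "drop_var (Suc i) (T_op i f) = pconst t_par * drop_var i f + pconst (1 - t_par) * drop_var (Suc i) f"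
proof -
  have "drop_var (Suc i) ((var i - var (Suc i)) * T_op i f) =
    drop_var (Suc i) (pconst (1 - t_par) * var i * f + (pconst t_par * var i - var (Suc i)) * swap_pol i f)"
    by (simp only: T_op_char)
  then have "var i * drop_var (Suc i) (T_op i f) =
    var i * (pconst t_par * drop_var i f + pconst (1 - t_par) * drop_var (Suc i) f)"
    by (simp add: drop_var_simps drop_var_swap algebra_simps)
  then show ?thesis by simp
qed

text \<open>The first summand is obtained by deleting the j-th variable, which makes the sequence
  symmetric from that place on. Deleting the variable a second time does not distinguish it from
  the original sequence, by symmetry, so the difference is divisible by the variable.\<close>

lemma stable_decomp:
  assumes "stable_seq j h" "1 \<le> j"
  obtains F g where "stable_seq (j - 1) F" "stable_seq j g" "\<forall>\<^sub>F m in sequentially. h m = F m + var j * g m"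
proof -
  obtain k0 d where h: "\<And>m. m \<ge> k0 \<Longrightarrow> stable_at j d h m" using assms(1) unfolding stable_seq_def by blast
  then have hP: "\<And>m. m \<ge> k0 \<Longrightarrow> h m \<in> Pol m" and hd: "\<And>m. m \<ge> k0 \<Longrightarrow> deg_le d (h m)"
    and hpi: "\<And>m. m \<ge> k0 \<Longrightarrow> pi_pol (Suc m) (h (Suc m)) = h m"
    and hT: "\<And>m i. m \<ge> k0 \<Longrightarrow> j < i \<Longrightarrow> i < m \<Longrightarrow> T_op i (h m) = h m"
    by (auto simp: stable_at_def)
  define F where "F m = drop_var j (h (Suc m))" for m
  have F: "stable_at (j - 1) d F m" if m: "m \<ge> k0 + j" for m
    unfolding stable_at_def
  proof (intro conjI allI impI)
    show "F m \<in> Pol m" unfolding F_def using hP[of "Suc m"] m assms(2) by (intro drop_var_in_Pol) auto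
    show "deg_le d (F m)" unfolding F_def using hd[of "Suc m"] m by (intro deg_le_drop_var) auto
    show "pi_pol (Suc m) (F (Suc m)) = F m"
      unfolding F_def using hpi[of "Suc m"] m by (simp add: pi_pol_drop_var)
    fix i assume i: "j - 1 < i" "i < m"
    then show "T_op i (F m) = F m"
      unfolding F_def using hT[of "Suc m" "Suc i"] m drop_var_T_op[of j i "h (Suc m)"] by simp
  qed
  have ex: "\<exists>g. h m - F m = var j * g" if m: "m \<ge> k0 + j" for m
  proof (rule drop_var_eq_0)
    have "drop_var j (F m) = pi_pol m (F m)"
      using F[OF m] m assms(2) by (intro drop_var_sym) (auto simp: stable_at_def T_op_fix_iff)
    also have "\<dots> = drop_var j (pi_pol (Suc m) (h (Suc m)))"
      unfolding F_def using m by (intro pi_pol_drop_var) simp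
    also have "\<dots> = drop_var j (h m)" using hpi[of m] m by simp
    finally show "drop_var j (h m - F m) = 0" by (simp add: drop_var_simps)
  qed
  define g where "g m = (SOME g. h m - F m = var j * g)" for m
  have g: "h m - F m = var j * g m" if "m \<ge> k0 + j" for m
    unfolding g_def using ex[OF that] by (rule someI_ex)
  have "stable_at j d g m" if m: "m \<ge> k0 + j" for m
    unfolding stable_at_def
  proof (intro conjI allI impI)
    have Fm: "stable_at (j - 1) d F m" "stable_at (j - 1) d F (Suc m)" using F m by simp_all
    have "var j * g m \<in> Pol m"
      unfolding g[OF m, symmetric] using hP[of m] Fm m by (intro Pol_diff) (auto simp: stable_at_def)
    then show "g m \<in> Pol m" by (rule var_mult_in_Pol_cancel)
    have "deg_le d (var j * g m)"
      unfolding g[OF m, symmetric] using hd[of m] Fm m by (intro deg_le_diff) (auto simp: stable_at_def)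
    then show "deg_le d (g m)" by (rule deg_le_var_mult_cancel)
    have "var j * pi_pol (Suc m) (g (Suc m)) = pi_pol (Suc m) (var j * g (Suc m))"
      using m by (simp add: pi_pol_mult pi_pol_var)
    also have "\<dots> = pi_pol (Suc m) (h (Suc m) - F (Suc m))" using g[of "Suc m"] m by simp
    also have "\<dots> = var j * g m"
      using hpi[of m] Fm m by (simp add: pi_pol_diff stable_at_def flip: g)
    finally show "pi_pol (Suc m) (g (Suc m)) = g m" by simp
    fix i assume i: "j < i" "i < m"
    have "var j * T_op i (g m) = T_op i (h m - F m)"
      using i by (simp add: g[OF m] T_op_var_other)
    also have "\<dots> = var j * g m"
      using hT[of m i] Fm i m by (simp add: T_op_diff stable_at_def flip: g)
    finally show "T_op i (g m) = g m" by simp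
  qed
  then have "stable_seq j g" by (rule stableI)
  moreover have "stable_seq (j - 1) F" using F by (rule stableI)
  moreover have "\<forall>\<^sub>F m in sequentially. h m = F m + var j * g m"
    using eventually_ge_at_top[of "k0 + j"] by eventually_elim (simp flip: g)
  ultimately show ?thesis using that by blast
qed

subsection \<open>Partial symmetrization\<close>

text \<open>A partial symmetrizer: the sum of \<open>t\<^bsup>r-1-s\<^esup> T\<^bsub>j+s-1\<^esub> \<cdots> T\<^sub>j f\<close> over s < r. It makes a
  polynomial that is symmetric in the variables from j+1 to j+r-1 symmetric also in the j-th.\<close>

primrec hecke_sum :: "nat \<Rightarrow> nat \<Rightarrow> pol \<Rightarrow> pol" where
  "hecke_sum j 0 f = 0"
| "hecke_sum j (Suc r) f = T_up j (j + r) f + pconst t_par * hecke_sum j r f"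

lemma hecke_sum_add: "hecke_sum j r (f + g) = hecke_sum j r f + hecke_sum j r g"
  by (induction r) (simp_all add: T_up_add algebra_simps)
lemma hecke_sum_pconst: "hecke_sum j r (pconst c * f) = pconst c * hecke_sum j r f"
  by (induction r) (simp_all add: T_up_pconst distrib_left mult.left_commute)
lemma hecke_sum_in_Pol: "f \<in> Pol k \<Longrightarrow> 1 \<le> j \<Longrightarrow> j + r \<le> Suc k \<Longrightarrow> hecke_sum j r f \<in> Pol k"
  by (induction r) (auto intro!: Pol_add Pol_mult T_up_in_Pol)
lemma deg_le_hecke_sum: "deg_le d f \<Longrightarrow> deg_le d (hecke_sum j r f)"
  by (induction r) (auto intro!: deg_le_add deg_le_pconst_mult deg_le_T_up)
lemma pi_pol_hecke_sum: "j + r \<le> n \<Longrightarrow> pi_pol n (hecke_sum j r f) = hecke_sum j r (pi_pol n f)"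
  by (induction r) (simp_all add: pi_pol_add pi_pol_mult pi_pol_T_up)

lemma T_op_hecke_sum_far:
  assumes "j + r \<le> l" "T_op l f = f" shows "T_op l (hecke_sum j r f) = hecke_sum j r f"
  using assms(1)
proof (induction r)
  case (Suc r)
  then have "T_op l (T_up j (j + r) f) = T_up j (j + r) f"
    using T_op_T_up_far[of l j "j + r" f] assms(2) by simp
  then show ?case using Suc by (simp add: T_op_add T_op_pconst)
qed simp

text \<open>Two neighbouring summands combine to an element of the image of \<open>T\<^sub>l + t\<close>, on which \<open>T\<^sub>l\<close>
  is the identity by the quadratic relation; the other summands are fixed separately.\<close>

lemma T_op_hecke_sum_inside:
  assumes "\<And>i. j < i \<Longrightarrow> i < j + r \<Longrightarrow> T_op i f = f" "j \<le> l" "Suc l < j + r"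
  shows "T_op l (hecke_sum j r f) = hecke_sum j r f"
  using assms
proof (induction r)
  case (Suc r)
  show ?case
  proof (cases "Suc l < j + r")
    case True
    then have "T_op l (T_up j (j + r) f) = T_up j (j + r) f"
      using T_op_T_up_inside[of j l "j + r" f] Suc.prems by simp
    then show ?thesis using Suc True by (simp add: T_op_add T_op_pconst)
  next
    case False
    then obtain s where "r = Suc s" using Suc.prems by (cases r) auto
    then have r: "r = Suc s" "l = j + s" using Suc.prems False by simp_all
    let ?R = "T_up j (j + s) f"
    have far: "T_op l (hecke_sum j s f) = hecke_sum j s f"
    proof (cases s)
      case (Suc s')
      then show ?thesis using Suc.prems r by (intro T_op_hecke_sum_far) auto
    qed simp
    have "hecke_sum j (Suc r) f = (T_op l ?R + pconst t_par * ?R) + pconst t_par * (pconst t_par * hecke_sum j s f)"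
      by (simp add: r T_up_Suc distrib_left)
    moreover have "T_op l (T_op l ?R + pconst t_par * ?R) = T_op l ?R + pconst t_par * ?R"
      by (simp add: T_op_add T_op_pconst T_op_quadratic pconst_diff algebra_simps)
    ultimately show ?thesis using far by (simp add: T_op_add T_op_pconst)
  qed
qed simp

lemma hecke_sum_sym:
  assumes "\<And>i. j \<le> i \<Longrightarrow> i < j + r \<Longrightarrow> T_op i f = f"
  shows "hecke_sum j r f = pconst ((1 - t_par ^ r) / (1 - t_par)) * f"
  using assms
proof (induction r)
  case (Suc r)
  have "T_up j (j + r) f = f" using Suc.prems by (intro T_up_fix) auto
  then have "hecke_sum j (Suc r) f = f + pconst (t_par * ((1 - t_par ^ r) / (1 - t_par))) * f"
    using Suc by (simp only: hecke_sum.simps pconst_mult mult.assoc less_Suc_eq add_Suc_right) simp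
  also have "\<dots> = pconst (1 + t_par * ((1 - t_par ^ r) / (1 - t_par))) * f" by (simp add: pconst_add distrib_right)
  also have "1 + t_par * ((1 - t_par ^ r) / (1 - t_par)) = (1 - t_par ^ Suc r) / (1 - t_par)"
    by (simp add: field_simps)
  finally show ?case .
qed simp

text \<open>Deleting a variable of \<open>T\<^sub>i f\<close> gives a combination, with coefficients t and 1 - t, of the
  two ways of deleting one in f. The first one continues the recursion, the second one is
  evaluated by symmetry, and together they reproduce the recursion of the partial symmetrizer.\<close>

lemma drop_var_T_up:
  assumes f: "f \<in> Pol M" "drop_var j f = 0" "\<And>i. j < i \<Longrightarrow> i < M \<Longrightarrow> T_op i f = f" and j: "1 \<le> j"
    and r: "j + r \<le> M"
  shows "drop_var (j + r) (T_up j (j + r) f) = pconst (1 - t_par) * hecke_sum j r (pi_pol M f)"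
  using r
proof (induction r)
  case 0 then show ?case using f(2) by simp
next
  case (Suc r)
  let ?R = "T_up j (j + r) f"
  have "drop_var (Suc (j + r)) ?R = pi_pol M ?R"
  proof (rule drop_var_sym)
    show "?R \<in> Pol M" using f(1) j Suc.prems by (intro T_up_in_Pol) auto
    fix l assume l: "Suc (j + r) \<le> l" "l < M"
    then have "T_op l ?R = ?R" using T_op_T_up_far[of l j "j + r" f] f(3)[of l] by simp
    then show "swap_pol l ?R = ?R" by (simp add: T_op_fix_iff)
  qed (use Suc.prems in simp)
  also have "\<dots> = T_up j (j + r) (pi_pol M f)" using Suc.prems by (intro pi_pol_T_up) simp
  finally show ?case using Suc
    by (simp add: T_up_Suc drop_var_T_op_same distrib_left mult.left_commute)
qed

text \<open>Let V be the symmetrization in m variables. If the last variable of the rotated polynomial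
  is set to zero, the additional summand of the symmetrization in m+1 variables contributes (1 -
  t) V and the rest contributes t V.\<close>

lemma stable_omega_inv_hecke_sum:
  assumes "stable_seq j g" "1 \<le> j" shows "stable_seq j (\<lambda>m. omega_inv m (hecke_sum j (m - j) (var j * g m)))"
proof -
  have "stable_seq j (\<lambda>m. var j * g m)" using assms by (intro stable_var_mult) auto
  then obtain k0 d where h: "\<And>m. m \<ge> k0 \<Longrightarrow> stable_at j d (\<lambda>m. var j * g m) m" unfolding stable_seq_def by blast
  let ?h = "\<lambda>m. var j * g m"
  have "stable_at j d (\<lambda>m. omega_inv m (hecke_sum j (m - j) (?h m))) m" if m: "m \<ge> k0 + j + 1" for m
    unfolding stable_at_def
  proof (intro conjI allI impI)
    have hm: "stable_at j d ?h m" "stable_at j d ?h (Suc m)" using h[of m] h[of "Suc m"] m by simp_all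
    then have hP: "?h m \<in> Pol m" "?h (Suc m) \<in> Pol (Suc m)" and hd: "deg_le d (?h m)"
      and hpi: "pi_pol (Suc m) (?h (Suc m)) = ?h m"
      and hT: "\<And>i. j < i \<Longrightarrow> i < m \<Longrightarrow> T_op i (?h m) = ?h m"
      and hT': "\<And>i. j < i \<Longrightarrow> i < Suc m \<Longrightarrow> T_op i (?h (Suc m)) = ?h (Suc m)"
      unfolding stable_at_def by blast+
    show "omega_inv m (hecke_sum j (m - j) (?h m)) \<in> Pol m"
      using hP m assms(2) by (intro omega_inv_in_Pol hecke_sum_in_Pol) auto
    show "deg_le d (omega_inv m (hecke_sum j (m - j) (?h m)))"
      using hd by (intro deg_le_omega_inv deg_le_hecke_sum)
    show "pi_pol (Suc m) (omega_inv (Suc m) (hecke_sum j (Suc m - j) (?h (Suc m)))) =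
       omega_inv m (hecke_sum j (m - j) (?h m))"
    proof -
      define n where "n = m - j"
      have n: "m - j = n" "Suc m - j = Suc n" "j + n = m" using m by (auto simp: n_def)
      let ?f = "?h (Suc m)" and ?V = "hecke_sum j n (?h m)"
      have TP: "T_up j m ?f \<in> Pol (Suc m)" using hP(2) assms(2) by (intro T_up_in_Pol) auto
      have VP: "hecke_sum j (Suc n) ?f \<in> Pol (Suc m)" using hP(2) assms(2) n by (intro hecke_sum_in_Pol) auto
      have "pi_pol (Suc m) (swap_pol m (T_up j m ?f)) = drop_var (Suc m) (swap_pol m (T_up j m ?f))"
        using TP m by (intro drop_var_last[symmetric] swap_pol_in_Pol) auto
      also have "\<dots> = drop_var (j + n) (T_up j (j + n) ?f)" by (simp add: drop_var_swap n(3))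
      also have "\<dots> = pconst (1 - t_par) * ?V"
        unfolding hpi[symmetric] using hP(2) hT' assms(2) n(3)
        by (intro drop_var_T_up) (auto simp: drop_var_simps)
      finally have 1: "pi_pol (Suc m) (swap_pol m (T_up j m ?f)) = pconst (1 - t_par) * ?V" .
      have "T_op m (hecke_sum j n ?f) = hecke_sum j n ?f"
        using hT'[of m] m n(3) by (intro T_op_hecke_sum_far) auto
      then have "pi_pol (Suc m) (swap_pol m (hecke_sum j n ?f)) = pi_pol (Suc m) (hecke_sum j n ?f)"
        by (simp add: T_op_fix_iff)
      also have "\<dots> = ?V" unfolding hpi[symmetric] using n(3) by (intro pi_pol_hecke_sum) simp
      finally have 2: "pi_pol (Suc m) (swap_pol m (hecke_sum j n ?f)) = ?V" .
      have "pi_pol (Suc m) (swap_pol m (hecke_sum j (Suc n) ?f)) = pconst (1 - t_par) * ?V + pconst t_par * ?V"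
        using 1 2 by (simp add: n(3) swap_pol_simps pi_pol_add pi_pol_mult)
      also have "\<dots> = ?V" by (simp add: pconst_diff algebra_simps)
      finally show ?thesis unfolding n(1,2) using m by (subst pi_pol_omega_inv[OF VP]) auto
    qed
    fix l assume l: "j < l" "l < m"
    have "T_op l (omega_inv m (hecke_sum j (m - j) (?h m))) = omega_inv m (T_op (l - 1) (hecke_sum j (m - j) (?h m)))"
      using omega_inv_T_op[of "l - 1" m "hecke_sum j (m - j) (?h m)"] l assms(2) by simp
    also have "T_op (l - 1) (hecke_sum j (m - j) (?h m)) = hecke_sum j (m - j) (?h m)"
      using l hT by (intro T_op_hecke_sum_inside) auto
    finally show "T_op l (omega_inv m (hecke_sum j (m - j) (?h m))) = omega_inv m (hecke_sum j (m - j) (?h m))" .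
  qed
  then show ?thesis by (rule stableI)
qed

subsection \<open>Limits of the basic operators\<close>

lemma sym_conv_omega_inv_T_up:
  assumes "sym_conv j f L" "1 \<le> j" shows "\<exists>M. sym_conv j (\<lambda>m. omega_inv m (T_up j m (f m))) M"
proof (rule sym_conv_map[OF assms(1), where R = "\<lambda>m f. omega_inv m (T_up j m f)"])
  show "\<exists>M. sym_conv j (\<lambda>m. omega_inv m (T_up j m (Pi_inf m G))) M" if "G \<in> Psym j" for G
    using that assms(2) by (intro stable_sym_conv stable_omega_inv_T_up stable_Pi_inf)
qed (simp_all add: T_up_add T_up_pconst omega_inv_simps)

lemma t_tendsto_geometric: "t_tendsto (\<lambda>m. (1 - t_par ^ (m - j)) / (1 - t_par)) (1 / (1 - t_par))"
proof -
  have "t_tendsto (\<lambda>m. t_par ^ (m - j)) 0"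
    by (rule t_tendsto_t_power[of _ j]) (auto intro!: always_eventually)
  then have "t_tendsto (\<lambda>m. (1 + (- 1) * t_par ^ (m - j)) * inverse (1 - t_par)) ((1 + (- 1) * 0) * inverse (1 - t_par))"
    by (intro t_tendsto_mult t_tendsto_add t_tendsto_const)
  then show ?thesis by (simp add: divide_inverse)
qed

text \<open>On the summand of the decomposition that is symmetric also in the j-th variable the
  symmetrizer is a geometric sum, whose limit exists; on the multiple of that variable the
  sequence is stable.\<close>

lemma sym_conv_omega_inv_hecke_sum:
  assumes "sym_conv j f L" "1 \<le> j" shows "\<exists>M. sym_conv j (\<lambda>m. omega_inv m (hecke_sum j (m - j) (f m))) M"
proof (rule sym_conv_map[OF assms(1), where R = "\<lambda>m f. omega_inv m (hecke_sum j (m - j) f)"])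
  fix G assume "G \<in> Psym j"
  then have "stable_seq j (\<lambda>m. Pi_inf m G)" by (rule stable_Pi_inf)
  then obtain F g where F: "stable_seq (j - 1) F" and g: "stable_seq j g"
    and e: "\<forall>\<^sub>F m in sequentially. Pi_inf m G = F m + var j * g m" using assms(2) by (rule stable_decomp)
  have "stable_seq j (\<lambda>m. omega_inv m (F m))" using stable_omega_inv[OF F] assms(2) by simp
  then obtain L1 where L1: "sym_conv j (\<lambda>m. omega_inv m (F m)) L1" using stable_sym_conv by blast
  obtain L2 where L2: "sym_conv j (\<lambda>m. omega_inv m (hecke_sum j (m - j) (var j * g m))) L2"
    using stable_sym_conv[OF stable_omega_inv_hecke_sum[OF g assms(2)]] by blast
  have "sym_conv j (\<lambda>m. pconst ((1 - t_par ^ (m - j)) / (1 - t_par)) * omega_inv m (F m) +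
      omega_inv m (hecke_sum j (m - j) (var j * g m))) (\<lambda>\<mu>. 1 / (1 - t_par) * L1 \<mu> + L2 \<mu>)"
    by (intro sym_conv_add sym_conv_scale t_tendsto_geometric L1 L2)
  then have "sym_conv j (\<lambda>m. omega_inv m (hecke_sum j (m - j) (Pi_inf m G))) (\<lambda>\<mu>. 1 / (1 - t_par) * L1 \<mu> + L2 \<mu>)"
  proof (rule sym_conv_cong)
    obtain k0 d where "\<And>m. m \<ge> k0 \<Longrightarrow> stable_at (j - 1) d F m" using F unfolding stable_seq_def by blast
    then have s: "\<forall>\<^sub>F m in sequentially. stable_at (j - 1) d F m \<and> j \<le> m"
      unfolding eventually_sequentially by (intro exI[of _ "max k0 j"]) auto
    show "\<forall>\<^sub>F m in sequentially. pconst ((1 - t_par ^ (m - j)) / (1 - t_par)) * omega_inv m (F m) +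
      omega_inv m (hecke_sum j (m - j) (var j * g m)) = omega_inv m (hecke_sum j (m - j) (Pi_inf m G))"
      using e s
    proof eventually_elim
      case (elim m)
      have "hecke_sum j (m - j) (F m) = pconst ((1 - t_par ^ (m - j)) / (1 - t_par)) * F m"
        using elim assms(2) by (intro hecke_sum_sym) (auto simp: stable_at_def)
      then show ?case unfolding elim(1) hecke_sum_add by (simp add: omega_inv_simps)
    qed
  qed
  then show "\<exists>M. sym_conv j (\<lambda>m. omega_inv m (hecke_sum j (m - j) (Pi_inf m G))) M" by blast
qed (simp_all add: hecke_sum_add hecke_sum_pconst omega_inv_simps)

lemma pr1_eq: "pr1 f = f - pi_pol 1 f"
proof (rule poly_mapping_eqI)
  fix \<mu>
  have "lookup (pr1 f) \<mu> = (\<Sum>m | m \<in> keys f \<and> lookup m 1 > 0. if m = \<mu> then lookup f \<mu> else 0)"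
    unfolding pr1_def lookup_sum by (rule sum.cong) (auto simp: lookup_single when_def)
  also have "\<dots> = (if lookup \<mu> 1 > 0 then lookup f \<mu> else 0)" by (simp add: in_keys_iff)
  finally show "lookup (pr1 f) \<mu> = lookup (f - pi_pol 1 f) \<mu>" by (simp add: lookup_minus lookup_pi_pol)
qed

text \<open>The product \<open>T\<^sub>m\<^sub>-\<^sub>1\<inverse> \<cdots> T\<^sub>i\<inverse>\<close> carries G to \<open>F + t\<^bsup>-(m-j)\<^esup> x\<^sub>m T\<^sub>m\<^sub>-\<^sub>1 \<cdots> T\<^sub>j g\<close> with stable
  F and g. After the rotation the second summand is a multiple of \<open>x\<^sub>1\<close>, on which the projection
  \<open>pr1\<close> is the identity, and its power of t is compensated by the one in front of the operator.
  The first summand keeps that power and vanishes in the limit, with or without the projection.\<close>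

lemma sym_conv_Y:
  assumes G: "G \<in> Psym j" and i: "1 \<le> i" "i \<le> j"
  shows "\<exists>M. sym_conv j (\<lambda>m. Y_op m i (Pi_inf m G)) M \<and> sym_conv j (\<lambda>m. Y_tilde m i (Pi_inf m G)) M"
proof -
  have j: "1 \<le> j" using i by simp
  have "stable_seq j (\<lambda>m. T_dn i j (Pi_inf m G))" using G i by (intro stable_T_dn stable_Pi_inf) auto
  then obtain F g where F: "stable_seq (j - 1) F" and g: "stable_seq j g"
    and e: "\<forall>\<^sub>F m in sequentially. T_dn i j (Pi_inf m G) = F m + var j * g m" using j by (rule stable_decomp)
  have oF: "stable_seq j (\<lambda>m. omega_inv m (F m))" using stable_omega_inv[OF F] j by simp
  let ?a = "\<lambda>m. T_up 1 i (omega_inv m (F m))" and ?b = "\<lambda>m. T_up 1 i (pr1 (omega_inv m (F m)))"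
    and ?c = "\<lambda>m. T_up 1 i (var 1 * omega_inv m (T_up j m (g m)))"
  have "stable_seq j ?a" using oF i by (intro stable_T_up) auto
  then obtain La where La: "sym_conv j ?a La" using stable_sym_conv by blast
  have "stable_seq j ?b" unfolding pr1_eq using oF i j by (intro stable_T_up stable_diff stable_pi_pol_1) auto
  then obtain Lb where Lb: "sym_conv j ?b Lb" using stable_sym_conv by blast
  have "stable_seq j ?c" using g i j by (intro stable_T_up stable_var_mult stable_omega_inv_T_up) auto
  then obtain Lc where Lc: "sym_conv j ?c Lc" using stable_sym_conv by blast
  let ?s = "\<lambda>m. t_par ^ (m + 1 - i)" and ?q = "t_par ^ (j + 1 - i) * q_par"
  have t0: "t_tendsto ?s 0"
    by (rule t_tendsto_t_power[of _ i]) (auto intro!: always_eventually)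
  obtain k0 d where "\<And>m. m \<ge> k0 \<Longrightarrow> stable_at (j - 1) d F m" using F unfolding stable_seq_def by blast
  then have s: "\<forall>\<^sub>F m in sequentially. stable_at (j - 1) d F m \<and> j < m"
    unfolding eventually_sequentially by (intro exI[of _ "max k0 (Suc j)"]) auto
  have Y: "\<forall>\<^sub>F m in sequentially. omega_inv m (T_dn i m (Pi_inf m G)) = omega_inv m (F m) +
      pconst (inverse t_par ^ (m - j)) * (pconst q_par * (var 1 * omega_inv m (T_up j m (g m)))) \<and> j < m"
    using e s
  proof eventually_elim
    case (elim m)
    have "T_dn i m (Pi_inf m G) = T_dn j m (F m + var j * g m)"
      using elim i by (subst T_dn_trans[of i j m]) auto
    also have "\<dots> = F m + pconst (inverse t_par ^ (m - j)) * (var m * T_up j m (g m))"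
      unfolding T_dn_add using elim j by (subst T_dn_var) (auto simp: stable_at_def intro!: T_dn_fix)
    finally show ?case using elim by (simp add: omega_inv_simps mult.assoc)
  qed
  have sc: "pconst (?s m) * (pconst (inverse t_par ^ (m - j)) * (pconst q_par * f)) = pconst ?q * f" if "j < m" for m f
  proof -
    have "?s m = t_par ^ (j + 1 - i) * t_par ^ (m - j)" using that i by (simp flip: power_add)
    then have "?s m * inverse t_par ^ (m - j) = t_par ^ (j + 1 - i)" by (simp add: power_inverse field_simps)
    then show ?thesis by (simp flip: mult.assoc pconst_mult)
  qed
  have "sym_conv j (\<lambda>m. pconst (?s m) * ?a m + pconst ?q * ?c m) (\<lambda>\<mu>. 0 * La \<mu> + ?q * Lc \<mu>)"
    by (intro sym_conv_add sym_conv_scale t0 t_tendsto_const La Lc)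
  then have "sym_conv j (\<lambda>m. Y_op m i (Pi_inf m G)) (\<lambda>\<mu>. 0 * La \<mu> + ?q * Lc \<mu>)"
  proof (rule sym_conv_cong)
    show "\<forall>\<^sub>F m in sequentially. pconst (?s m) * ?a m + pconst ?q * ?c m = Y_op m i (Pi_inf m G)"
      using Y
    proof eventually_elim
      case (elim m)
      then have "Y_op m i (Pi_inf m G) = pconst (?s m) * ?a m +
          pconst (?s m) * (pconst (inverse t_par ^ (m - j)) * (pconst q_par * ?c m))"
        by (simp add: Y_op_eq T_up_add T_up_pconst distrib_left)
      moreover have "pconst (?s m) * (pconst (inverse t_par ^ (m - j)) * (pconst q_par * ?c m)) = pconst ?q * ?c m"
        using elim by (intro sc) simp
      ultimately show ?case by (simp only:)
    qed
  qed
  moreover have "sym_conv j (\<lambda>m. pconst (?s m) * ?b m + pconst ?q * ?c m) (\<lambda>\<mu>. 0 * Lb \<mu> + ?q * Lc \<mu>)"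
    by (intro sym_conv_add sym_conv_scale t0 t_tendsto_const Lb Lc)
  then have "sym_conv j (\<lambda>m. Y_tilde m i (Pi_inf m G)) (\<lambda>\<mu>. 0 * Lb \<mu> + ?q * Lc \<mu>)"
  proof (rule sym_conv_cong)
    show "\<forall>\<^sub>F m in sequentially. pconst (?s m) * ?b m + pconst ?q * ?c m = Y_tilde m i (Pi_inf m G)"
      using Y
    proof eventually_elim
      case (elim m)
      have p: "pr1 (f + pconst c * (pconst c' * (var 1 * f'))) = pr1 f + pconst c * (pconst c' * (var 1 * f'))" for f f' c c'
        by (simp add: pr1_eq pi_pol_add pi_pol_mult pi_pol_var)
      have "Y_tilde m i (Pi_inf m G) = pconst (?s m) * ?b m +
          pconst (?s m) * (pconst (inverse t_par ^ (m - j)) * (pconst q_par * ?c m))"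
        using elim by (simp add: Y_tilde_def Y_gen_eq p[simplified] T_up_add T_up_pconst distrib_left)
      moreover have "pconst (?s m) * (pconst (inverse t_par ^ (m - j)) * (pconst q_par * ?c m)) = pconst ?q * ?c m"
        using elim by (intro sc) simp
      ultimately show ?case by (simp only:)
    qed
  qed
  ultimately show ?thesis by auto
qed

section \<open>Convergence of the Macdonald polynomials\<close>

subsection \<open>Dependence of the eigenvalues on the number of variables\<close>

lemma u_stat_positive:
  assumes "\<mu> \<in> Lambda k" "k \<le> m" "0 < lookup \<mu> i" shows "u_stat m \<mu> i = u_stat k \<mu> i"
proof -
  have "j \<le> k" if "lookup \<mu> i \<le> lookup \<mu> j" for j
    using that assms(3) Lambda_lookup_0[OF assms(1), of j] by (cases "k < j") auto
  then have "{j. i \<le> j \<and> j \<le> m \<and> lookup \<mu> i \<le> lookup \<mu> j} = {j. i \<le> j \<and> j \<le> k \<and> lookup \<mu> i \<le> lookup \<mu> j}"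
    using assms(2) by (meson order_trans)
  then show ?thesis by (simp add: u_stat_def)
qed

lemma u_stat_zero: "lookup \<mu> i = 0 \<Longrightarrow> m \<le> u_stat m \<mu> i + i"
proof -
  assume "lookup \<mu> i = 0"
  then have "{j. i \<le> j \<and> j \<le> m \<and> lookup \<mu> i \<le> lookup \<mu> j} = {i..m}" by auto
  then show ?thesis by (simp add: u_stat_def)
qed

lemma u_stat_last:
  assumes "\<mu> \<in> Lambda k" "k < m" shows "u_stat m \<mu> m = Suc (card (keys \<mu>))"
proof -
  have 0: "lookup \<mu> m = 0" using Lambda_lookup_0[OF assms(1)] assms(2) by simp
  have "1 \<le> j \<and> j \<le> m" if "0 < lookup \<mu> j" for j
    using that Lambda_lookup_0[OF assms(1), of j] assms(2) by (cases "j = 0"; cases "k < j") auto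
  then have "{j. 1 \<le> j \<and> j \<le> m \<and> lookup \<mu> m < lookup \<mu> j} = keys \<mu>" using 0 by (auto simp: in_keys_iff)
  moreover have "{j. m \<le> j \<and> j \<le> m \<and> lookup \<mu> m \<le> lookup \<mu> j} = {m}" by auto
  ultimately show ?thesis unfolding u_stat_def by simp
qed

lemma t_tendsto_eigval:
  assumes "\<mu> \<in> Lambda k"
  shows "t_tendsto (\<lambda>m. eigval m \<mu> i) (if 0 < lookup \<mu> i then eigval k \<mu> i else 0)"
proof (cases "0 < lookup \<mu> i")
  case True
  have "\<forall>\<^sub>F m in sequentially. eigval k \<mu> i = eigval m \<mu> i"
    using eventually_ge_at_top[of k]
  proof eventually_elim
    case (elim m)
    then show ?case using u_stat_positive[OF assms elim True] by (simp add: eigval_def)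
  qed
  then have "t_tendsto (\<lambda>m. eigval m \<mu> i) (eigval k \<mu> i)" by (rule t_tendsto_cong[OF _ t_tendsto_const])
  then show ?thesis using True by simp
next
  case False
  have "t_tendsto (\<lambda>m. t_par ^ u_stat m \<mu> i) 0"
    by (rule t_tendsto_t_power[of _ i]) (use False u_stat_zero[of \<mu> i] in \<open>auto intro!: always_eventually\<close>)
  then show ?thesis using False by (simp add: eigval_def)
qed

subsection \<open>Moving the last entry to the right\<close>

primrec shift_entry :: "nat \<Rightarrow> expo \<Rightarrow> nat \<Rightarrow> expo" where
  "shift_entry k \<mu> 0 = \<mu>"
| "shift_entry k \<mu> (Suc r) = swap_expo (k + r) (shift_entry k \<mu> r)"

lemma lookup_shift_entry:
  assumes "\<mu> \<in> Lambda k"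
  shows "lookup (shift_entry k \<mu> r) i = (if i = k + r then lookup \<mu> k else if i < k then lookup \<mu> i else 0)"
proof (induction r arbitrary: i)
  case 0 then show ?case using Lambda_lookup_0[OF assms, of i] by auto
next
  case (Suc r) then show ?case by (auto simp: lookup_swap_expo transpose_def)
qed

lemma shift_entry_in_Lambda:
  assumes "\<mu> \<in> Lambda k" "1 \<le> k" "k + r \<le> m" shows "shift_entry k \<mu> r \<in> Lambda m"
  using assms(3)
proof (induction r)
  case 0 then show ?case using assms(1) Lambda_mono[of k m] by auto
next
  case (Suc r) then show ?case using assms(2) by (simp add: swap_expo_in_Lambda)
qed

lemma eigval_shift_entry:
  assumes "\<mu> \<in> Lambda k" "1 \<le> k" "0 < lookup \<mu> k" "k + r \<le> m"
  shows "eigval m (shift_entry k \<mu> r) (k + r) = eigval m \<mu> k"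
    and "k + r < s \<Longrightarrow> s \<le> m \<Longrightarrow> eigval m (shift_entry k \<mu> r) s = eigval m \<mu> s"
  using assms(4)
proof (induction r arbitrary: s)
  case (Suc r)
  have ne: "lookup (shift_entry k \<mu> r) (k + r) \<noteq> lookup (shift_entry k \<mu> r) (Suc (k + r))"
    using assms(3) by (simp add: lookup_shift_entry[OF assms(1)])
  {
    case 1
    then show ?case using eigval_swap[OF _ _ ne, of m "Suc (k + r)"] Suc.IH(1) assms(2) by simp
  next
    case 2
    then show ?case using eigval_swap[OF _ _ ne, of m s] Suc.IH(2)[of s] assms(2) by (simp add: transpose_def)
  }
qed simp_all

text \<open>The operators \<open>T\<^sub>i\<close> with i > k fix \<open>E\<^sub>\<mu>\<close> and also the part of the partial symmetrizer that
  ends before i. So in the product of the intertwiners the lower terms combine to a single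
  multiple of the symmetrizer, because successive constants satisfy
  \<open>c\<^sub>s (1 + c\<^sub>s\<^sub>+\<^sub>1) = t c\<^sub>s\<^sub>+\<^sub>1\<close>; this in turn holds because the eigenvalues at successive
  zeros differ by the factor t.\<close>

lemma macdonald_E_shift_entry:
  assumes \<mu>: "\<mu> \<in> Lambda k" "1 \<le> k" "0 < lookup \<mu> k" and m: "k + r < m"
  defines "c \<equiv> \<lambda>s. (1 - t_par) * eigval m \<mu> s / (eigval m \<mu> k - eigval m \<mu> s)"
  shows "macdonald_E m (shift_entry k \<mu> (Suc r)) =
    T_up k (Suc (k + r)) (macdonald_E m \<mu>) +
    pconst (c (Suc (k + r))) * hecke_sum k (Suc r) (macdonald_E m \<mu>)"
  using m
proof (induction r)
  let ?E = "macdonald_E m \<mu>"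
  have m2: "2 \<le> m" and \<mu>m: "\<mu> \<in> Lambda m" using assms Lambda_mono[of k m] by auto
  have z0: "lookup \<mu> s = 0" if "k < s" for s using Lambda_lookup_0[OF \<mu>(1)] that by simp
  have ne: "eigval m \<mu> k \<noteq> eigval m \<mu> s" if "k < s" for s using z0[OF that] \<mu>(3) by (simp add: eigval_eq_iff)
  have step: "macdonald_E m (shift_entry k \<mu> (Suc r)) =
      T_op (k + r) (macdonald_E m (shift_entry k \<mu> r)) + pconst (c (Suc (k + r))) * macdonald_E m (shift_entry k \<mu> r)"
    if "k + r < m" for r
  proof -
    let ?\<nu> = "shift_entry k \<mu> r"
    have e: "eigval m ?\<nu> (k + r) = eigval m \<mu> k" "eigval m ?\<nu> (Suc (k + r)) = eigval m \<mu> (Suc (k + r))"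
      using eigval_shift_entry[OF \<mu>, of r m] that by simp_all
    show ?thesis unfolding shift_entry.simps
    proof (rule macdonald_E_swap[OF m2])
      show "c (Suc (k + r)) * (eigval m ?\<nu> (k + r) - eigval m ?\<nu> (Suc (k + r))) = (1 - t_par) * eigval m ?\<nu> (Suc (k + r))"
        unfolding e c_def using ne[of "Suc (k + r)"] by (intro intertwiner_constant) simp
    qed (use \<mu> that in \<open>simp_all add: shift_entry_in_Lambda lookup_shift_entry\<close>)
  qed
  {
    case 0
    then show ?case using step[of 0] by (simp add: T_up_Suc)
  next
    case (Suc r)
    let ?i = "Suc (k + r)" and ?H = "hecke_sum k (Suc r) ?E"
    have i: "k < ?i" "?i < m" using Suc.prems by simp_all
    have "T_op ?i ?E = ?E" using m2 \<mu>m i z0 by (intro T_op_macdonald_E) simp_all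
    then have H: "T_op ?i ?H = ?H" by (intro T_op_hecke_sum_far) simp_all
    have z: "eigval m \<mu> ?i = t_par * eigval m \<mu> (Suc ?i)" using i z0 by (intro eigval_equal_entries) simp_all
    have c: "c ?i * (1 + c (Suc ?i)) = t_par * c (Suc ?i)"
      using ne[of ?i] ne[of "Suc ?i"] unfolding c_def z by (simp add: divide_simps) (simp add: algebra_simps)
    have "macdonald_E m (shift_entry k \<mu> (Suc (Suc r))) =
        T_op ?i (T_up k ?i ?E + pconst (c ?i) * ?H) + pconst (c (Suc ?i)) * (T_up k ?i ?E + pconst (c ?i) * ?H)"
      using step[of "Suc r"] Suc by simp
    also have "\<dots> = T_up k (Suc ?i) ?E + pconst (c (Suc ?i)) * T_up k ?i ?E + pconst (c ?i * (1 + c (Suc ?i))) * ?H"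
      by (simp only: T_op_add T_op_pconst H T_up_Suc[of k ?i] pconst_mult pconst_add pconst_1) (simp add: T_up_Suc algebra_simps)
    also have "\<dots> = T_up k (Suc ?i) ?E + pconst (c (Suc ?i)) * hecke_sum k (Suc (Suc r)) ?E"
      unfolding c by (simp add: pconst_mult distrib_left algebra_simps)
    finally show ?case by simp
  }
qed

lemma cyc_expo_shift_entry:
  assumes "\<mu> \<in> Lambda k" "1 \<le> k" "k \<le> m"
  shows "cyc_expo m (shift_entry k \<mu> (m - k)) = cyc_expo k \<mu>"
proof (rule poly_mapping_eqI)
  fix i
  show "lookup (cyc_expo m (shift_entry k \<mu> (m - k))) i = lookup (cyc_expo k \<mu>) i"
    using assms by (auto simp: lookup_cyc_expo lookup_shift_entry)
qed

text \<open>The constant \<open>\<beta>\<close> is independent of m because, at the last of the zeros, the exponent of t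
  in the eigenvalue counts only the positive entries and that zero.\<close>

lemma macdonald_E_cyc_positive:
  assumes \<mu>: "\<mu> \<in> Lambda k" "1 \<le> k" "0 < lookup \<mu> k" and m: "k < m"
  defines "z \<equiv> t_par ^ Suc (card (keys \<mu>))"
  defines "\<beta> \<equiv> (1 - t_par) * z / (eigval k \<mu> k - z)"
  shows "macdonald_E m (cyc_expo k \<mu>) = pconst (inverse q_par ^ lookup \<mu> k) *
    Phi m (T_up k m (macdonald_E m \<mu>) + pconst \<beta> * hecke_sum k (m - k) (macdonald_E m \<mu>))"
proof -
  obtain r where r: "m = Suc (k + r)" using m less_iff_Suc_add by blast
  have y: "eigval m \<mu> k = eigval k \<mu> k" using u_stat_positive[OF \<mu>(1) less_imp_le[OF m] \<mu>(3)] by (simp add: eigval_def)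
  have z: "eigval m \<mu> m = z"
    using u_stat_last[OF \<mu>(1) m] Lambda_lookup_0[OF \<mu>(1), of m] m by (simp add: eigval_def z_def)
  let ?\<nu> = "shift_entry k \<mu> (m - k)"
  have "macdonald_E m ?\<nu> = T_up k m (macdonald_E m \<mu>) + pconst \<beta> * hecke_sum k (m - k) (macdonald_E m \<mu>)"
    using macdonald_E_shift_entry[OF \<mu>, of r m] y z r by (simp add: \<beta>_def)
  moreover have "macdonald_E m (cyc_expo m ?\<nu>) = pconst (inverse q_par ^ lookup ?\<nu> m) * Phi m (macdonald_E m ?\<nu>)"
    using \<mu> m by (intro macdonald_E_cyc shift_entry_in_Lambda) simp_all
  moreover have "lookup ?\<nu> m = lookup \<mu> k" using m by (simp add: lookup_shift_entry[OF \<mu>(1)])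
  ultimately show ?thesis using cyc_expo_shift_entry[OF \<mu>(1,2), of m] m by simp
qed

subsection \<open>The limits of the polynomials\<close>

lemma sym_conv_exists_cong:
  assumes "sym_conv j f L" "\<forall>\<^sub>F m in sequentially. f m = g m" shows "\<exists>L. sym_conv j g L"
  by (rule exI[of _ L]) (rule sym_conv_cong[OF assms])

lemma stable_1: "stable_seq j (\<lambda>m. 1)"
  by (rule stableI[of 0 j 0]) (simp add: stable_at_def T_op_fix_iff pi_pol_def)

lemma sym_conv_T_op:
  assumes "sym_conv j f L" "1 \<le> i" "i < j" shows "\<exists>M. sym_conv j (\<lambda>m. T_op i (f m)) M"
proof (rule sym_conv_map[OF assms(1), where R = "\<lambda>m. T_op i"])
  show "\<exists>M. sym_conv j (\<lambda>m. T_op i (Pi_inf m G)) M" if "G \<in> Psym j" for G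
    using that assms by (intro stable_sym_conv stable_T_op stable_Pi_inf)
qed (simp_all add: T_op_add T_op_pconst)

lemma sym_conv_var_mult:
  assumes "sym_conv j f L" "1 \<le> i" "i \<le> j" shows "\<exists>M. sym_conv j (\<lambda>m. var i * f m) M"
proof (rule sym_conv_map[OF assms(1), where R = "\<lambda>m f. var i * f"])
  show "\<exists>M. sym_conv j (\<lambda>m. var i * Pi_inf m G) M" if "G \<in> Psym j" for G
    using that assms by (intro stable_sym_conv stable_var_mult stable_Pi_inf)
qed (simp_all add: distrib_left mult.left_commute)

lemma sym_conv_omega_inv:
  assumes "sym_conv j f L" shows "\<exists>M. sym_conv (Suc j) (\<lambda>m. omega_inv m (f m)) M"
proof (rule sym_conv_map[OF assms, where R = omega_inv])
  show "\<exists>M. sym_conv (Suc j) (\<lambda>m. omega_inv m (Pi_inf m G)) M" if "G \<in> Psym j" for G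
    using that by (intro stable_sym_conv stable_omega_inv stable_Pi_inf)
qed (simp_all add: omega_inv_simps)

text \<open>The rotation is the only step in which the number of operators grows with m; there the
  intertwiners have been collapsed, and both of the resulting operators have limits on almost
  symmetric series.\<close>

lemma macdonald_E_sym_conv:
  assumes "\<mu> \<in> Lambda k" shows "\<exists>L. sym_conv k (\<lambda>m. macdonald_E m \<mu>) L"
  using assms
proof (induction rule: Lambda_build_induct)
  case (zero k)
  obtain L where L: "sym_conv k (\<lambda>m. 1) L" using stable_sym_conv[OF stable_1] by blast
  have "\<forall>\<^sub>F m in sequentially. 1 = macdonald_E m 0"
    using eventually_ge_at_top[of 2] by eventually_elim (simp add: macdonald_E_zero)
  then show ?case by (rule sym_conv_exists_cong[OF L])
next
  case (swap k \<mu> i)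
  then obtain L where L: "sym_conv k (\<lambda>m. macdonald_E m \<mu>) L" by blast
  obtain M where M: "sym_conv k (\<lambda>m. T_op i (macdonald_E m \<mu>)) M" using sym_conv_T_op[OF L swap(2,3)] by blast
  \<comment> \<open>The zero to the right of the moved entry has an eigenvalue \<open>t\<^sup>u\<close> with u growing with m.\<close>
  let ?c = "\<lambda>m. (1 - t_par) * eigval m \<mu> (Suc i) / (eigval m \<mu> i - eigval m \<mu> (Suc i))"
  have "t_tendsto ?c 0"
  proof (rule t_tendsto_cong)
    show "t_tendsto (\<lambda>m. (1 - t_par) * t_par ^ u_stat m \<mu> (Suc i) /
        (q_par ^ lookup \<mu> i * t_par ^ u_stat k \<mu> i - t_par ^ u_stat m \<mu> (Suc i))) 0"
      by (rule t_tendsto_intertwiner[of _ "Suc i"]) (intro always_eventually allI u_stat_zero swap(5))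
    show "\<forall>\<^sub>F m in sequentially. (1 - t_par) * t_par ^ u_stat m \<mu> (Suc i) /
        (q_par ^ lookup \<mu> i * t_par ^ u_stat k \<mu> i - t_par ^ u_stat m \<mu> (Suc i)) = ?c m"
      using eventually_ge_at_top[of k]
    proof eventually_elim
      case (elim m)
      then show ?case using u_stat_positive[OF swap(1) elim swap(4)] swap(5) by (simp add: eigval_def)
    qed
  qed
  then have "sym_conv k (\<lambda>m. T_op i (macdonald_E m \<mu>) + pconst (?c m) * macdonald_E m \<mu>) (\<lambda>\<nu>. M \<nu> + 0 * L \<nu>)"
    by (intro sym_conv_add sym_conv_scale M L)
  moreover have "\<forall>\<^sub>F m in sequentially. T_op i (macdonald_E m \<mu>) + pconst (?c m) * macdonald_E m \<mu> =
      macdonald_E m (swap_expo i \<mu>)"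
    using eventually_ge_at_top[of k]
  proof eventually_elim
    case (elim m)
    then show ?case
      using swap Lambda_mono[of k m]
      by (intro macdonald_E_swap[symmetric] intertwiner_constant) (auto simp: eigval_eq_iff)
  qed
  ultimately show ?case by (rule sym_conv_exists_cong)
next
  case (rotate k \<mu>)
  let ?q = "inverse q_par ^ lookup \<mu> k"
  \<comment> \<open>Multiplication by the first variable and by a constant preserves convergence.\<close>
  have finish: ?case if f: "sym_conv k f L"
    and e: "\<forall>\<^sub>F m in sequentially. pconst ?q * (var 1 * f m) = macdonald_E m (cyc_expo k \<mu>)" for f L
  proof -
    obtain M where "sym_conv k (\<lambda>m. var 1 * f m) M" using sym_conv_var_mult[OF f] rotate(2) by blast
    then have "sym_conv k (\<lambda>m. pconst ?q * (var 1 * f m)) (\<lambda>\<nu>. ?q * M \<nu>)" by (intro sym_conv_scale t_tendsto_const)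
    then show ?thesis using e by (rule sym_conv_exists_cong)
  qed
  show ?case
  proof (cases "lookup \<mu> k = 0")
    case True
    \<comment> \<open>The rotation raises the number of exceptional variables by one, so the series for \<open>\<mu>\<close> has to be
      symmetric already from the k-th variable on.\<close>
    then have "\<mu> \<in> Lambda (k - 1)" using rotate Lambda_pred_iff by blast
    then obtain L where "sym_conv (k - 1) (\<lambda>m. macdonald_E m \<mu>) L" using rotate(3) by blast
    then obtain M where M: "sym_conv k (\<lambda>m. omega_inv m (macdonald_E m \<mu>)) M"
      using sym_conv_omega_inv[of "k - 1"] rotate(2) by fastforce
    have "\<forall>\<^sub>F m in sequentially. pconst ?q * (var 1 * omega_inv m (macdonald_E m \<mu>)) = macdonald_E m (cyc_expo k \<mu>)"
      using eventually_ge_at_top[of "k + 1"]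
    proof eventually_elim
      case (elim m)
      have z: "lookup \<mu> l = 0" if "k \<le> l" for l
        using True Lambda_lookup_0[OF rotate(1), of l] that by (cases "l = k") auto
      have "cyc_expo k \<mu> = cyc_expo m \<mu>"
        by (rule poly_mapping_eqI) (use elim rotate(2) z in \<open>auto simp: lookup_cyc_expo\<close>)
      moreover have "lookup \<mu> m = 0" using z elim by simp
      ultimately show ?case
        using macdonald_E_cyc[of m \<mu>] rotate(1,2) Lambda_mono[of k m] elim True by (auto simp: Phi_def)
    qed
    then show ?thesis by (rule finish[OF M])
  next
    case False
    obtain L where L: "sym_conv k (\<lambda>m. macdonald_E m \<mu>) L" using rotate by blast
    obtain L1 where L1: "sym_conv k (\<lambda>m. omega_inv m (T_up k m (macdonald_E m \<mu>))) L1"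
      using sym_conv_omega_inv_T_up[OF L rotate(2)] by blast
    obtain L2 where L2: "sym_conv k (\<lambda>m. omega_inv m (hecke_sum k (m - k) (macdonald_E m \<mu>))) L2"
      using sym_conv_omega_inv_hecke_sum[OF L rotate(2)] by blast
    define z where "z = t_par ^ Suc (card (keys \<mu>))"
    define \<beta> where "\<beta> = (1 - t_par) * z / (eigval k \<mu> k - z)"
    show ?thesis
    proof (rule finish)
      show "sym_conv k (\<lambda>m. omega_inv m (T_up k m (macdonald_E m \<mu>)) +
          pconst \<beta> * omega_inv m (hecke_sum k (m - k) (macdonald_E m \<mu>))) (\<lambda>\<nu>. L1 \<nu> + \<beta> * L2 \<nu>)"
        by (intro sym_conv_add sym_conv_scale t_tendsto_const L1 L2)
      show "\<forall>\<^sub>F m in sequentially. pconst ?q * (var 1 * (omega_inv m (T_up k m (macdonald_E m \<mu>)) +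
          pconst \<beta> * omega_inv m (hecke_sum k (m - k) (macdonald_E m \<mu>)))) = macdonald_E m (cyc_expo k \<mu>)"
        using eventually_gt_at_top[of k]
        by eventually_elim
          (use macdonald_E_cyc_positive[OF rotate(1,2)] False in \<open>simp add: \<beta>_def z_def Phi_def omega_inv_simps\<close>)
    qed
  qed
qed

theorem theorem3:
  fixes k i :: nat and lam :: expo
  assumes "lam \<in> Lambda k" and "i \<ge> 1"
  shows "pol_convergent (E_seq lam) \<and>
    E_lim lam \<in> Psym k \<and>
    Y_lim i (E_lim lam) =
      (\<lambda>m. delta k lam i * q_par ^ Poly_Mapping.lookup lam i * t_par ^ u_stat k lam i * E_lim lam m)"
proof -
  obtain L where L: "sym_conv k (E_seq lam) L"
    using macdonald_E_sym_conv[OF assms(1)] unfolding E_seq_def by blast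
  have "pol_convergent (E_seq lam)" unfolding pol_convergent_def using sym_conv_pol_tendsto[OF L] by blast
  moreover have EL: "E_lim lam = L" unfolding E_lim_def using L by (intro pol_lim_eqI sym_conv_pol_tendsto)
  moreover have "L \<in> Psym k" using L by (rule sym_conv_Psym)
  moreover have "Y_lim i L = (\<lambda>m. delta k lam i * q_par ^ Poly_Mapping.lookup lam i * t_par ^ u_stat k lam i * L m)"
  proof -
    define e where "e = delta k lam i * q_par ^ Poly_Mapping.lookup lam i * t_par ^ u_stat k lam i"
    \<comment> \<open>The series is regarded as symmetric after the j-th variable with \<open>j \<ge> i\<close>, where the i-th Cherednik
      operator and its deformation have a common limit.\<close>
    let ?j = "max k i"
    have Lj: "sym_conv ?j (E_seq lam) L" using L by (rule sym_conv_mono) simp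
    have pr1: "pr1 (f + g) = pr1 f + pr1 g" "pr1 (pconst c * f) = pconst c * pr1 f" for f g c
      by (simp_all add: pr1_eq pi_pol_add pi_pol_mult algebra_simps)
    have Yt: "Y_tilde m i (f + g) = Y_tilde m i f + Y_tilde m i g" "Y_tilde m i (pconst c * f) = pconst c * Y_tilde m i f"
      for m f g c
      by (simp_all add: Y_tilde_def Y_gen_eq pr1 T_dn_add T_dn_pconst omega_inv_simps T_up_add T_up_pconst
          distrib_left mult.left_commute)
    have "\<exists>M. sym_conv ?j (\<lambda>m. Y_op m i (E_seq lam m)) M \<and> sym_conv ?j (\<lambda>m. Y_tilde m i (Pi_inf m L)) M"
      by (rule sym_conv_map2[OF Lj, where R = "\<lambda>m. Y_op m i" and R' = "\<lambda>m. Y_tilde m i", OF Y_op_add Y_op_pconst Yt],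
          rule sym_conv_Y) (use assms(2) in simp_all)
    then obtain M where M: "sym_conv ?j (\<lambda>m. Y_op m i (E_seq lam m)) M" "sym_conv ?j (\<lambda>m. Y_tilde m i (Pi_inf m L)) M"
      by blast
    have e: "e = (if 0 < lookup lam i then eigval k lam i else 0)"
      using Lambda_lookup_0[OF assms(1), of i] by (auto simp: e_def delta_def eigval_def)
    have "sym_conv k (\<lambda>m. pconst (eigval m lam i) * E_seq lam m) (\<lambda>\<nu>. e * L \<nu>)"
      unfolding e by (intro sym_conv_scale t_tendsto_eigval assms(1) L)
    moreover have "\<forall>\<^sub>F m in sequentially. pconst (eigval m lam i) * E_seq lam m = Y_op m i (E_seq lam m)"
      using eventually_ge_at_top[of "2 + i + k"]
    proof eventually_elim
      case (elim m)
      then have "lam \<in> Lambda m" using assms(1) Lambda_mono[of k m] by auto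
      then show ?case using macdonald_E_eigen[of m lam i] elim assms(2) by (simp add: E_seq_def)
    qed
    ultimately have "sym_conv k (\<lambda>m. Y_op m i (E_seq lam m)) (\<lambda>\<nu>. e * L \<nu>)" by (rule sym_conv_cong)
    then have "M = (\<lambda>\<nu>. e * L \<nu>)" using M(1) sym_conv_unique by blast
    moreover have "Y_lim i L = M"
      unfolding Y_lim_def lim_op_def using M(2) by (intro pol_lim_eqI sym_conv_pol_tendsto)
    ultimately show ?thesis by (simp add: e_def)
  qed
  ultimately show ?thesis by simp
qed

end
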